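(* Let $\omega\in\mathcal O$. Then there is a constant $C=C(j_c,\kappa,\epsilon,\nu,\mathbf f,\mathbf E_d,B,\omega)$, independent of $\gamma>0$, such that for every $\gamma>0$ the shape derivative of $J_\gamma$ at $\omega$ satisfies $$|dJ_\gamma(\omega)(\boldsymbol\theta)|\le C\,\|\boldsymbol\theta\|_{\mathcal C^{0,1}(B)}\qquad\forall\,\boldsymbol\theta\in\mathcal C^{0,1}_c(\Omega,\mathbb R^3)\text{ with }\operatorname{supp}\boldsymbol\theta\subset\subset B.$$
   Context: Setting. $\Omega\subset\mathbb R^3$ is a bounded Lipschitz domain and $B\subset\Omega$ is a Lipschitz domain. $\mathbf H_0(\mathbf{curl})$ is the closure of $C_0^\infty(\Omega)^3$ in $\mathbf H(\mathbf{curl})=\{\mathbf v\in L^2(\Omega)^3:\mathbf{curl}\,\mathbf v\in L^2(\Omega)^3\}$ with the graph norm. $\mathcal C^1(B,\cdot)$ is the Banach space of $C^1$ functions on $B$ that are bounded together with their first derivatives. Standing assumptions: $\mathbf E_d\in\mathcal C^1(B,\mathbb R^3)$; $\kappa\in\mathcal C^1(B)$ with $\kappa:B\to(0,\infty)$; $j_c>0$; $\epsilon,\nu:\Omega\to\mathbb R^{3\times3}$ lie in $L^\infty(\Omega,\mathbb R^{3\times3})\cap\mathcal C^1(B,\mathbb R^{3\times3})$, are symmetric and uniformly positive definite ($\xi^{\mathsf T}\nu(x)\xi\ge\underline\nu|\xi|^2$, $\xi^{\mathsf T}\epsilon(x)\xi\ge\underline\epsilon|\xi|^2$ for a.e. $x\in\Omega$,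 all $\xi\in\mathbb R^3$, with $\underline\nu,\underline\epsilon>0$); $\mathbf f\in L^2(\Omega)^3$ with $\mathbf f|_B\in\mathcal C^1(B,\mathbb R^3)$. $\mathcal O$ is the class of all open sets $\omega\subset B$ that are Lipschitz with uniform Lipschitz constant $L$ ($L$ fixed). $a(\mathbf v,\mathbf w)=\int_\Omega\nu\,\mathbf{curl}\,\mathbf v\cdot\mathbf{curl}\,\mathbf w\,dx+\int_\Omega\epsilon\mathbf v\cdot\mathbf w\,dx$. Penalization. For $\gamma>0$ and $x\in\mathbb R$: $\max_\gamma\{1,x\}=x$ if $x-1\ge\frac1{2\gamma}$; $=1+\frac\gamma2(x-1+\frac1{2\gamma})^2$ if $|x-1|\le\frac1{2\gamma}$; $=1$ if $x-1\le-\frac1{2\gamma}$. For $\mathbf e\in L^2(\Omega)^3$, $\boldsymbol\Lambda_\gamma(\mathbf e)=\frac{j_c\gamma\mathbf e}{\max_\gamma\{1,\gamma|\mathbf e|\}}$. Penalized state: for measurable $\omega\subset B$, $\mathbf E^\gamma(\omega)\in\mathbf H_0(\mathbf{curl})$ is the unique solution of $$a(\mathbf E^\gamma,\mathbf v)+\int_\omega\boldsymbol\Lambda_\gamma(\mathbf E^\gamma)\cdot\mathbf v\,dx=\int_\Omega\mathbf f\cdot\mathbf v\,dx\quad\forall\mathbf v\in\mathbf H_0(\mathbf{curl}),$$ and $J_\gamma(\omega)=\frac12\int_B\kappa|\mathbf E^\gamma(\omega)-\mathbf E_d|^2dx+\int_\omega dx$. Shape derivative. For $\boldsymbol\theta\in\mathcal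 C^{0,1}_c(\Omega,\mathbb R^3)$ (Lipschitz, compactly supported) with compact support in $B$, let $\mathbf T_t$ be its flow: $\mathbf T_t(X)=x(t,X)$ with $\frac{d}{dt}x(t,X)=\boldsymbol\theta(x(t,X))$, $x(0,X)=X$; put $\omega_t=\mathbf T_t(\omega)$. Then $dJ_\gamma(\omega)(\boldsymbol\theta)=\lim_{t\searrow0}\frac{J_\gamma(\omega_t)-J_\gamma(\omega)}t$; for every $\gamma>0$ this limit exists and is linear and continuous in $\boldsymbol\theta$. $\|\boldsymbol\theta\|_{\mathcal C^{0,1}(B)}=\sup_{x\in B}|\boldsymbol\theta(x)|+\sup_{x\ne y\in B}\frac{|\boldsymbol\theta(x)-\boldsymbol\theta(y)|}{|x-y|}$. *)

theory Defs
  imports "HOL-Analysis.Analysis"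
begin

type_synonym vec3 = "real^3"

section \<open>Lipschitz sets and domains\<close>

text \<open>Near every boundary point \<open>p\<close>, in the coordinates \<open>y = Q (x - p)\<close> given by an orthogonal
  map \<open>Q\<close>, the set is the strict subgraph of an \<open>L\<close>-Lipschitz function of the first two coordinates.
  The set need not be connected, and the empty set qualifies.\<close>

definition lipschitz_set :: "real \<Rightarrow> vec3 set \<Rightarrow> bool" where
  "lipschitz_set L S \<longleftrightarrow> open S \<and>
     (\<forall>p\<in>frontier S. \<exists>(Q :: vec3 \<Rightarrow> vec3) (g :: real^2 \<Rightarrow> real) r.
        orthogonal_transformation Q \<and> L-lipschitz_on UNIV g \<and> r > 0 \<and>
        (\<forall>x\<in>ball p r. x \<in> S \<longleftrightarrow> Q (x - p) $ 3 < g (vector [Q (x - p) $ 1, Q (x - p) $ 2])))"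

definition bounded_lipschitz_domain :: "vec3 set \<Rightarrow> bool" where
  "bounded_lipschitz_domain S \<longleftrightarrow>
     S \<noteq> {} \<and> connected S \<and> bounded S \<and> (\<exists>L. lipschitz_set L S)"

definition lipschitz_class :: "vec3 set \<Rightarrow> real \<Rightarrow> vec3 set set" where
  "lipschitz_class B L = {\<omega>. \<omega> \<subseteq> B \<and> lipschitz_set L \<omega>}"

section \<open>Function spaces\<close>

text \<open>Elements of the function spaces below are total functions; only their values on the set in
  question matter, and \<open>L\<^sup>2\<close>-type spaces consist of representatives rather than of classes
  modulo almost everywhere equality.\<close>

definition L2_on :: "vec3 set \<Rightarrow> (vec3 \<Rightarrow> vec3) set" where
  "L2_on \<Omega> = {v. v \<in> borel_measurable (lebesgue_on \<Omega>) \<and>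
                  integrable (lebesgue_on \<Omega>) (\<lambda>x. (norm (v x))\<^sup>2)}"

definition Linf_on :: "vec3 set \<Rightarrow> (vec3 \<Rightarrow> 'b::euclidean_space) set" where
  "Linf_on \<Omega> = {v. v \<in> borel_measurable (lebesgue_on \<Omega>) \<and>
                   (\<exists>M. AE x in lebesgue_on \<Omega>. norm (v x) \<le> M)}"

definition C1_bounded :: "vec3 set \<Rightarrow> (vec3 \<Rightarrow> 'b::real_normed_vector) set" where
  "C1_bounded B = {f. bounded (f ` B) \<and>
     (\<exists>f' :: vec3 \<Rightarrow> vec3 \<Rightarrow>\<^sub>L 'b.
        (\<forall>x\<in>B. (f has_derivative blinfun_apply (f' x)) (at x)) \<and>
        continuous_on B f' \<and> bounded (f' ` B))}"

definition fsupport :: "(vec3 \<Rightarrow> 'b::zero) \<Rightarrow> vec3 set" where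
  "fsupport f = closure {x. f x \<noteq> 0}"

primrec Ck :: "nat \<Rightarrow> (vec3 \<Rightarrow> 'b::real_normed_vector) \<Rightarrow> bool" where
  "Ck 0 f \<longleftrightarrow> continuous_on UNIV f"
| "Ck (Suc k) f \<longleftrightarrow> (\<forall>x. f differentiable (at x)) \<and>
                   (\<forall>v. Ck k (\<lambda>x. frechet_derivative f (at x) v))"

text \<open>\<open>C\<^sub>0\<^sup>\<infinity>(\<Omega>)\<^sup>3\<close>, the functions being extended by zero.\<close>

definition test_fields :: "vec3 set \<Rightarrow> (vec3 \<Rightarrow> vec3) set" where
  "test_fields \<Omega> = {\<phi>. (\<forall>k. Ck k \<phi>) \<and> compact (fsupport \<phi>) \<and> fsupport \<phi> \<subseteq> \<Omega>}"

definition partial_deriv :: "3 \<Rightarrow> 3 \<Rightarrow> (vec3 \<Rightarrow> vec3) \<Rightarrow> vec3 \<Rightarrow> real" where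
  "partial_deriv j i \<phi> x = frechet_derivative \<phi> (at x) (axis j 1) $ i"

definition classical_curl :: "(vec3 \<Rightarrow> vec3) \<Rightarrow> vec3 \<Rightarrow> vec3" where
  "classical_curl \<phi> x = vector
     [partial_deriv 2 3 \<phi> x - partial_deriv 3 2 \<phi> x,
      partial_deriv 3 1 \<phi> x - partial_deriv 1 3 \<phi> x,
      partial_deriv 1 2 \<phi> x - partial_deriv 2 1 \<phi> x]"

definition has_weak_curl :: "vec3 set \<Rightarrow> (vec3 \<Rightarrow> vec3) \<Rightarrow> (vec3 \<Rightarrow> vec3) \<Rightarrow> bool" where
  "has_weak_curl \<Omega> v w \<longleftrightarrow> w \<in> L2_on \<Omega> \<and>
     (\<forall>\<phi>\<in>test_fields \<Omega>. (LINT x|lebesgue_on \<Omega>. v x \<bullet> classical_curl \<phi> x)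
                        = (LINT x|lebesgue_on \<Omega>. w x \<bullet> \<phi> x))"

text \<open>The weak curl is unique up to a null set, so the choice below does not affect integrals.\<close>

definition weak_curl :: "vec3 set \<Rightarrow> (vec3 \<Rightarrow> vec3) \<Rightarrow> vec3 \<Rightarrow> vec3" where
  "weak_curl \<Omega> v = (SOME w. has_weak_curl \<Omega> v w)"

definition Hcurl :: "vec3 set \<Rightarrow> (vec3 \<Rightarrow> vec3) set" where
  "Hcurl \<Omega> = {v \<in> L2_on \<Omega>. \<exists>w. has_weak_curl \<Omega> v w}"

definition Hcurl_norm :: "vec3 set \<Rightarrow> (vec3 \<Rightarrow> vec3) \<Rightarrow> real" where
  "Hcurl_norm \<Omega> v = sqrt ((LINT x|lebesgue_on \<Omega>. (norm (v x))\<^sup>2)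
                         + (LINT x|lebesgue_on \<Omega>. (norm (weak_curl \<Omega> v x))\<^sup>2))"

definition H0curl :: "vec3 set \<Rightarrow> (vec3 \<Rightarrow> vec3) set" where
  "H0curl \<Omega> = {v \<in> Hcurl \<Omega>. \<forall>e>0. \<exists>\<phi>\<in>test_fields \<Omega>. Hcurl_norm \<Omega> (\<lambda>x. v x - \<phi> x) < e}"

section \<open>The penalized state and the penalized objective\<close>

definition unif_spd :: "vec3 set \<Rightarrow> (vec3 \<Rightarrow> real^3^3) \<Rightarrow> bool" where
  "unif_spd \<Omega> A \<longleftrightarrow> (AE x in lebesgue_on \<Omega>. transpose (A x) = A x) \<and>
     (\<exists>c>0. AE x in lebesgue_on \<Omega>. \<forall>\<xi>. \<xi> \<bullet> (A x *v \<xi>) \<ge> c * (norm \<xi>)\<^sup>2)"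

definition a_form ::
  "vec3 set \<Rightarrow> (vec3 \<Rightarrow> real^3^3) \<Rightarrow> (vec3 \<Rightarrow> real^3^3) \<Rightarrow> (vec3 \<Rightarrow> vec3) \<Rightarrow> (vec3 \<Rightarrow> vec3) \<Rightarrow> real" where
  "a_form \<Omega> \<epsilon> \<nu> v w =
     (LINT x|lebesgue_on \<Omega>. (\<nu> x *v weak_curl \<Omega> v x) \<bullet> weak_curl \<Omega> w x)
   + (LINT x|lebesgue_on \<Omega>. (\<epsilon> x *v v x) \<bullet> w x)"

definition smooth_max1 :: "real \<Rightarrow> real \<Rightarrow> real" where
  "smooth_max1 \<gamma> x =
     (if x - 1 \<ge> 1 / (2 * \<gamma>) then x
      else if \<bar>x - 1\<bar> \<le> 1 / (2 * \<gamma>) then 1 + \<gamma> / 2 * (x - 1 + 1 / (2 * \<gamma>))\<^sup>2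
      else 1)"

definition Lambda_pen :: "real \<Rightarrow> real \<Rightarrow> vec3 \<Rightarrow> vec3" where
  "Lambda_pen j\<^sub>c \<gamma> e = (j\<^sub>c * \<gamma> / smooth_max1 \<gamma> (\<gamma> * norm e)) *\<^sub>R e"

definition is_state ::
  "vec3 set \<Rightarrow> real \<Rightarrow> (vec3 \<Rightarrow> real^3^3) \<Rightarrow> (vec3 \<Rightarrow> real^3^3) \<Rightarrow> (vec3 \<Rightarrow> vec3) \<Rightarrow> real \<Rightarrow> vec3 set
   \<Rightarrow> (vec3 \<Rightarrow> vec3) \<Rightarrow> bool" where
  "is_state \<Omega> j\<^sub>c \<epsilon> \<nu> f \<gamma> \<omega> E \<longleftrightarrow> E \<in> H0curl \<Omega> \<and>
     (\<forall>v\<in>H0curl \<Omega>. a_form \<Omega> \<epsilon> \<nu> E v + (LINT x|lebesgue_on \<omega>. Lambda_pen j\<^sub>c \<gamma> (E x) \<bullet> v x)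
                  = (LINT x|lebesgue_on \<Omega>. f x \<bullet> v x))"

text \<open>The state is unique as an element of \<open>L\<^sup>2\<close>, that is, up to modification on a null set and
  outside \<open>\<Omega>\<close>; hence a representative is chosen by \<open>SOME\<close> rather than by \<open>THE\<close>.\<close>

definition state ::
  "vec3 set \<Rightarrow> real \<Rightarrow> (vec3 \<Rightarrow> real^3^3) \<Rightarrow> (vec3 \<Rightarrow> real^3^3) \<Rightarrow> (vec3 \<Rightarrow> vec3) \<Rightarrow> real \<Rightarrow> vec3 set
   \<Rightarrow> vec3 \<Rightarrow> vec3" where
  "state \<Omega> j\<^sub>c \<epsilon> \<nu> f \<gamma> \<omega> = (SOME E. is_state \<Omega> j\<^sub>c \<epsilon> \<nu> f \<gamma> \<omega> E)"

definition J_pen ::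
  "vec3 set \<Rightarrow> vec3 set \<Rightarrow> real \<Rightarrow> (vec3 \<Rightarrow> real) \<Rightarrow> (vec3 \<Rightarrow> real^3^3) \<Rightarrow> (vec3 \<Rightarrow> real^3^3)
   \<Rightarrow> (vec3 \<Rightarrow> vec3) \<Rightarrow> (vec3 \<Rightarrow> vec3) \<Rightarrow> real \<Rightarrow> vec3 set \<Rightarrow> real" where
  "J_pen \<Omega> B j\<^sub>c \<kappa> \<epsilon> \<nu> f E\<^sub>d \<gamma> \<omega> =
     1 / 2 * (LINT x|lebesgue_on B. \<kappa> x * (norm (state \<Omega> j\<^sub>c \<epsilon> \<nu> f \<gamma> \<omega> x - E\<^sub>d x))\<^sup>2)
   + measure lebesgue \<omega>"

section \<open>Shape derivatives along flows\<close>

text \<open>Compactly supported Lipschitz fields on \<open>\<Omega>\<close>, extended by zero.\<close>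

definition C01_c :: "vec3 set \<Rightarrow> (vec3 \<Rightarrow> vec3) set" where
  "C01_c \<Omega> = {\<theta>. (\<exists>K. K-lipschitz_on \<Omega> \<theta>) \<and> compact (fsupport \<theta>) \<and> fsupport \<theta> \<subseteq> \<Omega>}"

definition C01_norm :: "vec3 set \<Rightarrow> (vec3 \<Rightarrow> vec3) \<Rightarrow> real" where
  "C01_norm B \<theta> = (SUP x\<in>B. norm (\<theta> x))
     + (SUP (x, y)\<in>{(x, y). x \<in> B \<and> y \<in> B \<and> x \<noteq> y}. norm (\<theta> x - \<theta> y) / norm (x - y))"

definition flow :: "(vec3 \<Rightarrow> vec3) \<Rightarrow> real \<Rightarrow> vec3 \<Rightarrow> vec3" where
  "flow \<theta> t X =
     (THE x :: real \<Rightarrow> vec3. x 0 = X \<and> (\<forall>s. (x has_vector_derivative \<theta> (x s)) (at s))) t"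

definition has_shape_derivative ::
  "(vec3 set \<Rightarrow> real) \<Rightarrow> vec3 set \<Rightarrow> (vec3 \<Rightarrow> vec3) \<Rightarrow> real \<Rightarrow> bool" where
  "has_shape_derivative J \<omega> \<theta> D \<longleftrightarrow>
     ((\<lambda>t. (J (flow \<theta> t ` \<omega>) - J \<omega>) / t) \<longlongrightarrow> D) (at_right 0)"

end

theory Submission imports Defs "HOL-Real_Asymp.Real_Asymp" begin

text \<open>For a smooth perturbation \<open>T = id + u\<close> of the identity with Lipschitz size \<open>s\<close>, the covariant pullback
  \<open>E \<mapsto> (DT)\<^sup>T (E \<circ> T)\<close>, which acts on curls through the Piola transform, maps \<open>H0curl\<close> onto itself. Testing the
  difference of the state on \<open>T(\<omega>)\<close> and the transported state on \<open>\<omega>\<close> with itself, all terms are \<open>O(s)\<close>: those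
  with coefficients because these are Lipschitz on \<open>B\<close>, and the penalty term because \<open>\<bar>\<Lambda>(a) - \<Lambda>(b)\<bar> \<bar>b\<bar> \<le> 2 j \<bar>a - b\<bar>\<close>
  with no \<open>\<gamma>\<close> on the right, while the monotonicity of \<open>\<Lambda>\<close> removes what is not small. Hence \<open>J(T(\<omega>)) - J(\<omega>)\<close> is
  bounded by \<open>C s\<close> with \<open>C\<close> independent of \<open>\<gamma>\<close>. The flow of a Lipschitz field is only bi-Lipschitz, but
  mollifying its displacement gives such smooth \<open>T\<close>; the estimate survives the limit since \<open>J\<close> is continuous
  in the symmetric difference of the sets and \<open>frontier \<omega>\<close> is null.\<close>

section \<open>Smooth functions\<close>

text \<open>The obstacle is that \<open>H0curl\<close> is a closure of C-infinity test fields: a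
  transport acts on it if it maps test fields to test fields, which the pullback by a bi-Lipschitz
  flow does not do in general. Hence the estimate is made for smooth maps, and these must have the
  same Lipschitz size as the displacement of the flow, a property that averaging preserves. The
  inequality for \<Lambda> fits because the transport multiplies the state by a matrix close to the
  identity: the argument moves by at most \<open>2 s\<close> times its own norm, and this norm is
  the factor on the left of the inequality, so it cancels. The indicator of \<omega> is carried
  along exactly by T and produces no error. Off the support of u nothing changes, so that regularity
  of the data on B is enough. The shape derivative enters as a given limit of difference quotients,
  and it suffices to bound these for small t. Since \<open>state\<close>, \<open>weak_curl\<close>
  and \<open>flow\<close> are choices by SOME or THE, existence of the state, uniqueness of the weak
  curl and unique solvability of the flow equation have to be established to say anything about
  them.\<close>

lemma Ck_SucI:
  assumes "\<And>x. (f has_derivative f' x) (at x)" "\<And>v. Ck k (\<lambda>x. f' x v)"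
  shows "Ck (Suc k) f"
proof -
  have "frechet_derivative f (at x) = f' x" for x
    using frechet_derivative_at[OF assms(1)[of x]] by simp
  then show ?thesis
    using assms by (auto simp: differentiable_def)
qed

lemma Ck_Suc_derivative:
  assumes "Ck (Suc k) f"
  shows "(f has_derivative frechet_derivative f (at x)) (at x)"
  using assms by (simp add: frechet_derivative_works)

lemma Ck_continuous: "Ck k f \<Longrightarrow> continuous_on UNIV f"
proof (cases k)
  case (Suc n)
  assume "Ck k f"
  with Suc show ?thesis
    by (auto intro!: differentiable_imp_continuous_on simp: differentiable_on_def)
qed simp

lemma Ck_SucD: "Ck (Suc k) f \<Longrightarrow> Ck k f"
proof (induction k arbitrary: f)
  case 0
  then show ?case using Ck_continuous Ck.simps(1) by blast
next
  case (Suc k)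
  then show ?case by (auto simp del: Ck.simps(1))
qed

lemma Ck_const [simp]: "Ck k (\<lambda>x. c)"
proof (induction k arbitrary: c)
  case (Suc k)
  show ?case by (rule Ck_SucI[where f' = "\<lambda>x v. 0"]) (auto intro: Suc)
qed simp

lemma Ck_bounded_linear:
  assumes "bounded_linear h" "Ck k f"
  shows "Ck k (\<lambda>x. h (f x))"
  using assms(2)
proof (induction k arbitrary: f)
  case 0
  then show ?case using assms(1)
    by (simp add: bounded_linear.continuous_on)
next
  case (Suc k)
  show ?case
  proof (rule Ck_SucI)
    show "((\<lambda>x. h (f x)) has_derivative (\<lambda>v. h (frechet_derivative f (at x) v))) (at x)" for x
      by (rule bounded_linear.has_derivative[OF assms(1) Ck_Suc_derivative[OF Suc.prems]])
    show "Ck k (\<lambda>x. h (frechet_derivative f (at x) v))" for v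
      using Suc by simp
  qed
qed

lemma Ck_id: "Ck k (\<lambda>x::vec3. x)"
proof (cases k)
  case (Suc n)
  then show ?thesis by (auto intro!: Ck_SucI[where f' = "\<lambda>x v. v"])
qed simp

lemma Ck_add:
  assumes "Ck k f" "Ck k g"
  shows "Ck k (\<lambda>x. f x + g x)"
  using assms
proof (induction k arbitrary: f g)
  case 0
  then show ?case by (simp add: continuous_on_add)
next
  case (Suc k)
  show ?case
  proof (rule Ck_SucI)
    show "((\<lambda>x. f x + g x) has_derivative
        (\<lambda>v. frechet_derivative f (at x) v + frechet_derivative g (at x) v)) (at x)" for x
      by (intro has_derivative_add Ck_Suc_derivative[OF Suc.prems(1)] Ck_Suc_derivative[OF Suc.prems(2)])
    show "Ck k (\<lambda>x. frechet_derivative f (at x) v + frechet_derivative g (at x) v)" for v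
      using Suc by simp
  qed
qed

lemma Ck_sum:
  assumes "\<And>i. i \<in> A \<Longrightarrow> Ck k (f i)"
  shows "Ck k (\<lambda>x. \<Sum>i\<in>A. f i x)"
  using assms by (induction A rule: infinite_finite_induct) (auto intro: Ck_add)

lemma Ck_bilinear:
  assumes "bounded_bilinear h" "Ck k f" "Ck k g"
  shows "Ck k (\<lambda>x. h (f x) (g x))"
  using assms(2,3)
proof (induction k arbitrary: f g)
  case 0
  then show ?case by (simp add: bounded_bilinear.continuous_on[OF assms(1)])
next
  case (Suc k)
  show ?case
  proof (rule Ck_SucI)
    show "((\<lambda>x. h (f x) (g x)) has_derivative
        (\<lambda>v. h (f x) (frechet_derivative g (at x) v) + h (frechet_derivative f (at x) v) (g x))) (at x)" for x
      by (intro bounded_bilinear.FDERIV[OF assms(1)] Ck_Suc_derivative[OF Suc.prems(1)] Ck_Suc_derivative[OF Suc.prems(2)])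
    show "Ck k (\<lambda>x. h (f x) (frechet_derivative g (at x) v) + h (frechet_derivative f (at x) v) (g x))" for v
      using Suc.prems by (intro Ck_add Suc.IH) (auto intro: Ck_SucD simp del: Ck.simps(1))
  qed
qed

lemmas Ck_mult = Ck_bilinear[OF bounded_bilinear_mult]
lemmas Ck_scaleR = Ck_bilinear[OF bounded_bilinear_scaleR]
lemmas Ck_inner = Ck_bilinear[OF bounded_bilinear_inner]
lemmas Ck_minus = Ck_bounded_linear[OF bounded_linear_minus[OF bounded_linear_ident]]

lemma Ck_diff: "Ck k f \<Longrightarrow> Ck k g \<Longrightarrow> Ck k (\<lambda>x. f x - g x)"
  using Ck_add[of k f "\<lambda>x. - g x"] Ck_minus[of k g] by simp

text \<open>Reduces smoothness of fields to scalar entries, so that curls, pullbacks and inverse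
  Jacobians can be treated as sums, products and quotients of smooth functions.\<close>

lemma Ck_vec_iff:
  fixes f :: "vec3 \<Rightarrow> real ^ 'n"
  shows "Ck k f \<longleftrightarrow> (\<forall>i. Ck k (\<lambda>x. f x $ i))"
proof
  assume "Ck k f"
  then show "\<forall>i. Ck k (\<lambda>x. f x $ i)"
    using Ck_bounded_linear[OF bounded_linear_vec_nth] by blast
next
  assume "\<forall>i. Ck k (\<lambda>x. f x $ i)"
  then show "Ck k f"
  proof (induction k arbitrary: f)
    case 0
    then show ?case
      using continuous_on_vec_lambda[of UNIV "\<lambda>i x. f x $ i"] by simp
  next
    case (Suc k)
    let ?D = "\<lambda>x i. frechet_derivative (\<lambda>x. f x $ i) (at x)"
    show ?case
    proof (rule Ck_SucI)
      fix x
      have "((\<lambda>x. f x $ i) has_derivative ?D x i) (at x)" for i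
        using Suc.prems Ck_Suc_derivative by blast
      then show "(f has_derivative (\<lambda>v. \<chi> i. ?D x i v)) (at x)"
        by (subst has_derivative_componentwise_within) (auto simp: Basis_vec_def inner_axis)
    next
      fix v show "Ck k (\<lambda>x. \<chi> i. ?D x i v)"
        using Suc by simp
    qed
  qed
qed

text \<open>The chain rule evaluates the derivative of \<open>f\<close> at \<open>T x\<close> in a
  direction that itself varies with \<open>x\<close>, whereas \<open>Ck\<close> speaks of
  derivatives in fixed directions. Expanding the direction in the coordinate axes gives a sum of
  products to which the induction hypothesis applies.\<close>

lemma Ck_compose:
  fixes f :: "vec3 \<Rightarrow> 'b::real_normed_vector" and T :: "vec3 \<Rightarrow> vec3"
  assumes "Ck k f" "Ck k T"
  shows "Ck k (\<lambda>x. f (T x))"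
  using assms
proof (induction k arbitrary: f)
  case 0
  then show ?case
    using continuous_on_compose2[of UNIV f UNIV T] by simp
next
  case (Suc k)
  let ?Df = "\<lambda>x. frechet_derivative f (at x)" and ?DT = "\<lambda>x. frechet_derivative T (at x)"
  have expand: "?Df y w = (\<Sum>j\<in>UNIV. w $ j *\<^sub>R ?Df y (axis j 1))" for y w
  proof -
    have lin: "linear (?Df y)"
      using Ck_Suc_derivative[OF Suc.prems(1), of y] has_derivative_linear by blast
    have "w = (\<Sum>j\<in>UNIV. w $ j *\<^sub>R axis j 1)"
      using basis_expansion[of w] by (simp add: scalar_mult_eq_scaleR)
    then have "?Df y w = ?Df y (\<Sum>j\<in>UNIV. w $ j *\<^sub>R axis j 1)" by simp
    then show ?thesis by (simp add: linear_sum[OF lin] linear_scale[OF lin])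
  qed
  show ?case
  proof (rule Ck_SucI)
    fix x
    have "((f \<circ> T) has_derivative (?Df (T x) \<circ> ?DT x)) (at x)"
      by (rule diff_chain_at[OF Ck_Suc_derivative[OF Suc.prems(2)] Ck_Suc_derivative[OF Suc.prems(1)]])
    then show "((\<lambda>x. f (T x)) has_derivative (\<lambda>v. ?Df (T x) (?DT x v))) (at x)"
      by (simp add: o_def)
  next
    fix v
    have "Ck k (\<lambda>x. \<Sum>j\<in>UNIV. (?DT x v) $ j *\<^sub>R ?Df (T x) (axis j 1))"
    proof (intro Ck_sum Ck_scaleR Suc.IH)
      show "Ck k (\<lambda>x. ?DT x v $ j)" for j
        using Suc.prems(2) by (intro Ck_bounded_linear[OF bounded_linear_vec_nth]) simp
      show "Ck k (\<lambda>x. ?Df x (axis j 1))" for j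
        using Suc.prems(1) by simp
      show "Ck k T" using Ck_SucD Suc.prems(2) by blast
    qed
    then show "Ck k (\<lambda>x. ?Df (T x) (?DT x v))"
      by (subst expand)
  qed
qed

text \<open>\<open>h\<close> lists a scalar function together with all its derivatives, and the
  induction on \<open>k\<close> runs for all \<open>n\<close> at once: differentiating moves from
  \<open>h n\<close> to \<open>h (Suc n)\<close>. The set \<open>U\<close> admits functions with
  singularities, such as \<open>1 / y\<close> away from zero.\<close>

lemma Ck_real_compose:
  fixes h :: "nat \<Rightarrow> real \<Rightarrow> real" and g :: "vec3 \<Rightarrow> real"
  assumes h: "\<And>n y. y \<in> U \<Longrightarrow> (h n has_real_derivative h (Suc n) y) (at y)"
    and "Ck k g" "\<And>x. g x \<in> U"
  shows "Ck k (\<lambda>x. h n (g x))"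
  using assms(2)
proof (induction k arbitrary: n)
  case 0
  have "continuous_on U (h n)"
    by (meson DERIV_continuous_on h has_field_derivative_at_within)
  then show ?case
    using 0 assms(3) continuous_on_compose2[of U "h n" UNIV g] by auto
next
  case (Suc k)
  show ?case
  proof (rule Ck_SucI)
    fix x
    show "((\<lambda>x. h n (g x)) has_derivative (\<lambda>v. h (Suc n) (g x) * frechet_derivative g (at x) v)) (at x)"
      using has_derivative_compose[OF Ck_Suc_derivative[OF Suc.prems(1)], of "h n" "(*) (h (Suc n) (g x))" x]
        h[OF assms(3), of n x]
      by (simp add: has_field_derivative_def)
  next
    fix v show "Ck k (\<lambda>x. h (Suc n) (g x) * frechet_derivative g (at x) v)"
      using Suc Ck_SucD by (intro Ck_mult) (auto simp del: Ck.simps(1))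
  qed
qed

lemma Ck_inverse:
  fixes g :: "vec3 \<Rightarrow> real"
  assumes "Ck k g" "\<And>x. g x \<noteq> 0"
  shows "Ck k (\<lambda>x. 1 / g x)"
proof -
  \<comment> \<open>The n-th derivative of \<open>1 / y\<close>, that is
    \<open>(-1)^n n! / y^(n+1)\<close>.\<close>
  let ?h = "\<lambda>n y::real. (-1)^n * fact n * inverse y ^ Suc n"
  have "(?h n has_real_derivative ?h (Suc n) y) (at y)" if "y \<in> -{0}" for n y
  proof -
    have "(?h n has_real_derivative
        (-1)^n * fact n * (real (Suc n) * inverse y ^ n * (- (inverse y * inverse y)))) (at y)"
      using that DERIV_cmult[OF DERIV_power[OF DERIV_inverse'[OF DERIV_ident], where n = "Suc n"], of y "(-1)^n * fact n" UNIV]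
      by (simp add: mult_ac)
    moreover have "(-1)^n * fact n * (real (Suc n) * inverse y ^ n * (- (inverse y * inverse y))) = ?h (Suc n) y"
      by (simp add: algebra_simps)
    ultimately show ?thesis by (rule DERIV_cong)
  qed
  from Ck_real_compose[of "-{0}" ?h, OF this assms(1), of 0] show ?thesis
    using assms(2) by (simp add: divide_inverse)
qed

lemma Ck_exp:
  fixes g :: "vec3 \<Rightarrow> real"
  assumes "Ck k g"
  shows "Ck k (\<lambda>x. exp (g x))"
  using Ck_real_compose[of UNIV "\<lambda>n. exp" k g 0] assms by (simp add: DERIV_exp)

section \<open>Smooth bump functions on balls\<close>

definition flat_fun :: "real poly \<Rightarrow> real \<Rightarrow> real" where
  "flat_fun p x = (if x > 0 then poly p (1/x) * exp (- (1/x)) else 0)"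

lemma flat_fun_at_right: "((\<lambda>x. flat_fun p x / x) \<longlongrightarrow> 0) (at_right 0)"
proof -
  have *: "((\<lambda>y::real. y ^ n / exp y) \<longlongrightarrow> 0) at_top" for n
    by (rule tendsto_power_div_exp_0)
  have "((\<lambda>y. \<Sum>i\<le>degree q. coeff q i * (y ^ i / exp y)) \<longlongrightarrow> (\<Sum>i\<le>degree q. coeff q i * 0)) at_top" for q :: "real poly"
    by (intro tendsto_intros *)
  then have "((\<lambda>y. poly q y * exp (-y)) \<longlongrightarrow> 0) at_top" for q :: "real poly"
    by (simp add: poly_altdef sum_distrib_right exp_minus divide_inverse mult.assoc)
  from this[of "pCons 0 p"] have "((\<lambda>y. y * poly p y * exp (-y)) \<longlongrightarrow> 0) at_top" by simp
  then have "((\<lambda>x. inverse x * poly p (inverse x) * exp (-(inverse x))) \<longlongrightarrow> 0) (at_right 0)"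
    by (rule filterlim_compose[OF _ filterlim_inverse_at_top_right])
  then show ?thesis
    by (rule Lim_transform_eventually)
       (auto simp: flat_fun_def eventually_at_right_field divide_inverse intro!: exI[of _ 1])
qed

text \<open>The functions \<open>p(1/x) exp(-1/x)\<close> are closed under differentiation: with
  \<open>y = 1/x\<close> the derivative belongs to the polynomial \<open>y^2 (p - p')\<close>. At
  the origin the difference quotients from the right vanish in the limit by exponential decay, those
  from the left identically. Iterating this makes \<open>exp(-1/x)\<close> smooth across
  zero.\<close>

lemma flat_fun_derivative:
  "(flat_fun p has_real_derivative flat_fun ([:0,0,1:] * (p - pderiv p)) x) (at x)"
proof -
  let ?q = "[:0,0,1:] * (p - pderiv p)"
  consider "x > 0" | "x < 0" | "x = 0" by linarith
  then show ?thesis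
  proof cases
    case 1
    have "((\<lambda>x. poly p (1/x) * exp (- (1/x))) has_real_derivative flat_fun ?q x) (at x)"
      using 1 by (auto intro!: derivative_eq_intros DERIV_chain2[OF poly_DERIV]
          simp: flat_fun_def field_simps power2_eq_square)
    then show ?thesis
      by (rule has_field_derivative_transform_within_open[of _ _ _ "{0<..}"])
         (use 1 in \<open>auto simp: flat_fun_def\<close>)
  next
    case 2
    have "((\<lambda>x. 0) has_real_derivative flat_fun ?q x) (at x)"
      using 2 by (simp add: flat_fun_def)
    then show ?thesis
      by (rule has_field_derivative_transform_within_open[of _ _ _ "{..<0}"])
         (use 2 in \<open>auto simp: flat_fun_def\<close>)
  next
    case 3
    have "((\<lambda>x. flat_fun p x / x) \<longlongrightarrow> 0) (at_left 0)"
      by (rule Lim_transform_eventually[OF tendsto_const])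
         (auto simp: flat_fun_def eventually_at_left_field intro!: exI[of _ "-1"])
    then have "((\<lambda>x. flat_fun p x / x) \<longlongrightarrow> 0) (at 0)"
      using flat_fun_at_right filterlim_split_at by blast
    then show ?thesis
      using 3 by (simp add: has_field_derivative_iff flat_fun_def)
  qed
qed

text \<open>The argument uses the squared distance, which unlike the distance is smooth at the
  centre.\<close>

definition ball_bump :: "vec3 \<Rightarrow> real \<Rightarrow> vec3 \<Rightarrow> real" where
  "ball_bump c r x = flat_fun 1 (r\<^sup>2 - (x - c) \<bullet> (x - c))"

lemma Ck_ball_bump: "Ck k (ball_bump c r)"
proof -
  let ?h = "\<lambda>n. flat_fun (((\<lambda>p. [:0,0,1:] * (p - pderiv p)) ^^ n) 1)"
  have "Ck k (\<lambda>x. r\<^sup>2 - (x - c) \<bullet> (x - c))"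
    by (intro Ck_diff Ck_const Ck_inner Ck_id)
  moreover have "(?h n has_real_derivative ?h (Suc n) y) (at y)" for n y
    using flat_fun_derivative[of "((\<lambda>p. [:0,0,1:] * (p - pderiv p)) ^^ n) 1" y] by simp
  ultimately have "Ck k (\<lambda>x. ?h 0 (r\<^sup>2 - (x - c) \<bullet> (x - c)))"
    using Ck_real_compose[of UNIV ?h k "\<lambda>x. r\<^sup>2 - (x - c) \<bullet> (x - c)" 0] by blast
  then show ?thesis
    by (simp add: ball_bump_def[abs_def])
qed

lemma ball_bump_pos_iff: "r \<ge> 0 \<Longrightarrow> ball_bump c r x > 0 \<longleftrightarrow> x \<in> ball c r"
proof -
  assume "r \<ge> 0"
  have "dist c x < r \<longleftrightarrow> (norm (x - c))\<^sup>2 < r\<^sup>2"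
    using \<open>r \<ge> 0\<close> by (metis abs_le_square_iff abs_norm_cancel abs_of_nonneg dist_norm norm_minus_commute not_le)
  then show ?thesis
    by (simp add: ball_bump_def flat_fun_def power2_norm_eq_inner)
qed

lemma ball_bump_nonneg: "ball_bump c r x \<ge> 0"
  by (simp add: ball_bump_def flat_fun_def)

lemma ball_bump_eq_0: "r \<ge> 0 \<Longrightarrow> x \<notin> ball c r \<Longrightarrow> ball_bump c r x = 0"
  using ball_bump_pos_iff[of r c x] ball_bump_nonneg[of c r x] by linarith

section \<open>Square integrable fields\<close>

text \<open>The elements are functions, so \<open>L2norm\<close> is a seminorm and null sets have to
  be carried along. The codomain is a general Euclidean space because fields, pairs of fields and
  scalar functions all occur.\<close>

definition L2 :: "'a measure \<Rightarrow> ('a \<Rightarrow> 'b::euclidean_space) set" where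
  "L2 M = {f \<in> borel_measurable M. integrable M (\<lambda>x. (norm (f x))\<^sup>2)}"

definition L2norm :: "'a measure \<Rightarrow> ('a \<Rightarrow> 'b::euclidean_space) \<Rightarrow> real" where
  "L2norm M f = sqrt (LINT x|M. (norm (f x))\<^sup>2)"

lemma L2_on_eq: "L2_on \<Omega> = L2 (lebesgue_on \<Omega>)"
  by (auto simp: L2_on_def L2_def)

lemma L2_measurable: "f \<in> L2 M \<Longrightarrow> f \<in> borel_measurable M"
  and L2_integrable: "f \<in> L2 M \<Longrightarrow> integrable M (\<lambda>x. (norm (f x))\<^sup>2)"
  by (auto simp: L2_def)

lemma L2norm_nonneg [simp]: "L2norm M f \<ge> 0"
  by (simp add: L2norm_def)

lemma L2norm_sq: "(L2norm M f)\<^sup>2 = (LINT x|M. (norm (f x))\<^sup>2)"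
  by (simp add: L2norm_def)

lemma L2norm_cong_AE:
  assumes "f \<in> borel_measurable M" "g \<in> borel_measurable M" "AE x in M. norm (f x) = norm (g x)"
  shows "L2norm M f = L2norm M g"
  unfolding L2norm_def using assms by (auto intro!: arg_cong[of _ _ sqrt] integral_cong_AE)

lemma L2_dominated:
  assumes "f \<in> L2 M" "g \<in> borel_measurable M" "C \<ge> 0" "AE x in M. norm (g x) \<le> C * norm (f x)"
  shows "g \<in> L2 M" "L2norm M g \<le> C * L2norm M f"
proof -
  have int: "integrable M (\<lambda>x. C\<^sup>2 * (norm (f x))\<^sup>2)"
    using assms(1) by (simp add: L2_def)
  have le: "AE x in M. (norm (g x))\<^sup>2 \<le> C\<^sup>2 * (norm (f x))\<^sup>2"
    using assms(4) by eventually_elim (metis norm_ge_zero power_mono power_mult_distrib)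
  have "integrable M (\<lambda>x. (norm (g x))\<^sup>2)"
    by (rule Bochner_Integration.integrable_bound[OF int]) (use assms(2) le in auto)
  then show "g \<in> L2 M" using assms(2) by (simp add: L2_def)
  have "(LINT x|M. (norm (g x))\<^sup>2) \<le> (LINT x|M. C\<^sup>2 * (norm (f x))\<^sup>2)"
    by (rule integral_mono_AE[OF \<open>integrable M (\<lambda>x. (norm (g x))\<^sup>2)\<close> int le])
  then have "(L2norm M g)\<^sup>2 \<le> (C * L2norm M f)\<^sup>2"
    by (simp add: L2norm_sq power_mult_distrib)
  then show "L2norm M g \<le> C * L2norm M f"
    by (rule power2_le_imp_le) (simp add: assms(3))
qed

lemma L2_AE_cong:
  assumes "f \<in> L2 M" "g \<in> borel_measurable M" "AE x in M. g x = f x"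
  shows "g \<in> L2 M"
proof (rule L2_dominated(1)[OF assms(1,2), of 1])
  show "AE x in M. norm (g x) \<le> 1 * norm (f x)"
    using assms(3) by eventually_elim simp
qed simp

lemma L2_norm_mult:
  assumes "f \<in> L2 M" "g \<in> L2 M"
  shows "integrable M (\<lambda>x. norm (f x) * norm (g x))"
proof -
  have "integrable M (\<lambda>x. (norm (f x))\<^sup>2 + (norm (g x))\<^sup>2)"
    using assms by (simp add: L2_def)
  moreover have "(\<lambda>x. norm (f x) * norm (g x)) \<in> borel_measurable M"
    using assms[THEN L2_measurable] by simp
  moreover have "AE x in M. norm (norm (f x) * norm (g x)) \<le> norm ((norm (f x))\<^sup>2 + (norm (g x))\<^sup>2)"
  proof (rule AE_I2)
    fix x
    have "2 * (norm (f x) * norm (g x)) \<le> (norm (f x))\<^sup>2 + (norm (g x))\<^sup>2"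
      using sum_squares_bound[of "norm (f x)" "norm (g x)"] by simp
    moreover have "0 \<le> norm (f x) * norm (g x)" by simp
    ultimately show "norm (norm (f x) * norm (g x)) \<le> norm ((norm (f x))\<^sup>2 + (norm (g x))\<^sup>2)"
      unfolding real_norm_def by linarith
  qed
  ultimately show ?thesis
    by (rule Bochner_Integration.integrable_bound)
qed

text \<open>Cauchy-Schwarz from the discriminant of the nonnegative quadratic polynomial
  \<open>a - 2 t b + t^2 c\<close> in \<open>t\<close>, the integral of the square of
  \<open>norm (f x) - t * norm (g x)\<close>.\<close>

lemma L2_norm_mult_le:
  assumes "f \<in> L2 M" "g \<in> L2 M"
  shows "(LINT x|M. norm (f x) * norm (g x)) \<le> L2norm M f * L2norm M g"
proof -
  let ?a = "(L2norm M f)\<^sup>2" and ?c = "(L2norm M g)\<^sup>2" and ?b = "LINT x|M. norm (f x) * norm (g x)"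
  have quad: "0 \<le> ?a - 2 * t * ?b + t\<^sup>2 * ?c" for t
  proof -
    have "0 \<le> (LINT x|M. (norm (f x) - t * norm (g x))\<^sup>2)"
      by simp
    also have "\<dots> = (LINT x|M. (norm (f x))\<^sup>2 - 2 * t * (norm (f x) * norm (g x)) + t\<^sup>2 * (norm (g x))\<^sup>2)"
      by (simp add: power2_diff power_mult_distrib algebra_simps)
    also have "\<dots> = ?a - 2 * t * ?b + t\<^sup>2 * ?c"
      using assms L2_norm_mult[OF assms]
      by (simp add: L2_integrable L2norm_sq Bochner_Integration.integral_add Bochner_Integration.integral_diff)
    finally show ?thesis .
  qed
  have b: "?b \<ge> 0" by simp
  have "?b\<^sup>2 \<le> ?a * ?c"
  proof (cases "?c = 0")
    case True
    have "?b = 0"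
    proof (rule ccontr)
      assume "?b \<noteq> 0"
      then have "?b > 0" using b by linarith
      \<comment> \<open>With \<open>?c = 0\<close> the quadratic is affine in \<open>t\<close>, and
        this \<open>t\<close> makes it equal to \<open>-1\<close>.\<close>
      from quad[of "(?a + 1) / (2 * ?b)"] True \<open>?b > 0\<close> show False
        by (simp add: field_simps)
    qed
    then show ?thesis using True by simp
  next
    case False
    then have c: "?c > 0" by simp
    have "b\<^sup>2 \<le> a * c" if "0 \<le> a - 2 * (b / c) * b + (b / c)\<^sup>2 * c" "c > 0" for a b c :: real
      using that by (simp add: field_simps power2_eq_square)
    from this[OF quad c] show ?thesis .
  qed
  then have "?b\<^sup>2 \<le> (L2norm M f * L2norm M g)\<^sup>2"
    by (simp add: power_mult_distrib)
  then show ?thesis by (rule power2_le_imp_le) simp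
qed

lemma L2_bound_integrable:
  assumes "f \<in> L2 M" "g \<in> L2 M" "h \<in> borel_measurable M"
    and "AE x in M. \<bar>h x\<bar> \<le> C * (norm (f x) * norm (g x))"
  shows "integrable M h" "\<bar>LINT x|M. h x\<bar> \<le> \<bar>C\<bar> * (L2norm M f * L2norm M g)"
proof -
  have int: "integrable M (\<lambda>x. C * (norm (f x) * norm (g x)))"
    using L2_norm_mult[OF assms(1,2)] by simp
  show h: "integrable M h"
    by (rule Bochner_Integration.integrable_bound[OF int assms(3)]) (use assms(4) in \<open>eventually_elim, auto\<close>)
  have "\<bar>LINT x|M. h x\<bar> \<le> (LINT x|M. \<bar>h x\<bar>)"
    using integral_norm_bound[of M h] by simp
  also have "\<dots> \<le> (LINT x|M. C * (norm (f x) * norm (g x)))"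
    using h int assms(4) by (intro integral_mono_AE) auto
  also have "\<dots> = C * (LINT x|M. norm (f x) * norm (g x))"
    by simp
  also have "\<dots> \<le> \<bar>C\<bar> * (LINT x|M. norm (f x) * norm (g x))"
    by (intro mult_right_mono) auto
  also have "\<dots> \<le> \<bar>C\<bar> * (L2norm M f * L2norm M g)"
    using L2_norm_mult_le[OF assms(1,2)] by (simp add: mult_left_mono)
  finally show "\<bar>LINT x|M. h x\<bar> \<le> \<bar>C\<bar> * (L2norm M f * L2norm M g)" .
qed

lemma L2_inner:
  assumes "f \<in> L2 M" "g \<in> L2 M"
  shows "integrable M (\<lambda>x. f x \<bullet> g x)" "\<bar>LINT x|M. f x \<bullet> g x\<bar> \<le> L2norm M f * L2norm M g"
proof -
  have m: "(\<lambda>x. f x \<bullet> g x) \<in> borel_measurable M"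
    by (intro borel_measurable_inner L2_measurable assms)
  have "AE x in M. \<bar>f x \<bullet> g x\<bar> \<le> 1 * (norm (f x) * norm (g x))"
    by (simp add: Cauchy_Schwarz_ineq2)
  from L2_bound_integrable[OF assms m this]
  show "integrable M (\<lambda>x. f x \<bullet> g x)" "\<bar>LINT x|M. f x \<bullet> g x\<bar> \<le> L2norm M f * L2norm M g"
    by simp_all
qed

lemma L2_scaleR:
  assumes "f \<in> L2 M"
  shows "(\<lambda>x. c *\<^sub>R f x) \<in> L2 M" "L2norm M (\<lambda>x. c *\<^sub>R f x) = \<bar>c\<bar> * L2norm M f"
proof -
  have "(\<lambda>x. c *\<^sub>R f x) \<in> borel_measurable M"
    by (intro borel_measurable_scaleR borel_measurable_const L2_measurable assms)
  then show "(\<lambda>x. c *\<^sub>R f x) \<in> L2 M" "L2norm M (\<lambda>x. c *\<^sub>R f x) = \<bar>c\<bar> * L2norm M f"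
    using L2_integrable[OF assms] by (simp_all add: L2_def L2norm_def power_mult_distrib real_sqrt_mult)
qed

lemma L2_add:
  assumes "f \<in> L2 M" "g \<in> L2 M"
  shows "(\<lambda>x. f x + g x) \<in> L2 M" "L2norm M (\<lambda>x. f x + g x) \<le> L2norm M f + L2norm M g"
proof -
  have eq: "(norm (f x + g x))\<^sup>2 = (norm (f x))\<^sup>2 + 2 * (f x \<bullet> g x) + (norm (g x))\<^sup>2" for x
    unfolding power2_norm_eq_inner inner_add_left inner_add_right inner_commute[of "g x" "f x"] by linarith
  note [simp] = L2_inner(1)[OF assms] L2_integrable[OF assms(1)] L2_integrable[OF assms(2)]
  show "(\<lambda>x. f x + g x) \<in> L2 M"
    using assms by (simp add: L2_def eq)
  have "(L2norm M (\<lambda>x. f x + g x))\<^sup>2 = (L2norm M f)\<^sup>2 + 2 * (LINT x|M. f x \<bullet> g x) + (L2norm M g)\<^sup>2"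
    by (simp add: L2norm_sq eq)
  also have "\<dots> \<le> (L2norm M f + L2norm M g)\<^sup>2"
    using L2_inner(2)[OF assms] by (simp add: power2_sum abs_le_iff)
  finally show "L2norm M (\<lambda>x. f x + g x) \<le> L2norm M f + L2norm M g"
    by (rule power2_le_imp_le) simp
qed

lemma L2_diff:
  assumes "f \<in> L2 M" "g \<in> L2 M"
  shows "(\<lambda>x. f x - g x) \<in> L2 M" "L2norm M (\<lambda>x. f x - g x) \<le> L2norm M f + L2norm M g"
  using L2_add[OF assms(1) L2_scaleR(1)[OF assms(2), of "-1"]] L2_scaleR(2)[OF assms(2), of "-1"]
  by auto

lemma L2norm_triangle:
  assumes "f \<in> L2 M" "g \<in> L2 M" "h \<in> L2 M"
  shows "L2norm M (\<lambda>x. f x - h x) \<le> L2norm M (\<lambda>x. f x - g x) + L2norm M (\<lambda>x. g x - h x)"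
  using L2_add(2)[OF L2_diff(1)[OF assms(1,2)] L2_diff(1)[OF assms(2,3)]] by simp

lemma L2norm_minus_commute: "L2norm M (\<lambda>x. f x - g x) = L2norm M (\<lambda>x. g x - f x)"
  by (simp add: L2norm_def norm_minus_commute)

lemma L2_bounded:
  assumes "finite_measure M" "f \<in> borel_measurable M" "AE x in M. norm (f x) \<le> C"
  shows "f \<in> L2 M"
proof -
  interpret finite_measure M by fact
  have "AE x in M. (norm (f x))\<^sup>2 \<le> \<bar>C\<bar>\<^sup>2"
    using assms(3) by eventually_elim (auto intro!: power_mono simp del: power2_abs)
  then have "integrable M (\<lambda>x. (norm (f x))\<^sup>2)"
    using assms(2) by (intro integrable_const_bound[where B = "\<bar>C\<bar>\<^sup>2"]) auto
  then show ?thesis using assms(2) by (simp add: L2_def)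
qed

lemma L2_const: "finite_measure M \<Longrightarrow> (\<lambda>x. c) \<in> L2 M"
  by (rule L2_bounded[where C = "norm c"]) auto

lemma L2_norm_integrable:
  assumes "finite_measure M" "f \<in> L2 M"
  shows "integrable M (\<lambda>x. norm (f x))" "(LINT x|M. norm (f x)) \<le> sqrt (measure M (space M)) * L2norm M f"
proof -
  interpret finite_measure M by fact
  have one: "(\<lambda>x. 1::real) \<in> L2 M" by (rule L2_const) fact
  show "integrable M (\<lambda>x. norm (f x))"
    using L2_norm_mult[OF one assms(2)] by simp
  have "L2norm M (\<lambda>x. 1::real) = sqrt (measure M (space M))"
    by (simp add: L2norm_def)
  then show "(LINT x|M. norm (f x)) \<le> sqrt (measure M (space M)) * L2norm M f"
    using L2_norm_mult_le[OF one assms(2)] by simp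
qed

lemma L2_Pair:
  assumes "f \<in> L2 M" "g \<in> L2 M"
  shows "(\<lambda>x. (f x, g x)) \<in> L2 M"
    "(L2norm M (\<lambda>x. (f x, g x)))\<^sup>2 = (L2norm M f)\<^sup>2 + (L2norm M g)\<^sup>2"
proof -
  have eq: "(norm (f x, g x))\<^sup>2 = (norm (f x))\<^sup>2 + (norm (g x))\<^sup>2" for x
    by (simp add: norm_Pair)
  show "(\<lambda>x. (f x, g x)) \<in> L2 M"
    unfolding L2_def mem_Collect_eq eq using assms by (auto simp: L2_def)
  show "(L2norm M (\<lambda>x. (f x, g x)))\<^sup>2 = (L2norm M f)\<^sup>2 + (L2norm M g)\<^sup>2"
    unfolding L2norm_sq eq using assms by (simp add: L2_integrable)
qed

lemma L2_fst_snd: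
  assumes "p \<in> L2 M"
  shows "(\<lambda>x. fst (p x)) \<in> L2 M" "(\<lambda>x. snd (p x)) \<in> L2 M"
    "L2norm M (\<lambda>x. fst (p x)) \<le> L2norm M p" "L2norm M (\<lambda>x. snd (p x)) \<le> L2norm M p"
proof -
  have m[measurable]: "p \<in> borel_measurable M" using assms by (simp add: L2_def)
  have f: "(\<lambda>x. fst (p x)) \<in> borel_measurable M" and s: "(\<lambda>x. snd (p x)) \<in> borel_measurable M"
    by (auto intro!: borel_measurable_continuous_on[OF _ m] continuous_intros)
  show "(\<lambda>x. fst (p x)) \<in> L2 M" "(\<lambda>x. snd (p x)) \<in> L2 M"
    "L2norm M (\<lambda>x. fst (p x)) \<le> L2norm M p" "L2norm M (\<lambda>x. snd (p x)) \<le> L2norm M p"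
    using L2_dominated[OF assms f, of 1] L2_dominated[OF assms s, of 1]
      norm_fst_le[of "fst (p x)" "snd (p x)" for x] norm_snd_le[of "snd (p x)" "fst (p x)" for x]
    by auto
qed

section \<open>Completeness of L2\<close>

lemma AE_summable_of_L2norm:
  fixes d :: "nat \<Rightarrow> 'a \<Rightarrow> 'b::euclidean_space"
  assumes fin: "finite_measure M" and d: "\<And>n. d n \<in> L2 M" and K: "\<And>n. L2norm M (d n) \<le> K / 2^n"
  shows "AE x in M. summable (\<lambda>n. norm (d n x))"
proof -
  let ?m = "sqrt (measure M (space M))"
  have meas[measurable]: "d n \<in> borel_measurable M" for n using d by (simp add: L2_def)
  have K0: "K \<ge> 0" using order_trans[OF L2norm_nonneg K[of 0]] by simp
  have "(\<integral>\<^sup>+x. (\<Sum>n. ennreal (norm (d n x))) \<partial>M) = (\<Sum>n. \<integral>\<^sup>+x. ennreal (norm (d n x)) \<partial>M)"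
    by (rule nn_integral_suminf) auto
  also have "\<dots> = (\<Sum>n. ennreal (LINT x|M. norm (d n x)))"
    using L2_norm_integrable(1)[OF fin d] by (simp add: nn_integral_eq_integral)
  also have "\<dots> \<le> (\<Sum>n. ennreal (?m * K * (1/2)^n))"
  proof (intro suminf_le ennreal_leI)
    fix n
    have "(LINT x|M. norm (d n x)) \<le> ?m * L2norm M (d n)"
      using L2_norm_integrable(2)[OF fin d] .
    also have "\<dots> \<le> ?m * (K / 2^n)" by (intro mult_left_mono K) auto
    finally show "(LINT x|M. norm (d n x)) \<le> ?m * K * (1/2)^n"
      by (simp add: power_divide)
  qed auto
  also have "\<dots> = ennreal (\<Sum>n. ?m * K * (1/2)^n)"
    using K0 by (intro suminf_ennreal_eq sums_mult summable_sums) (auto intro!: summable_sums summable_geometric summable_mult)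
  finally have "(\<integral>\<^sup>+x. (\<Sum>n. ennreal (norm (d n x))) \<partial>M) \<noteq> \<infinity>"
    by (auto simp: top_unique)
  then have "AE x in M. (\<Sum>n. ennreal (norm (d n x))) \<noteq> \<infinity>"
    by (intro nn_integral_PInf_AE) auto
  then show ?thesis
    by eventually_elim (auto intro!: summable_suminf_not_top)
qed

text \<open>Riesz-Fischer for sequences with geometrically small steps. On a finite measure space
  the sum of the step norms has a finite integral, so the sequence converges almost everywhere to
  \<open>g\<close>; Fatou's lemma then turns the Cauchy estimate into convergence in norm.\<close>

lemma L2_complete:
  fixes f :: "nat \<Rightarrow> 'a \<Rightarrow> 'b::euclidean_space"
  assumes fin: "finite_measure M" and f: "\<And>n. f n \<in> L2 M"
    and K: "\<And>n. L2norm M (\<lambda>x. f (Suc n) x - f n x) \<le> K / 2^n"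
  obtains g where "g \<in> L2 M" "(\<lambda>n. L2norm M (\<lambda>x. f n x - g x)) \<longlonglongrightarrow> 0"
proof -
  have meas[measurable]: "f n \<in> borel_measurable M" for n using f by (simp add: L2_def)
  have K0: "K \<ge> 0" using order_trans[OF L2norm_nonneg K[of 0]] by simp
  define g where "g x = lim (\<lambda>n. f n x)" for x
  have g[measurable]: "g \<in> borel_measurable M"
    unfolding g_def[abs_def] by measurable
  have conv: "AE x in M. (\<lambda>n. f n x) \<longlonglongrightarrow> g x"
    using AE_summable_of_L2norm[OF fin L2_diff(1)[OF f f] K]
  proof eventually_elim
    case (elim x)
    then have "summable (\<lambda>n. f (Suc n) x - f n x)" by (rule summable_norm_cancel)
    then have "convergent (\<lambda>n. (\<Sum>i<n. f (Suc i) x - f i x) + f 0 x)"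
      by (intro convergent_add convergent_const) (simp add: summable_iff_convergent)
    then have "convergent (\<lambda>n. f n x)"
      using sum_lessThan_telescope[of "\<lambda>n. f n x"] by simp
    then show ?case unfolding g_def using convergent_LIMSEQ_iff by blast
  qed
  have dist: "L2norm M (\<lambda>x. f n x - f (n + k) x) \<le> 2 * K / 2^n" for n k
  proof -
    \<comment> \<open>Keeping the exact remainder \<open>2 K / 2^(n+k)\<close> of the geometric
      series lets the induction close.\<close>
    have "L2norm M (\<lambda>x. f n x - f (n + k) x) \<le> 2 * K / 2^n - 2 * K / 2^(n+k)"
    proof (induction k)
      case 0
      then show ?case by (simp add: L2norm_def)
    next
      case (Suc k)
      have "L2norm M (\<lambda>x. f n x - f (n + Suc k) x)
          \<le> L2norm M (\<lambda>x. f n x - f (n + k) x) + L2norm M (\<lambda>x. f (n + k) x - f (Suc (n + k)) x)"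
        using L2norm_triangle[OF f f f] by simp
      also have "\<dots> \<le> 2 * K / 2^n - 2 * K / 2^(n+k) + K / 2^(n+k)"
        using Suc K[of "n+k"] by (subst (2) L2norm_minus_commute) linarith
      finally show ?case by (simp add: field_simps)
    qed
    then show ?thesis using K0 by (smt (verit) divide_nonneg_pos zero_less_power)
  qed
  have bnd: "(\<integral>\<^sup>+x. ennreal ((norm (f n x - g x))\<^sup>2) \<partial>M) \<le> ennreal ((2 * K / 2^n)\<^sup>2)" for n
  proof -
    have "(\<integral>\<^sup>+x. ennreal ((norm (f n x - g x))\<^sup>2) \<partial>M)
        = (\<integral>\<^sup>+x. liminf (\<lambda>k. ennreal ((norm (f n x - f (n + k) x))\<^sup>2)) \<partial>M)"
    proof (rule nn_integral_cong_AE, use conv in eventually_elim)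
      case (elim x)
      have "(\<lambda>k. ennreal ((norm (f n x - f (n + k) x))\<^sup>2)) \<longlonglongrightarrow> ennreal ((norm (f n x - g x))\<^sup>2)"
        using LIMSEQ_ignore_initial_segment[OF elim, of n]
        by (intro tendsto_ennrealI tendsto_intros) (simp add: add.commute)
      then show ?case by (rule lim_imp_Liminf[OF sequentially_bot, symmetric])
    qed
    also have "\<dots> \<le> liminf (\<lambda>k. \<integral>\<^sup>+x. ennreal ((norm (f n x - f (n + k) x))\<^sup>2) \<partial>M)"
      by (rule nn_integral_liminf) auto
    also have "\<dots> \<le> ennreal ((2 * K / 2^n)\<^sup>2)"
    proof (rule order_trans[OF Liminf_le_Limsup Limsup_bounded], simp, rule always_eventually, rule allI)
      fix k
      have "(\<integral>\<^sup>+x. ennreal ((norm (f n x - f (n + k) x))\<^sup>2) \<partial>M) = ennreal ((L2norm M (\<lambda>x. f n x - f (n+k) x))\<^sup>2)"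
        using L2_integrable[OF L2_diff(1)[OF f f]] by (simp add: L2norm_sq nn_integral_eq_integral)
      also have "\<dots> \<le> ennreal ((2 * K / 2^n)\<^sup>2)"
        by (intro ennreal_leI power_mono dist) simp
      finally show "(\<integral>\<^sup>+x. ennreal ((norm (f n x - f (n + k) x))\<^sup>2) \<partial>M) \<le> ennreal ((2 * K / 2^n)\<^sup>2)" .
    qed
    finally show ?thesis .
  qed
  have diffL2: "(\<lambda>x. f n x - g x) \<in> L2 M" for n
  proof -
    have "(\<integral>\<^sup>+x. ennreal (norm ((norm (f n x - g x))\<^sup>2)) \<partial>M) < \<infinity>"
      using le_less_trans[OF bnd[of n]] by simp
    then have "integrable M (\<lambda>x. (norm (f n x - g x))\<^sup>2)"
      by (intro integrableI_bounded) measurable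
    then show ?thesis by (simp add: L2_def)
  qed
  have "L2norm M (\<lambda>x. f n x - g x) \<le> 2 * K / 2^n" for n
  proof -
    have "ennreal ((L2norm M (\<lambda>x. f n x - g x))\<^sup>2) \<le> ennreal ((2 * K / 2^n)\<^sup>2)"
      using bnd[of n] L2_integrable[OF diffL2[of n]] by (simp add: L2norm_sq nn_integral_eq_integral)
    then have "(L2norm M (\<lambda>x. f n x - g x))\<^sup>2 \<le> (2 * K / 2^n)\<^sup>2"
      by (subst (asm) ennreal_le_iff) auto
    then show ?thesis by (rule power2_le_imp_le) (use K0 in simp)
  qed
  then have ub: "norm (L2norm M (\<lambda>x. f n x - g x)) \<le> 2 * K / 2^n" for n
    by simp
  have lim0: "(\<lambda>n. 2 * K / 2^n) \<longlonglongrightarrow> 0"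
    by real_asymp
  have "(\<lambda>n. L2norm M (\<lambda>x. f n x - g x)) \<longlonglongrightarrow> 0"
    by (rule Lim_null_comparison[OF always_eventually[OF allI[OF ub]] lim0])
  moreover have "g \<in> L2 M"
    using L2_diff(1)[OF f[of 0] diffL2[of 0]] by simp
  ultimately show ?thesis using that by blast
qed

section \<open>Test fields and integration by parts\<close>

lemma not_in_fsupport: "x \<notin> fsupport f \<Longrightarrow> f x = 0"
  using closure_subset[of "{x. f x \<noteq> 0}"] by (auto simp: fsupport_def)

lemma fsupport_subset: "closed K \<Longrightarrow> (\<And>x. x \<notin> K \<Longrightarrow> f x = 0) \<Longrightarrow> fsupport f \<subseteq> K"
  unfolding fsupport_def by (rule closure_minimal) auto

lemma closed_fsupport [simp]: "closed (fsupport f)"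
  by (simp add: fsupport_def)

lemma compact_fsupportI: "compact K \<Longrightarrow> (\<And>x. x \<notin> K \<Longrightarrow> f x = 0) \<Longrightarrow> compact (fsupport f)"
  using fsupport_subset[of K f] compact_Int_closed[of K "fsupport f"] compact_imp_closed[of K]
  by (metis closed_fsupport inf.absorb2)

lemma has_derivative_off_fsupport:
  assumes "x \<notin> fsupport f"
  shows "(f has_derivative (\<lambda>v. 0)) (at x)"
proof -
  have "((\<lambda>x. 0) has_derivative (\<lambda>v. 0)) (at x)" by simp
  then show ?thesis
    by (rule has_derivative_transform_within_open[OF _ open_Compl[OF closed_fsupport[of f]]])
       (use assms not_in_fsupport[of _ f] in auto)
qed

lemma frechet_derivative_off_fsupport:
  "x \<notin> fsupport f \<Longrightarrow> frechet_derivative f (at x) = (\<lambda>v. 0)"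
  using frechet_derivative_at[OF has_derivative_off_fsupport] by metis

lemma continuous_fsupport_bounded:
  fixes f :: "vec3 \<Rightarrow> 'b::real_normed_vector"
  assumes "continuous_on UNIV f" "compact K" "\<And>x. x \<notin> K \<Longrightarrow> f x = 0"
  obtains C where "C \<ge> 0" "\<And>x. norm (f x) \<le> C"
proof -
  have "bounded (f ` K)"
    using assms continuous_on_subset compact_continuous_image compact_imp_bounded by blast
  then obtain C where "\<And>x. x \<in> K \<Longrightarrow> norm (f x) \<le> C" "C > 0"
    by (auto simp: bounded_pos)
  then show ?thesis using that[of C] assms(3) by (metis norm_zero less_imp_le)
qed

lemma vec_expand:
  fixes v :: "real^'n"
  shows "v = (\<Sum>j\<in>UNIV. v $ j *\<^sub>R axis j 1)"
  using basis_expansion[of v] by (simp add: scalar_mult_eq_scaleR)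

lemma linear_expand:
  fixes D :: "real^'n \<Rightarrow> 'b::real_vector"
  assumes "linear D"
  shows "D v = (\<Sum>j\<in>UNIV. v $ j *\<^sub>R D (axis j 1))"
proof -
  have "D v = D (\<Sum>j\<in>UNIV. v $ j *\<^sub>R axis j 1)" using vec_expand[of v] by simp
  then show ?thesis by (simp add: linear_sum[OF assms] linear_scale[OF assms])
qed

lemma Ck_linear_derivative: "Ck (Suc k) f \<Longrightarrow> linear (frechet_derivative f (at x))"
  using Ck_Suc_derivative has_derivative_linear by blast

lemma Ck_derivative_bounded:
  assumes "Ck (Suc k) g" "compact (fsupport g)"
  obtains C where "C \<ge> 0" "\<And>x v. norm (frechet_derivative g (at x) v) \<le> C * norm v"
proof -
  let ?D = "\<lambda>j x. frechet_derivative g (at x) (axis j 1)"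
  have "\<exists>C. C \<ge> 0 \<and> (\<forall>x. norm (?D j x) \<le> C)" for j
  proof -
    have "continuous_on UNIV (?D j)"
      using assms(1) by (auto intro: Ck_continuous)
    then show ?thesis
      using continuous_fsupport_bounded[of "?D j", OF _ assms(2)] frechet_derivative_off_fsupport by metis
  qed
  then obtain C where C: "\<And>j. C j \<ge> 0" "\<And>j x. norm (?D j x) \<le> C j" by metis
  show ?thesis
  proof
    show "sum C UNIV \<ge> 0" using C by (simp add: sum_nonneg)
    fix x v
    have "norm (frechet_derivative g (at x) v) = norm (\<Sum>j\<in>UNIV. v $ j *\<^sub>R ?D j x)"
      by (subst linear_expand[OF Ck_linear_derivative[OF assms(1)]]) simp
    also have "\<dots> \<le> (\<Sum>j\<in>UNIV. norm v * C j)"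
      by (intro sum_norm_le) (auto intro!: mult_mono component_le_norm_cart C)
    finally show "norm (frechet_derivative g (at x) v) \<le> sum C UNIV * norm v"
      by (simp add: sum_distrib_left mult.commute)
  qed
qed

lemma integrable_continuous_fsupport:
  fixes f :: "vec3 \<Rightarrow> 'b::euclidean_space"
  assumes "continuous_on UNIV f" "compact K" "\<And>x. x \<notin> K \<Longrightarrow> f x = 0"
  shows "integrable lborel f"
proof -
  have "integrable lborel (\<lambda>x. indicator K x *\<^sub>R f x)"
    using assms(2) continuous_on_subset[OF assms(1)] by (intro borel_integrable_compact) auto
  moreover have "(\<lambda>x. indicator K x *\<^sub>R f x) = f"
    using assms(3) by (force simp: indicator_def)
  ultimately show ?thesis by simp
qed

text \<open>Translation invariance makes every difference quotient of \<open>g\<close> integrate to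
  zero, and the quotients converge to the derivative, dominated by a multiple of the indicator of a
  fixed compact set.\<close>

lemma integral_derivative_eq_0:
  fixes g :: "vec3 \<Rightarrow> real"
  assumes g: "Ck (Suc k) g" and K: "compact (fsupport g)"
  shows "(LINT x|lborel. frechet_derivative g (at x) v) = 0"
proof -
  \<comment> \<open>Since the step sizes \<open>h n\<close> are at most 1, every difference quotient
    vanishes outside this enlargement of the support by \<open>norm v\<close>.\<close>
  define K' where "K' = {x + y |x y. x \<in> fsupport g \<and> y \<in> cball 0 (norm v)}"
  have K': "compact K'"
    unfolding K'_def by (rule compact_sums[OF K compact_cball])
  obtain C where C: "C \<ge> 0" "\<And>x w. norm (frechet_derivative g (at x) w) \<le> C * norm w"
    using Ck_derivative_bounded[OF g K] by blast
  have contg: "continuous_on UNIV g" using g by (rule Ck_continuous)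
  have lip: "\<bar>g y - g x\<bar> \<le> C * norm (y - x)" for x y
  proof -
    have "norm (g y - g x) \<le> C * norm (y - x)"
      by (rule differentiable_bound[of UNIV g "\<lambda>x. frechet_derivative g (at x)"])
         (use Ck_Suc_derivative[OF g] C in \<open>auto intro!: onorm_bound\<close>)
    then show ?thesis by simp
  qed
  define h :: "nat \<Rightarrow> real" where "h n = 1 / real (Suc n)" for n
  have h: "h n > 0" "h n \<le> 1" for n by (auto simp: h_def)
  define s where "s n x = (g (x + h n *\<^sub>R v) - g x) / h n" for n x
  have "(\<lambda>n. LINT x|lborel. s n x) \<longlonglongrightarrow> (LINT x|lborel. frechet_derivative g (at x) v)"
  proof (rule integral_dominated_convergence[where w = "\<lambda>x. C * norm v * indicator K' x"])
    have D: "continuous_on UNIV (\<lambda>x. frechet_derivative g (at x) v)"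
      using g by (auto intro: Ck_continuous)
    then show "(\<lambda>x. frechet_derivative g (at x) v) \<in> borel_measurable lborel"
      using borel_measurable_continuous_onI by simp
    have "continuous_on UNIV (s n)" for n
      unfolding s_def[abs_def] by (intro continuous_intros continuous_on_compose2[OF contg]) (use h[of n] in auto)
    from borel_measurable_continuous_onI[OF this] show "s n \<in> borel_measurable lborel" for n
      by simp
    have "integrable lborel (\<lambda>x. indicator K' x *\<^sub>R (C * norm v))"
      by (intro borel_integrable_compact K') auto
    then show "integrable lborel (\<lambda>x. C * norm v * indicator K' x)"
      by (simp add: mult.commute)
    have "(\<lambda>n. s n x) \<longlonglongrightarrow> frechet_derivative g (at x) v" for x
    proof -
      have "((\<lambda>t. g (x + t *\<^sub>R v)) has_vector_derivative frechet_derivative g (at x) v) (at 0)"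
      proof -
        have "((\<lambda>t. x + t *\<^sub>R v) has_vector_derivative v) (at 0)"
          by (auto intro!: derivative_eq_intros)
        moreover have "(g has_derivative frechet_derivative g (at x)) (at (x + 0 *\<^sub>R v) within (range (\<lambda>t. x + t *\<^sub>R v)))"
          using Ck_Suc_derivative[OF g, of x] has_derivative_at_withinI by simp
        ultimately show ?thesis
          using vector_derivative_diff_chain_within[of "\<lambda>t. x + t *\<^sub>R v" v 0 UNIV g] by (simp add: o_def)
      qed
      then have lim: "((\<lambda>t. (g (x + t *\<^sub>R v) - g x) / t) \<longlongrightarrow> frechet_derivative g (at x) v) (at 0)"
        by (simp add: has_real_derivative_iff_has_vector_derivative[symmetric] has_field_derivative_iff)
      have "filterlim h (at 0) sequentially"
        unfolding filterlim_at using h lim_1_over_n LIMSEQ_Suc[OF lim_1_over_n]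
        by (auto simp: h_def[abs_def] intro!: always_eventually)
      from filterlim_compose[OF lim this] show ?thesis by (simp add: s_def)
    qed
    then show "AE x in lborel. (\<lambda>n. s n x) \<longlonglongrightarrow> frechet_derivative g (at x) v" by simp
    have "norm (s n x) \<le> C * norm v * indicator K' x" for n x
    proof (cases "x \<in> K'")
      case True
      have "\<bar>g (x + h n *\<^sub>R v) - g x\<bar> \<le> C * (h n * norm v)"
        using lip[of "x + h n *\<^sub>R v" x] h[of n] by simp
      then show ?thesis using True h(1)[of n] by (simp add: s_def field_simps)
    next
      case False
      have "x \<notin> fsupport g"
      proof
        assume "x \<in> fsupport g"
        then have "x + 0 \<in> K'" unfolding K'_def by force
        with False show False by simp
      qed
      moreover have "x + h n *\<^sub>R v \<notin> fsupport g"
      proof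
        assume "x + h n *\<^sub>R v \<in> fsupport g"
        moreover have "norm (h n *\<^sub>R v) \<le> norm v"
          using h[of n] by (simp add: mult_left_le_one_le)
        ultimately have "(x + h n *\<^sub>R v) + (- (h n *\<^sub>R v)) \<in> K'"
          unfolding K'_def by (intro CollectI exI[of _ "x + h n *\<^sub>R v"] exI[of _ "- (h n *\<^sub>R v)"] conjI) simp_all
        with False show False by simp
      qed
      ultimately show ?thesis using C(1) by (simp add: s_def not_in_fsupport)
    qed
    then show "AE x in lborel. norm (s n x) \<le> C * norm v * indicator K' x" for n by simp
  qed
  moreover have "(LINT x|lborel. s n x) = 0" for n
  proof -
    have int: "integrable lborel g"
      using integrable_continuous_fsupport[OF contg K not_in_fsupport[of _ g]] .
    have "(LINT x|lborel. g x) = (LINT x|distr lborel borel ((+) (h n *\<^sub>R v)). g x)"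
      by (simp add: lborel_distr_plus)
    also have "\<dots> = (LINT x|lborel. g (h n *\<^sub>R v + x))"
      by (rule integral_distr) (use borel_measurable_continuous_onI[OF contg] in auto)
    finally have eq: "(LINT x|lborel. g (x + h n *\<^sub>R v)) = (LINT x|lborel. g x)"
      by (simp add: add.commute)
    have "integrable (distr lborel borel ((+) (h n *\<^sub>R v))) g"
      using int by (simp add: lborel_distr_plus)
    then have "integrable lborel (\<lambda>x. g (h n *\<^sub>R v + x))"
      by (subst (asm) integrable_distr_eq) (use borel_measurable_continuous_onI[OF contg] in auto)
    then show ?thesis using int eq by (simp add: s_def add.commute)
  qed
  ultimately show ?thesis
    using LIMSEQ_unique[OF tendsto_const] by force
qed

text \<open>The product inherits compact support from \<open>a\<close>, so its derivative integrates
  to zero.\<close>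

lemma integral_by_parts_partial:
  fixes a b :: "vec3 \<Rightarrow> real"
  assumes a: "Ck (Suc 0) a" and b: "Ck (Suc 0) b" and K: "compact (fsupport a)"
  shows "(LINT x|lborel. a x * frechet_derivative b (at x) v) = - (LINT x|lborel. frechet_derivative a (at x) v * b x)"
proof -
  let ?Da = "\<lambda>x. frechet_derivative a (at x)" and ?Db = "\<lambda>x. frechet_derivative b (at x)"
  have der: "((\<lambda>x. a x * b x) has_derivative (\<lambda>v. a x * ?Db x v + ?Da x v * b x)) (at x)" for x
    by (intro has_derivative_mult Ck_Suc_derivative[OF a] Ck_Suc_derivative[OF b])
  have ab: "Ck (Suc 0) (\<lambda>x. a x * b x)" by (rule Ck_mult[OF a b])
  have supp: "compact (fsupport (\<lambda>x. a x * b x))"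
    by (rule compact_fsupportI[OF K]) (simp add: not_in_fsupport)
  have "(LINT x|lborel. a x * ?Db x v + ?Da x v * b x) = 0"
    using integral_derivative_eq_0[OF ab supp, of v] frechet_derivative_at[OF der] by (metis (no_types, lifting) ext)
  moreover have c: "continuous_on UNIV a" "continuous_on UNIV b" "continuous_on UNIV (\<lambda>x. ?Da x v)" "continuous_on UNIV (\<lambda>x. ?Db x v)"
    using Ck_continuous[OF a] Ck_continuous[OF b] a b by simp_all
  have "integrable lborel (\<lambda>x. a x * ?Db x v)" "integrable lborel (\<lambda>x. ?Da x v * b x)"
    by (rule integrable_continuous_fsupport[OF _ K];
        auto intro!: continuous_intros c simp: not_in_fsupport frechet_derivative_off_fsupport)+
  ultimately show ?thesis by simp
qed

lemma test_fields_Ck: "\<phi> \<in> test_fields \<Omega> \<Longrightarrow> Ck k \<phi>"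
  and test_fields_support: "\<phi> \<in> test_fields \<Omega> \<Longrightarrow> compact (fsupport \<phi>)" "\<phi> \<in> test_fields \<Omega> \<Longrightarrow> fsupport \<phi> \<subseteq> \<Omega>"
  by (auto simp: test_fields_def)

lemma test_fieldsI:
  assumes "\<And>k. Ck k \<phi>" "compact K" "K \<subseteq> \<Omega>" "\<And>x. x \<notin> K \<Longrightarrow> \<phi> x = 0"
  shows "\<phi> \<in> test_fields \<Omega>"
  using assms(1,3) compact_fsupportI[of K \<phi>, OF assms(2,4)]
    fsupport_subset[of K \<phi>, OF compact_imp_closed[OF assms(2)] assms(4)]
  by (auto simp: test_fields_def)

lemma partial_deriv_nth:
  assumes "Ck (Suc k) \<phi>"
  shows "partial_deriv j i \<phi> x = frechet_derivative (\<lambda>x. \<phi> x $ i) (at x) (axis j 1)"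
proof -
  have "((\<lambda>x. \<phi> x $ i) has_derivative (\<lambda>v. frechet_derivative \<phi> (at x) v $ i)) (at x)"
    by (rule bounded_linear.has_derivative[OF bounded_linear_vec_nth Ck_Suc_derivative[OF assms]])
  from frechet_derivative_at[OF this] show ?thesis by (metis partial_deriv_def)
qed

lemma Ck_partial_deriv: "Ck (Suc k) \<phi> \<Longrightarrow> Ck k (partial_deriv j i \<phi>)"
  unfolding partial_deriv_def[abs_def] by (intro Ck_bounded_linear[OF bounded_linear_vec_nth]) simp

lemma Ck_classical_curl:
  assumes "Ck (Suc k) \<phi>"
  shows "Ck k (classical_curl \<phi>)"
  unfolding classical_curl_def[abs_def] Ck_vec_iff forall_3 vector_3
  by (intro conjI Ck_diff Ck_partial_deriv assms)

lemma classical_curl_off_fsupport: "x \<notin> fsupport \<phi> \<Longrightarrow> classical_curl \<phi> x = 0"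
  by (simp add: classical_curl_def partial_deriv_def frechet_derivative_off_fsupport vec_eq_iff forall_3)

lemma classical_curl_test_field: "\<phi> \<in> test_fields \<Omega> \<Longrightarrow> classical_curl \<phi> \<in> test_fields \<Omega>"
  by (rule test_fieldsI[of _ "fsupport \<phi>"])
     (auto intro: Ck_classical_curl test_fields_Ck classical_curl_off_fsupport test_fields_support(1)
       dest: subsetD[OF test_fields_support(2)])

lemma integral_partial_deriv_by_parts:
  assumes "\<phi> \<in> test_fields \<Omega>" "\<psi> \<in> test_fields \<Omega>"
  shows "(LINT x|lborel. \<phi> x $ i * partial_deriv j k \<psi> x) = - (LINT x|lborel. partial_deriv j i \<phi> x * \<psi> x $ k)"
proof -
  have c: "Ck (Suc 0) (\<lambda>x. \<phi> x $ i)" "Ck (Suc 0) (\<lambda>x. \<psi> x $ k)"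
    using assms test_fields_Ck by (intro Ck_bounded_linear[OF bounded_linear_vec_nth]; blast)+
  have "compact (fsupport (\<lambda>x. \<phi> x $ i))"
    by (rule compact_fsupportI[OF test_fields_support(1)[OF assms(1)]]) (simp add: not_in_fsupport)
  from integral_by_parts_partial[OF c this, of "axis j 1"] show ?thesis
    using partial_deriv_nth[OF test_fields_Ck[OF assms(1)]] partial_deriv_nth[OF test_fields_Ck[OF assms(2)]] by simp
qed

text \<open>The curl is formally self-adjoint: each partial integration changes a sign, and the
  antisymmetry of the curl changes it back.\<close>

lemma integral_curl_by_parts:
  assumes \<phi>: "\<phi> \<in> test_fields \<Omega>" and \<psi>: "\<psi> \<in> test_fields \<Omega>"
  shows "(LINT x|lborel. \<phi> x \<bullet> classical_curl \<psi> x) = (LINT x|lborel. classical_curl \<phi> x \<bullet> \<psi> x)"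
proof -
  have c: "continuous_on UNIV (\<lambda>x. \<eta> x $ i)" "continuous_on UNIV (partial_deriv j i \<eta>)" if "\<eta> \<in> test_fields \<Omega>" for \<eta> i j
    using test_fields_Ck[OF that] Ck_continuous Ck_partial_deriv
    by (auto intro!: continuous_on_component, blast)
  have 1: "integrable lborel (\<lambda>x. \<phi> x $ i * partial_deriv j k \<psi> x)" for i j k
    by (rule integrable_continuous_fsupport[OF _ test_fields_support(1)[OF \<phi>]])
       (auto intro!: continuous_on_mult c \<phi> \<psi> simp: not_in_fsupport)
  have 2: "integrable lborel (\<lambda>x. partial_deriv j i \<phi> x * \<psi> x $ k)" for i j k
    by (rule integrable_continuous_fsupport[OF _ test_fields_support(1)[OF \<psi>]])
       (auto intro!: continuous_on_mult c \<phi> \<psi> simp: not_in_fsupport)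
  show ?thesis
    unfolding inner_vec_def sum_3 classical_curl_def vector_3 inner_real_def right_diff_distrib left_diff_distrib
    by (simp add: 1 2 integral_partial_deriv_by_parts[OF \<phi> \<psi>])
qed

lemma lebesgue_on_integral_fsupport:
  fixes g :: "vec3 \<Rightarrow> 'b::euclidean_space"
  assumes "g \<in> borel_measurable borel" "\<Omega> \<in> sets lebesgue" "\<And>x. x \<notin> \<Omega> \<Longrightarrow> g x = 0"
  shows "(LINT x|lebesgue_on \<Omega>. g x) = (LINT x|lborel. g x)"
proof -
  have "(LINT x|lebesgue_on \<Omega>. g x) = (LINT x|lebesgue. indicator \<Omega> x *\<^sub>R g x)"
    using assms(2) by (subst integral_restrict_space) auto
  also have "(\<lambda>x. indicator \<Omega> x *\<^sub>R g x) = g"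
    using assms(3) by (force simp: indicator_def)
  also have "(LINT x|lebesgue. g x) = (LINT x|lborel. g x)"
    by (rule integral_completion) (use assms(1) in simp)
  finally show ?thesis .
qed

lemma finite_measure_lebesgue_on:
  assumes "open \<Omega>" "bounded \<Omega>"
  shows "finite_measure (lebesgue_on \<Omega>)"
  using lmeasurable_open[OF assms(2,1)] by (rule finite_measure_lebesgue_on)

lemma borel_measurable_lebesgue_on:
  assumes "g \<in> borel_measurable borel"
  shows "g \<in> borel_measurable (lebesgue_on S)"
proof (intro measurable_restrict_space1 measurable_completion)
  show "g \<in> borel_measurable lborel" using assms by simp
qed

lemma test_field_L2:
  assumes "open \<Omega>" "bounded \<Omega>" "\<phi> \<in> test_fields \<Omega>"
  shows "\<phi> \<in> L2 (lebesgue_on \<Omega>)"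
proof -
  have c: "continuous_on UNIV \<phi>" using test_fields_Ck[OF assms(3)] Ck_continuous by blast
  obtain C where "\<And>x. norm (\<phi> x) \<le> C"
    using continuous_fsupport_bounded[of \<phi> "fsupport \<phi>", OF c test_fields_support(1)[OF assms(3)] not_in_fsupport[of _ \<phi>]] by blast
  then show ?thesis
    using finite_measure_lebesgue_on[OF assms(1,2)] borel_measurable_continuous_onI[OF c]
    by (intro L2_bounded[where C = C]) (auto intro: borel_measurable_lebesgue_on)
qed

lemma has_weak_curl_classical:
  assumes "open \<Omega>" "bounded \<Omega>" "\<phi> \<in> test_fields \<Omega>"
  shows "has_weak_curl \<Omega> \<phi> (classical_curl \<phi>)"
  unfolding has_weak_curl_def L2_on_eq
proof (intro conjI ballI test_field_L2[OF assms(1,2)] classical_curl_test_field[OF assms(3)])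
  fix \<psi> assume \<psi>: "\<psi> \<in> test_fields \<Omega>"
  note \<phi> = assms(3)
  have m: "\<eta> \<in> borel_measurable borel" if "\<eta> \<in> test_fields \<Omega>" for \<eta>
    using borel_measurable_continuous_onI Ck_continuous test_fields_Ck[OF that] by blast
  have z: "\<eta> x = 0" if "\<eta> \<in> test_fields \<Omega>" "x \<notin> \<Omega>" for \<eta> x
    using not_in_fsupport test_fields_support(2)[OF that(1)] that(2) by blast
  note c = classical_curl_test_field
  have S: "\<Omega> \<in> sets lebesgue" using assms(1) by (simp add: lmeasurable_open)
  show "(LINT x|lebesgue_on \<Omega>. \<phi> x \<bullet> classical_curl \<psi> x) = (LINT x|lebesgue_on \<Omega>. classical_curl \<phi> x \<bullet> \<psi> x)"
    using S m[OF \<phi>] m[OF \<psi>] m[OF c[OF \<phi>]] m[OF c[OF \<psi>]] z[OF \<phi>] z[OF \<psi>] z[OF c[OF \<phi>]] z[OF c[OF \<psi>]]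
    by (simp add: lebesgue_on_integral_fsupport integral_curl_by_parts[OF \<phi> \<psi>])
qed

lemma test_fields_combine:
  assumes "\<phi> \<in> test_fields \<Omega>" "\<psi> \<in> test_fields \<Omega>"
  shows "(\<lambda>x. c *\<^sub>R \<phi> x + d *\<^sub>R \<psi> x) \<in> test_fields \<Omega>"
    "classical_curl (\<lambda>x. c *\<^sub>R \<phi> x + d *\<^sub>R \<psi> x) x = c *\<^sub>R classical_curl \<phi> x + d *\<^sub>R classical_curl \<psi> x"
proof -
  show "(\<lambda>x. c *\<^sub>R \<phi> x + d *\<^sub>R \<psi> x) \<in> test_fields \<Omega>"
  proof (rule test_fieldsI[of _ "fsupport \<phi> \<union> fsupport \<psi>"])
    show "Ck k (\<lambda>x. c *\<^sub>R \<phi> x + d *\<^sub>R \<psi> x)" for k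
      by (intro Ck_add Ck_scaleR Ck_const test_fields_Ck[OF assms(1)] test_fields_Ck[OF assms(2)])
  qed (use test_fields_support[OF assms(1)] test_fields_support[OF assms(2)] in \<open>auto simp: not_in_fsupport\<close>)
  have "((\<lambda>x. c *\<^sub>R \<phi> x + d *\<^sub>R \<psi> x) has_derivative
      (\<lambda>v. c *\<^sub>R frechet_derivative \<phi> (at x) v + d *\<^sub>R frechet_derivative \<psi> (at x) v)) (at x)"
    using test_fields_Ck[OF assms(1), of "Suc 0"] test_fields_Ck[OF assms(2), of "Suc 0"]
    by (intro has_derivative_add has_derivative_scaleR_right Ck_Suc_derivative)
  note fd = frechet_derivative_at[OF this, symmetric]
  have "partial_deriv j i (\<lambda>x. c *\<^sub>R \<phi> x + d *\<^sub>R \<psi> x) x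
      = c * partial_deriv j i \<phi> x + d * partial_deriv j i \<psi> x" for i j
    unfolding partial_deriv_def fd by simp
  then show "classical_curl (\<lambda>x. c *\<^sub>R \<phi> x + d *\<^sub>R \<psi> x) x = c *\<^sub>R classical_curl \<phi> x + d *\<^sub>R classical_curl \<psi> x"
    by (simp add: classical_curl_def vec_eq_iff forall_3 algebra_simps)
qed

section \<open>The fundamental lemma of the calculus of variations\<close>

text \<open>If \<open>b\<close> is a sum of bumps, positive exactly on the union of the balls, then
  \<open>1 - exp(- n b)\<close> tends to the indicator of the union, is smooth and vanishes outside
  the closed balls. Multiplied by a constant vector it is a test field, and dominated convergence
  transfers the orthogonality to the indicator.\<close>

lemma set_integral_orthogonal_balls:
  fixes w :: "vec3 \<Rightarrow> vec3"
  assumes "open \<Omega>" "bounded \<Omega>" and w: "w \<in> L2 (lebesgue_on \<Omega>)"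
    and orth: "\<And>\<phi>. \<phi> \<in> test_fields \<Omega> \<Longrightarrow> (LINT x|lebesgue_on \<Omega>. w x \<bullet> \<phi> x) = 0"
    and F: "finite F" "\<And>c r. (c, r) \<in> F \<Longrightarrow> r > 0 \<and> cball c r \<subseteq> \<Omega>"
  shows "(LINT x:(\<Union>(c,r)\<in>F. ball c r)|lebesgue_on \<Omega>. w x) = 0"
proof -
  let ?M = "lebesgue_on \<Omega>" and ?U = "\<Union>(c,r)\<in>F. ball c r"
  have fin: "finite_measure ?M" by (rule finite_measure_lebesgue_on) fact+
  have wm[measurable]: "w \<in> borel_measurable ?M" using w by (rule L2_measurable)
  have intw: "integrable ?M w"
    using L2_norm_integrable(1)[OF fin w] wm integrable_norm_iff by blast
  have US: "?U \<in> sets ?M"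
  proof -
    have "?U \<subseteq> \<Omega>" using F(2) ball_subset_cball by fastforce
    moreover have "open ?U" by auto
    ultimately show ?thesis
      using assms(1) by (simp add: sets_restrict_space_iff borel_open)
  qed
  define b where "b x = (\<Sum>(c,r)\<in>F. ball_bump c r x)" for x
  have b0: "b x \<ge> 0" for x
    unfolding b_def by (intro sum_nonneg) (auto simp: ball_bump_nonneg)
  have bpos: "b x > 0" if xU: "x \<in> ?U" for x
  proof -
    obtain c r where cr: "(c, r) \<in> F" "x \<in> ball c r" using xU by auto
    have "0 < ball_bump c r x" using cr F(2) ball_bump_pos_iff[of r c x] by force
    also have "\<dots> = (\<Sum>(c,r)\<in>{(c,r)}. ball_bump c r x)" by simp
    also have "\<dots> \<le> b x"
      unfolding b_def using F(1) cr by (intro sum_mono2) (auto simp: ball_bump_nonneg)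
    finally show ?thesis .
  qed
  have bzero: "b x = 0" if "x \<notin> ?U" for x
    unfolding b_def using that F(2) by (intro sum.neutral) (auto intro!: ball_bump_eq_0 less_imp_le)
  have Ckb: "Ck k b" for k
    unfolding b_def[abs_def] by (intro Ck_sum) (auto simp: Ck_ball_bump)
  have "(LINT x|?M. indicator ?U x *\<^sub>R w x) \<bullet> a = 0" for a
  proof -
    define \<phi> where "\<phi> n x = (1 - exp (- (real n * b x))) *\<^sub>R a" for n x
    have test: "\<phi> n \<in> test_fields \<Omega>" for n
      unfolding \<phi>_def[abs_def]
    proof (rule test_fieldsI[of _ "\<Union>(c,r)\<in>F. cball c r"])
      show "Ck k (\<lambda>x. (1 - exp (- (real n * b x))) *\<^sub>R a)" for k
        by (intro Ck_scaleR Ck_diff Ck_const Ck_exp Ck_minus Ck_mult Ckb)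
      show "compact (\<Union>(c,r)\<in>F. cball c r)" using F(1) by (intro compact_UN) auto
      show "(\<Union>(c,r)\<in>F. cball c r) \<subseteq> \<Omega>" using F(2) by auto
      show "(1 - exp (- (real n * b x))) *\<^sub>R a = 0" if "x \<notin> (\<Union>(c,r)\<in>F. cball c r)" for x
      proof -
        have "x \<notin> ?U" using that ball_subset_cball by fastforce
        then show ?thesis by (simp add: bzero)
      qed
    qed
    have "(\<lambda>n. LINT x|?M. w x \<bullet> \<phi> n x) \<longlonglongrightarrow> (LINT x|?M. (indicator ?U x *\<^sub>R w x) \<bullet> a)"
    proof (rule integral_dominated_convergence[where w = "\<lambda>x. norm (w x) * norm a"])
      show "(\<lambda>x. (indicator ?U x *\<^sub>R w x) \<bullet> a) \<in> borel_measurable ?M"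
        using US by measurable
      show "(\<lambda>x. w x \<bullet> \<phi> n x) \<in> borel_measurable ?M" for n
        using L2_measurable[OF test_field_L2[OF assms(1,2) test]] by measurable
      show "integrable ?M (\<lambda>x. norm (w x) * norm a)"
        using L2_norm_integrable(1)[OF fin w] by simp
      have "(\<lambda>n. w x \<bullet> \<phi> n x) \<longlonglongrightarrow> (indicator ?U x *\<^sub>R w x) \<bullet> a" for x
      proof (cases "x \<in> ?U")
        case True
        have "b x > 0" using bpos[OF True] .
        then have "(\<lambda>n. exp (- (real n * b x))) \<longlonglongrightarrow> 0" by real_asymp
        then have "(\<lambda>n. w x \<bullet> \<phi> n x) \<longlonglongrightarrow> w x \<bullet> ((1 - 0) *\<^sub>R a)"
          unfolding \<phi>_def by (intro tendsto_intros)
        then show ?thesis using True by simp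
      next
        case False
        then show ?thesis by (simp add: \<phi>_def bzero)
      qed
      then show "AE x in ?M. (\<lambda>n. w x \<bullet> \<phi> n x) \<longlonglongrightarrow> (indicator ?U x *\<^sub>R w x) \<bullet> a" by simp
      have "norm (w x \<bullet> \<phi> n x) \<le> norm (w x) * norm a" for n x
      proof -
        have "\<bar>1 - exp (- (real n * b x))\<bar> \<le> 1" using b0[of x] by (simp add: abs_le_iff)
        then have "norm (\<phi> n x) \<le> norm a" by (simp add: \<phi>_def mult_left_le_one_le)
        then show ?thesis
          using Cauchy_Schwarz_ineq2[of "w x" "\<phi> n x"] by (smt (verit) mult_left_mono norm_ge_zero real_norm_def)
      qed
      then show "AE x in ?M. norm (w x \<bullet> \<phi> n x) \<le> norm (w x) * norm a" for n by simp
    qed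
    then have "(LINT x|?M. (indicator ?U x *\<^sub>R w x) \<bullet> a) = 0"
      using orth[OF test] LIMSEQ_unique[OF tendsto_const] by force
    then show ?thesis
      using integral_inner_left[of a ?M "\<lambda>x. indicator ?U x *\<^sub>R w x"] integrable_mult_indicator[OF US intw] by simp
  qed
  then have "(LINT x|?M. indicator ?U x *\<^sub>R w x) = 0"
    using inner_eq_zero_iff by blast
  then show ?thesis by (simp add: set_lebesgue_integral_def)
qed

text \<open>Vanishing of the integral passes from finite unions of balls to open sets by the
  Lindelof property and monotone limits, and from open sets to measurable ones by outer regularity.
  A function whose integrals over all measurable sets vanish is zero almost everywhere.\<close>

lemma orthogonal_test_fields_AE_0:
  fixes w :: "vec3 \<Rightarrow> vec3"
  assumes "open \<Omega>" "bounded \<Omega>" and w: "w \<in> L2 (lebesgue_on \<Omega>)"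
    and orth: "\<And>\<phi>. \<phi> \<in> test_fields \<Omega> \<Longrightarrow> (LINT x|lebesgue_on \<Omega>. w x \<bullet> \<phi> x) = 0"
  shows "AE x in lebesgue_on \<Omega>. w x = 0"
proof -
  let ?M = "lebesgue_on \<Omega>"
  have fin: "finite_measure ?M" by (rule finite_measure_lebesgue_on) fact+
  have wm[measurable]: "w \<in> borel_measurable ?M" using w by (rule L2_measurable)
  have intw: "integrable ?M w"
    using L2_norm_integrable(1)[OF fin w] wm integrable_norm_iff by blast
  have \<Omega>S: "\<Omega> \<in> sets lebesgue" using assms(1) by (simp add: borel_open)
  have openS: "A \<in> sets ?M" if "open A" "A \<subseteq> \<Omega>" for A
    using that \<Omega>S by (simp add: sets_restrict_space_iff borel_open)
  have op: "(LINT x:A|?M. w x) = 0" if A: "open A" "A \<subseteq> \<Omega>" for A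
  proof (cases "A = {}")
    case False
    define \<F> where "\<F> = (\<lambda>(c,r). ball c r) ` {(c,r). r > 0 \<and> cball c r \<subseteq> A}"
    obtain \<F>' where \<F>': "\<F>' \<subseteq> \<F>" "countable \<F>'" "\<Union>\<F>' = \<Union>\<F>"
    proof -
      have "open S" if "S \<in> \<F>" for S using that by (auto simp: \<F>_def)
      from Lindelof[of \<F>, OF this] show ?thesis using that by blast
    qed
    have "\<Union>\<F> = A"
    proof
      show "\<Union>\<F> \<subseteq> A"
      proof (rule Union_least)
        fix S assume "S \<in> \<F>"
        then obtain c r where "S = ball c r" "cball c r \<subseteq> A" by (auto simp: \<F>_def)
        then show "S \<subseteq> A" using ball_subset_cball by blast
      qed
      show "A \<subseteq> \<Union>\<F>"
      proof
        fix x assume "x \<in> A"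
        then obtain e where "e > 0" "cball x e \<subseteq> A" using A(1) open_contains_cball by blast
        then have "ball x e \<in> \<F>" unfolding \<F>_def by (intro image_eqI[of _ _ "(x, e)"]) auto
        then show "x \<in> \<Union>\<F>" using \<open>e > 0\<close> by (intro UnionI[of "ball x e"]) auto
      qed
    qed
    then have "\<F>' \<noteq> {}" using False \<F>'(3) by auto
    then obtain B :: "nat \<Rightarrow> vec3 set" where B: "range B = \<F>'"
      using range_from_nat_into[OF _ \<F>'(2)] by blast
    have "\<exists>c r. B n = ball c r \<and> r > 0 \<and> cball c r \<subseteq> A" for n
    proof -
      have "B n \<in> \<F>" using B \<F>'(1) by blast
      then show ?thesis by (auto simp: \<F>_def)
    qed
    then obtain c r where cr: "\<And>n. B n = ball (c n) (r n) \<and> r n > 0 \<and> cball (c n) (r n) \<subseteq> A" by metis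
    define U where "U n = (\<Union>i\<le>n. B i)" for n :: nat
    have Un: "(\<Union>n. U n) = A"
      using B \<F>'(3) \<open>\<Union>\<F> = A\<close> by (auto simp: U_def)
    have Usub: "U n \<subseteq> \<Omega>" for n using Un A(2) by blast
    have "(\<lambda>n. LINT x:U n|?M. w x) \<longlonglongrightarrow> (LINT x:(\<Union>n. U n)|?M. w x)"
    proof (rule set_integral_cont_up)
      show "U n \<in> sets ?M" for n
        using cr Usub by (intro openS) (auto simp: U_def)
      show "incseq U" by (force simp: incseq_def U_def)
      show "set_integrable ?M (\<Union>n. U n) w"
        unfolding set_integrable_def Un by (intro integrable_mult_indicator openS A intw)
    qed
    moreover have "(LINT x:U n|?M. w x) = 0" for n
    proof -
      have "U n = (\<Union>(c,r)\<in>(\<lambda>i. (c i, r i)) ` {..n}. ball c r)"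
        using cr by (simp add: U_def)
      moreover have "(LINT x:(\<Union>(c,r)\<in>(\<lambda>i. (c i, r i)) ` {..n}. ball c r)|?M. w x) = 0"
      proof (rule set_integral_orthogonal_balls[OF assms])
        show "r' > 0 \<and> cball c' r' \<subseteq> \<Omega>" if "(c', r') \<in> (\<lambda>i. (c i, r i)) ` {..n}" for c' r'
          using that cr A(2) by blast
      qed simp_all
      ultimately show ?thesis by simp
    qed
    ultimately show ?thesis using LIMSEQ_unique[OF tendsto_const] Un by force
  qed (simp add: set_lebesgue_integral_def)
  interpret finite_measure ?M by fact
  show ?thesis
  proof (rule density_zero[OF intw])
    fix A assume "A \<in> sets ?M"
    then have A: "A \<in> sets lebesgue" "A \<subseteq> \<Omega>"
      using \<Omega>S by (auto simp: sets_restrict_space_iff)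
    \<comment> \<open>The integral over \<open>A\<close> differs from the one over an open superset
      by an integral over a set of measure at most \<open>e\<close>, which Cauchy-Schwarz controls
      by \<open>sqrt e\<close>.\<close>
    have small: "norm (LINT x:A|?M. w x) \<le> sqrt e * L2norm ?M w" if "e > 0" for e
    proof -
      obtain T where T: "open T" "A \<subseteq> T" "T - A \<in> lmeasurable" "emeasure lebesgue (T - A) < ennreal e"
        using sets_lebesgue_outer_open[OF A(1) \<open>e > 0\<close>] .
      let ?T = "T \<inter> \<Omega>" and ?D = "T \<inter> \<Omega> - A"
      have oT: "open ?T" "?T \<subseteq> \<Omega>" using T(1) assms(1) by auto
      have AM: "A \<in> sets ?M" by fact
      have DM: "?D \<in> sets ?M" using openS[OF oT] AM by blast
      have si: "set_integrable ?M X w" if "X \<in> sets ?M" for X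
        unfolding set_integrable_def using that by (intro integrable_mult_indicator intw)
      have "(LINT x:A \<union> ?D|?M. w x) = (LINT x:A|?M. w x) + (LINT x:?D|?M. w x)"
        by (intro set_integral_Un si AM DM) auto
      moreover have "A \<union> ?D = ?T" using T(2) A(2) by auto
      ultimately have "(LINT x:A|?M. w x) = - (LINT x:?D|?M. w x)"
        using op[OF oT] by (simp add: eq_neg_iff_add_eq_0)
      then have "norm (LINT x:A|?M. w x) = norm (LINT x|?M. indicator ?D x *\<^sub>R w x)"
        by (simp add: set_lebesgue_integral_def)
      also have "\<dots> \<le> (LINT x|?M. norm (indicator ?D x *\<^sub>R w x))"
        by (rule integral_norm_bound)
      also have "\<dots> = (LINT x|?M. norm (indicator ?D x :: real) * norm (w x))"
        by simp
      also have "\<dots> \<le> L2norm ?M (indicator ?D :: _ \<Rightarrow> real) * L2norm ?M w"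
      proof (rule L2_norm_mult_le[OF L2_bounded[OF fin borel_measurable_indicator[OF DM]] w])
        show "AE x in ?M. norm (indicator ?D x :: real) \<le> 1" by (simp add: indicator_def)
      qed
      also have "L2norm ?M (indicator ?D :: _ \<Rightarrow> real) \<le> sqrt e"
      proof -
        have "(LINT x|?M. (norm (indicator ?D x :: real))\<^sup>2) = (LINT x|?M. indicator ?D x)"
          by (intro Bochner_Integration.integral_cong) (auto simp: indicator_def)
        also have "\<dots> = measure ?M ?D"
          unfolding Bochner_Integration.integral_indicator by (rule arg_cong[of _ _ "measure ?M"]) auto
        also have "\<dots> = measure lebesgue ?D"
          using \<Omega>S by (subst measure_restrict_space) auto
        also have "\<dots> \<le> measure lebesgue (T - A)"
          using T(3) DM \<Omega>S by (intro measure_mono_fmeasurable) (auto simp: sets_restrict_space_iff)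
        also have "\<dots> \<le> e"
          using T(4) \<open>e > 0\<close> by (simp add: measure_def enn2real_leI less_imp_le)
        finally show ?thesis by (simp add: L2norm_def)
      qed
      finally show ?thesis by (simp add: mult_right_mono)
    qed
    have "((\<lambda>e. sqrt e * L2norm ?M w) \<longlongrightarrow> sqrt 0 * L2norm ?M w) (at_right 0)"
      by (intro tendsto_intros)
    then have "norm (LINT x:A|?M. w x) \<le> sqrt 0 * L2norm ?M w"
      by (rule tendsto_lowerbound) (auto simp: eventually_at_right_field intro!: exI[of _ 1] small)
    then show "(LINT x:A|?M. w x) = 0" by simp
  qed
qed

text \<open>This makes the choice in \<open>weak_curl\<close> harmless: the difference of two
  candidates is orthogonal to all test fields.\<close>

lemma weak_curl_unique:
  assumes "open \<Omega>" "bounded \<Omega>" "has_weak_curl \<Omega> v w" "has_weak_curl \<Omega> v w'"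
  shows "AE x in lebesgue_on \<Omega>. w x = w' x"
proof -
  have L: "w \<in> L2 (lebesgue_on \<Omega>)" "w' \<in> L2 (lebesgue_on \<Omega>)"
    using assms(3,4) by (auto simp: has_weak_curl_def L2_on_eq)
  have "AE x in lebesgue_on \<Omega>. w x - w' x = 0"
  proof (rule orthogonal_test_fields_AE_0[OF assms(1,2) L2_diff(1)[OF L]])
    fix \<phi> assume \<phi>: "\<phi> \<in> test_fields \<Omega>"
    then have \<phi>L: "\<phi> \<in> L2 (lebesgue_on \<Omega>)" using test_field_L2 assms(1,2) by blast
    have "(LINT x|lebesgue_on \<Omega>. w x \<bullet> \<phi> x) = (LINT x|lebesgue_on \<Omega>. w' x \<bullet> \<phi> x)"
    proof -
      have "(LINT x|lebesgue_on \<Omega>. v x \<bullet> classical_curl \<phi> x) = (LINT x|lebesgue_on \<Omega>. w x \<bullet> \<phi> x)"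
        using assms(3) \<phi> by (simp add: has_weak_curl_def)
      moreover have "(LINT x|lebesgue_on \<Omega>. v x \<bullet> classical_curl \<phi> x) = (LINT x|lebesgue_on \<Omega>. w' x \<bullet> \<phi> x)"
        using assms(4) \<phi> by (simp add: has_weak_curl_def)
      ultimately show ?thesis by simp
    qed
    then show "(LINT x|lebesgue_on \<Omega>. (w x - w' x) \<bullet> \<phi> x) = 0"
      by (simp add: inner_diff_left L2_inner(1)[OF _ \<phi>L] L)
  qed
  then show ?thesis by simp
qed

section \<open>The graph of the curl\<close>

text \<open>Pairs \<open>(v, curl v)\<close> with \<open>v\<close> in \<open>H0curl\<close>. Working with pairs turns \<open>H0curl\<close> into a closed subspace of a
  plain \<open>L2\<close> space.\<close>

definition curl_graph :: "vec3 set \<Rightarrow> (vec3 \<Rightarrow> vec3 \<times> vec3) set" where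
  "curl_graph \<Omega> = {p \<in> L2 (lebesgue_on \<Omega>). \<forall>e>0. \<exists>\<phi>\<in>test_fields \<Omega>.
     L2norm (lebesgue_on \<Omega>) (\<lambda>x. p x - (\<phi> x, classical_curl \<phi> x)) < e}"

lemma curl_graph_L2: "p \<in> curl_graph \<Omega> \<Longrightarrow> p \<in> L2 (lebesgue_on \<Omega>)"
  by (simp add: curl_graph_def)

lemma test_pair_L2:
  assumes "open \<Omega>" "bounded \<Omega>" "\<phi> \<in> test_fields \<Omega>"
  shows "(\<lambda>x. (\<phi> x, classical_curl \<phi> x)) \<in> L2 (lebesgue_on \<Omega>)"
  by (intro L2_Pair test_field_L2 assms classical_curl_test_field)

lemma curl_graph_closed:
  assumes "open \<Omega>" "bounded \<Omega>" "p \<in> L2 (lebesgue_on \<Omega>)"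
    and "\<And>e. e > 0 \<Longrightarrow> \<exists>q\<in>curl_graph \<Omega>. L2norm (lebesgue_on \<Omega>) (\<lambda>x. p x - q x) < e"
  shows "p \<in> curl_graph \<Omega>"
proof -
  let ?M = "lebesgue_on \<Omega>"
  have "\<exists>\<phi>\<in>test_fields \<Omega>. L2norm ?M (\<lambda>x. p x - (\<phi> x, classical_curl \<phi> x)) < e" if "e > 0" for e
  proof -
    have e2: "e / 2 > 0" using that by simp
    obtain q where q: "q \<in> curl_graph \<Omega>" "L2norm ?M (\<lambda>x. p x - q x) < e / 2"
      using assms(4)[OF e2] by blast
    obtain \<phi> where \<phi>: "\<phi> \<in> test_fields \<Omega>" "L2norm ?M (\<lambda>x. q x - (\<phi> x, classical_curl \<phi> x)) < e / 2"
      using q(1) e2 unfolding curl_graph_def by blast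
    have "L2norm ?M (\<lambda>x. p x - (\<phi> x, classical_curl \<phi> x)) < e"
      using L2norm_triangle[OF assms(3) curl_graph_L2[OF q(1)] test_pair_L2[OF assms(1,2) \<phi>(1)]] q(2) \<phi>(2)
      by linarith
    then show ?thesis using \<phi>(1) by blast
  qed
  then show ?thesis using assms(3) by (simp add: curl_graph_def)
qed

lemma curl_graph_combine:
  assumes "open \<Omega>" "bounded \<Omega>" and p: "p \<in> curl_graph \<Omega>" and q: "q \<in> curl_graph \<Omega>"
  shows "(\<lambda>x. c *\<^sub>R p x + d *\<^sub>R q x) \<in> curl_graph \<Omega>"
  unfolding curl_graph_def
proof (intro CollectI conjI allI impI)
  let ?M = "lebesgue_on \<Omega>"
  note L = L2_scaleR(1)[OF curl_graph_L2[OF p], of c] L2_scaleR(1)[OF curl_graph_L2[OF q], of d]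
  show "(\<lambda>x. c *\<^sub>R p x + d *\<^sub>R q x) \<in> L2 ?M" by (rule L2_add(1)[OF L])
  fix e :: real assume "e > 0"
  define e' where "e' = e / (\<bar>c\<bar> + \<bar>d\<bar> + 1)"
  have e': "e' > 0" using \<open>e > 0\<close> by (simp add: e'_def)
  obtain \<phi> where \<phi>: "\<phi> \<in> test_fields \<Omega>" "L2norm ?M (\<lambda>x. p x - (\<phi> x, classical_curl \<phi> x)) < e'"
    using p e' by (auto simp: curl_graph_def)
  obtain \<psi> where \<psi>: "\<psi> \<in> test_fields \<Omega>" "L2norm ?M (\<lambda>x. q x - (\<psi> x, classical_curl \<psi> x)) < e'"
    using q e' by (auto simp: curl_graph_def)
  let ?a = "\<lambda>x. p x - (\<phi> x, classical_curl \<phi> x)" and ?b = "\<lambda>x. q x - (\<psi> x, classical_curl \<psi> x)"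
  have ab: "?a \<in> L2 ?M" "?b \<in> L2 ?M"
    by (intro L2_diff(1) curl_graph_L2 p q test_pair_L2 assms \<phi> \<psi>)+
  define \<eta> where "\<eta> x = c *\<^sub>R \<phi> x + d *\<^sub>R \<psi> x" for x
  have \<eta>: "\<eta> \<in> test_fields \<Omega>" and cu: "classical_curl \<eta> x = c *\<^sub>R classical_curl \<phi> x + d *\<^sub>R classical_curl \<psi> x" for x
    unfolding \<eta>_def[abs_def] using test_fields_combine[OF \<phi>(1) \<psi>(1)] by auto
  have "(\<lambda>x. c *\<^sub>R p x + d *\<^sub>R q x - (\<eta> x, classical_curl \<eta> x)) = (\<lambda>x. c *\<^sub>R ?a x + d *\<^sub>R ?b x)"
    by (auto simp: cu \<eta>_def algebra_simps prod_eq_iff)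
  then have "L2norm ?M (\<lambda>x. c *\<^sub>R p x + d *\<^sub>R q x - (\<eta> x, classical_curl \<eta> x)) \<le> \<bar>c\<bar> * L2norm ?M ?a + \<bar>d\<bar> * L2norm ?M ?b"
    using L2_add(2)[OF L2_scaleR(1)[OF ab(1), of c] L2_scaleR(1)[OF ab(2), of d]] by (simp add: L2_scaleR(2)[OF ab(1)] L2_scaleR(2)[OF ab(2)])
  also have "\<dots> \<le> \<bar>c\<bar> * e' + \<bar>d\<bar> * e'"
    using \<phi>(2) \<psi>(2) by (intro add_mono mult_left_mono) auto
  also have "\<dots> < (\<bar>c\<bar> + \<bar>d\<bar> + 1) * e'"
    using e' by (simp add: algebra_simps)
  also have "\<dots> = e"
    by (simp add: e'_def add_nonneg_pos less_imp_neq[THEN not_sym])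
  finally show "\<exists>\<phi>\<in>test_fields \<Omega>. L2norm ?M (\<lambda>x. c *\<^sub>R p x + d *\<^sub>R q x - (\<phi> x, classical_curl \<phi> x)) < e"
    using \<eta> by blast
qed

lemma curl_graph_cong_AE:
  assumes "p \<in> curl_graph \<Omega>" "q \<in> borel_measurable (lebesgue_on \<Omega>)" "AE x in lebesgue_on \<Omega>. q x = p x" "open \<Omega>" "bounded \<Omega>"
  shows "q \<in> curl_graph \<Omega>"
proof (rule curl_graph_closed[OF assms(4,5) L2_AE_cong[OF curl_graph_L2[OF assms(1)] assms(2,3)]])
  fix e :: real assume "e > 0"
  have "L2norm (lebesgue_on \<Omega>) (\<lambda>x. q x - p x) = L2norm (lebesgue_on \<Omega>) (\<lambda>x. 0 :: vec3 \<times> vec3)"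
    using assms(3) L2_measurable[OF curl_graph_L2[OF assms(1)]]
    by (intro L2norm_cong_AE borel_measurable_diff assms(2)) auto
  then show "\<exists>p\<in>curl_graph \<Omega>. L2norm (lebesgue_on \<Omega>) (\<lambda>x. q x - p x) < e"
    using assms(1) \<open>e > 0\<close> by (intro bexI[of _ p]) (simp_all add: L2norm_def)
qed

text \<open>Pairing with \<open>?q\<close>, which consists of the curl of \<open>\<psi>\<close> and
  of \<open>- \<psi>\<close>, is a bounded functional on pairs. It vanishes on test pairs by
  integration by parts, hence on their closure, and its vanishing is exactly the weak curl
  identity.\<close>

lemma curl_graph_has_weak_curl:
  assumes "open \<Omega>" "bounded \<Omega>" "p \<in> curl_graph \<Omega>"
  shows "has_weak_curl \<Omega> (\<lambda>x. fst (p x)) (\<lambda>x. snd (p x))"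
  unfolding has_weak_curl_def L2_on_eq
proof (intro conjI ballI)
  let ?M = "lebesgue_on \<Omega>"
  note pL = curl_graph_L2[OF assms(3)]
  show "(\<lambda>x. snd (p x)) \<in> L2 ?M" by (rule L2_fst_snd[OF pL])
  fix \<psi> assume \<psi>: "\<psi> \<in> test_fields \<Omega>"
  let ?q = "\<lambda>x. (classical_curl \<psi> x, - \<psi> x)"
  have \<psi>L: "\<psi> \<in> L2 ?M" "classical_curl \<psi> \<in> L2 ?M"
    using \<psi> by (intro test_field_L2 assms classical_curl_test_field; simp)+
  have qL: "?q \<in> L2 ?M"
    using L2_Pair(1)[OF \<psi>L(2) L2_scaleR(1)[OF \<psi>L(1), of "-1"]] by simp
  have split: "(LINT x|?M. r x \<bullet> ?q x) = (LINT x|?M. fst (r x) \<bullet> classical_curl \<psi> x) - (LINT x|?M. snd (r x) \<bullet> \<psi> x)"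
    if "r \<in> L2 ?M" for r
    using L2_inner(1)[OF L2_fst_snd(1)[OF that] \<psi>L(2)] L2_inner(1)[OF L2_fst_snd(2)[OF that] \<psi>L(1)]
    by (simp add: inner_prod_def)
  have "\<bar>LINT x|?M. p x \<bullet> ?q x\<bar> \<le> e" if "e > 0" for e
  proof -
    define e' where "e' = e / (L2norm ?M ?q + 1)"
    have "L2norm ?M ?q + 1 > 0" using L2norm_nonneg[of ?M ?q] by linarith
    then have e': "e' > 0" using that by (simp add: e'_def)
    then obtain \<phi> where \<phi>: "\<phi> \<in> test_fields \<Omega>" "L2norm ?M (\<lambda>x. p x - (\<phi> x, classical_curl \<phi> x)) < e'"
      using assms(3) by (auto simp: curl_graph_def)
    let ?f = "\<lambda>x. (\<phi> x, classical_curl \<phi> x)"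
    have fL: "?f \<in> L2 ?M" by (intro test_pair_L2 assms \<phi>)
    have "(LINT x|?M. ?f x \<bullet> ?q x) = 0"
      unfolding split[OF fL] using has_weak_curl_classical[OF assms(1,2) \<phi>(1)] \<psi> by (simp add: has_weak_curl_def)
    then have "(LINT x|?M. p x \<bullet> ?q x) = (LINT x|?M. (p x - ?f x) \<bullet> ?q x)"
      by (simp add: inner_diff_left L2_inner(1)[OF pL qL] L2_inner(1)[OF fL qL] del: inner_Pair)
    also have "\<bar>\<dots>\<bar> \<le> L2norm ?M (\<lambda>x. p x - ?f x) * L2norm ?M ?q"
      by (rule L2_inner(2)[OF L2_diff(1)[OF pL fL] qL])
    also have "\<dots> \<le> e' * (L2norm ?M ?q + 1)"
      using \<phi>(2) e' by (intro mult_mono) auto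
    also have "\<dots> = e" using \<open>L2norm ?M ?q + 1 > 0\<close> by (simp add: e'_def)
    finally show ?thesis .
  qed
  then have "\<bar>LINT x|?M. p x \<bullet> ?q x\<bar> \<le> 0"
    by (rule field_le_epsilon) simp
  then have "(LINT x|?M. p x \<bullet> ?q x) = 0" by simp
  then show "(LINT x|?M. fst (p x) \<bullet> classical_curl \<psi> x) = (LINT x|?M. snd (p x) \<bullet> \<psi> x)"
    using split[OF pL] by simp
qed

lemma weak_curl_works: "v \<in> Hcurl \<Omega> \<Longrightarrow> has_weak_curl \<Omega> v (weak_curl \<Omega> v)"
  unfolding Hcurl_def weak_curl_def by (blast intro: someI[of "has_weak_curl \<Omega> v"])

lemma Hcurl_L2: "v \<in> Hcurl \<Omega> \<Longrightarrow> v \<in> L2 (lebesgue_on \<Omega>)" "v \<in> Hcurl \<Omega> \<Longrightarrow> weak_curl \<Omega> v \<in> L2 (lebesgue_on \<Omega>)"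
  using weak_curl_works[of v \<Omega>] by (auto simp: Hcurl_def has_weak_curl_def L2_on_eq)

lemma has_weak_curl_diff_classical:
  assumes "open \<Omega>" "bounded \<Omega>" "has_weak_curl \<Omega> v w" "v \<in> L2 (lebesgue_on \<Omega>)" "\<phi> \<in> test_fields \<Omega>"
  shows "has_weak_curl \<Omega> (\<lambda>x. v x - \<phi> x) (\<lambda>x. w x - classical_curl \<phi> x)"
proof -
  let ?M = "lebesgue_on \<Omega>"
  have L: "\<phi> \<in> L2 ?M" "classical_curl \<phi> \<in> L2 ?M" "w \<in> L2 ?M"
    using assms(3) by (auto intro!: test_field_L2 assms classical_curl_test_field simp: has_weak_curl_def L2_on_eq)
  show ?thesis
    unfolding has_weak_curl_def L2_on_eq
  proof (intro conjI ballI L2_diff(1) L)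
    fix \<psi> assume \<psi>: "\<psi> \<in> test_fields \<Omega>"
    have \<psi>L: "\<psi> \<in> L2 ?M" "classical_curl \<psi> \<in> L2 ?M"
      using \<psi> by (intro test_field_L2 assms classical_curl_test_field; simp)+
    show "(LINT x|?M. (v x - \<phi> x) \<bullet> classical_curl \<psi> x) = (LINT x|?M. (w x - classical_curl \<phi> x) \<bullet> \<psi> x)"
      using assms(3) has_weak_curl_classical[OF assms(1,2,5)] \<psi>
      by (simp add: inner_diff_left L2_inner(1) assms(4) L \<psi>L has_weak_curl_def)
  qed
qed

text \<open>The graph norm of \<open>v - \<phi>\<close> is the L2 norm of the difference of the
  pairs, because the weak curl of \<open>v - \<phi>\<close> is almost everywhere the difference of
  the curls.\<close>

lemma curl_graph_iff_H0curl:
  assumes "open \<Omega>" "bounded \<Omega>" "v \<in> Hcurl \<Omega>"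
  shows "v \<in> H0curl \<Omega> \<longleftrightarrow> (\<lambda>x. (v x, weak_curl \<Omega> v x)) \<in> curl_graph \<Omega>"
proof -
  let ?M = "lebesgue_on \<Omega>"
  note vL = Hcurl_L2[OF assms(3)]
  have "Hcurl_norm \<Omega> (\<lambda>x. v x - \<phi> x) = L2norm ?M (\<lambda>x. (v x, weak_curl \<Omega> v x) - (\<phi> x, classical_curl \<phi> x))"
    if \<phi>: "\<phi> \<in> test_fields \<Omega>" for \<phi>
  proof -
    have \<phi>L: "\<phi> \<in> L2 ?M" "classical_curl \<phi> \<in> L2 ?M"
      using \<phi> by (intro test_field_L2 assms classical_curl_test_field; simp)+
    note D = L2_diff(1)[OF vL(1) \<phi>L(1)] L2_diff(1)[OF vL(2) \<phi>L(2)]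
    have hw: "has_weak_curl \<Omega> (\<lambda>x. v x - \<phi> x) (\<lambda>x. weak_curl \<Omega> v x - classical_curl \<phi> x)"
      by (intro has_weak_curl_diff_classical assms(1,2) weak_curl_works assms(3) vL \<phi>)
    then have "(\<lambda>x. v x - \<phi> x) \<in> Hcurl \<Omega>"
      using D by (auto simp: Hcurl_def L2_on_eq)
    from weak_curl_unique[OF assms(1,2) weak_curl_works[OF this] hw] Hcurl_L2(2)[OF this]
    have "(LINT x|?M. (norm (weak_curl \<Omega> (\<lambda>x. v x - \<phi> x) x))\<^sup>2) = (LINT x|?M. (norm (weak_curl \<Omega> v x - classical_curl \<phi> x))\<^sup>2)"
      using L2_measurable[OF D(2)] by (intro integral_cong_AE) (auto dest: L2_measurable)
    then have "(Hcurl_norm \<Omega> (\<lambda>x. v x - \<phi> x))\<^sup>2 = (L2norm ?M (\<lambda>x. (v x - \<phi> x, weak_curl \<Omega> v x - classical_curl \<phi> x)))\<^sup>2"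
      unfolding L2_Pair(2)[OF D] by (simp add: Hcurl_norm_def L2norm_sq)
    then show ?thesis by (simp add: Hcurl_norm_def)
  qed
  then show ?thesis
    using assms(3) L2_Pair(1)[OF vL] by (simp add: H0curl_def curl_graph_def cong: bex_cong)
qed

lemma H0curl_curl_graph:
  assumes "open \<Omega>" "bounded \<Omega>" "v \<in> H0curl \<Omega>"
  shows "(\<lambda>x. (v x, weak_curl \<Omega> v x)) \<in> curl_graph \<Omega>"
  using assms curl_graph_iff_H0curl[OF assms(1,2), of v] by (auto simp: H0curl_def)

text \<open>The second component of a pair need not be the representative that
  \<open>weak_curl\<close> selects, so the curl is identified up to a null set.\<close>

lemma curl_graph_H0curl:
  assumes "open \<Omega>" "bounded \<Omega>" "p \<in> curl_graph \<Omega>"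
  shows "(\<lambda>x. fst (p x)) \<in> H0curl \<Omega>"
    "AE x in lebesgue_on \<Omega>. weak_curl \<Omega> (\<lambda>x. fst (p x)) x = snd (p x)"
proof -
  let ?v = "\<lambda>x. fst (p x)"
  have hw: "has_weak_curl \<Omega> ?v (\<lambda>x. snd (p x))"
    by (rule curl_graph_has_weak_curl[OF assms])
  have H: "?v \<in> Hcurl \<Omega>"
    using hw L2_fst_snd(1)[OF curl_graph_L2[OF assms(3)]] by (auto simp: Hcurl_def L2_on_eq)
  show ae: "AE x in lebesgue_on \<Omega>. weak_curl \<Omega> ?v x = snd (p x)"
    by (rule weak_curl_unique[OF assms(1,2) weak_curl_works[OF H] hw])
  have "(\<lambda>x. (?v x, weak_curl \<Omega> ?v x)) \<in> curl_graph \<Omega>"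
  proof (rule curl_graph_cong_AE[OF assms(3) _ _ assms(1,2)])
    show "(\<lambda>x. (?v x, weak_curl \<Omega> ?v x)) \<in> borel_measurable (lebesgue_on \<Omega>)"
      by (intro L2_measurable L2_Pair Hcurl_L2 H)
    show "AE x in lebesgue_on \<Omega>. (?v x, weak_curl \<Omega> ?v x) = p x"
      using ae by eventually_elim simp
  qed
  then show "?v \<in> H0curl \<Omega>"
    using curl_graph_iff_H0curl[OF assms(1,2) H] by blast
qed

section \<open>Monotone variational problems in a closed subspace of L2\<close>

text \<open>The direct method: the energy with density \<open>N y \<bullet> y / 2 + \<Psi> y - g \<bullet> y\<close> is strongly convex, so minimizing sequences
  are Cauchy.\<close>

lemma variational_problem_exists:
  fixes G :: "('a \<Rightarrow> 'b::euclidean_space) set" and N \<beta> :: "'a \<Rightarrow> 'b \<Rightarrow> 'b" and \<Psi> :: "'a \<Rightarrow> 'b \<Rightarrow> real"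
  assumes fin: "finite_measure M"
    and GL: "G \<subseteq> L2 M" and G0: "(\<lambda>x. 0) \<in> G"
    and Gcomb: "\<And>p q c d. p \<in> G \<Longrightarrow> q \<in> G \<Longrightarrow> (\<lambda>x. c *\<^sub>R p x + d *\<^sub>R q x) \<in> G"
    and Gcl: "\<And>p. p \<in> L2 M \<Longrightarrow> (\<And>e. e > 0 \<Longrightarrow> \<exists>q\<in>G. L2norm M (\<lambda>x. p x - q x) < e) \<Longrightarrow> p \<in> G"
    and c: "c > 0" and K: "K \<ge> 0" and L: "L \<ge> 0"
    and N_lin: "\<And>x. linear (N x)"
    and N: "AE x in M. (\<forall>y z. N x y \<bullet> z = y \<bullet> N x z) \<and> (\<forall>y. c * (norm y)\<^sup>2 \<le> N x y \<bullet> y \<and> norm (N x y) \<le> K * norm y)"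
    and N_meas: "\<And>p. p \<in> L2 M \<Longrightarrow> (\<lambda>x. N x (p x)) \<in> borel_measurable M"
    and \<beta>_bound: "\<And>x y. norm (\<beta> x y) \<le> j"
    and \<beta>_lip: "\<And>x y z. norm (\<beta> x y - \<beta> x z) \<le> L * norm (y - z)"
    and \<beta>_meas: "\<And>p. p \<in> L2 M \<Longrightarrow> (\<lambda>x. \<beta> x (p x)) \<in> borel_measurable M"
    and \<Psi>: "\<And>x y z. \<Psi> x y + \<beta> x y \<bullet> (z - y) \<le> \<Psi> x z" "\<And>x. \<Psi> x 0 = 0"
    and \<Psi>_meas: "\<And>p. p \<in> L2 M \<Longrightarrow> (\<lambda>x. \<Psi> x (p x)) \<in> borel_measurable M"
    and g: "g \<in> L2 M"
  obtains p where "p \<in> G"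
    "\<And>q. q \<in> G \<Longrightarrow> (LINT x|M. N x (p x) \<bullet> q x) + (LINT x|M. \<beta> x (p x) \<bullet> q x) = (LINT x|M. g x \<bullet> q x)"
proof -
  have j: "j \<ge> 0" using order_trans[OF norm_ge_zero \<beta>_bound] .
  have NL: "(\<lambda>x. N x (p x)) \<in> L2 M" if "p \<in> L2 M" for p
    by (rule L2_dominated(1)[OF that N_meas[OF that] K]) (use N in \<open>eventually_elim, simp\<close>)
  have \<beta>L: "(\<lambda>x. \<beta> x (p x)) \<in> L2 M" if "p \<in> L2 M" for p
    by (rule L2_bounded[OF fin \<beta>_meas[OF that]]) (use \<beta>_bound in blast)
  \<comment> \<open>The subgradient inequality between \<open>y\<close> and 0, read in both
    directions, bounds the potential linearly by the bound \<open>j\<close> of its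
    subgradients.\<close>
  have \<Psi>_abs: "\<bar>\<Psi> x y\<bar> \<le> j * norm y" for x y
  proof -
    have "\<Psi> x y \<le> norm (\<beta> x y) * norm y"
      using \<Psi>(1)[of x y 0] \<Psi>(2)[of x] norm_cauchy_schwarz[of "\<beta> x y" y] by simp
    moreover have "- \<Psi> x y \<le> norm (\<beta> x 0) * norm y"
      using \<Psi>(1)[of x 0 y] \<Psi>(2)[of x] Cauchy_Schwarz_ineq2[of "\<beta> x 0" y] by simp
    ultimately show ?thesis
      using mult_right_mono[OF \<beta>_bound[of x y], of "norm y"] mult_right_mono[OF \<beta>_bound[of x 0], of "norm y"]
      by (simp add: abs_le_iff)
  qed
  have \<Psi>_int: "integrable M (\<lambda>x. \<Psi> x (p x))" if "p \<in> L2 M" for p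
  proof (rule Bochner_Integration.integrable_bound[OF _ \<Psi>_meas[OF that]])
    show "integrable M (\<lambda>x. j * norm (p x))" using L2_norm_integrable(1)[OF fin that] by simp
    show "AE x in M. norm (\<Psi> x (p x)) \<le> norm (j * norm (p x))"
      using \<Psi>_abs j by (simp add: abs_mult)
  qed
  define e where "e x y = N x y \<bullet> y / 2 + \<Psi> x y - g x \<bullet> y" for x y
  define D where "D x y z = N x y \<bullet> z + \<beta> x y \<bullet> z - g x \<bullet> z" for x y z
  have e_int: "integrable M (\<lambda>x. e x (p x))" if "p \<in> L2 M" for p
    unfolding e_def
    by (intro Bochner_Integration.integrable_diff Bochner_Integration.integrable_add integrable_divide
        L2_inner(1) NL \<Psi>_int g that)
  have D_int: "integrable M (\<lambda>x. D x (p x) (q x))" if "p \<in> L2 M" "q \<in> L2 M" for p q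
    unfolding D_def
    by (intro Bochner_Integration.integrable_diff Bochner_Integration.integrable_add L2_inner(1) NL \<beta>L g that)
  define I where "I p = (LINT x|M. e x (p x))" for p
  define Q where "Q = K / 2 + L"
  have "Q \<ge> 0" using K L by (simp add: Q_def)

  \<comment> \<open>\<open>D\<close> is the directional derivative of the energy density. The
    subgradient at the far end of the step bounds the growth of \<open>\<Psi>\<close>, and the
    Lipschitz bound for \<open>\<beta>\<close> moves it back to the starting point at quadratic
    cost.\<close>
  have upper: "I (\<lambda>x. p x + t *\<^sub>R q x) \<le> I p + t * (LINT x|M. D x (p x) (q x)) + t\<^sup>2 * (Q * (L2norm M q)\<^sup>2)"
    if p: "p \<in> L2 M" and q: "q \<in> L2 M" for p q t
  proof -
    have pq: "(\<lambda>x. p x + t *\<^sub>R q x) \<in> L2 M" by (intro L2_add(1) L2_scaleR(1) p q)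
    have "I (\<lambda>x. p x + t *\<^sub>R q x) \<le> (LINT x|M. e x (p x) + t * D x (p x) (q x) + t\<^sup>2 * (Q * (norm (q x))\<^sup>2))"
      unfolding I_def
    proof (rule integral_mono_AE[OF e_int[OF pq]])
      show "integrable M (\<lambda>x. e x (p x) + t * D x (p x) (q x) + t\<^sup>2 * (Q * (norm (q x))\<^sup>2))"
        using e_int[OF p] D_int[OF p q] L2_integrable[OF q] by simp
      show "AE x in M. e x (p x + t *\<^sub>R q x) \<le> e x (p x) + t * D x (p x) (q x) + t\<^sup>2 * (Q * (norm (q x))\<^sup>2)"
        using N
      proof eventually_elim
        case (elim x)
        define y z where "y = p x" and "z = q x"
        have sym: "N x z \<bullet> y = N x y \<bullet> z" using elim by (metis inner_commute)
        have "N x (y + t *\<^sub>R z) \<bullet> (y + t *\<^sub>R z) = N x y \<bullet> y + 2 * t * (N x y \<bullet> z) + t\<^sup>2 * (N x z \<bullet> z)"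
          by (simp add: linear_add[OF N_lin] linear_scale[OF N_lin] inner_add_left inner_add_right sym power2_eq_square algebra_simps)
        moreover have "N x z \<bullet> z \<le> K * (norm z)\<^sup>2"
        proof -
          have "N x z \<bullet> z \<le> norm (N x z) * norm z" by (rule norm_cauchy_schwarz)
          also have "\<dots> \<le> (K * norm z) * norm z" using elim by (intro mult_right_mono) auto
          finally show ?thesis by (simp add: power2_eq_square)
        qed
        then have "t\<^sup>2 * (N x z \<bullet> z) \<le> t\<^sup>2 * (K * (norm z)\<^sup>2)"
          by (intro mult_left_mono) auto
        moreover have "\<Psi> x (y + t *\<^sub>R z) \<le> \<Psi> x y + t * (\<beta> x y \<bullet> z) + t\<^sup>2 * (L * (norm z)\<^sup>2)"
        proof -
          have "\<Psi> x (y + t *\<^sub>R z) \<le> \<Psi> x y + \<beta> x (y + t *\<^sub>R z) \<bullet> (t *\<^sub>R z)"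
            using \<Psi>(1)[of x "y + t *\<^sub>R z" y] by simp
          also have "\<beta> x (y + t *\<^sub>R z) \<bullet> (t *\<^sub>R z) = t * (\<beta> x y \<bullet> z) + (\<beta> x (y + t *\<^sub>R z) - \<beta> x y) \<bullet> (t *\<^sub>R z)"
            by (simp add: inner_diff_left algebra_simps)
          also have "(\<beta> x (y + t *\<^sub>R z) - \<beta> x y) \<bullet> (t *\<^sub>R z) \<le> norm (\<beta> x (y + t *\<^sub>R z) - \<beta> x y) * norm (t *\<^sub>R z)"
            by (rule norm_cauchy_schwarz)
          also have "\<dots> \<le> (L * norm (t *\<^sub>R z)) * norm (t *\<^sub>R z)"
            using \<beta>_lip[of x "y + t *\<^sub>R z" y] by (intro mult_right_mono) auto
          also have "\<dots> = t\<^sup>2 * (L * (norm z)\<^sup>2)"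
            by (simp add: power2_eq_square)
          finally show ?thesis by simp
        qed
        moreover have "t * D x y z = t * (N x y \<bullet> z) + t * (\<beta> x y \<bullet> z) - t * (g x \<bullet> z)"
          by (simp add: D_def algebra_simps)
        moreover have "t\<^sup>2 * (Q * (norm z)\<^sup>2) = t\<^sup>2 * (K * (norm z)\<^sup>2) / 2 + t\<^sup>2 * (L * (norm z)\<^sup>2)"
          by (simp add: Q_def algebra_simps)
        moreover have "g x \<bullet> (y + t *\<^sub>R z) = g x \<bullet> y + t * (g x \<bullet> z)"
          by (simp add: inner_add_right)
        ultimately show ?case
          unfolding e_def y_def[symmetric] z_def[symmetric] by linarith
      qed
    qed
    also have "\<dots> = I p + t * (LINT x|M. D x (p x) (q x)) + t\<^sup>2 * (Q * (L2norm M q)\<^sup>2)"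
      using e_int[OF p] D_int[OF p q] L2_integrable[OF q] by (simp add: I_def L2norm_sq)
    finally show ?thesis .
  qed

  \<comment> \<open>Midpoint form of strong convexity: the quadratic part contributes one eighth of
    \<open>N x (y - z) \<bullet> (y - z)\<close>, the convex potential a nonnegative amount, and the
    linear part nothing.\<close>
  have mid: "c / 8 * (L2norm M (\<lambda>x. p x - q x))\<^sup>2 \<le> I p / 2 + I q / 2 - I (\<lambda>x. (1/2) *\<^sub>R p x + (1/2) *\<^sub>R q x)"
    if p: "p \<in> L2 M" and q: "q \<in> L2 M" for p q
  proof -
    have pq: "(\<lambda>x. (1/2) *\<^sub>R p x + (1/2) *\<^sub>R q x) \<in> L2 M" by (intro L2_add(1) L2_scaleR(1) p q)
    have "(LINT x|M. c / 8 * (norm (p x - q x))\<^sup>2) \<le> (LINT x|M. e x (p x) / 2 + e x (q x) / 2 - e x ((1/2) *\<^sub>R p x + (1/2) *\<^sub>R q x))"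
    proof (rule integral_mono_AE)
      show "integrable M (\<lambda>x. c / 8 * (norm (p x - q x))\<^sup>2)"
        using L2_integrable[OF L2_diff(1)[OF p q]] by simp
      show "integrable M (\<lambda>x. e x (p x) / 2 + e x (q x) / 2 - e x ((1/2) *\<^sub>R p x + (1/2) *\<^sub>R q x))"
        using e_int[OF p] e_int[OF q] e_int[OF pq] by simp
      show "AE x in M. c / 8 * (norm (p x - q x))\<^sup>2 \<le> e x (p x) / 2 + e x (q x) / 2 - e x ((1/2) *\<^sub>R p x + (1/2) *\<^sub>R q x)"
        using N
      proof eventually_elim
        case (elim x)
        define y z where "y = p x" and "z = q x"
        define m where "m = (1/2) *\<^sub>R y + (1/2) *\<^sub>R z"
        have sym: "N x z \<bullet> y = N x y \<bullet> z" using elim by (metis inner_commute)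
        have "c * (norm (y - z))\<^sup>2 \<le> N x (y - z) \<bullet> (y - z)" using elim by blast
        also have "\<dots> = N x y \<bullet> y - 2 * (N x y \<bullet> z) + N x z \<bullet> z"
          by (simp add: linear_diff[OF N_lin] inner_diff_left inner_diff_right sym)
        finally have 1: "c * (norm (y - z))\<^sup>2 \<le> N x y \<bullet> y - 2 * (N x y \<bullet> z) + N x z \<bullet> z" .
        have 2: "N x m \<bullet> m = (N x y \<bullet> y) / 4 + (N x y \<bullet> z) / 2 + (N x z \<bullet> z) / 4"
          by (simp add: m_def linear_add[OF N_lin] linear_scale[OF N_lin] inner_add_left inner_add_right sym add_divide_distrib)
        \<comment> \<open>The subgradient inequalities at the midpoint towards \<open>y\<close> and
          towards \<open>z\<close> are added; their linear terms cancel.\<close>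
        have "\<beta> x m \<bullet> (y - m) + \<beta> x m \<bullet> (z - m) = \<beta> x m \<bullet> (y + z - 2 *\<^sub>R m)"
          by (simp add: inner_diff_right inner_add_right)
        also have "\<dots> = 0" by (simp add: m_def algebra_simps)
        finally have 3: "\<Psi> x m \<le> \<Psi> x y / 2 + \<Psi> x z / 2"
          using \<Psi>(1)[of x m y] \<Psi>(1)[of x m z] by linarith
        have 4: "g x \<bullet> m = (g x \<bullet> y) / 2 + (g x \<bullet> z) / 2"
          by (simp add: m_def inner_add_right)
        have arith: "n / 8 \<le> (a / 2 + u - r) / 2 + (b / 2 + v - s) / 2 - (d / 2 + w - t)"
          if "n \<le> a - 2 * h + b" "d = a / 4 + h / 2 + b / 4" "w \<le> u / 2 + v / 2" "t = r / 2 + s / 2"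
          for n a b h d u v w r s t :: real
          using that by (simp add: field_simps)
        from arith[OF 1 2 3 4] show ?case
          unfolding e_def y_def[symmetric] z_def[symmetric] m_def[symmetric] by simp
      qed
    qed
    then show ?thesis
      using e_int[OF p] e_int[OF q] e_int[OF pq] by (simp add: I_def L2norm_sq)
  qed

  have low: "- (LINT x|M. (j\<^sup>2 + (norm (g x))\<^sup>2) / c) \<le> I p" if p: "p \<in> L2 M" for p
  proof -
    interpret finite_measure M by fact
    have "(LINT x|M. - ((j\<^sup>2 + (norm (g x))\<^sup>2) / c)) \<le> I p"
      unfolding I_def
    proof (rule integral_mono_AE[OF _ e_int[OF p]])
      show "integrable M (\<lambda>x. - ((j\<^sup>2 + (norm (g x))\<^sup>2) / c))"
        using L2_integrable[OF g] by simp
      show "AE x in M. - ((j\<^sup>2 + (norm (g x))\<^sup>2) / c) \<le> e x (p x)"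
        using N
      proof eventually_elim
        case (elim x)
        define r s where "r = norm (p x)" and "s = norm (g x)"
        have "c * r\<^sup>2 \<le> N x (p x) \<bullet> p x" unfolding r_def using elim by blast
        moreover have "- (j * r) \<le> \<Psi> x (p x)" using \<Psi>_abs[of x "p x"] by (simp add: r_def abs_le_iff)
        moreover have "g x \<bullet> p x \<le> s * r" by (simp add: r_def s_def norm_cauchy_schwarz)
        ultimately have "c * r\<^sup>2 / 2 - j * r - s * r \<le> e x (p x)" unfolding e_def by linarith
        moreover have "- ((j\<^sup>2 + s\<^sup>2) / c) \<le> c * r\<^sup>2 / 2 - j * r - s * r"
        proof -
          \<comment> \<open>Two completed squares, one absorbing the linear term from the potential,
            the other that from \<open>g\<close>; each takes half of the quadratic term.\<close>
          have "0 \<le> (c * r / 2 - j)\<^sup>2 + (c * r / 2 - s)\<^sup>2" by simp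
          also have "\<dots> = c * (c * r\<^sup>2 / 2 - j * r - s * r) + (j\<^sup>2 + s\<^sup>2)"
            by (simp add: power2_eq_square algebra_simps)
          finally show ?thesis using c by (simp add: field_simps)
        qed
        ultimately show ?case by (simp add: s_def)
      qed
    qed
    then show ?thesis by simp
  qed

  define m where "m = (INF p\<in>G. I p)"
  have bdd: "bdd_below (I ` G)"
    using low GL by (intro bdd_belowI2[where m = "- (LINT x|M. (j\<^sup>2 + (norm (g x))\<^sup>2) / c)"]) blast
  have m_le: "m \<le> I p" if "p \<in> G" for p
    unfolding m_def using bdd that by (rule cINF_lower)
  \<comment> \<open>Energy errors \<open>4^-n\<close> turn, through \<open>mid\<close>, into steps
    of order \<open>2^-n\<close>, the rate that \<open>L2_complete\<close> asks for.\<close>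
  have "\<exists>p\<in>G. I p < m + 1 / 4^n" for n :: nat
    using cINF_less_iff[of G I "m + 1 / 4^n"] bdd G0 by (auto simp: m_def)
  then obtain P where P: "\<And>n. P n \<in> G" "\<And>n. I (P n) < m + 1 / 4^n" by metis
  have PL: "P n \<in> L2 M" for n using P(1) GL by blast
  have Pd: "L2norm M (\<lambda>x. P (Suc n) x - P n x) \<le> sqrt (8 / c) / 2^n" for n
  proof -
    have "c / 8 * (L2norm M (\<lambda>x. P (Suc n) x - P n x))\<^sup>2 \<le> I (P (Suc n)) / 2 + I (P n) / 2 - m"
      using mid[OF PL PL, of "Suc n" n] m_le[OF Gcomb[OF P(1)[of "Suc n"] P(1)[of n], of "1/2" "1/2"]] by linarith
    also have "\<dots> \<le> 1 / 4^n"
      using P(2)[of n] P(2)[of "Suc n"] by (simp add: field_simps)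
    finally have "(L2norm M (\<lambda>x. P (Suc n) x - P n x))\<^sup>2 \<le> (8 / c) / 4^n"
      using c by (simp add: field_simps)
    also have "\<dots> = (sqrt (8 / c) / 2^n)\<^sup>2"
    proof -
      have "(2^n)\<^sup>2 = (4::real)^n" by (simp add: power2_eq_square flip: power_mult_distrib)
      then show ?thesis using c by (simp add: power_divide)
    qed
    finally show ?thesis by (rule power2_le_imp_le) (use c in simp)
  qed
  obtain p where p: "p \<in> L2 M" and lim: "(\<lambda>n. L2norm M (\<lambda>x. P n x - p x)) \<longlonglongrightarrow> 0"
    by (rule L2_complete[of M P "sqrt (8 / c)", OF fin PL Pd])
  have pG: "p \<in> G"
  proof (rule Gcl[OF p])
    fix e :: real assume "e > 0"
    from order_tendstoD(2)[OF lim this] obtain n where "L2norm M (\<lambda>x. P n x - p x) < e"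
      by (auto simp: eventually_sequentially)
    then show "\<exists>q\<in>G. L2norm M (\<lambda>x. p x - q x) < e"
      using P(1) L2norm_minus_commute by metis
  qed
  show ?thesis
  proof
    show "p \<in> G" by fact
    fix q assume q: "q \<in> G"
    then have qL: "q \<in> L2 M" using GL by blast
    define d where "d r = (LINT x|M. D x (r x) (q x))" for r
    \<comment> \<open>The Euler-Lagrange equation is obtained as a limit along the almost
      minimizers: for a step \<open>t\<close> of size \<open>2^-n\<close> in either direction the
      energy error \<open>4^-n\<close> is of order \<open>t^2\<close>, so the derivative at
      \<open>P n\<close> is of order \<open>2^-n\<close>.\<close>
    have small: "\<bar>d (P n)\<bar> \<le> (1 + Q * (L2norm M q)\<^sup>2) / 2^n" for n
    proof -
      have *: "- (1 / 4^n) \<le> t * d (P n) + t\<^sup>2 * (Q * (L2norm M q)\<^sup>2)" for t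
        using upper[OF PL qL, of n t] m_le[OF Gcomb[OF P(1)[of n] q, of 1 t]] P(2)[of n]
        by (simp add: d_def)
      define h :: real where "h = 1 / 2^n"
      have h: "h > 0" by (simp add: h_def)
      have sq: "1 / 4^n = h * h"
        by (simp add: h_def flip: power_mult_distrib)
      let ?Q = "Q * (L2norm M q)\<^sup>2"
      have "0 \<le> h * (h + d (P n) + h * ?Q)" "0 \<le> h * (h - d (P n) + h * ?Q)"
        using *[of h] *[of "- h"] unfolding sq by (simp_all add: algebra_simps power2_eq_square)
      then have "\<bar>d (P n)\<bar> \<le> h + h * ?Q"
        using h by (simp add: zero_le_mult_iff abs_le_iff)
      also have "\<dots> = (1 + ?Q) / 2^n" by (simp add: h_def field_simps)
      finally show ?thesis .
    qed
    have cont: "\<bar>d (P n) - d p\<bar> \<le> (K + L) * (L2norm M (\<lambda>x. P n x - p x) * L2norm M q)" for n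
    proof -
      have diffL: "(\<lambda>x. P n x - p x) \<in> L2 M" by (rule L2_diff(1)[OF PL p])
      have "AE x in M. \<bar>D x (P n x) (q x) - D x (p x) (q x)\<bar> \<le> (K + L) * (norm (P n x - p x) * norm (q x))"
        using N
      proof eventually_elim
        case (elim x)
        have "D x (P n x) (q x) - D x (p x) (q x) = (N x (P n x - p x) + (\<beta> x (P n x) - \<beta> x (p x))) \<bullet> q x"
          by (simp add: D_def linear_diff[OF N_lin] inner_diff_left inner_add_left)
        also have "\<bar>\<dots>\<bar> \<le> norm (N x (P n x - p x) + (\<beta> x (P n x) - \<beta> x (p x))) * norm (q x)"
          by (rule Cauchy_Schwarz_ineq2)
        also have "\<dots> \<le> (K * norm (P n x - p x) + L * norm (P n x - p x)) * norm (q x)"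
          using elim \<beta>_lip[of x "P n x" "p x"] by (intro mult_right_mono norm_triangle_mono) auto
        finally show ?case by (simp add: algebra_simps)
      qed
      from L2_bound_integrable(2)[OF diffL qL _ this] have
        "\<bar>LINT x|M. D x (P n x) (q x) - D x (p x) (q x)\<bar> \<le> \<bar>K + L\<bar> * (L2norm M (\<lambda>x. P n x - p x) * L2norm M q)"
        using D_int[OF PL qL, of n] D_int[OF p qL] by auto
      then show ?thesis
        using D_int[OF PL qL, of n] D_int[OF p qL] K L by (simp add: d_def)
    qed
    have "(\<lambda>n. d (P n)) \<longlonglongrightarrow> 0"
    proof (rule Lim_null_comparison)
      show "\<forall>\<^sub>F n in sequentially. norm (d (P n)) \<le> (1 + Q * (L2norm M q)\<^sup>2) / 2^n"
        using small by simp
      show "(\<lambda>n. (1 + Q * (L2norm M q)\<^sup>2) / 2^n) \<longlonglongrightarrow> 0" by (rule LIMSEQ_divide_realpow_zero) simp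
    qed
    moreover have "(\<lambda>n. d (P n) - d p) \<longlonglongrightarrow> 0"
    proof (rule Lim_null_comparison)
      show "\<forall>\<^sub>F n in sequentially. norm (d (P n) - d p) \<le> (K + L) * (L2norm M (\<lambda>x. P n x - p x) * L2norm M q)"
        using cont by simp
      show "(\<lambda>n. (K + L) * (L2norm M (\<lambda>x. P n x - p x) * L2norm M q)) \<longlonglongrightarrow> 0"
        by (intro tendsto_mult_right_zero tendsto_mult_left_zero lim)
    qed
    ultimately have "(\<lambda>n. d (P n) - (d (P n) - d p)) \<longlonglongrightarrow> 0 - 0" by (rule tendsto_diff)
    then have "d p = 0" by (simp add: LIMSEQ_const_iff)
    then show "(LINT x|M. N x (p x) \<bullet> q x) + (LINT x|M. \<beta> x (p x) \<bullet> q x) = (LINT x|M. g x \<bullet> q x)"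
      using L2_inner(1)[OF NL[OF p] qL] L2_inner(1)[OF \<beta>L[OF p] qL] L2_inner(1)[OF g qL]
      by (simp add: d_def D_def)
  qed
qed

section \<open>The penalization\<close>

text \<open>\<open>smooth_max1 \<gamma>\<close> is the maximum of the affine functions \<open>\<lambda>x. p * x + (1 - p) * (1 + p / (2 * \<gamma>))\<close> over \<open>p\<close> in
  \<open>[0, 1]\<close>. All its properties are read off from this representation.\<close>

lemma smooth_max1_ge:
  assumes "\<gamma> > 0" "0 \<le> p" "p \<le> 1"
  shows "p * x + (1 - p) * (1 + p / (2 * \<gamma>)) \<le> smooth_max1 \<gamma> x"
proof -
  \<comment> \<open>In these coordinates the affine function is \<open>1 + p z - p^2 c\<close>, a
    concave parabola in \<open>p\<close> with vertex \<open>p = z / (2 c)\<close>.\<close>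
  define c z where "c = 1 / (2 * \<gamma>)" and "z = x - 1 + c"
  have c: "c > 0" and \<gamma>: "\<gamma> = 1 / (2 * c)" using assms(1) by (auto simp: c_def)
  have lhs: "p * x + (1 - p) * (1 + p / (2 * \<gamma>)) = 1 + p * z - p\<^sup>2 * c"
    by (simp add: z_def c_def power2_eq_square algebra_simps add_divide_distrib diff_divide_distrib)
  consider "x - 1 \<ge> c" | "x - 1 < c" "\<bar>x - 1\<bar> \<le> c" | "x - 1 < - c" by linarith
  then show ?thesis
  proof cases
    case 1
    \<comment> \<open>The product on the right is \<open>x - (1 + p z - p^2 c)\<close> in factored
      form.\<close>
    have "0 \<le> (1 - p) * (z - (1 + p) * c)"
    proof (rule mult_nonneg_nonneg)
      have "(1 + p) * c \<le> 2 * c" using assms c by (intro mult_right_mono) auto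
      then show "0 \<le> z - (1 + p) * c" using 1 by (simp add: z_def)
    qed (use assms in simp)
    then have "1 + p * z - p\<^sup>2 * c \<le> x"
      by (simp add: z_def power2_eq_square algebra_simps)
    then show ?thesis using 1 by (simp add: lhs smooth_max1_def c_def)
  next
    case 2
    have "0 \<le> (z - 2 * c * p)\<^sup>2 / (4 * c)" using c by simp
    also have "\<dots> = z\<^sup>2 / (4 * c) - p * z + p\<^sup>2 * c"
      using c by (simp add: field_simps power2_eq_square)
    finally have "1 + p * z - p\<^sup>2 * c \<le> 1 + z\<^sup>2 / (4 * c)" by simp
    also have "z\<^sup>2 / (4 * c) = \<gamma> / 2 * z\<^sup>2" by (simp add: \<gamma>)
    finally show ?thesis using 2 by (simp add: lhs smooth_max1_def c_def z_def)
  next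
    case 3
    have "p * z \<le> 0" using assms 3 by (intro mult_nonneg_nonpos) (auto simp: z_def)
    moreover have "0 \<le> p\<^sup>2 * c" using c by simp
    ultimately have "1 + p * z - p\<^sup>2 * c \<le> 1" by linarith
    moreover have n: "\<not> x - 1 \<ge> c" "\<not> \<bar>x - 1\<bar> \<le> c" using 3 c by linarith+
    ultimately show ?thesis
      unfolding lhs smooth_max1_def c_def[symmetric] if_not_P[OF n(1)] if_not_P[OF n(2)] by simp
  qed
qed

lemma smooth_max1_eq:
  assumes "\<gamma> > 0"
  obtains p where "0 \<le> p" "p \<le> 1" "smooth_max1 \<gamma> x = p * x + (1 - p) * (1 + p / (2 * \<gamma>))"
proof -
  define c z where "c = 1 / (2 * \<gamma>)" and "z = x - 1 + c"
  have c: "c > 0" and \<gamma>: "\<gamma> = 1 / (2 * c)" using assms(1) by (auto simp: c_def)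
  consider "x - 1 \<ge> c" | "x - 1 < c" "\<bar>x - 1\<bar> \<le> c" | "x - 1 < - c" by linarith
  then show ?thesis
  proof cases
    case 1
    then show ?thesis using that[of 1] by (simp add: smooth_max1_def c_def)
  next
    case 2
    \<comment> \<open>The vertex of the parabola, which lies in \<open>[0, 1]\<close> throughout the
      transition zone.\<close>
    define p where "p = z / (2 * c)"
    have z: "z = 2 * c * p" using c by (simp add: p_def)
    have "0 \<le> p" "p \<le> 1" using 2 c by (auto simp: p_def z_def field_simps)
    moreover have "smooth_max1 \<gamma> x = p * x + (1 - p) * (1 + p / (2 * \<gamma>))"
    proof -
      have "smooth_max1 \<gamma> x = 1 + \<gamma> / 2 * z\<^sup>2" using 2 by (simp add: smooth_max1_def c_def z_def)
      also have "\<dots> = 1 + c * p\<^sup>2" using c by (simp add: \<gamma> z power2_eq_square)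
      also have "\<dots> = 1 + p * z - p\<^sup>2 * c" by (simp add: z power2_eq_square)
      also have "\<dots> = p * x + (1 - p) * (1 + p / (2 * \<gamma>))"
        by (simp add: z_def c_def power2_eq_square algebra_simps add_divide_distrib diff_divide_distrib)
      finally show ?thesis .
    qed
    ultimately show ?thesis using that by blast
  next
    case 3
    then have n: "\<not> x - 1 \<ge> c" "\<not> \<bar>x - 1\<bar> \<le> c" using c by linarith+
    have "smooth_max1 \<gamma> x = 1"
      unfolding smooth_max1_def c_def[symmetric] if_not_P[OF n(1)] if_not_P[OF n(2)] by simp
    then show ?thesis using that[of 0] by simp
  qed
qed

lemma smooth_max1_ge_1: "\<gamma> > 0 \<Longrightarrow> 1 \<le> smooth_max1 \<gamma> x"
  and smooth_max1_ge_self: "\<gamma> > 0 \<Longrightarrow> x \<le> smooth_max1 \<gamma> x"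
  using smooth_max1_ge[of \<gamma> 0 x] smooth_max1_ge[of \<gamma> 1 x] by auto

text \<open>The affine functions in the representation have slopes \<open>p \<ge> 0\<close>.\<close>

lemma smooth_max1_mono:
  assumes "\<gamma> > 0" "x \<le> y"
  shows "smooth_max1 \<gamma> x \<le> smooth_max1 \<gamma> y"
proof -
  obtain p where p: "0 \<le> p" "p \<le> 1" "smooth_max1 \<gamma> x = p * x + (1 - p) * (1 + p / (2 * \<gamma>))"
    using smooth_max1_eq[OF assms(1)] .
  have "smooth_max1 \<gamma> x \<le> p * y + (1 - p) * (1 + p / (2 * \<gamma>))"
    unfolding p(3) using assms(2) p(1) by (simp add: mult_left_mono)
  then show ?thesis using smooth_max1_ge[OF assms(1) p(1,2), of y] by linarith
qed

text \<open>The affine functions have nonnegative intercepts, so each of them divided by its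
  argument is nonincreasing on the positive axis, and so is their maximum. The product form avoids
  dividing by zero.\<close>

lemma smooth_max1_quotient_mono:
  assumes "\<gamma> > 0" "0 \<le> x" "x \<le> y"
  shows "x * smooth_max1 \<gamma> y \<le> y * smooth_max1 \<gamma> x"
proof -
  obtain p where p: "0 \<le> p" "p \<le> 1" "smooth_max1 \<gamma> y = p * y + (1 - p) * (1 + p / (2 * \<gamma>))"
    using smooth_max1_eq[OF assms(1)] .
  have "x * smooth_max1 \<gamma> y = p * x * y + x * ((1 - p) * (1 + p / (2 * \<gamma>)))"
    by (simp add: p(3) algebra_simps)
  also have "\<dots> \<le> p * x * y + y * ((1 - p) * (1 + p / (2 * \<gamma>)))"
    using assms p by (intro add_left_mono mult_right_mono mult_nonneg_nonneg) auto
  also have "\<dots> = y * (p * x + (1 - p) * (1 + p / (2 * \<gamma>)))"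
    by (simp add: algebra_simps)
  also have "\<dots> \<le> y * smooth_max1 \<gamma> x"
    using assms by (intro mult_left_mono smooth_max1_ge p) auto
  finally show ?thesis .
qed

text \<open>The radial factor of \<open>Lambda_pen\<close>. The properties below rest on three facts
  about it: it is nonincreasing in \<open>r\<close>, while \<open>r\<close> times the factor is
  nondecreasing and bounded by \<open>j\<close>.\<close>

definition pen_factor :: "real \<Rightarrow> real \<Rightarrow> real \<Rightarrow> real" where
  "pen_factor j \<gamma> r = j * \<gamma> / smooth_max1 \<gamma> (\<gamma> * r)"

lemma Lambda_pen_eq: "Lambda_pen j \<gamma> e = pen_factor j \<gamma> (norm e) *\<^sub>R e"
  by (simp add: Lambda_pen_def pen_factor_def)

context
  fixes j \<gamma> :: real
  assumes j: "j > 0" and \<gamma>: "\<gamma> > 0"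
begin

lemma smooth_max1_pos: "smooth_max1 \<gamma> x > 0"
  using smooth_max1_ge_1[OF \<gamma>, of x] by linarith

lemma pen_factor_pos: "pen_factor j \<gamma> r > 0"
  using j \<gamma> smooth_max1_pos by (simp add: pen_factor_def)

lemma pen_factor_le: "pen_factor j \<gamma> r \<le> j * \<gamma>"
  using j \<gamma> smooth_max1_pos[of "\<gamma> * r"]
    mult_left_mono[OF smooth_max1_ge_1[OF \<gamma>, of "\<gamma> * r"], of "j * \<gamma>"]
  by (simp add: pen_factor_def pos_divide_le_eq)

lemma pen_factor_mult_le: "pen_factor j \<gamma> r * r \<le> j"
proof -
  have "pen_factor j \<gamma> r * r = j * (\<gamma> * r / smooth_max1 \<gamma> (\<gamma> * r))"
    by (simp add: pen_factor_def)
  also have "\<dots> \<le> j * 1"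
    using j smooth_max1_pos[of "\<gamma> * r"] smooth_max1_ge_self[OF \<gamma>, of "\<gamma> * r"]
    by (intro mult_left_mono) (auto simp: divide_le_eq)
  finally show ?thesis by simp
qed

lemma pen_factor_antimono: "r \<le> s \<Longrightarrow> pen_factor j \<gamma> s \<le> pen_factor j \<gamma> r"
  unfolding pen_factor_def using j \<gamma> smooth_max1_pos
  by (intro divide_left_mono smooth_max1_mono mult_pos_pos) auto

lemma pen_factor_mult_mono:
  assumes "0 \<le> r" "r \<le> s"
  shows "pen_factor j \<gamma> r * r \<le> pen_factor j \<gamma> s * s"
proof -
  have "\<gamma> * r * smooth_max1 \<gamma> (\<gamma> * s) \<le> \<gamma> * s * smooth_max1 \<gamma> (\<gamma> * r)"
    using assms \<gamma> by (intro smooth_max1_quotient_mono) auto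
  then have "\<gamma> * r / smooth_max1 \<gamma> (\<gamma> * r) \<le> \<gamma> * s / smooth_max1 \<gamma> (\<gamma> * s)"
    using smooth_max1_pos by (simp add: frac_le_eq divide_le_eq field_simps)
  then have "j * (\<gamma> * r / smooth_max1 \<gamma> (\<gamma> * r)) \<le> j * (\<gamma> * s / smooth_max1 \<gamma> (\<gamma> * s))"
    using j by (intro mult_left_mono) auto
  then show ?thesis by (simp add: pen_factor_def)
qed

lemma Lambda_pen_norm: "norm (Lambda_pen j \<gamma> e) \<le> j"
  using pen_factor_mult_le[of "norm e"] pen_factor_pos[of "norm e"] by (simp add: Lambda_pen_eq)

text \<open>Written with the factor of the longer vector \<open>a\<close>, the difference leaves a
  multiple of \<open>b\<close>, and monotonicity of \<open>r\<close> times the factor bounds it by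
  \<open>pen_factor j \<gamma> (norm a) * (norm a - norm b)\<close>.\<close>

lemma Lambda_pen_diff_aux:
  assumes "norm b \<le> norm a"
  shows "norm (Lambda_pen j \<gamma> a - Lambda_pen j \<gamma> b) \<le> 2 * pen_factor j \<gamma> (norm a) * norm (a - b)"
proof -
  let ?l = "pen_factor j \<gamma>"
  have "Lambda_pen j \<gamma> a - Lambda_pen j \<gamma> b = ?l (norm a) *\<^sub>R (a - b) - (?l (norm b) - ?l (norm a)) *\<^sub>R b"
    by (simp add: Lambda_pen_eq algebra_simps)
  also have "norm \<dots> \<le> ?l (norm a) * norm (a - b) + (?l (norm b) - ?l (norm a)) * norm b"
    using pen_factor_pos[of "norm a"] pen_factor_antimono[OF assms] norm_triangle_ineq4 by (smt (verit) norm_scaleR)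
  also have "(?l (norm b) - ?l (norm a)) * norm b \<le> ?l (norm a) * (norm a - norm b)"
    using pen_factor_mult_mono[OF norm_ge_zero assms] by (simp add: algebra_simps)
  also have "\<dots> \<le> ?l (norm a) * norm (a - b)"
    using pen_factor_pos[of "norm a"] by (intro mult_left_mono norm_triangle_ineq2) auto
  finally show ?thesis by linarith
qed

text \<open>The constant grows with \<gamma>. The bound serves continuity of
  \<open>Lambda_pen\<close> and existence of the state at fixed \<gamma>.\<close>

lemma Lambda_pen_lipschitz: "norm (Lambda_pen j \<gamma> a - Lambda_pen j \<gamma> b) \<le> 2 * (j * \<gamma>) * norm (a - b)"
proof -
  have *: "norm (Lambda_pen j \<gamma> a - Lambda_pen j \<gamma> b) \<le> 2 * (j * \<gamma>) * norm (a - b)" if "norm b \<le> norm a" for a b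
    using Lambda_pen_diff_aux[OF that] mult_right_mono[OF pen_factor_le[of "norm a"] norm_ge_zero[of "a - b"]] by linarith
  show ?thesis
    using *[of b a] *[of a b] by (metis linear norm_minus_commute)
qed

text \<open>The Lipschitz constant of \<open>Lambda_pen\<close> at distance \<open>r\<close> from the origin is of order \<open>j / r\<close>, uniformly
  in \<open>\<gamma>\<close>; this is where the estimates become independent of \<open>\<gamma>\<close>.\<close>

lemma Lambda_pen_diff: "norm (Lambda_pen j \<gamma> a - Lambda_pen j \<gamma> b) * norm b \<le> 2 * j * norm (a - b)"
proof -
  have aux: "norm (Lambda_pen j \<gamma> a - Lambda_pen j \<gamma> b) * norm a \<le> 2 * j * norm (a - b)" if "norm b \<le> norm a" for a b
  proof -
    have "norm (Lambda_pen j \<gamma> a - Lambda_pen j \<gamma> b) * norm a \<le> 2 * pen_factor j \<gamma> (norm a) * norm (a - b) * norm a"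
      by (intro mult_right_mono Lambda_pen_diff_aux that) auto
    also have "\<dots> = 2 * (pen_factor j \<gamma> (norm a) * norm a) * norm (a - b)" by simp
    also have "\<dots> \<le> 2 * j * norm (a - b)"
      by (intro mult_right_mono mult_left_mono pen_factor_mult_le) auto
    finally show ?thesis .
  qed
  show ?thesis
  proof (cases "norm b \<le> norm a")
    case True
    show ?thesis
      using aux[OF True] mult_left_mono[OF True, of "norm (Lambda_pen j \<gamma> a - Lambda_pen j \<gamma> b)"] by simp
  next
    case False
    then show ?thesis using aux[of a b] by (simp add: norm_minus_commute)
  qed
qed

text \<open>The convex radial function that has \<open>Lambda_pen\<close> as its subgradient; it
  turns the state equation into an Euler-Lagrange equation. \<open>integral\<close> is the gauge
  integral, for which monotone integrands are integrable.\<close>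

definition pen_potential :: "vec3 \<Rightarrow> real" where
  "pen_potential e = integral {0..norm e} (\<lambda>r. pen_factor j \<gamma> r * r)"

text \<open>The primitive of a nondecreasing function lies above its tangents, which is
  \<open>conv\<close>; Cauchy-Schwarz and positivity of the factor lead from lengths to
  vectors.\<close>

lemma pen_potential_subgradient:
  "pen_potential a + Lambda_pen j \<gamma> a \<bullet> (b - a) \<le> pen_potential b"
proof -
  let ?h = "\<lambda>r. pen_factor j \<gamma> r * r"
  define \<psi> where "\<psi> r = integral {0..r} ?h" for r
  have "mono_on {0..r} ?h" for r
    by (intro mono_onI pen_factor_mult_mono) auto
  then have int: "?h integrable_on {s..r}" if "0 \<le> s" for s r
    using integrable_on_mono_on[of s r ?h] that by (meson atLeastatMost_subset_iff mono_on_subset order_refl)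
  have conv: "\<psi> r + ?h r * (s - r) \<le> \<psi> s" if "0 \<le> r" "0 \<le> s" for r s
  proof (cases "r \<le> s")
    case True
    have "\<psi> s = \<psi> r + integral {r..s} ?h"
      unfolding \<psi>_def using True that int by (simp add: Henstock_Kurzweil_Integration.integral_combine)
    moreover have "integral {r..s} (\<lambda>x. ?h r) \<le> integral {r..s} ?h"
      using that by (intro integral_le int pen_factor_mult_mono) auto
    ultimately show ?thesis using True by (simp add: algebra_simps)
  next
    case False
    have "\<psi> r = \<psi> s + integral {s..r} ?h"
      unfolding \<psi>_def using False that int by (simp add: Henstock_Kurzweil_Integration.integral_combine)
    moreover have "integral {s..r} ?h \<le> integral {s..r} (\<lambda>x. ?h r)"
      using that by (intro integral_le int pen_factor_mult_mono) auto
    ultimately show ?thesis using False by (simp add: algebra_simps)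
  qed
  have "Lambda_pen j \<gamma> a \<bullet> (b - a) = pen_factor j \<gamma> (norm a) * (a \<bullet> b - norm a * norm a)"
    by (simp add: Lambda_pen_eq inner_diff_right power2_norm_eq_inner[symmetric] power2_eq_square right_diff_distrib)
  also have "\<dots> \<le> pen_factor j \<gamma> (norm a) * (norm a * norm b - norm a * norm a)"
    using pen_factor_pos[of "norm a"] by (intro mult_left_mono diff_right_mono norm_cauchy_schwarz) auto
  also have "\<dots> = ?h (norm a) * (norm b - norm a)" by (simp add: algebra_simps)
  finally show ?thesis
    using conv[of "norm a" "norm b"] by (simp add: pen_potential_def \<psi>_def)
qed

text \<open>Sum of the subgradient inequalities from \<open>a\<close> to \<open>b\<close> and from
  \<open>b\<close> to \<open>a\<close>.\<close>

lemma Lambda_pen_monotone: "0 \<le> (Lambda_pen j \<gamma> a - Lambda_pen j \<gamma> b) \<bullet> (a - b)"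
  using pen_potential_subgradient[of a b] pen_potential_subgradient[of b a]
  by (simp add: inner_diff_left inner_diff_right)

lemma continuous_on_Lambda_pen: "continuous_on UNIV (Lambda_pen j \<gamma>)"
  by (rule lipschitz_on_continuous_on[of "2 * (j * \<gamma>)"])
     (use j \<gamma> Lambda_pen_lipschitz in \<open>auto intro!: lipschitz_onI simp: dist_norm\<close>)

lemma pen_potential_lipschitz: "\<bar>pen_potential a - pen_potential b\<bar> \<le> j * norm (a - b)"
proof -
  have "pen_potential a - pen_potential b \<le> j * norm (a - b)" for a b
  proof -
    have "pen_potential a - pen_potential b \<le> Lambda_pen j \<gamma> a \<bullet> (a - b)"
      using pen_potential_subgradient[of a b] by (simp add: inner_diff_right)
    also have "\<dots> \<le> norm (Lambda_pen j \<gamma> a) * norm (a - b)" by (rule norm_cauchy_schwarz)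
    also have "\<dots> \<le> j * norm (a - b)" by (intro mult_right_mono Lambda_pen_norm) auto
    finally show ?thesis .
  qed
  from this[of a b] this[of b a] show ?thesis by (simp add: abs_le_iff norm_minus_commute)
qed

lemma continuous_on_pen_potential: "continuous_on UNIV pen_potential"
  by (rule lipschitz_on_continuous_on[of j])
     (use j pen_potential_lipschitz in \<open>auto intro!: lipschitz_onI simp: dist_norm\<close>)

end

section \<open>The penalized Maxwell problem\<close>

lemma norm_matrix_vector_mult_le:
  fixes A :: "real^'n^'m"
  shows "norm (A *v x) \<le> norm A * norm x"
proof -
  have "norm (A *v x) = L2_set (\<lambda>i. \<bar>A $ i \<bullet> x\<bar>) UNIV"
    by (simp add: norm_vec_def matrix_vector_mult_def inner_vec_def)
  also have "\<dots> \<le> L2_set (\<lambda>i. norm (A $ i) * norm x) UNIV"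
    by (intro L2_set_mono) (auto simp: Cauchy_Schwarz_ineq2)
  also have "\<dots> = norm A * norm x"
    by (simp add: norm_vec_def L2_set_left_distrib)
  finally show ?thesis .
qed

lemma borel_measurable_matrix_vector_mult:
  fixes A :: "'a \<Rightarrow> real^'n^'m"
  assumes "A \<in> borel_measurable M" "v \<in> borel_measurable M"
  shows "(\<lambda>x. A x *v v x) \<in> borel_measurable M"
proof (rule borel_measurable_continuous_Pair[OF assms, of "\<lambda>A v. A *v v"])
  show "continuous_on UNIV (\<lambda>x. fst x *v snd x :: real^'m)"
    by (simp add: matrix_vector_mult_def) (intro continuous_on_vec_lambda continuous_intros)
qed

lemma borel_measurable_fst_snd:
  fixes p :: "'a \<Rightarrow> 'b::euclidean_space \<times> 'c::euclidean_space"
  assumes "p \<in> borel_measurable M"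
  shows "(\<lambda>x. fst (p x)) \<in> borel_measurable M" "(\<lambda>x. snd (p x)) \<in> borel_measurable M"
  by (auto intro!: borel_measurable_continuous_on[OF _ assms] continuous_intros)

lemma lebesgue_on_integral_subset:
  fixes h :: "'a::euclidean_space \<Rightarrow> real"
  assumes "\<omega> \<in> sets lebesgue" "\<Omega> \<in> sets lebesgue" "\<omega> \<subseteq> \<Omega>"
  shows "(LINT x|lebesgue_on \<omega>. h x) = (LINT x|lebesgue_on \<Omega>. indicator \<omega> x * h x)"
proof -
  have "(LINT x|lebesgue_on \<omega>. h x) = (LINT x|lebesgue. indicator \<omega> x *\<^sub>R h x)"
    using assms by (subst integral_restrict_space) auto
  also have "(\<lambda>x. indicator \<omega> x *\<^sub>R h x) = (\<lambda>x. indicator \<Omega> x *\<^sub>R (indicator \<omega> x * h x))"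
    using assms(3) by (auto simp: indicator_def fun_eq_iff)
  also have "(LINT x|lebesgue. indicator \<Omega> x *\<^sub>R (indicator \<omega> x * h x)) = (LINT x|lebesgue_on \<Omega>. indicator \<omega> x * h x)"
    using assms by (subst integral_restrict_space) auto
  finally show ?thesis .
qed

lemma norm_fst_snd_le: "norm (fst z) \<le> norm z" "norm (snd z) \<le> norm z"
  by (cases z; simp add: norm_fst_le norm_snd_le)+

text \<open>One constant \<open>K\<close> serves as bound and as Lipschitz constant of all data, and
  \<open>c\<close> as lower bound of both tensors. The Lipschitz bounds refer to segments inside
  \<open>B\<close>, where the mean value inequality provides them although \<open>B\<close> may fail
  to be convex. On \<open>B\<close> the bounds hold at every point, since values at \<open>x\<close>
  and at a displaced point are compared.\<close>

locale maxwell =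
  fixes \<Omega> B :: "vec3 set" and E\<^sub>d f :: "vec3 \<Rightarrow> vec3" and \<kappa> :: "vec3 \<Rightarrow> real"
    and \<epsilon> \<nu> :: "vec3 \<Rightarrow> real^3^3" and j c K :: real
  assumes open_\<Omega>: "open \<Omega>" and bounded_\<Omega>: "bounded \<Omega>" and open_B: "open B" and B_sub: "B \<subseteq> \<Omega>"
    and j: "j > 0" and c: "c > 0" and K: "K \<ge> 1"
    and \<epsilon>_meas: "\<epsilon> \<in> borel_measurable (lebesgue_on \<Omega>)" and \<nu>_meas: "\<nu> \<in> borel_measurable (lebesgue_on \<Omega>)"
    and sym: "AE x in lebesgue_on \<Omega>. transpose (\<epsilon> x) = \<epsilon> x \<and> transpose (\<nu> x) = \<nu> x"
    and coercive: "AE x in lebesgue_on \<Omega>. \<forall>\<xi>. c * (norm \<xi>)\<^sup>2 \<le> \<xi> \<bullet> (\<epsilon> x *v \<xi>) \<and> c * (norm \<xi>)\<^sup>2 \<le> \<xi> \<bullet> (\<nu> x *v \<xi>)"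
    and upper: "AE x in lebesgue_on \<Omega>. norm (\<epsilon> x) \<le> K \<and> norm (\<nu> x) \<le> K"
    and f_L2: "f \<in> L2 (lebesgue_on \<Omega>)"
    and bound_B: "\<And>x. x \<in> B \<Longrightarrow> norm (\<epsilon> x) \<le> K \<and> norm (\<nu> x) \<le> K \<and> norm (f x) \<le> K \<and> norm (\<kappa> x) \<le> K \<and> norm (E\<^sub>d x) \<le> K"
    and lip_B: "\<And>x y. closed_segment x y \<subseteq> B \<Longrightarrow>
        norm (\<epsilon> y - \<epsilon> x) \<le> K * norm (y - x) \<and> norm (\<nu> y - \<nu> x) \<le> K * norm (y - x) \<and> norm (f y - f x) \<le> K * norm (y - x)
        \<and> norm (\<kappa> y - \<kappa> x) \<le> K * norm (y - x) \<and> norm (E\<^sub>d y - E\<^sub>d x) \<le> K * norm (y - x)"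
    and cont_B: "continuous_on B \<kappa>" "continuous_on B E\<^sub>d"
begin

abbreviation "M \<equiv> lebesgue_on \<Omega>"
abbreviation "G \<equiv> curl_graph \<Omega>"
abbreviation "nrm p \<equiv> L2norm M p"

text \<open>The tensors act block diagonally on pairs of a field and its curl, so that
  \<open>a_form\<close> becomes the single pairing \<open>A\<close>.\<close>

definition N :: "vec3 \<Rightarrow> vec3 \<times> vec3 \<Rightarrow> vec3 \<times> vec3" where
  "N x y = (\<epsilon> x *v fst y, \<nu> x *v snd y)"

definition A :: "(vec3 \<Rightarrow> vec3 \<times> vec3) \<Rightarrow> (vec3 \<Rightarrow> vec3 \<times> vec3) \<Rightarrow> real" where
  "A p q = (LINT x|M. N x (p x) \<bullet> q x)"

definition S :: "real \<Rightarrow> vec3 set \<Rightarrow> (vec3 \<Rightarrow> vec3 \<times> vec3) \<Rightarrow> (vec3 \<Rightarrow> vec3 \<times> vec3) \<Rightarrow> real" where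
  "S \<gamma> \<omega> p q = (LINT x|M. indicator \<omega> x * (Lambda_pen j \<gamma> (fst (p x)) \<bullet> fst (q x)))"

definition R :: "(vec3 \<Rightarrow> vec3 \<times> vec3) \<Rightarrow> real" where
  "R q = (LINT x|M. f x \<bullet> fst (q x))"

definition st :: "real \<Rightarrow> vec3 set \<Rightarrow> vec3 \<Rightarrow> vec3 \<times> vec3" where
  "st \<gamma> \<omega> x = (state \<Omega> j \<epsilon> \<nu> f \<gamma> \<omega> x, weak_curl \<Omega> (state \<Omega> j \<epsilon> \<nu> f \<gamma> \<omega>) x)"

lemma fin: "finite_measure M"
  by (rule finite_measure_lebesgue_on[OF open_\<Omega> bounded_\<Omega>])

lemma \<Omega>_sets: "\<Omega> \<in> sets lebesgue"
  using open_\<Omega> by (simp add: borel_open)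

lemma open_sets_M: "open \<omega> \<Longrightarrow> \<omega> \<subseteq> \<Omega> \<Longrightarrow> \<omega> \<in> sets M"
  using \<Omega>_sets by (simp add: sets_restrict_space_iff borel_open)

lemma open_sets_lebesgue: "open \<omega> \<Longrightarrow> \<omega> \<in> sets lebesgue"
  by (simp add: borel_open)

lemma G_L2: "p \<in> G \<Longrightarrow> p \<in> L2 M"
  by (rule curl_graph_L2)

lemma G_combine: "p \<in> G \<Longrightarrow> q \<in> G \<Longrightarrow> (\<lambda>x. a *\<^sub>R p x + b *\<^sub>R q x) \<in> G"
  by (rule curl_graph_combine[OF open_\<Omega> bounded_\<Omega>])

lemma G_diff: "p \<in> G \<Longrightarrow> q \<in> G \<Longrightarrow> (\<lambda>x. p x - q x) \<in> G"
  using G_combine[of p q 1 "-1"] by simp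

lemma G_zero: "(\<lambda>x. 0) \<in> G"
proof (rule curl_graph_closed[OF open_\<Omega> bounded_\<Omega> L2_const[OF fin]])
  have 0: "(\<lambda>x. 0) \<in> test_fields \<Omega>"
    by (rule test_fieldsI[of _ "{}"]) auto
  have "classical_curl (\<lambda>x. 0) = (\<lambda>x. 0)"
    by (rule ext, rule classical_curl_off_fsupport) (simp add: fsupport_def)
  then have "(\<lambda>x. 0) \<in> G"
    unfolding curl_graph_def using 0 L2_const[OF fin] by (auto intro!: bexI[OF _ 0] simp: L2norm_def zero_prod_def)
  then show "\<exists>q\<in>G. nrm (\<lambda>x. 0 - q x) < e" if "e > 0" for e
    using that by (intro bexI[of _ "\<lambda>x. 0"]) (simp_all add: L2norm_def)
qed

lemma N_linear: "linear (N x)"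
  by (rule linearI) (simp_all add: N_def matrix_vector_right_distrib matrix_vector_mult_scaleR)

lemma N_meas: "p \<in> borel_measurable M \<Longrightarrow> (\<lambda>x. N x (p x)) \<in> borel_measurable M"
  unfolding N_def
  by (intro borel_measurable_Pair borel_measurable_matrix_vector_mult \<epsilon>_meas \<nu>_meas borel_measurable_fst_snd)

lemma norm_Pair_le:
  fixes a a' :: "'x::real_normed_vector" and b b' :: "'y::real_normed_vector"
  assumes "norm a \<le> k * norm a'" "norm b \<le> k * norm b'" "k \<ge> 0"
  shows "norm (a, b) \<le> k * norm (a', b')"
proof -
  have "(norm (a, b))\<^sup>2 = (norm a)\<^sup>2 + (norm b)\<^sup>2" by (simp add: norm_Pair)
  also have "\<dots> \<le> (k * norm a')\<^sup>2 + (k * norm b')\<^sup>2"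
    using assms by (intro add_mono power_mono) auto
  also have "\<dots> = (k * norm (a', b'))\<^sup>2" by (simp add: norm_Pair power_mult_distrib algebra_simps)
  finally show ?thesis by (rule power2_le_imp_le) (use assms in auto)
qed

lemma N_norm_le:
  assumes "norm (\<epsilon> x) \<le> k" "norm (\<nu> x) \<le> k"
  shows "norm (N x y) \<le> k * norm y"
proof -
  have "k \<ge> 0" using assms(1) norm_ge_zero order_trans by blast
  then have "norm (\<epsilon> x *v fst y) \<le> k * norm (fst y)" "norm (\<nu> x *v snd y) \<le> k * norm (snd y)"
    using norm_matrix_vector_mult_le[of "\<epsilon> x" "fst y"] norm_matrix_vector_mult_le[of "\<nu> x" "snd y"]
      mult_right_mono[OF assms(1), of "norm (fst y)"] mult_right_mono[OF assms(2), of "norm (snd y)"]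
    by auto
  from norm_Pair_le[OF this \<open>k \<ge> 0\<close>] show ?thesis by (simp add: N_def)
qed

lemma N_AE: "AE x in M. (\<forall>y z. N x y \<bullet> z = y \<bullet> N x z) \<and> (\<forall>y. c * (norm y)\<^sup>2 \<le> N x y \<bullet> y \<and> norm (N x y) \<le> K * norm y)"
  using sym coercive upper
proof eventually_elim
  case (elim x)
  have "N x y \<bullet> z = y \<bullet> N x z" for y z
    using elim(1) by (metis (no_types, lifting) N_def dot_lmul_matrix inner_prod_def fst_conv snd_conv vector_transpose_matrix inner_commute)
  moreover have "c * (norm y)\<^sup>2 \<le> N x y \<bullet> y" for y
  proof -
    have "(norm y)\<^sup>2 = (norm (fst y))\<^sup>2 + (norm (snd y))\<^sup>2"
      by (cases y) (simp add: norm_Pair)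
    moreover have "c * (norm (fst y))\<^sup>2 \<le> (\<epsilon> x *v fst y) \<bullet> fst y" "c * (norm (snd y))\<^sup>2 \<le> (\<nu> x *v snd y) \<bullet> snd y"
      using elim(2) by (simp_all add: inner_commute)
    ultimately show ?thesis by (simp add: N_def inner_prod_def algebra_simps)
  qed
  moreover have "norm (N x y) \<le> K * norm y" for y
    using N_norm_le elim(3) by blast
  ultimately show ?case by blast
qed

lemma N_L2: "p \<in> L2 M \<Longrightarrow> (\<lambda>x. N x (p x)) \<in> L2 M"
proof (rule L2_dominated(1)[of p M _ K])
  show "AE x in M. norm (N x (p x)) \<le> K * norm (p x)"
    using N_AE by eventually_elim blast
qed (use K in \<open>auto intro: N_meas L2_measurable\<close>)

lemma A_integrable: "p \<in> L2 M \<Longrightarrow> q \<in> L2 M \<Longrightarrow> integrable M (\<lambda>x. N x (p x) \<bullet> q x)"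
  by (intro L2_inner N_L2)

lemma A_coercive:
  assumes "p \<in> L2 M"
  shows "c * (nrm p)\<^sup>2 \<le> A p p"
proof -
  have "(LINT x|M. c * (norm (p x))\<^sup>2) \<le> (LINT x|M. N x (p x) \<bullet> p x)"
  proof (rule integral_mono_AE)
    show "AE x in M. c * (norm (p x))\<^sup>2 \<le> N x (p x) \<bullet> p x"
      using N_AE by eventually_elim blast
  qed (use L2_integrable[OF assms] A_integrable[OF assms assms] in auto)
  then show ?thesis by (simp add: A_def L2norm_sq)
qed

lemma A_diff_left:
  assumes "p \<in> L2 M" "p' \<in> L2 M" "q \<in> L2 M"
  shows "A (\<lambda>x. p x - p' x) q = A p q - A p' q"
  using A_integrable[OF assms(1,3)] A_integrable[OF assms(2,3)]
  by (simp add: A_def linear_diff[OF N_linear] inner_diff_left)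

lemma Lambda_meas:
  assumes "\<gamma> > 0" "p \<in> L2 M"
  shows "(\<lambda>x. Lambda_pen j \<gamma> (fst (p x))) \<in> borel_measurable M"
  by (rule borel_measurable_continuous_on[OF continuous_on_Lambda_pen[OF j assms(1)] L2_measurable[OF L2_fst_snd(1)[OF assms(2)]]])

lemma Lambda_L2:
  assumes "\<gamma> > 0" "p \<in> L2 M"
  shows "(\<lambda>x. Lambda_pen j \<gamma> (fst (p x))) \<in> L2 M"
  by (rule L2_bounded[OF fin Lambda_meas[OF assms], of j]) (simp add: Lambda_pen_norm[OF j assms(1)])

lemma S_integrable:
  assumes "\<gamma> > 0" "p \<in> L2 M" "q \<in> L2 M" "\<omega> \<in> sets M"
  shows "integrable M (\<lambda>x. indicator \<omega> x * (Lambda_pen j \<gamma> (fst (p x)) \<bullet> fst (q x)))"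
  using integrable_mult_indicator[OF assms(4) L2_inner(1)[OF Lambda_L2[OF assms(1,2)] L2_fst_snd(1)[OF assms(3)]]] by simp

lemma R_integrable: "q \<in> L2 M \<Longrightarrow> integrable M (\<lambda>x. f x \<bullet> fst (q x))"
  by (intro L2_inner(1) f_L2 L2_fst_snd)

text \<open>The curl components of the pairs agree with \<open>weak_curl\<close> only almost
  everywhere, as is the case for general elements of \<open>curl_graph\<close>.\<close>

lemma a_form_eq:
  assumes "v \<in> Hcurl \<Omega>" "w \<in> Hcurl \<Omega>" "p \<in> L2 M" "q \<in> L2 M"
    and "\<And>x. fst (p x) = v x" "\<And>x. fst (q x) = w x"
    and "AE x in M. snd (p x) = weak_curl \<Omega> v x" "AE x in M. snd (q x) = weak_curl \<Omega> w x"
  shows "a_form \<Omega> \<epsilon> \<nu> v w = A p q"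
proof -
  let ?v = "\<lambda>x. (v x, weak_curl \<Omega> v x)" and ?w = "\<lambda>x. (w x, weak_curl \<Omega> w x)"
  have vw: "?v \<in> L2 M" "?w \<in> L2 M" by (intro L2_Pair Hcurl_L2 assms)+
  have z: "(\<lambda>x. 0) \<in> L2 M" by (rule L2_const[OF fin])
  have i1: "integrable M (\<lambda>x. (\<nu> x *v weak_curl \<Omega> v x) \<bullet> weak_curl \<Omega> w x)"
    using L2_inner(1)[OF L2_fst_snd(2)[OF N_L2[OF vw(1)]] L2_fst_snd(2)[OF vw(2)]] by (simp add: N_def)
  have i2: "integrable M (\<lambda>x. (\<epsilon> x *v v x) \<bullet> w x)"
    using L2_inner(1)[OF L2_fst_snd(1)[OF N_L2[OF vw(1)]] L2_fst_snd(1)[OF vw(2)]] by (simp add: N_def)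
  have "a_form \<Omega> \<epsilon> \<nu> v w = A ?v ?w"
    using i1 i2 by (simp add: a_form_def A_def N_def inner_prod_def add.commute)
  also have "\<dots> = A p q"
    unfolding A_def
  proof (rule integral_cong_AE)
    show "AE x in M. N x (?v x) \<bullet> ?w x = N x (p x) \<bullet> q x"
      using assms(7,8) by eventually_elim (simp add: inner_prod_def N_def assms(5,6))
  qed (use A_integrable[OF vw] A_integrable[OF assms(3,4)] in auto)
  finally show ?thesis .
qed

text \<open>The equation is an instance of the abstract variational problem on
  \<open>curl_graph \<Omega>\<close>. Penalty and load act on the field and not on its curl, hence
  the zero second components of \<open>\<beta>\<close> and \<open>g\<close>.\<close>

lemma is_state_exists:
  assumes \<gamma>: "\<gamma> > 0" and \<omega>: "open \<omega>" "\<omega> \<subseteq> \<Omega>"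
  shows "\<exists>E. is_state \<Omega> j \<epsilon> \<nu> f \<gamma> \<omega> E"
proof -
  define \<beta> where "\<beta> x y = (indicator \<omega> x *\<^sub>R Lambda_pen j \<gamma> (fst y), 0 :: vec3)" for x and y :: "vec3 \<times> vec3"
  define \<Psi> where "\<Psi> x y = indicator \<omega> x * pen_potential j \<gamma> (fst y)" for x and y :: "vec3 \<times> vec3"
  define g where "g x = (f x, 0 :: vec3)" for x
  have \<omega>M: "\<omega> \<in> sets M" by (rule open_sets_M[OF \<omega>])
  have gL: "g \<in> L2 M" unfolding g_def[abs_def] by (intro L2_Pair f_L2 L2_const[OF fin])
  have GL: "G \<subseteq> L2 M" using G_L2 by blast
  have \<beta>1: "norm (\<beta> x y) \<le> j" for x y
    using Lambda_pen_norm[OF j \<gamma>, of "fst y"] j by (simp add: \<beta>_def norm_Pair indicator_def)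
  have \<beta>2: "norm (\<beta> x y - \<beta> x z) \<le> 2 * (j * \<gamma>) * norm (y - z)" for x y z
  proof -
    have "norm (\<beta> x y - \<beta> x z) \<le> norm (Lambda_pen j \<gamma> (fst y) - Lambda_pen j \<gamma> (fst z))"
      by (simp add: \<beta>_def norm_Pair indicator_def)
    also have "\<dots> \<le> 2 * (j * \<gamma>) * norm (fst y - fst z)" by (rule Lambda_pen_lipschitz[OF j \<gamma>])
    also have "\<dots> \<le> 2 * (j * \<gamma>) * norm (y - z)"
      using j \<gamma> norm_fst_snd_le(1)[of "y - z"] by (intro mult_left_mono) auto
    finally show ?thesis .
  qed
  have \<Psi>1: "\<Psi> x y + \<beta> x y \<bullet> (z - y) \<le> \<Psi> x z" for x y z
    using pen_potential_subgradient[OF j \<gamma>, of "fst y" "fst z"]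
    by (simp add: \<Psi>_def \<beta>_def inner_prod_def indicator_def)
  have \<Psi>2: "\<Psi> x 0 = 0" for x
    by (simp add: \<Psi>_def pen_potential_def[OF j \<gamma>])
  have \<beta>3: "(\<lambda>x. \<beta> x (p x)) \<in> borel_measurable M" if "p \<in> L2 M" for p
    unfolding \<beta>_def
    by (intro borel_measurable_Pair borel_measurable_scaleR borel_measurable_indicator \<omega>M Lambda_meas \<gamma> that borel_measurable_const)
  have \<Psi>3: "(\<lambda>x. \<Psi> x (p x)) \<in> borel_measurable M" if "p \<in> L2 M" for p
    unfolding \<Psi>_def
    by (intro borel_measurable_times borel_measurable_indicator \<omega>M
        borel_measurable_continuous_on[OF continuous_on_pen_potential[OF j \<gamma>]] L2_measurable[OF L2_fst_snd(1)] that)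
  obtain p where p: "p \<in> G"
    "\<And>q. q \<in> G \<Longrightarrow> (LINT x|M. N x (p x) \<bullet> q x) + (LINT x|M. \<beta> x (p x) \<bullet> q x) = (LINT x|M. g x \<bullet> q x)"
    by (rule variational_problem_exists[where M = M and G = G and N = N and \<beta> = \<beta> and \<Psi> = \<Psi> and g = g and c = c and K = K and j = j
            and L = "2 * (j * \<gamma>)", OF fin GL G_zero G_combine curl_graph_closed[OF open_\<Omega> bounded_\<Omega>] c _ _ N_linear N_AE
            N_meas[OF L2_measurable] \<beta>1 \<beta>2 \<beta>3 \<Psi>1 \<Psi>2 \<Psi>3 gL])
       (use K j \<gamma> in auto)
  let ?E = "\<lambda>x. fst (p x)"
  note H = curl_graph_H0curl[OF open_\<Omega> bounded_\<Omega> p(1)]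
  have "a_form \<Omega> \<epsilon> \<nu> ?E v + (LINT x|lebesgue_on \<omega>. Lambda_pen j \<gamma> (?E x) \<bullet> v x) = (LINT x|M. f x \<bullet> v x)"
    if v: "v \<in> H0curl \<Omega>" for v
  proof -
    let ?q = "\<lambda>x. (v x, weak_curl \<Omega> v x)"
    have q: "?q \<in> G" by (rule H0curl_curl_graph[OF open_\<Omega> bounded_\<Omega> v])
    have "a_form \<Omega> \<epsilon> \<nu> ?E v = A p ?q"
      using H v by (intro a_form_eq G_L2 p(1) q) (auto simp: H0curl_def elim: eventually_mono)
    moreover have "(LINT x|lebesgue_on \<omega>. Lambda_pen j \<gamma> (?E x) \<bullet> v x) = (LINT x|M. \<beta> x (p x) \<bullet> ?q x)"
      using lebesgue_on_integral_subset[OF open_sets_lebesgue[OF \<omega>(1)] \<Omega>_sets \<omega>(2)]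
      by (simp add: \<beta>_def inner_prod_def)
    moreover have "(LINT x|M. f x \<bullet> v x) = (LINT x|M. g x \<bullet> ?q x)"
      by (simp add: g_def inner_prod_def)
    ultimately show ?thesis using p(2)[OF q] by (simp add: A_def)
  qed
  then have "is_state \<Omega> j \<epsilon> \<nu> f \<gamma> \<omega> ?E"
    using H(1) by (simp add: is_state_def)
  then show ?thesis by blast
qed

lemma st_works:
  assumes \<gamma>: "\<gamma> > 0" and \<omega>: "open \<omega>" "\<omega> \<subseteq> \<Omega>"
  shows "st \<gamma> \<omega> \<in> G" "\<And>q. q \<in> G \<Longrightarrow> A (st \<gamma> \<omega>) q + S \<gamma> \<omega> (st \<gamma> \<omega>) q = R q"
proof -
  let ?E = "state \<Omega> j \<epsilon> \<nu> f \<gamma> \<omega>"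
  have E: "is_state \<Omega> j \<epsilon> \<nu> f \<gamma> \<omega> ?E"
    unfolding state_def by (rule someI_ex[OF is_state_exists[OF assms]])
  then have EH: "?E \<in> H0curl \<Omega>" by (simp add: is_state_def)
  show G: "st \<gamma> \<omega> \<in> G"
    unfolding st_def[abs_def] by (rule H0curl_curl_graph[OF open_\<Omega> bounded_\<Omega> EH])
  fix q assume q: "q \<in> G"
  note H = curl_graph_H0curl[OF open_\<Omega> bounded_\<Omega> q]
  have "a_form \<Omega> \<epsilon> \<nu> ?E (\<lambda>x. fst (q x)) = A (st \<gamma> \<omega>) q"
    using EH H by (intro a_form_eq G_L2 q G) (auto simp: st_def H0curl_def elim: eventually_mono)
  then show "A (st \<gamma> \<omega>) q + S \<gamma> \<omega> (st \<gamma> \<omega>) q = R q"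
    using bspec[OF conjunct2[OF E[unfolded is_state_def]] H(1)]
      lebesgue_on_integral_subset[OF open_sets_lebesgue[OF \<omega>(1)] \<Omega>_sets \<omega>(2)]
    by (simp add: S_def R_def st_def)
qed

text \<open>Testing with the state itself makes the penalty term nonnegative, so it drops out; the
  bound is uniform in \<gamma> and \<omega>.\<close>

lemma st_bound:
  assumes \<gamma>: "\<gamma> > 0" and \<omega>: "open \<omega>" "\<omega> \<subseteq> \<Omega>"
  shows "nrm (st \<gamma> \<omega>) \<le> nrm f / c"
proof -
  let ?p = "st \<gamma> \<omega>"
  have L: "?p \<in> L2 M" by (rule G_L2[OF st_works(1)[OF assms]])
  have "0 \<le> S \<gamma> \<omega> ?p ?p"
    unfolding S_def using pen_factor_pos[OF j \<gamma>]
    by (intro Bochner_Integration.integral_nonneg) (auto simp: Lambda_pen_eq indicator_def less_imp_le)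
  then have "c * (nrm ?p)\<^sup>2 \<le> R ?p"
    using A_coercive[OF L] st_works(2)[OF assms st_works(1)[OF assms]] by linarith
  also have "\<dots> \<le> nrm f * nrm (\<lambda>x. fst (?p x))"
    unfolding R_def using L2_inner(2)[OF f_L2 L2_fst_snd(1)[OF L]] by linarith
  also have "\<dots> \<le> nrm f * nrm ?p"
    by (intro mult_left_mono L2_fst_snd(3)[OF L]) simp
  finally have "(c * nrm ?p) * nrm ?p \<le> nrm f * nrm ?p" by (simp add: power2_eq_square mult.assoc)
  then have "c * nrm ?p \<le> nrm f"
    using L2norm_nonneg[of M ?p] L2norm_nonneg[of M f] by (cases "nrm ?p = 0") (simp_all add: mult_le_cancel_right del: L2norm_nonneg)
  then show ?thesis using c by (simp add: field_simps)
qed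

text \<open>The difference of the two states is the test field. On the intersection of the sets
  monotonicity of \<open>Lambda_pen\<close> gives a favourable sign, and on the symmetric difference
  the bound \<open>j\<close> for the penalty is used, so \<gamma> does not appear.\<close>

lemma st_continuous:
  assumes \<gamma>: "\<gamma> > 0" and \<omega>: "open \<omega>" "\<omega> \<subseteq> \<Omega>" and \<omega>': "open \<omega>'" "\<omega>' \<subseteq> \<Omega>"
  shows "c * nrm (\<lambda>x. st \<gamma> \<omega> x - st \<gamma> \<omega>' x) \<le> j * sqrt (measure M ((\<omega> - \<omega>') \<union> (\<omega>' - \<omega>)))"
proof -
  let ?p = "st \<gamma> \<omega>" and ?q = "st \<gamma> \<omega>'" and ?w = "\<lambda>x. st \<gamma> \<omega> x - st \<gamma> \<omega>' x"
  let ?D = "(\<omega> - \<omega>') \<union> (\<omega>' - \<omega>)"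
  note pG = st_works(1)[OF \<gamma> \<omega>] and qG = st_works(1)[OF \<gamma> \<omega>']
  note wG = G_diff[OF pG qG]
  note L = G_L2[OF pG] G_L2[OF qG] G_L2[OF wG]
  note \<omega>M = open_sets_M[OF \<omega>] open_sets_M[OF \<omega>']
  have DM: "?D \<in> sets M" using \<omega>M by blast
  have ind: "(indicator ?D :: _ \<Rightarrow> real) \<in> L2 M"
  proof (rule L2_bounded[OF fin borel_measurable_indicator[OF DM]])
    show "AE x in M. norm (indicator ?D x :: real) \<le> 1" by (simp add: indicator_def)
  qed
  have ind_norm: "L2norm M (indicator ?D :: _ \<Rightarrow> real) = sqrt (measure M ?D)"
  proof -
    have "(LINT x|M. (norm (indicator ?D x :: real))\<^sup>2) = (LINT x|M. indicator ?D x)"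
      by (intro Bochner_Integration.integral_cong) (auto simp: indicator_def)
    also have "\<dots> = measure M ?D"
      unfolding Bochner_Integration.integral_indicator
      using sets.sets_into_space[OF DM] by (intro arg_cong[of _ _ "measure M"]) auto
    finally show ?thesis by (simp add: L2norm_def)
  qed
  have "c * (nrm ?w)\<^sup>2 \<le> A ?p ?w - A ?q ?w"
    using A_coercive[OF L(3)] by (simp add: A_diff_left[OF L])
  also have "\<dots> = S \<gamma> \<omega>' ?q ?w - S \<gamma> \<omega> ?p ?w"
    using st_works(2)[OF \<gamma> \<omega> wG] st_works(2)[OF \<gamma> \<omega>' wG] by linarith
  also have "\<dots> = (LINT x|M. indicator \<omega>' x * (Lambda_pen j \<gamma> (fst (?q x)) \<bullet> fst (?w x))
      - indicator \<omega> x * (Lambda_pen j \<gamma> (fst (?p x)) \<bullet> fst (?w x)))"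
    unfolding S_def
    by (intro Bochner_Integration.integral_diff[symmetric] S_integrable \<gamma> L \<omega>M)
  also have "\<dots> \<le> (LINT x|M. j * (norm (indicator ?D x :: real) * norm (?w x)))"
  proof (rule integral_mono_AE)
    show "integrable M (\<lambda>x. indicator \<omega>' x * (Lambda_pen j \<gamma> (fst (?q x)) \<bullet> fst (?w x))
      - indicator \<omega> x * (Lambda_pen j \<gamma> (fst (?p x)) \<bullet> fst (?w x)))"
      by (intro Bochner_Integration.integrable_diff S_integrable \<gamma> L \<omega>M)
    show "integrable M (\<lambda>x. j * (norm (indicator ?D x :: real) * norm (?w x)))"
      by (intro integrable_mult_right L2_norm_mult ind L(3))
    show "AE x in M. indicator \<omega>' x * (Lambda_pen j \<gamma> (fst (?q x)) \<bullet> fst (?w x))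
      - indicator \<omega> x * (Lambda_pen j \<gamma> (fst (?p x)) \<bullet> fst (?w x)) \<le> j * (norm (indicator ?D x :: real) * norm (?w x))"
    proof (rule AE_I2)
      fix x
      have b: "\<bar>Lambda_pen j \<gamma> (fst y) \<bullet> fst (?w x)\<bar> \<le> j * norm (?w x)" for y :: "vec3 \<times> vec3"
      proof -
        have "\<bar>Lambda_pen j \<gamma> (fst y) \<bullet> fst (?w x)\<bar> \<le> norm (Lambda_pen j \<gamma> (fst y)) * norm (fst (?w x))"
          by (rule Cauchy_Schwarz_ineq2)
        also have "\<dots> \<le> j * norm (?w x)"
          using norm_fst_snd_le(1)[of "?w x"] j by (intro mult_mono Lambda_pen_norm[OF j \<gamma>]) auto
        finally show ?thesis .
      qed
      have "Lambda_pen j \<gamma> (fst (?q x)) \<bullet> fst (?w x) \<le> Lambda_pen j \<gamma> (fst (?p x)) \<bullet> fst (?w x)"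
        using Lambda_pen_monotone[OF j \<gamma>, of "fst (?p x)" "fst (?q x)"] by (simp add: inner_diff_left)
      then show "indicator \<omega>' x * (Lambda_pen j \<gamma> (fst (?q x)) \<bullet> fst (?w x))
        - indicator \<omega> x * (Lambda_pen j \<gamma> (fst (?p x)) \<bullet> fst (?w x)) \<le> j * (norm (indicator ?D x :: real) * norm (?w x))"
        using b[of "?p x"] b[of "?q x"] by (cases "x \<in> \<omega>"; cases "x \<in> \<omega>'") (auto simp: abs_le_iff)
    qed
  qed
  also have "\<dots> = j * (LINT x|M. norm (indicator ?D x :: real) * norm (?w x))" by simp
  also have "\<dots> \<le> j * (L2norm M (indicator ?D :: _ \<Rightarrow> real) * nrm ?w)"
    using j by (intro mult_left_mono L2_norm_mult_le ind L(3)) auto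
  finally have "(c * nrm ?w) * nrm ?w \<le> (j * sqrt (measure M ?D)) * nrm ?w"
    by (simp add: power2_eq_square mult.assoc ind_norm)
  then show ?thesis
    using L2norm_nonneg[of M ?w] j by (cases "nrm ?w = 0") (simp_all add: mult_le_cancel_right del: L2norm_nonneg)
qed

end

section \<open>Pullback by diffeomorphisms\<close>

lemma has_vector_derivative_line:
  fixes g :: "vec3 \<Rightarrow> real"
  assumes "Ck (Suc k) g"
  shows "((\<lambda>t. g (x + t *\<^sub>R v)) has_vector_derivative frechet_derivative g (at (x + t0 *\<^sub>R v)) v) (at t0 within U)"
proof -
  have "((\<lambda>t. x + t *\<^sub>R v) has_vector_derivative v) (at t0 within U)"
    by (auto intro!: derivative_eq_intros)
  moreover have "(g has_derivative frechet_derivative g (at (x + t0 *\<^sub>R v))) (at (x + t0 *\<^sub>R v) within ((\<lambda>t. x + t *\<^sub>R v) ` U))"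
    using Ck_Suc_derivative[OF assms] has_derivative_at_withinI by blast
  ultimately show ?thesis
    using vector_derivative_diff_chain_within[of "\<lambda>t. x + t *\<^sub>R v" v t0 U g] by (simp add: o_def)
qed

text \<open>Integrating the mixed derivative along \<open>a\<close> and differentiating under the
  integral in direction \<open>b\<close> yields the identity \<open>key\<close>; its derivative in
  \<open>h\<close> at zero is the claim.\<close>

lemma frechet_derivative_commute:
  fixes g :: "vec3 \<Rightarrow> real"
  assumes g: "Ck (Suc (Suc 0)) g"
  shows "frechet_derivative (\<lambda>x. frechet_derivative g (at x) a) (at x) b
    = frechet_derivative (\<lambda>x. frechet_derivative g (at x) b) (at x) a"
proof -
  define Da where "Da y = frechet_derivative g (at y) a" for y
  define Db where "Db y = frechet_derivative g (at y) b" for y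
  define Dab where "Dab y = frechet_derivative Da (at y) b" for y
  have Da: "Ck (Suc 0) Da" and Db: "Ck (Suc 0) Db"
    using g by (auto simp: Da_def[abs_def] Db_def[abs_def])
  have g1: "Ck (Suc 0) g" using g by (rule Ck_SucD)
  have contDa: "continuous_on UNIV Da" and contDab: "continuous_on UNIV Dab"
    using Ck_continuous[OF Da] Da by (auto simp: Dab_def[abs_def])
  have key: "integral {0..h} (\<lambda>\<tau>. Dab (x + \<tau> *\<^sub>R a)) = Db (x + h *\<^sub>R a) - Db x" if "0 \<le> h" for h
  proof -
    define F where "F k \<tau> = Da ((x + k *\<^sub>R b) + \<tau> *\<^sub>R a)" for k \<tau>
    have ftc: "integral (cbox 0 h) (F k) = g ((x + h *\<^sub>R a) + k *\<^sub>R b) - g (x + k *\<^sub>R b)" for k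
    proof -
      have I: "(F k has_integral g ((x + k *\<^sub>R b) + h *\<^sub>R a) - g ((x + k *\<^sub>R b) + 0 *\<^sub>R a)) {0..h}"
        unfolding F_def Da_def
        by (rule fundamental_theorem_of_calculus[OF that]) (rule has_vector_derivative_line[OF g1])
      have eq: "(x + k *\<^sub>R b) + h *\<^sub>R a = (x + h *\<^sub>R a) + k *\<^sub>R b" by simp
      show ?thesis using integral_unique[OF I[unfolded eq]] by simp
    qed
    have 1: "((\<lambda>k. integral (cbox 0 h) (F k)) has_vector_derivative
        integral (cbox 0 h) (\<lambda>\<tau>. Dab ((x + \<tau> *\<^sub>R a) + 0 *\<^sub>R b))) (at 0)"
    proof (rule leibniz_rule_vector_derivative[of UNIV 0 h F "\<lambda>k \<tau>. Dab ((x + \<tau> *\<^sub>R a) + k *\<^sub>R b)" 0])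
      fix k \<tau> :: real
      have eq: "(\<lambda>k. F k \<tau>) = (\<lambda>k. Da ((x + \<tau> *\<^sub>R a) + k *\<^sub>R b))"
        by (simp add: F_def fun_eq_iff algebra_simps)
      show "((\<lambda>k. F k \<tau>) has_vector_derivative Dab ((x + \<tau> *\<^sub>R a) + k *\<^sub>R b)) (at k)"
        unfolding eq Dab_def by (rule has_vector_derivative_line[OF Da])
      show "F k integrable_on cbox 0 h"
        unfolding F_def by (intro integrable_continuous continuous_on_compose2[OF contDa] continuous_intros) auto
    next
      show "continuous_on (UNIV \<times> cbox 0 h) (\<lambda>(k, \<tau>). Dab ((x + \<tau> *\<^sub>R a) + k *\<^sub>R b))"
        unfolding split_beta by (intro continuous_on_compose2[OF contDab] continuous_intros) auto
    qed auto
    have 2: "((\<lambda>k. g ((x + h *\<^sub>R a) + k *\<^sub>R b) - g (x + k *\<^sub>R b)) has_vector_derivative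
        Db ((x + h *\<^sub>R a) + 0 *\<^sub>R b) - Db (x + 0 *\<^sub>R b)) (at 0)"
      unfolding Db_def by (intro has_vector_derivative_diff has_vector_derivative_line[OF g1])
    show ?thesis
      using vector_derivative_unique_at[OF 1[unfolded ftc] 2] by simp
  qed
  \<comment> \<open>\<open>key\<close> is available for \<open>h \<ge> 0\<close>, so one-sided
    derivatives within \<open>{0..1}\<close> are compared.\<close>
  have "continuous_on {0..1} (\<lambda>\<tau>. Dab (x + \<tau> *\<^sub>R a))"
    by (intro continuous_on_compose2[OF contDab] continuous_intros) auto
  from integral_has_vector_derivative[OF this, of 0]
  have 1: "((\<lambda>h. integral {0..h} (\<lambda>\<tau>. Dab (x + \<tau> *\<^sub>R a))) has_vector_derivative Dab x) (at 0 within {0..1})"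
    by simp
  have "((\<lambda>h. Db (x + h *\<^sub>R a) - Db x) has_vector_derivative frechet_derivative Db (at (x + 0 *\<^sub>R a)) a - 0) (at 0 within {0..1})"
    by (intro has_vector_derivative_diff has_vector_derivative_line[OF Db] has_vector_derivative_const)
  then have "((\<lambda>h. Db (x + h *\<^sub>R a) - Db x) has_vector_derivative frechet_derivative Db (at x) a) (at 0 within {0..1})"
    by simp
  then have 2: "((\<lambda>h. integral {0..h} (\<lambda>\<tau>. Dab (x + \<tau> *\<^sub>R a))) has_vector_derivative frechet_derivative Db (at x) a) (at 0 within {0..1})"
    by (rule has_vector_derivative_transform[rotated 2]) (use key in auto)
  have "Dab x = frechet_derivative Db (at x) a"
    using vector_derivative_unique_within_closed_interval[of 0 1 0, OF _ _ 1[unfolded cbox_interval[symmetric]] 2[unfolded cbox_interval[symmetric]]] by simp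
  then show ?thesis by (simp add: Dab_def Da_def[abs_def] Db_def[abs_def])
qed

definition jac :: "(vec3 \<Rightarrow> vec3) \<Rightarrow> vec3 \<Rightarrow> real^3^3" where
  "jac T x = matrix (frechet_derivative T (at x))"

lemma jac_nth: "jac T x $ i $ j = partial_deriv j i T x"
  by (simp add: jac_def matrix_def partial_deriv_def)

lemma jac_mult:
  assumes "Ck (Suc k) T"
  shows "jac T x *v v = frechet_derivative T (at x) v"
  unfolding jac_def using fun_cong[OF matrix_vector_mul(2)[OF Ck_linear_derivative[OF assms]]] .

lemma Ck_jac_nth: "Ck (Suc k) T \<Longrightarrow> Ck k (\<lambda>x. jac T x $ i $ j)"
  by (simp add: jac_nth Ck_partial_deriv[of k T j i, unfolded eta_contract_eq])

text \<open>The pullback of a 1-form, the vector field being read as a 1-form. The curl is then the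
  exterior derivative, which commutes with pullbacks.\<close>

definition pull :: "(vec3 \<Rightarrow> vec3) \<Rightarrow> (vec3 \<Rightarrow> vec3) \<Rightarrow> vec3 \<Rightarrow> vec3" where
  "pull T \<phi> x = transpose (jac T x) *v \<phi> (T x)"

lemma pull_nth: "pull T \<phi> x $ i = (\<Sum>k\<in>UNIV. partial_deriv i k T x * \<phi> (T x) $ k)"
  by (simp add: pull_def matrix_vector_mult_def transpose_def jac_nth)

lemma Ck_pull:
  assumes "Ck (Suc k) T" "Ck k \<phi>"
  shows "Ck k (pull T \<phi>)"
  unfolding Ck_vec_iff pull_nth
proof (intro allI Ck_sum Ck_mult)
  show "Ck k (partial_deriv i l T)" for i l by (rule Ck_partial_deriv[OF assms(1)])
  show "Ck k (\<lambda>x. \<phi> (T x) $ l)" for l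
    by (rule Ck_bounded_linear[OF bounded_linear_vec_nth Ck_compose[OF assms(2) Ck_SucD[OF assms(1)]]])
qed

text \<open>The term \<open>h\<close> collects the second derivatives of \<open>T\<close>. It is
  symmetric because these commute, and therefore invisible to the curl, which
  antisymmetrizes.\<close>

lemma partial_deriv_pull:
  assumes T: "Ck (Suc (Suc 0)) T" and \<phi>: "Ck (Suc 0) \<phi>"
  obtains h where "\<And>i j. h i j = h j i"
    "\<And>i j. partial_deriv j i (pull T \<phi>) x =
      (\<Sum>k\<in>UNIV. jac T x $ k $ i * (\<Sum>l\<in>UNIV. partial_deriv l k \<phi> (T x) * jac T x $ l $ j)) + h i j"
proof
  have T1: "Ck (Suc 0) T" using T by (rule Ck_SucD)
  let ?D2 = "\<lambda>k i j. frechet_derivative (partial_deriv i k T) (at x) (axis j 1)"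
  define h where "h i j = (\<Sum>k\<in>UNIV. ?D2 k i j * \<phi> (T x) $ k)" for i j
  have "?D2 k i j = ?D2 k j i" for k i j
  proof -
    have "Ck (Suc (Suc 0)) (\<lambda>x. T x $ k)" by (rule Ck_bounded_linear[OF bounded_linear_vec_nth T])
    from frechet_derivative_commute[OF this, of "axis i 1" x "axis j 1"] show ?thesis
      by (simp add: partial_deriv_nth[OF T, abs_def])
  qed
  then show "h i j = h j i" for i j by (simp add: h_def)
  fix i j
  have D: "((\<lambda>x. pull T \<phi> x $ i) has_derivative (\<lambda>v. \<Sum>k\<in>UNIV. partial_deriv i k T x * (frechet_derivative \<phi> (at (T x)) (frechet_derivative T (at x) v) $ k)
     + frechet_derivative (partial_deriv i k T) (at x) v * \<phi> (T x) $ k)) (at x)"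
    unfolding pull_nth
  proof (intro has_derivative_sum has_derivative_mult)
    fix k
    show "(partial_deriv i k T has_derivative frechet_derivative (partial_deriv i k T) (at x)) (at x)"
      by (rule Ck_Suc_derivative[OF Ck_partial_deriv[OF T]])
    have "((\<phi> \<circ> T) has_derivative (frechet_derivative \<phi> (at (T x)) \<circ> frechet_derivative T (at x))) (at x)"
      by (rule diff_chain_at[OF Ck_Suc_derivative[OF T1] Ck_Suc_derivative[OF \<phi>]])
    from bounded_linear.has_derivative[OF bounded_linear_vec_nth[of k] this]
    show "((\<lambda>x. \<phi> (T x) $ k) has_derivative (\<lambda>v. frechet_derivative \<phi> (at (T x)) (frechet_derivative T (at x) v) $ k)) (at x)"
      by (simp add: o_def)
  qed
  have "frechet_derivative \<phi> (at (T x)) (frechet_derivative T (at x) (axis j 1)) $ k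
      = (\<Sum>l\<in>UNIV. partial_deriv l k \<phi> (T x) * jac T x $ l $ j)" for k
    by (subst linear_expand[OF Ck_linear_derivative[OF \<phi>]])
       (simp add: partial_deriv_def jac_nth mult.commute)
  moreover have "partial_deriv j i (pull T \<phi>) x = frechet_derivative (\<lambda>x. pull T \<phi> x $ i) (at x) (axis j 1)"
    by (rule partial_deriv_nth[OF Ck_pull[OF T \<phi>]])
  ultimately show "partial_deriv j i (pull T \<phi>) x =
      (\<Sum>k\<in>UNIV. jac T x $ k $ i * (\<Sum>l\<in>UNIV. partial_deriv l k \<phi> (T x) * jac T x $ l $ j)) + h i j"
    by (simp add: frechet_derivative_at[OF D, symmetric] h_def sum.distrib jac_nth)
qed

text \<open>Once the symmetric terms have cancelled, a polynomial identity in the entries of the two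
  Jacobians remains. Multiplying by \<open>jac T x\<close> from the left keeps it free of inverse
  matrices.\<close>

lemma classical_curl_pull:
  assumes T: "Ck (Suc (Suc 0)) T" and \<phi>: "Ck (Suc 0) \<phi>"
  shows "jac T x *v classical_curl (pull T \<phi>) x = det (jac T x) *\<^sub>R classical_curl \<phi> (T x)"
proof -
  obtain h where sym: "\<And>i j. h i j = h j i" and pd:
    "\<And>i j. partial_deriv j i (pull T \<phi>) x =
      (\<Sum>k\<in>UNIV. jac T x $ k $ i * (\<Sum>l\<in>UNIV. partial_deriv l k \<phi> (T x) * jac T x $ l $ j)) + h i j"
    using partial_deriv_pull[where x = x, OF assms] by blast
  define P where "P = jac T x"
  define \<Phi> where "\<Phi> l k = partial_deriv l k \<phi> (T x)" for l k
  have s: "h 2 1 = h 1 2" "h 3 1 = h 1 3" "h 3 2 = h 2 3" using sym by auto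
  show ?thesis
    unfolding classical_curl_def pd P_def[symmetric] \<Phi>_def[symmetric]
    by (simp add: vec_eq_iff forall_3 matrix_vector_mult_def sum_3 det_3 s) (simp add: algebra_simps)
qed

text \<open>\<open>S\<close> stands for the inverse of \<open>T\<close>: the second component is the Piola transform \<open>det (DT) (DT)\<^sup>-\<^sup>1 (curl v \<circ> T)\<close>.\<close>

definition pull_pair :: "(vec3 \<Rightarrow> vec3) \<Rightarrow> (vec3 \<Rightarrow> vec3) \<Rightarrow> (vec3 \<Rightarrow> vec3 \<times> vec3) \<Rightarrow> vec3 \<Rightarrow> vec3 \<times> vec3" where
  "pull_pair T S p x = (transpose (jac T x) *v fst (p (T x)), det (jac T x) *\<^sub>R (jac S (T x) *v snd (p (T x))))"

lemma jac_inverse: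
  assumes "Ck (Suc 0) T" "Ck (Suc 0) S" "\<And>x. S (T x) = x"
  shows "jac S (T x) ** jac T x = mat 1"
proof -
  have "((S \<circ> T) has_derivative (frechet_derivative S (at (T x)) \<circ> frechet_derivative T (at x))) (at x)"
    by (rule diff_chain_at[OF Ck_Suc_derivative[OF assms(1)] Ck_Suc_derivative[OF assms(2)]])
  moreover have "S \<circ> T = (\<lambda>x. x)" using assms(3) by auto
  ultimately have "frechet_derivative S (at (T x)) \<circ> frechet_derivative T (at x) = (\<lambda>v. v)"
    using has_derivative_unique[OF _ has_derivative_ident] by metis
  then have "(jac S (T x) ** jac T x) *v v = v" for v
    by (simp add: matrix_vector_mul_assoc[symmetric] jac_mult[OF assms(1)] jac_mult[OF assms(2)] fun_eq_iff)
  then show ?thesis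
    by (simp add: matrix_eq)
qed

lemma change_of_variables_lebesgue_on:
  fixes h :: "vec3 \<Rightarrow> real"
  assumes \<Omega>: "\<Omega> \<in> sets lebesgue" and T: "Ck (Suc 0) T" and inj: "inj T" and img: "T ` \<Omega> = \<Omega>"
    and h: "integrable (lebesgue_on \<Omega>) h"
  shows "integrable (lebesgue_on \<Omega>) (\<lambda>x. \<bar>det (jac T x)\<bar> * h (T x))"
    "(LINT x|lebesgue_on \<Omega>. \<bar>det (jac T x)\<bar> * h (T x)) = (LINT x|lebesgue_on \<Omega>. h x)"
proof -
  \<comment> \<open>The change of variables theorem concerns functions with values in
    \<open>real^n\<close>, so the scalar \<open>h\<close> is read as a function into
    \<open>real^1\<close>.\<close>
  let ?f = "\<lambda>x. vec (h x) :: real^1" and ?g = "\<lambda>x. \<bar>det (jac T x)\<bar> *\<^sub>R (vec (h (T x)) :: real^1)"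
  have abs: "k absolutely_integrable_on \<Omega> \<longleftrightarrow> integrable (lebesgue_on \<Omega>) k" for k :: "vec3 \<Rightarrow> real^1"
    using \<Omega> by (simp add: set_integrable_def integrable_restrict_space)
  have intf: "integrable (lebesgue_on \<Omega>) ?f"
  proof -
    have "integrable (lebesgue_on \<Omega>) (\<lambda>x. h x *\<^sub>R (vec 1 :: real^1))" using h by simp
    moreover have "(\<lambda>x. h x *\<^sub>R (vec 1 :: real^1)) = ?f" by (simp add: vec_eq_iff fun_eq_iff)
    ultimately show ?thesis by simp
  qed
  have inj': "inj_on T \<Omega>" using inj by (rule inj_on_subset) simp
  have der: "(T has_derivative frechet_derivative T (at x)) (at x within \<Omega>)" for x
    using Ck_Suc_derivative[OF T] by (rule has_derivative_at_withinI)
  note cv = has_absolute_integral_change_of_variables[OF \<Omega> der inj', of ?f "integral \<Omega> ?f"]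
  have g: "?g absolutely_integrable_on \<Omega> \<and> integral \<Omega> ?g = integral \<Omega> ?f"
    using cv intf by (simp add: img abs jac_def)
  then have intg: "integrable (lebesgue_on \<Omega>) ?g" by (simp add: abs)
  have "integrable (lebesgue_on \<Omega>) (\<lambda>x. ?g x $ 1)"
    by (rule integrable_bounded_linear[OF bounded_linear_vec_nth intg])
  then show "integrable (lebesgue_on \<Omega>) (\<lambda>x. \<bar>det (jac T x)\<bar> * h (T x))" by simp
  have "(LINT x|lebesgue_on \<Omega>. ?g x) = (LINT x|lebesgue_on \<Omega>. ?f x)"
    using g \<Omega> intg intf by (simp add: lebesgue_integral_eq_integral)
  then have "(LINT x|lebesgue_on \<Omega>. ?g x) $ 1 = (LINT x|lebesgue_on \<Omega>. ?f x) $ 1" by simp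
  then show "(LINT x|lebesgue_on \<Omega>. \<bar>det (jac T x)\<bar> * h (T x)) = (LINT x|lebesgue_on \<Omega>. h x)"
    using integral_bounded_linear[OF bounded_linear_vec_nth[of 1] intg] integral_bounded_linear[OF bounded_linear_vec_nth[of 1] intf]
    by simp
qed

text \<open>Interface for a smooth orientation preserving map \<open>T\<close> with inverse
  \<open>S\<close>: \<open>C\<close> bounds the two matrices in \<open>pull_pair\<close>, and
  \<open>\<delta>\<close> bounds the determinant from below. It is instantiated with a perturbation
  and its inverse in both orders, which makes the transport bounded in both directions.\<close>

locale diffeo =
  fixes \<Omega> :: "vec3 set" and T S :: "vec3 \<Rightarrow> vec3" and C \<delta> :: real
  assumes open_\<Omega>: "open \<Omega>" and bounded_\<Omega>: "bounded \<Omega>"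
    and T: "\<And>k. Ck k T" and S: "\<And>k. Ck k S"
    and ST: "\<And>x. S (T x) = x" and TS: "\<And>x. T (S x) = x" and img: "T ` \<Omega> = \<Omega>"
    and C: "C \<ge> 0" and jT: "\<And>x v. norm (transpose (jac T x) *v v) \<le> C * norm v"
    and jS: "\<And>x v. norm (det (jac T x) *\<^sub>R (jac S (T x) *v v)) \<le> C * norm v"
    and \<delta>: "\<delta> > 0" and det_T: "\<And>x. \<delta> \<le> det (jac T x)"
begin

abbreviation "M \<equiv> lebesgue_on \<Omega>"

lemma fin: "finite_measure M"
  by (rule finite_measure_lebesgue_on[OF open_\<Omega> bounded_\<Omega>])

lemma T1: "Ck (Suc 0) T" by (rule T)

lemma inj_T: "inj T" using ST by (metis injI)

lemma change_of_variables:
  fixes h :: "vec3 \<Rightarrow> real"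
  assumes "integrable M h"
  shows "integrable M (\<lambda>x. det (jac T x) * h (T x))"
    "(LINT x|M. det (jac T x) * h (T x)) = (LINT x|M. h x)"
proof -
  have "\<bar>det (jac T x)\<bar> = det (jac T x)" for x using det_T[of x] \<delta> by simp
  then show "integrable M (\<lambda>x. det (jac T x) * h (T x))"
    "(LINT x|M. det (jac T x) * h (T x)) = (LINT x|M. h x)"
    using change_of_variables_lebesgue_on[OF _ T1 inj_T img assms] open_\<Omega> by (simp_all add: borel_open)
qed

lemma jac_nth_measurable: "(\<lambda>x. jac T x $ i $ k) \<in> borel_measurable M"
  by (intro borel_measurable_lebesgue_on borel_measurable_continuous_onI Ck_continuous[OF Ck_jac_nth[OF T1]])

lemma det_measurable: "(\<lambda>x. det (jac T x)) \<in> borel_measurable M"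
  unfolding det_3 by (intro borel_measurable_add borel_measurable_diff borel_measurable_times jac_nth_measurable)

text \<open>Since \<open>p\<close> is Lebesgue measurable, preimages of null sets under
  \<open>T\<close> are the issue, and continuity of \<open>T\<close> does not settle it. The change
  of variables formula shows that each component times the determinant is integrable, and the
  positive determinant can be divided out.\<close>

lemma compose_measurable:
  fixes p :: "vec3 \<Rightarrow> 'b::euclidean_space"
  assumes "p \<in> L2 M"
  shows "(\<lambda>x. p (T x)) \<in> borel_measurable M"
proof (subst borel_measurable_euclidean_space, rule ballI)
  fix b :: 'b assume "b \<in> Basis"
  have "integrable M (\<lambda>x. p x \<bullet> b)"
    by (rule L2_inner(1)[OF assms L2_const[OF fin]])
  from change_of_variables(1)[OF this] have "(\<lambda>x. det (jac T x) * (p (T x) \<bullet> b)) \<in> borel_measurable M"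
    by (rule borel_measurable_integrable)
  then have "(\<lambda>x. det (jac T x) * (p (T x) \<bullet> b) / det (jac T x)) \<in> borel_measurable M"
    by (intro borel_measurable_divide det_measurable)
  moreover have "det (jac T x) \<noteq> 0" for x using det_T[of x] \<delta> by linarith
  ultimately show "(\<lambda>x. p (T x) \<bullet> b) \<in> borel_measurable M" by simp
qed

lemma compose_L2:
  fixes p :: "vec3 \<Rightarrow> 'b::euclidean_space"
  assumes "p \<in> L2 M"
  shows "(\<lambda>x. p (T x)) \<in> L2 M" "L2norm M (\<lambda>x. p (T x)) \<le> sqrt (1 / \<delta>) * L2norm M p"
proof -
  note cv = change_of_variables[OF L2_integrable[OF assms]]
  have le: "(norm (p (T x)))\<^sup>2 \<le> 1 / \<delta> * (det (jac T x) * (norm (p (T x)))\<^sup>2)" for x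
    using mult_right_mono[OF det_T[of x], of "(norm (p (T x)))\<^sup>2"] \<delta> by (simp add: field_simps)
  have int: "integrable M (\<lambda>x. (norm (p (T x)))\<^sup>2)"
  proof (rule Bochner_Integration.integrable_bound)
    show "integrable M (\<lambda>x. 1 / \<delta> * (det (jac T x) * (norm (p (T x)))\<^sup>2))" using cv(1) by simp
    show "AE x in M. norm ((norm (p (T x)))\<^sup>2) \<le> norm (1 / \<delta> * (det (jac T x) * (norm (p (T x)))\<^sup>2))"
    proof (rule AE_I2)
      fix x
      have "0 \<le> 1 / \<delta> * (det (jac T x) * (norm (p (T x)))\<^sup>2)"
        using order_trans[OF zero_le_power2 le] .
      then show "norm ((norm (p (T x)))\<^sup>2) \<le> norm (1 / \<delta> * (det (jac T x) * (norm (p (T x)))\<^sup>2))"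
        unfolding real_norm_def abs_of_nonneg[OF zero_le_power2] using le[of x] by (simp only: abs_of_nonneg)
    qed
  qed (use compose_measurable[OF assms] in measurable)
  then show "(\<lambda>x. p (T x)) \<in> L2 M" using compose_measurable[OF assms] by (simp add: L2_def)
  have "(LINT x|M. (norm (p (T x)))\<^sup>2) \<le> (LINT x|M. 1 / \<delta> * (det (jac T x) * (norm (p (T x)))\<^sup>2))"
    using int cv(1) le by (intro integral_mono) auto
  also have "\<dots> = 1 / \<delta> * (L2norm M p)\<^sup>2" using cv(2) by (simp add: L2norm_sq)
  finally have "(L2norm M (\<lambda>x. p (T x)))\<^sup>2 \<le> (sqrt (1 / \<delta>) * L2norm M p)\<^sup>2"
    using \<delta> by (simp add: L2norm_sq power_mult_distrib)
  then show "L2norm M (\<lambda>x. p (T x)) \<le> sqrt (1 / \<delta>) * L2norm M p"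
    by (rule power2_le_imp_le) (use \<delta> in simp)
qed

lemma pull_pair_L2:
  assumes "p \<in> L2 M"
  shows "pull_pair T S p \<in> L2 M" "L2norm M (pull_pair T S p) \<le> C * (sqrt (1 / \<delta>) * L2norm M p)"
proof -
  note pT = compose_L2[OF assms]
  have S1: "Ck (Suc 0) S" by (rule S)
  have "(\<lambda>x. jac S (T x) $ i $ k) \<in> borel_measurable M" for i k
  proof (intro borel_measurable_lebesgue_on borel_measurable_continuous_onI)
    show "continuous_on UNIV (\<lambda>x. jac S (T x) $ i $ k)"
      using Ck_continuous[OF Ck_compose[OF Ck_jac_nth[OF S1] T[of 0]]] .
  qed
  then have m2: "(\<lambda>x. jac S (T x)) \<in> borel_measurable M"
    by (subst borel_measurable_euclidean_space) (auto simp: Basis_vec_def inner_axis)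
  have m1: "(\<lambda>x. transpose (jac T x)) \<in> borel_measurable M"
    using jac_nth_measurable by (subst borel_measurable_euclidean_space) (auto simp: Basis_vec_def inner_axis transpose_def)
  have m: "pull_pair T S p \<in> borel_measurable M"
    unfolding pull_pair_def[abs_def]
    by (intro borel_measurable_Pair borel_measurable_scaleR det_measurable borel_measurable_matrix_vector_mult m1 m2
        borel_measurable_fst_snd L2_measurable[OF pT(1)])
  have le: "norm (pull_pair T S p x) \<le> C * norm (p (T x))" for x
  proof -
    have "(norm (pull_pair T S p x))\<^sup>2 \<le> (C * norm (fst (p (T x))))\<^sup>2 + (C * norm (snd (p (T x))))\<^sup>2"
      unfolding pull_pair_def norm_Pair using jT[of x "fst (p (T x))"] jS[of x "snd (p (T x))"]
      by (simp add: power_mono add_mono)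
    also have "\<dots> = (C * norm (p (T x)))\<^sup>2"
      by (cases "p (T x)") (simp add: norm_Pair power_mult_distrib algebra_simps)
    finally show ?thesis by (rule power2_le_imp_le) (use C in simp)
  qed
  then have ae: "AE x in M. norm (pull_pair T S p x) \<le> C * norm (p (T x))" by simp
  show "pull_pair T S p \<in> L2 M" by (rule L2_dominated(1)[OF pT(1) m C ae])
  show "L2norm M (pull_pair T S p) \<le> C * (sqrt (1 / \<delta>) * L2norm M p)"
    using L2_dominated(2)[OF pT(1) m C ae] mult_left_mono[OF pT(2) C] by linarith
qed

text \<open>The place where \<open>T\<close> has to be C-infinity. The second claim is the Piola
  identity with the Jacobian of \<open>T\<close> moved to the other side by that of
  \<open>S\<close>.\<close>

lemma pull_test_field:
  assumes "\<phi> \<in> test_fields \<Omega>"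
  shows "pull T \<phi> \<in> test_fields \<Omega>"
    "pull_pair T S (\<lambda>x. (\<phi> x, classical_curl \<phi> x)) = (\<lambda>x. (pull T \<phi> x, classical_curl (pull T \<phi>) x))"
proof -
  show "pull T \<phi> \<in> test_fields \<Omega>"
  proof (rule test_fieldsI[of _ "S ` fsupport \<phi>"])
    show "Ck k (pull T \<phi>)" for k by (rule Ck_pull[OF T test_fields_Ck[OF assms]])
    show "compact (S ` fsupport \<phi>)"
      using Ck_continuous[OF S[of 0]] continuous_on_subset
      by (intro compact_continuous_image test_fields_support(1)[OF assms]) blast
    show "S ` fsupport \<phi> \<subseteq> \<Omega>"
    proof
      fix z assume "z \<in> S ` fsupport \<phi>"
      then obtain y where "y \<in> fsupport \<phi>" "z = S y" by blast
      moreover from this obtain x where "x \<in> \<Omega>" "y = T x"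
        using test_fields_support(2)[OF assms] img by blast
      ultimately show "z \<in> \<Omega>" using ST by simp
    qed
    show "pull T \<phi> x = 0" if "x \<notin> S ` fsupport \<phi>" for x
    proof -
      have "T x \<notin> fsupport \<phi>" using that ST by (metis image_eqI)
      then show ?thesis by (simp add: pull_def not_in_fsupport)
    qed
  qed
  have "det (jac T x) *\<^sub>R (jac S (T x) *v classical_curl \<phi> (T x)) = classical_curl (pull T \<phi>) x" for x
  proof -
    have "det (jac T x) *\<^sub>R (jac S (T x) *v classical_curl \<phi> (T x))
        = jac S (T x) *v (jac T x *v classical_curl (pull T \<phi>) x)"
      by (simp add: classical_curl_pull[OF T test_fields_Ck[OF assms]] matrix_vector_mult_scaleR)
    also have "\<dots> = classical_curl (pull T \<phi>) x"
      using jac_inverse[OF T S ST, of x] by (simp add: matrix_vector_mul_assoc)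
    finally show ?thesis .
  qed
  then show "pull_pair T S (\<lambda>x. (\<phi> x, classical_curl \<phi> x)) = (\<lambda>x. (pull T \<phi> x, classical_curl (pull T \<phi>) x))"
    by (simp add: pull_pair_def[abs_def] pull_def)
qed

lemma pull_pair_diff: "pull_pair T S (\<lambda>x. p x - q x) x = pull_pair T S p x - pull_pair T S q x"
  by (simp add: pull_pair_def matrix_vector_mult_diff_distrib scaleR_diff_right)

text \<open>A linear map that is bounded in L2 and sends test pairs to test pairs respects their
  closure.\<close>

lemma pull_pair_curl_graph:
  assumes "p \<in> curl_graph \<Omega>"
  shows "pull_pair T S p \<in> curl_graph \<Omega>"
  unfolding curl_graph_def
proof (intro CollectI conjI allI impI)
  note pL = curl_graph_L2[OF assms]
  show "pull_pair T S p \<in> L2 M" by (rule pull_pair_L2(1)[OF pL])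
  fix e :: real assume "e > 0"
  define k where "k = C * sqrt (1 / \<delta>) + 1"
  have k: "k > 0" using C \<delta> by (simp add: k_def add_nonneg_pos)
  obtain \<phi> where \<phi>: "\<phi> \<in> test_fields \<Omega>" "L2norm M (\<lambda>x. p x - (\<phi> x, classical_curl \<phi> x)) < e / k"
    using assms divide_pos_pos[OF \<open>e > 0\<close> k] unfolding curl_graph_def by blast
  let ?d = "\<lambda>x. p x - (\<phi> x, classical_curl \<phi> x)"
  have dL: "?d \<in> L2 M" by (intro L2_diff(1) pL test_pair_L2 open_\<Omega> bounded_\<Omega> \<phi>)
  have "(\<lambda>x. pull_pair T S p x - (pull T \<phi> x, classical_curl (pull T \<phi>) x)) = pull_pair T S ?d"
    using pull_test_field(2)[OF \<phi>(1)] by (auto simp: pull_pair_diff fun_eq_iff)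
  then have "L2norm M (\<lambda>x. pull_pair T S p x - (pull T \<phi> x, classical_curl (pull T \<phi>) x)) \<le> C * (sqrt (1 / \<delta>) * L2norm M ?d)"
    using pull_pair_L2(2)[OF dL] by simp
  also have "\<dots> \<le> k * L2norm M ?d" by (simp add: k_def algebra_simps)
  also have "\<dots> < k * (e / k)" using \<phi>(2) k by (intro mult_strict_left_mono)
  also have "\<dots> = e" using k by simp
  finally show "\<exists>\<phi>\<in>test_fields \<Omega>. L2norm M (\<lambda>x. pull_pair T S p x - (\<phi> x, classical_curl \<phi> x)) < e"
    using pull_test_field(1)[OF \<phi>(1)] by blast
qed

end

section \<open>Perturbations of the identity\<close>

text \<open>The square of the norm of \<open>?w\<close> is the inner product of
  \<open>H *v ?w\<close> with \<open>v\<close>; Cauchy-Schwarz and division by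
  \<open>norm ?w\<close> finish.\<close>

lemma norm_transpose_mult_le:
  fixes H :: "real^'n^'m"
  assumes "\<And>v. norm (H *v v) \<le> s * norm v"
  shows "norm (transpose H *v v) \<le> s * norm v"
proof -
  let ?w = "transpose H *v v"
  have "(norm ?w)\<^sup>2 = (H *v ?w) \<bullet> v"
    by (metis dot_lmul_matrix inner_commute power2_norm_eq_inner vector_transpose_matrix)
  also have "\<dots> \<le> norm (H *v ?w) * norm v" by (rule norm_cauchy_schwarz)
  also have "\<dots> \<le> (s * norm ?w) * norm v" by (intro mult_right_mono assms) simp
  finally have "norm ?w * norm ?w \<le> (s * norm v) * norm ?w"
    by (simp add: power2_eq_square mult_ac)
  moreover have "0 \<le> s * norm v"
    using order_trans[OF norm_ge_zero assms[of "axis undefined 1"]] by simp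
  ultimately show ?thesis
    by (cases "norm ?w = 0") (auto simp: mult_le_cancel_right)
qed

lemma transpose_diff: "transpose (A - B) = transpose A - transpose (B :: real^'n^'m)"
  by (simp add: transpose_def vec_eq_iff)

text \<open>Expanding the determinant of the identity plus \<open>h\<close> leaves 3 linear, 6
  quadratic and 6 cubic monomials besides 1. Each is at most \<open>s\<close>, because the entries
  are at most \<open>s \<le> 1\<close>.\<close>

lemma det_near_1:
  fixes P :: "real^3^3"
  assumes "\<And>v. norm (P *v v - v) \<le> s * norm v" "s \<le> 1"
  shows "\<bar>det P - 1\<bar> \<le> 15 * s"
proof -
  define h where "h i j = P $ i $ j - (if i = j then 1 else 0)" for i j
  have h: "\<bar>h i j\<bar> \<le> s" for i j
  proof -
    have "h i j = (P *v axis j 1 - axis j 1) $ i"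
      by (simp add: h_def matrix_vector_mul_component inner_axis) (simp add: axis_def)
    also have "\<bar>\<dots>\<bar> \<le> norm (P *v axis j 1 - axis j 1)" by (rule component_le_norm_cart)
    also have "\<dots> \<le> s" using assms(1)[of "axis j 1"] by simp
    finally show ?thesis .
  qed
  have s: "0 \<le> s" using h[of 1 1] abs_ge_zero order_trans by blast
  have two: "\<bar>h i j * h k l\<bar> \<le> s" for i j k l
  proof -
    have "\<bar>h i j * h k l\<bar> \<le> s * 1"
      unfolding abs_mult using h assms(2) s by (intro mult_mono) (auto intro: order_trans)
    then show ?thesis by simp
  qed
  have three: "\<bar>h i j * h k l * h m n\<bar> \<le> s" for i j k l m n
  proof -
    have "\<bar>h i j * h k l * h m n\<bar> \<le> s * 1"
      unfolding abs_mult[of "h i j * h k l"] using two[of i j k l] h[of m n] assms(2) s by (intro mult_mono) auto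
    then show ?thesis by simp
  qed
  have P: "P $ i $ j = h i j + (if i = j then 1 else 0)" for i j by (simp add: h_def)
  have "det P - 1 = h 1 1 + h 2 2 + h 3 3 + h 1 1 * h 2 2 + h 1 1 * h 3 3 + h 2 2 * h 3 3 + h 1 1 * h 2 2 * h 3 3
     + h 1 2 * h 2 3 * h 3 1 + h 1 3 * h 2 1 * h 3 2
     - (h 2 3 * h 3 2 + h 1 1 * h 2 3 * h 3 2) - (h 1 2 * h 2 1 + h 1 2 * h 2 1 * h 3 3) - (h 1 3 * h 3 1 + h 1 3 * h 2 2 * h 3 1)"
    unfolding det_3 P by (simp add: algebra_simps)
  then show ?thesis
    using h[of 1 1] h[of 2 2] h[of 3 3] two[of 1 1 2 2] two[of 1 1 3 3] two[of 2 2 3 3] three[of 1 1 2 2 3 3]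
      three[of 1 2 2 3 3 1] three[of 1 3 2 1 3 2] two[of 2 3 3 2] three[of 1 1 2 3 3 2]
      two[of 1 2 2 1] three[of 1 2 2 1 3 3] two[of 1 3 3 1] three[of 1 3 2 2 3 1]
    by (simp only: abs_le_iff) linarith
qed

lemma has_derivative_lipschitz_bound:
  fixes u :: "vec3 \<Rightarrow> 'b::real_normed_vector"
  assumes "(u has_derivative D) (at x)" "\<And>x y. norm (u x - u y) \<le> s * norm (x - y)"
  shows "norm (D v) \<le> s * norm v"
proof (cases "v = 0")
  case True
  then show ?thesis using linear_0[OF has_derivative_linear[OF assms(1)]] by simp
next
  case False
  have lin: "linear D" by (rule has_derivative_linear[OF assms(1)])
  have "norm (D v) / norm v \<le> s"
  proof (rule field_le_epsilon)
    fix e :: real assume "e > 0"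
    then obtain d where d: "d > 0" "\<And>y. norm (y - x) < d \<Longrightarrow> norm (u y - u x - D (y - x)) \<le> e * norm (y - x)"
      using assms(1) unfolding has_derivative_at_alt by blast
    define t where "t = d / (2 * norm v)"
    have t: "t > 0" "norm (t *\<^sub>R v) < d" using d(1) False by (auto simp: t_def)
    have "norm (D (t *\<^sub>R v)) \<le> norm (u (x + t *\<^sub>R v) - u x) + norm (u (x + t *\<^sub>R v) - u x - D (t *\<^sub>R v))"
      using norm_triangle_ineq4[of "u (x + t *\<^sub>R v) - u x" "u (x + t *\<^sub>R v) - u x - D (t *\<^sub>R v)"] by simp
    also have "\<dots> \<le> s * norm (t *\<^sub>R v) + e * norm (t *\<^sub>R v)"
      using assms(2)[of "x + t *\<^sub>R v" x] d(2)[of "x + t *\<^sub>R v"] t(2) by (intro add_mono) auto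
    finally have "t * norm (D v) \<le> t * ((s + e) * norm v)"
      using t(1) by (simp add: linear_scale[OF lin] algebra_simps)
    then show "norm (D v) / norm v \<le> s + e"
      using t(1) False by (simp add: pos_divide_le_eq)
  qed
  then show ?thesis using False by (simp add: pos_divide_le_eq)
qed

text \<open>Smoothness is kept out, so that the locale covers the flow displacement as well as its
  mollifications. The threshold \<open>1 / 100\<close> is a generous choice that makes all later
  smallness conditions hold, such as \<open>15 s \<le> 1/4\<close> and
  \<open>40 s \<le> 1\<close>.\<close>

locale lipschitz_perturbation =
  fixes u :: "vec3 \<Rightarrow> vec3" and s :: real
  assumes s0: "0 \<le> s" and s1: "s \<le> 1 / 100"
    and lip: "\<And>x y. norm (u x - u y) \<le> s * norm (x - y)"
begin

definition T :: "vec3 \<Rightarrow> vec3" where "T x = x + u x"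

definition Ti :: "vec3 \<Rightarrow> vec3" where "Ti = inv T"

lemma T_expand: "norm (x - y) \<le> 2 * norm (T x - T y)"
proof -
  have "norm (x - y) \<le> norm (T x - T y) + norm (u x - u y)"
    using norm_triangle_ineq4[of "T x - T y" "u x - u y"] by (simp add: T_def)
  moreover have "norm (u x - u y) \<le> 1 / 100 * norm (x - y)"
    using lip[of x y] mult_right_mono[OF s1 norm_ge_zero[of "x - y"]] by linarith
  ultimately show ?thesis using norm_ge_zero[of "T x - T y"] by linarith
qed

lemma inj_T: "inj T"
  using T_expand by (intro injI) (metis cancel_comm_monoid_add_class.diff_cancel eq_iff_diff_eq_0 mult_zero_right norm_le_zero_iff norm_zero)

text \<open>A preimage of \<open>y\<close> is a fixed point of the contraction that sends
  \<open>x\<close> to \<open>y - u x\<close>.\<close>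

lemma surj_T: "surj T"
proof -
  have "\<exists>x. T x = y" for y
  proof -
    have "\<exists>!x. y - u x = x"
    proof (rule banach_fix_type[of "1 / 100"])
      show "\<forall>a b. dist (y - u a) (y - u b) \<le> 1 / 100 * dist a b"
      proof (intro allI)
        fix a b
        have "norm (u b - u a) \<le> 1 / 100 * norm (b - a)"
          using lip[of b a] mult_right_mono[OF s1 norm_ge_zero[of "b - a"]] by linarith
        then show "dist (y - u a) (y - u b) \<le> 1 / 100 * dist a b"
          by (simp add: dist_norm norm_minus_commute)
      qed
    qed auto
    then obtain x where "y - u x = x" by auto
    then show ?thesis by (intro exI[of _ x]) (metis T_def add.commute diff_add_cancel)
  qed
  then show ?thesis by (metis surj_def)
qed

lemma Ti_T [simp]: "Ti (T x) = x"
  unfolding Ti_def by (rule inv_f_f[OF inj_T])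

lemma T_Ti [simp]: "T (Ti x) = x"
  unfolding Ti_def by (rule surj_f_inv_f[OF surj_T])

lemma Ti_lipschitz: "norm (Ti x - Ti y) \<le> 2 * norm (x - y)"
  using T_expand[of "Ti x" "Ti y"] by simp

lemma T_fixed: "x \<notin> fsupport u \<Longrightarrow> T x = x"
  by (simp add: T_def not_in_fsupport)

text \<open>Off the support \<open>T\<close> is the identity; being injective, it cannot move a
  point of the support out of it.\<close>

lemma T_image:
  assumes "fsupport u \<subseteq> W"
  shows "T ` W = W"
proof -
  have mem: "T x \<in> fsupport u \<longleftrightarrow> x \<in> fsupport u" for x
    using T_fixed[of x] T_fixed[of "T x"] Ti_T by metis
  have "T x \<in> W \<longleftrightarrow> x \<in> W" for x
    using mem[of x] T_fixed[of x] assms by (cases "x \<in> fsupport u") auto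
  then show ?thesis using T_Ti by (metis (no_types, lifting) image_iff subsetI subset_antisym image_subset_iff)
qed

lemma open_T_image:
  assumes "open \<omega>"
  shows "open (T ` \<omega>)"
proof -
  have "2-lipschitz_on UNIV Ti"
    by (rule lipschitz_onI) (auto simp: dist_norm Ti_lipschitz)
  then have "open (Ti -` \<omega>)"
    by (intro open_vimage assms lipschitz_on_continuous_on)
  moreover have "Ti -` \<omega> = T ` \<omega>"
    using Ti_T T_Ti by (force simp: image_iff)
  ultimately show ?thesis by simp
qed

end

locale perturbation = lipschitz_perturbation +
  assumes u: "\<And>k. Ck k u"
begin

lemma Ck_T: "Ck k T"
  unfolding T_def[abs_def] by (intro Ck_add Ck_id u)

lemma jac_T_mult: "jac T x *v v = v + frechet_derivative u (at x) v"
proof -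
  have "(T has_derivative (\<lambda>v. v + frechet_derivative u (at x) v)) (at x)"
    unfolding T_def[abs_def] by (intro has_derivative_add has_derivative_ident Ck_Suc_derivative[OF u[of "Suc 0"]])
  from frechet_derivative_at[OF this] show ?thesis
    by (simp add: jac_mult[OF Ck_T[of "Suc 0"]] fun_eq_iff)
qed

lemma jac_T_near: "norm (jac T x *v v - v) \<le> s * norm v"
  using has_derivative_lipschitz_bound[OF Ck_Suc_derivative[OF u[of "Suc 0"]] lip] by (simp add: jac_T_mult)

lemma transpose_jac_T_near: "norm (transpose (jac T x) *v v - v) \<le> s * norm v"
proof -
  have "norm (transpose (jac T x - mat 1) *v v) \<le> s * norm v"
    by (rule norm_transpose_mult_le) (simp add: matrix_vector_mult_diff_rdistrib jac_T_near)
  then show ?thesis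
    by (simp add: transpose_diff matrix_vector_mult_diff_rdistrib transpose_mat)
qed

lemma det_T: "\<bar>det (jac T x) - 1\<bar> \<le> 15 * s"
  by (rule det_near_1[OF jac_T_near]) (use s1 in simp)

lemma det_T_bounds: "3 / 4 \<le> det (jac T x)" "det (jac T x) \<le> 5 / 4"
  using det_T[of x] s1 by (auto simp: abs_le_iff)

text \<open>The derivative of \<open>Ti\<close> at \<open>y\<close> is the inverse Jacobian at
  \<open>Ti y\<close>. Cramer's rule makes the inverse Jacobian a smooth function \<open>V\<close>
  of the base point, so its composition with \<open>Ti\<close> of class \<open>Ck k\<close> yields
  one more derivative of \<open>Ti\<close>.\<close>

lemma Ck_Ti: "Ck k Ti"
proof (induction k)
  case 0
  have "2-lipschitz_on UNIV Ti"
    by (rule lipschitz_onI) (auto simp: dist_norm Ti_lipschitz)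
  then show ?case by (simp add: lipschitz_on_continuous_on)
next
  case (Suc k)
  define V where "V v x = (\<chi> m. det (\<chi> i j. if j = m then v $ i else jac T x $ i $ j) * (1 / det (jac T x)))" for v x
  have d: "det (jac T x) \<noteq> 0" for x using det_T_bounds(1)[of x] by auto
  have V: "jac T x *v V v x = v" for v x
    using cramer[OF d, of x "V v x" v] by (simp add: V_def vec_eq_iff)
  have Ck_det: "Ck k (\<lambda>x. det (A x))" if "\<And>i j. Ck k (\<lambda>x. A x $ i $ j)" for A :: "vec3 \<Rightarrow> real^3^3" and k
    unfolding det_3 by (intro Ck_add Ck_diff Ck_mult that)
  have CkV: "Ck k (V v)" for v
    unfolding Ck_vec_iff V_def vec_lambda_beta
  proof (intro allI Ck_mult Ck_inverse Ck_det d)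
    show "Ck k (\<lambda>x. jac T x $ i $ j)" for i j by (rule Ck_jac_nth[OF Ck_T])
    then show "Ck k (\<lambda>x. (\<chi> i j. if j = m then v $ i else jac T x $ i $ j) $ i $ j)" for m i j
      by (cases "j = m") simp_all
  qed
  have jinj: "jac T x *v w = 0 \<Longrightarrow> w = 0" for x w
    using d[of x] by (metis invertible_det_nz matrix_left_invertible_ker invertible_def)
  show ?case
  proof (rule Ck_SucI)
    fix y
    have "V (a + b) x = V a x + V b x" "V (r *\<^sub>R a) x = r *\<^sub>R V a x" for a b r x
      using jinj[of x "V (a + b) x - (V a x + V b x)"] jinj[of x "V (r *\<^sub>R a) x - r *\<^sub>R V a x"]
      by (simp_all add: matrix_vector_right_distrib matrix_vector_mult_diff_distrib matrix_vector_mult_scaleR V)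
    then have "linear (\<lambda>v. V v x)" for x by (intro linearI) auto
    have comp: "frechet_derivative T (at (Ti y)) \<circ> (\<lambda>v. V v (Ti y)) = id"
      by (simp add: fun_eq_iff jac_mult[OF Ck_T[of "Suc 0"], symmetric] V)
    show "(Ti has_derivative (\<lambda>v. V v (Ti y))) (at y)"
      by (rule has_derivative_inverse_strong_x[of UNIV Ti y T])
         (use Ck_continuous[OF Ck_T[of 0]] Ck_Suc_derivative[OF Ck_T[of "Suc 0"]] comp in auto)
  next
    show "Ck k (\<lambda>y. V v (Ti y))" for v by (rule Ck_compose[OF CkV Suc])
  qed
qed

lemma jac_Ti_T: "jac Ti (T x) ** jac T x = mat 1"
  by (rule jac_inverse[OF Ck_T Ck_Ti]) simp

lemma jac_T_Ti: "jac T x ** jac Ti (T x) = mat 1"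
  using jac_Ti_T matrix_left_right_inverse by blast

lemma det_Ti: "det (jac Ti (T x)) = 1 / det (jac T x)"
proof -
  have "det (jac Ti (T x)) * det (jac T x) = 1"
    using jac_Ti_T[of x] by (metis det_I det_mul)
  then show ?thesis using det_T_bounds(1)[of x] by (simp add: field_simps)
qed

text \<open>For inverse matrices the error is known relative to the unknown vector \<open>w\<close>;
  smallness of \<open>s\<close> absorbs it and expresses it by the given vector
  \<open>z\<close>.\<close>

lemma near_inverse_bound:
  fixes w z :: "'a::real_normed_vector"
  assumes "norm (w - z) \<le> s * norm w"
  shows "norm w \<le> 2 * norm z" "norm (w - z) \<le> 2 * s * norm z"
proof -
  have "norm w \<le> norm (w - z) + norm z" by (metis diff_add_cancel norm_triangle_ineq)
  moreover have "s * norm w \<le> 1 / 100 * norm w" by (rule mult_right_mono[OF s1]) simp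
  ultimately show 1: "norm w \<le> 2 * norm z"
    using assms norm_ge_zero[of z] by linarith
  have "s * norm w \<le> s * (2 * norm z)" by (rule mult_left_mono[OF 1 s0])
  then show "norm (w - z) \<le> 2 * s * norm z" using assms by simp
qed

lemma jac_Ti_bound: "norm (jac Ti (T x) *v v) \<le> 2 * norm v"
proof (rule near_inverse_bound(1))
  have "jac T x *v (jac Ti (T x) *v v) = v"
    by (simp add: matrix_vector_mul_assoc jac_T_Ti)
  then show "norm (jac Ti (T x) *v v - v) \<le> s * norm (jac Ti (T x) *v v)"
    using jac_T_near[of x "jac Ti (T x) *v v"] by (simp add: norm_minus_commute)
qed

lemma jac_inverse_mult:
  "jac T x *v (jac Ti (T x) *v v) = v" "jac Ti (T x) *v (jac T x *v v) = v"
  by (simp_all only: matrix_vector_mul_assoc jac_Ti_T jac_T_Ti matrix_vector_mul_lid)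

lemma transpose_jac_inverse:
  "transpose (jac T x) *v (transpose (jac Ti (T x)) *v v) = v"
  "transpose (jac Ti (T x)) *v (transpose (jac T x) *v v) = v"
  by (simp_all only: matrix_vector_mul_assoc matrix_transpose_mul[symmetric] jac_Ti_T jac_T_Ti transpose_mat matrix_vector_mul_lid)

lemma transpose_jac_Ti:
  "norm (transpose (jac Ti (T x)) *v v) \<le> 2 * norm v"
  "norm (transpose (jac Ti (T x)) *v v - v) \<le> 2 * s * norm v"
proof -
  let ?w = "transpose (jac Ti (T x)) *v v"
  have "norm (?w - v) \<le> s * norm ?w"
    using transpose_jac_T_near[of x ?w] unfolding transpose_jac_inverse by (simp only: norm_minus_commute)
  from near_inverse_bound[OF this] show "norm ?w \<le> 2 * norm v" "norm (?w - v) \<le> 2 * s * norm v" .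
qed

lemma near_bound:
  fixes w v :: "'a::real_normed_vector"
  assumes "norm (w - v) \<le> s * norm v"
  shows "norm w \<le> 2 * norm v"
proof -
  have "norm w \<le> norm (w - v) + norm v" by (metis diff_add_cancel norm_triangle_ineq)
  moreover have "s * norm v \<le> 1 / 100 * norm v" by (rule mult_right_mono[OF s1]) simp
  ultimately show ?thesis using assms norm_ge_zero[of v] by linarith
qed

lemma diffeo_T:
  assumes "open \<Omega>" "bounded \<Omega>" "fsupport u \<subseteq> \<Omega>"
  shows "diffeo \<Omega> T Ti 4 (3 / 4)"
proof
  show "norm (transpose (jac T x) *v v) \<le> 4 * norm v" for x v
    using near_bound[OF transpose_jac_T_near[of x v]] norm_ge_zero[of v] by linarith
  show "norm (det (jac T x) *\<^sub>R (jac Ti (T x) *v v)) \<le> 4 * norm v" for x v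
  proof -
    have "norm (det (jac T x) *\<^sub>R (jac Ti (T x) *v v)) \<le> 5 / 4 * (2 * norm v)"
      unfolding norm_scaleR using det_T_bounds[of x] jac_Ti_bound[of x v] by (intro mult_mono) auto
    then show ?thesis using norm_ge_zero[of v] by linarith
  qed
qed (use assms T_image Ck_T Ck_Ti det_T_bounds in auto)

lemma diffeo_Ti:
  assumes "open \<Omega>" "bounded \<Omega>" "fsupport u \<subseteq> \<Omega>"
  shows "diffeo \<Omega> Ti T 4 (3 / 4)"
proof
  show "norm (transpose (jac Ti y) *v v) \<le> 4 * norm v" for y v
    using transpose_jac_Ti(1)[of "Ti y" v] norm_ge_zero[of v] unfolding T_Ti by linarith
  have d: "det (jac Ti y) = 1 / det (jac T (Ti y))" for y using det_Ti[of "Ti y"] by simp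
  show "norm (det (jac Ti y) *\<^sub>R (jac T (Ti y) *v v)) \<le> 4 * norm v" for y v
  proof -
    have "\<bar>det (jac Ti y)\<bar> \<le> 2" using det_T_bounds[of "Ti y"] by (simp add: d divide_le_eq)
    then have "norm (det (jac Ti y) *\<^sub>R (jac T (Ti y) *v v)) \<le> 2 * (2 * norm v)"
      unfolding norm_scaleR using near_bound[OF jac_T_near[of "Ti y" v]] by (intro mult_mono) auto
    then show ?thesis by simp
  qed
  show "3 / 4 \<le> det (jac Ti y)" for y
    using det_T_bounds[of "Ti y"] by (simp add: d le_divide_eq)
  show "Ti ` \<Omega> = \<Omega>" using T_image[OF assms(3)] Ti_T by (metis image_inv_f_f inj_T Ti_def)
qed (use assms Ck_T Ck_Ti in auto)

text \<open>The matrix of the transport \<open>pull_pair Ti T\<close> at the moved point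
  \<open>T x\<close>. After the change of variables every transported pair occurs as this matrix
  applied to its value at \<open>x\<close>.\<close>

definition Rm :: "vec3 \<Rightarrow> vec3 \<times> vec3 \<Rightarrow> vec3 \<times> vec3" where
  "Rm x y = (transpose (jac Ti (T x)) *v fst y, (1 / det (jac T x)) *\<^sub>R (jac T x *v snd y))"

lemma pull_pair_Ti_T: "pull_pair Ti T q (T x) = Rm x (q x)"
  by (simp add: pull_pair_def Rm_def det_Ti)

lemma pull_pair_inverse: "pull_pair Ti T (pull_pair T Ti p) = p" "pull_pair T Ti (pull_pair Ti T p) = p"
proof -
  have d: "det (jac T x) \<noteq> 0" for x using det_T_bounds(1)[of x] by auto
  have "pull_pair Ti T (pull_pair T Ti p) (T x) = p (T x)" for x
    using d[of x] unfolding pull_pair_Ti_T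
    by (simp add: Rm_def pull_pair_def transpose_jac_inverse matrix_vector_mult_scaleR jac_inverse_mult
        del: transpose_matrix_vector)
  then show "pull_pair Ti T (pull_pair T Ti p) = p" by (metis T_Ti ext)
  show "pull_pair T Ti (pull_pair Ti T p) = p"
  proof
    fix x
    show "pull_pair T Ti (pull_pair Ti T p) x = p x"
      using d[of x] unfolding pull_pair_def[of T Ti] pull_pair_Ti_T
      by (simp add: Rm_def transpose_jac_inverse matrix_vector_mult_scaleR jac_inverse_mult
          del: transpose_matrix_vector)
  qed
qed

lemma Rm_near: "norm (Rm x y - y) \<le> 40 * s * norm y"
proof -
  let ?d = "det (jac T x)"
  have "(1 / ?d) *\<^sub>R (jac T x *v snd y) - snd y = (1 / ?d) *\<^sub>R ((jac T x *v snd y - snd y) - (?d - 1) *\<^sub>R snd y)"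
    using det_T_bounds(1)[of x] by (simp add: algebra_simps)
  \<comment> \<open>The bounds \<open>1 / ?d \<le> 2\<close> and
    \<open>\<bar>?d - 1\<bar> \<le> 15 s\<close> give \<open>32 s\<close>, rounded up to
    \<open>40 s\<close>.\<close>
  also have "norm \<dots> \<le> 2 * (s * norm (snd y) + 15 * s * norm (snd y))"
    unfolding norm_scaleR
  proof (rule mult_mono)
    show "\<bar>1 / ?d\<bar> \<le> 2" using det_T_bounds(1)[of x] by (simp add: divide_le_eq)
    have "norm ((?d - 1) *\<^sub>R snd y) \<le> 15 * s * norm (snd y)"
      unfolding norm_scaleR using det_T[of x] by (intro mult_right_mono) auto
    then show "norm ((jac T x *v snd y - snd y) - (?d - 1) *\<^sub>R snd y) \<le> s * norm (snd y) + 15 * s * norm (snd y)"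
      using jac_T_near[of x "snd y"] by (intro order_trans[OF norm_triangle_ineq4 add_mono])
  qed auto
  also have "\<dots> \<le> 40 * s * norm (snd y)"
    using s0 mult_nonneg_nonneg[OF s0 norm_ge_zero[of "snd y"]] by simp
  finally have 2: "norm ((1 / ?d) *\<^sub>R (jac T x *v snd y) - snd y) \<le> 40 * s * norm (snd y)" .
  have 1: "norm (transpose (jac Ti (T x)) *v fst y - fst y) \<le> 40 * s * norm (fst y)"
    using transpose_jac_Ti(2)[of x "fst y"] mult_nonneg_nonneg[OF s0 norm_ge_zero[of "fst y"]] by simp
  have "(norm (Rm x y - y))\<^sup>2 \<le> (40 * s * norm (fst y))\<^sup>2 + (40 * s * norm (snd y))\<^sup>2"
    using power_mono[OF 1, of 2] power_mono[OF 2, of 2] by (cases y) (simp add: Rm_def norm_Pair)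
  also have "\<dots> = (40 * s * norm y)\<^sup>2"
    by (cases y) (simp add: norm_Pair power_mult_distrib algebra_simps)
  finally show ?thesis by (rule power2_le_imp_le) (use s0 in simp)
qed

text \<open>Transported and original integrands coincide off the support of \<open>u\<close>, so the
  data have to be controlled only at points of \<open>B\<close>.\<close>

lemma off_support:
  assumes "x \<notin> fsupport u"
  shows "T x = x" "jac T x = mat 1" "det (jac T x) = 1" "Rm x y = y"
proof -
  show T: "T x = x" by (rule T_fixed[OF assms])
  show J: "jac T x = mat 1"
    by (simp add: matrix_eq jac_T_mult frechet_derivative_off_fsupport[OF assms])
  then show "det (jac T x) = 1" by simp
  have "jac Ti (T x) = mat 1" using jac_Ti_T[of x] by (simp add: J)
  then show "Rm x y = y" by (simp add: Rm_def J transpose_mat)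
qed

end

section \<open>The Lipschitz estimate along smooth perturbations\<close>

text \<open>A transported integrand has three perturbed factors: the determinant \<open>d\<close>,
  the coefficient part \<open>x\<close> and the test vector \<open>b\<close>. They are exchanged one
  at a time; the first and the last exchange contribute \<open>2 \<delta> X\<close> and
  \<open>\<delta> X\<close>, the middle one \<open>2 e\<close>.\<close>

lemma perturbed_inner_le:
  fixes x x' b b' :: "'a::real_inner"
  assumes "\<bar>d - 1\<bar> \<le> \<delta>" "\<delta> \<le> 1" "norm x \<le> X" "norm x' \<le> X" "norm (x' - x) \<le> e" "norm (b' - b) \<le> \<delta> * norm b"
  shows "\<bar>d * (x' \<bullet> b') - x \<bullet> b\<bar> \<le> (3 * \<delta> * X + 2 * e) * norm b"
proof -
  have X: "X \<ge> 0" and e: "e \<ge> 0" and \<delta>: "\<delta> \<ge> 0"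
    using assms norm_ge_zero order_trans abs_ge_zero by blast+
  have "norm b' \<le> norm (b' - b) + norm b" by (metis diff_add_cancel norm_triangle_ineq)
  also have "\<dots> \<le> 1 * norm b + norm b"
    using assms(6) mult_right_mono[OF assms(2), of "norm b"] by (intro add_right_mono) (metis norm_ge_zero order_trans)
  finally have b': "norm b' \<le> 2 * norm b" by simp
  have eq: "d * (x' \<bullet> b') - x \<bullet> b = (d - 1) * (x' \<bullet> b') + (x' - x) \<bullet> b' + x \<bullet> (b' - b)"
    by (simp add: inner_diff_left inner_diff_right algebra_simps)
  have "\<bar>(d - 1) * (x' \<bullet> b')\<bar> \<le> \<delta> * (X * (2 * norm b))"
    unfolding abs_mult using assms b' X \<delta>
    by (intro mult_mono order_trans[OF Cauchy_Schwarz_ineq2]) auto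
  moreover have "\<bar>(x' - x) \<bullet> b'\<bar> \<le> e * (2 * norm b)"
    using assms b' e by (intro order_trans[OF Cauchy_Schwarz_ineq2] mult_mono) auto
  moreover have "\<bar>x \<bullet> (b' - b)\<bar> \<le> X * (\<delta> * norm b)"
    using assms X by (intro order_trans[OF Cauchy_Schwarz_ineq2] mult_mono) auto
  ultimately show ?thesis
    unfolding eq by (simp add: algebra_simps)
qed

lemma inner_diff_sum: "(a - b) \<bullet> (a + b) = (norm a)\<^sup>2 - (norm b)\<^sup>2" for a b :: "'a::real_inner"
  by (simp add: power2_norm_eq_inner inner_diff_left inner_add_right inner_commute[of b a])

context maxwell
begin

section \<open>Objective functional and constants independent of \<gamma>\<close>

abbreviation "m1 \<equiv> L2norm M (\<lambda>x. 1 :: real)"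

lemma one_L2: "(\<lambda>x. 1 :: real) \<in> L2 M"
  by (rule L2_const[OF fin])

lemma m1_sq: "m1\<^sup>2 = measure M \<Omega>"
  by (simp add: L2norm_sq)

text \<open>Extension by zero writes the tracking term as an integral over \<open>\<Omega>\<close>;
  measurability of the extension comes from continuity on the open set \<open>B\<close>.\<close>

definition \<kappa>B :: "vec3 \<Rightarrow> real" where "\<kappa>B x = indicator B x * \<kappa> x"
definition EB :: "vec3 \<Rightarrow> vec3" where "EB x = indicator B x *\<^sub>R E\<^sub>d x"

lemma B_sets: "B \<in> sets M" "B \<in> sets borel"
  using open_sets_M[OF open_B B_sub] open_B by auto

lemma \<kappa>B_meas: "\<kappa>B \<in> borel_measurable M"
proof (rule borel_measurable_lebesgue_on)
  have "(\<lambda>x. indicator B x *\<^sub>R \<kappa> x) \<in> borel_measurable borel"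
    by (rule borel_measurable_continuous_on_indicator[OF B_sets(2) cont_B(1)])
  then show "\<kappa>B \<in> borel_measurable borel" by (simp add: \<kappa>B_def[abs_def])
qed

lemma EB_meas: "EB \<in> borel_measurable M"
  unfolding EB_def[abs_def]
  by (rule borel_measurable_lebesgue_on[OF borel_measurable_continuous_on_indicator[OF B_sets(2) cont_B(2)]])

lemma \<kappa>B_bound: "\<bar>\<kappa>B x\<bar> \<le> K" and EB_bound: "norm (EB x) \<le> K"
  using bound_B[of x] K by (auto simp: \<kappa>B_def EB_def indicator_def)

lemma EB_L2: "EB \<in> L2 M" and EB_nrm: "nrm EB \<le> K * m1"
  using L2_dominated[OF one_L2 EB_meas, of K] EB_bound K by auto

text \<open>The tracking term without its factor 1/2, as a functional of pairs.\<close>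

definition Q :: "(vec3 \<Rightarrow> vec3 \<times> vec3) \<Rightarrow> real" where
  "Q p = (LINT x|M. \<kappa>B x * (norm (fst (p x) - EB x))\<^sup>2)"

lemma Q_arg_L2: "p \<in> L2 M \<Longrightarrow> (\<lambda>x. fst (p x) - EB x) \<in> L2 M"
  by (intro L2_diff L2_fst_snd EB_L2)

lemma Q_integrable:
  assumes "p \<in> L2 M"
  shows "integrable M (\<lambda>x. \<kappa>B x * (norm (fst (p x) - EB x))\<^sup>2)"
proof (rule Bochner_Integration.integrable_bound)
  show "integrable M (\<lambda>x. K * (norm (fst (p x) - EB x))\<^sup>2)"
    using L2_integrable[OF Q_arg_L2[OF assms]] by simp
  show "AE x in M. norm (\<kappa>B x * (norm (fst (p x) - EB x))\<^sup>2) \<le> norm (K * (norm (fst (p x) - EB x))\<^sup>2)"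
    using \<kappa>B_bound K by (intro AE_I2) (simp add: abs_mult mult_right_mono)
qed (use \<kappa>B_meas L2_measurable[OF Q_arg_L2[OF assms]] in measurable)

text \<open>Difference of squares: the difference of the states enters linearly, multiplied by a sum
  that is bounded.\<close>

lemma Q_diff:
  assumes p: "p \<in> L2 M" and q: "q \<in> L2 M"
  shows "\<bar>Q p - Q q\<bar> \<le> K * nrm (\<lambda>x. p x - q x) * (nrm p + nrm q + 2 * K * m1)"
proof -
  let ?a = "\<lambda>x. fst (p x) - EB x" and ?b = "\<lambda>x. fst (q x) - EB x"
  note L = Q_arg_L2[OF p] Q_arg_L2[OF q]
  have dL: "(\<lambda>x. p x - q x) \<in> L2 M" by (rule L2_diff(1)[OF p q])
  have sL: "(\<lambda>x. ?a x + ?b x) \<in> L2 M" by (rule L2_add(1)[OF L])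
  have n: "nrm ?a \<le> nrm p + K * m1" "nrm ?b \<le> nrm q + K * m1"
    using L2_diff(2)[OF L2_fst_snd(1)[OF p] EB_L2] L2_diff(2)[OF L2_fst_snd(1)[OF q] EB_L2]
      L2_fst_snd(3)[OF p] L2_fst_snd(3)[OF q] EB_nrm by linarith+
  have "\<bar>LINT x|M. \<kappa>B x * (norm (?a x))\<^sup>2 - \<kappa>B x * (norm (?b x))\<^sup>2\<bar> \<le> \<bar>K\<bar> * (nrm (\<lambda>x. p x - q x) * nrm (\<lambda>x. ?a x + ?b x))"
  proof (rule L2_bound_integrable(2)[OF dL sL])
    show "(\<lambda>x. \<kappa>B x * (norm (?a x))\<^sup>2 - \<kappa>B x * (norm (?b x))\<^sup>2) \<in> borel_measurable M"
      using Q_integrable[OF p] Q_integrable[OF q] by measurable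
    show "AE x in M. \<bar>\<kappa>B x * (norm (?a x))\<^sup>2 - \<kappa>B x * (norm (?b x))\<^sup>2\<bar> \<le> K * (norm (p x - q x) * norm (?a x + ?b x))"
    proof (rule AE_I2)
      fix x
      have "\<kappa>B x * (norm (?a x))\<^sup>2 - \<kappa>B x * (norm (?b x))\<^sup>2 = \<kappa>B x * (fst (p x - q x) \<bullet> (?a x + ?b x))"
        using inner_diff_sum[of "?a x" "?b x"] by (simp add: right_diff_distrib)
      also have "\<bar>\<dots>\<bar> \<le> K * (norm (fst (p x - q x)) * norm (?a x + ?b x))"
        unfolding abs_mult using \<kappa>B_bound K by (intro mult_mono Cauchy_Schwarz_ineq2) auto
      also have "\<dots> \<le> K * (norm (p x - q x) * norm (?a x + ?b x))"
        using K norm_fst_snd_le(1)[of "p x - q x"] by (intro mult_left_mono mult_right_mono) auto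
      finally show "\<bar>\<kappa>B x * (norm (?a x))\<^sup>2 - \<kappa>B x * (norm (?b x))\<^sup>2\<bar> \<le> K * (norm (p x - q x) * norm (?a x + ?b x))" .
    qed
  qed
  also have "\<dots> \<le> \<bar>K\<bar> * (nrm (\<lambda>x. p x - q x) * (nrm p + nrm q + 2 * K * m1))"
    using n L2_add(2)[OF L] by (intro mult_left_mono) auto
  finally show ?thesis
    using Q_integrable[OF p] Q_integrable[OF q] K by (simp add: Q_def mult.assoc)
qed

abbreviation "J \<equiv> J_pen \<Omega> B j \<kappa> \<epsilon> \<nu> f E\<^sub>d"

lemma J_eq: "J \<gamma> \<omega> = Q (st \<gamma> \<omega>) / 2 + measure lebesgue \<omega>"
proof -
  have eq: "indicator B x * (\<kappa> x * (norm (state \<Omega> j \<epsilon> \<nu> f \<gamma> \<omega> x - E\<^sub>d x))\<^sup>2)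
      = \<kappa>B x * (norm (fst (st \<gamma> \<omega> x) - EB x))\<^sup>2" for x
    by (simp add: \<kappa>B_def EB_def st_def indicator_def)
  show ?thesis
    unfolding J_pen_def Q_def
    using lebesgue_on_integral_subset[OF open_sets_lebesgue[OF open_B] \<Omega>_sets B_sub, of "\<lambda>x. \<kappa> x * (norm (state \<Omega> j \<epsilon> \<nu> f \<gamma> \<omega> x - E\<^sub>d x))\<^sup>2"]
    by (simp add: eq)
qed

definition P0 :: real where "P0 = nrm f / c"
text \<open>\<open>400 K P0\<close> comes from \<open>A_hat\<close>, \<open>200 (K + j) m1\<close>
  from \<open>R_hat\<close> and \<open>S_hat\<close>, \<open>c\<close> from coercivity, and 6 is the
  norm bound of the inverse transport.\<close>

definition C1 :: real where "C1 = (6 / c) * (400 * K * P0 + 200 * (K + j) * m1)"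
text \<open>The first term is the state estimate inserted in \<open>Q_diff\<close>, where
  \<open>7 P0\<close> consists of \<open>P0\<close> for the new state and \<open>6 P0\<close> for
  the transported one. The second has half of the factor 400 in \<open>Q_hat\<close>, and the last
  is the change of volume.\<close>

definition C2 :: real where
  "C2 = K * C1 * (7 * P0 + 2 * K * m1) + 200 * K * (P0\<^sup>2 + K\<^sup>2 * m1\<^sup>2) + 15 * m1\<^sup>2"

lemma P0_nonneg: "P0 \<ge> 0"
  using c by (simp add: P0_def)

end

text \<open>A single \<open>s\<close> bounds the displacement, which moves the coefficients, and the
  Lipschitz constant, which moves the Jacobian. The segments are those along which the Lipschitz
  bounds of the data are applied.\<close>

locale perturbed_maxwell = maxwell + perturbation u s for u s +
  assumes supp_B: "fsupport u \<subseteq> B"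
    and small: "\<And>x. norm (u x) \<le> s"
    and segment_B: "\<And>x. x \<in> B \<Longrightarrow> closed_segment x (x + u x) \<subseteq> B"
begin

lemma supp_\<Omega>: "fsupport u \<subseteq> \<Omega>"
  using supp_B B_sub by blast

sublocale dT: diffeo \<Omega> T Ti 4 "3/4"
  by (rule diffeo_T[OF open_\<Omega> bounded_\<Omega> supp_\<Omega>])

sublocale dTi: diffeo \<Omega> Ti T 4 "3/4"
  by (rule diffeo_Ti[OF open_\<Omega> bounded_\<Omega> supp_\<Omega>])

abbreviation "d x \<equiv> det (jac T x)"
abbreviation "hat \<equiv> pull_pair Ti T"

lemma hat_G: "q \<in> G \<Longrightarrow> hat q \<in> G"
  by (rule dTi.pull_pair_curl_graph)

lemma unhat_G: "q \<in> G \<Longrightarrow> pull_pair T Ti q \<in> G"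
  by (rule dT.pull_pair_curl_graph)

text \<open>The norm bound of both transports: 4 is the pointwise bound and \<open>3/4\<close> the
  determinant bound from \<open>diffeo\<close>.\<close>

lemma sqrt_4_3: "4 * sqrt (1 / (3 / 4)) \<le> (6 :: real)"
proof -
  have "sqrt (4 / 3 :: real) \<le> sqrt ((3 / 2)\<^sup>2)" by (subst real_sqrt_le_iff) (simp add: power2_eq_square)
  then show ?thesis by simp
qed

lemma hat_nrm: "p \<in> L2 M \<Longrightarrow> nrm (hat p) \<le> 6 * nrm p"
  using dTi.pull_pair_L2(2)[of p] mult_right_mono[OF sqrt_4_3 L2norm_nonneg[of M p]]
  unfolding mult.assoc by linarith

lemma unhat_nrm: "p \<in> L2 M \<Longrightarrow> nrm (pull_pair T Ti p) \<le> 6 * nrm p"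
  using dT.pull_pair_L2(2)[of p] mult_right_mono[OF sqrt_4_3 L2norm_nonneg[of M p]]
  unfolding mult.assoc by linarith

lemma seg: "x \<in> B \<Longrightarrow> closed_segment x (T x) \<subseteq> B"
  using segment_B by (simp add: T_def)

lemma T_B: "x \<in> B \<Longrightarrow> T x \<in> B"
  using seg by auto

lemma T_move: "norm (T x - x) \<le> s"
  using small by (simp add: T_def)

lemma T_mem_iff: "T x \<in> T ` \<omega> \<longleftrightarrow> x \<in> \<omega>"
  using inj_T by (simp add: inj_image_mem_iff)

lemma lip_T:
  assumes "x \<in> B"
  shows "norm (\<epsilon> (T x) - \<epsilon> x) \<le> K * s" "norm (\<nu> (T x) - \<nu> x) \<le> K * s" "norm (f (T x) - f x) \<le> K * s"
    "norm (\<kappa> (T x) - \<kappa> x) \<le> K * s" "norm (E\<^sub>d (T x) - E\<^sub>d x) \<le> K * s"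
proof -
  have "K * norm (T x - x) \<le> K * s" using K T_move by (intro mult_left_mono) auto
  then show "norm (\<epsilon> (T x) - \<epsilon> x) \<le> K * s" "norm (\<nu> (T x) - \<nu> x) \<le> K * s" "norm (f (T x) - f x) \<le> K * s"
    "norm (\<kappa> (T x) - \<kappa> x) \<le> K * s" "norm (E\<^sub>d (T x) - E\<^sub>d x) \<le> K * s"
    using lip_B[OF seg[OF assms]] by linarith+
qed

lemma d_near: "\<bar>d x - 1\<bar> \<le> 40 * s"
  using det_T[of x] s0 by linarith

lemma s40: "40 * s \<le> 1" using s1 by simp

lemma Rm_norm: "norm (Rm x y) \<le> 2 * norm y"
proof -
  have "norm (Rm x y) \<le> norm (Rm x y - y) + norm y" by (metis diff_add_cancel norm_triangle_ineq)
  moreover have "40 * s * norm y \<le> 1 * norm y" by (rule mult_right_mono[OF s40]) simp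
  ultimately show ?thesis using Rm_near[of x y] by linarith
qed

lemma fst_Rm: "fst (Rm x y) = transpose (jac Ti (T x)) *v fst y"
  by (simp add: Rm_def)

lemma fst_Rm_near: "norm (fst (Rm x y) - fst y) \<le> 2 * s * norm (fst y)"
  unfolding fst_Rm by (rule transpose_jac_Ti)

lemma fst_Rm_near40: "norm (fst (Rm x y) - fst y) \<le> 40 * s * norm (fst y)"
  using fst_Rm_near[of x y] mult_nonneg_nonneg[OF s0 norm_ge_zero[of "fst y"]] by linarith

lemma transform:
  fixes h :: "vec3 \<Rightarrow> real"
  assumes "integrable M h"
  shows "integrable M (\<lambda>x. d x * h (T x))" "(LINT x|M. h x) = (LINT x|M. d x * h (T x))"
  using dT.change_of_variables[OF assms] by simp_all

lemma N_diff_le: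
  assumes "x \<in> B"
  shows "norm (N (T x) y - N x y) \<le> K * s * norm y"
proof -
  have "norm (\<epsilon> (T x) *v fst y - \<epsilon> x *v fst y) \<le> K * s * norm (fst y)"
    "norm (\<nu> (T x) *v snd y - \<nu> x *v snd y) \<le> K * s * norm (snd y)"
    using norm_matrix_vector_mult_le[of "\<epsilon> (T x) - \<epsilon> x" "fst y"] norm_matrix_vector_mult_le[of "\<nu> (T x) - \<nu> x" "snd y"]
      mult_right_mono[OF lip_T(1)[OF assms] norm_ge_zero[of "fst y"]] mult_right_mono[OF lip_T(2)[OF assms] norm_ge_zero[of "snd y"]]
    by (auto simp: matrix_vector_mult_diff_rdistrib)
  from norm_Pair_le[OF this] show ?thesis using K s0 by (simp add: N_def)
qed

text \<open>After the change of variables the integrands are compared at the same \<open>x\<close>.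
  Off \<open>B\<close> they coincide; on \<open>B\<close> the tensors move by \<open>K s\<close> and
  the pairs by the factor \<open>40 s\<close>.\<close>

lemma A_hat:
  assumes p: "p \<in> G" and q: "q \<in> G"
  shows "\<bar>A (hat p) (hat q) - A p q\<bar> \<le> 400 * K * s * (nrm p * nrm q)"
proof -
  note L = G_L2[OF p] G_L2[OF q] and hL = G_L2[OF hat_G[OF p]] G_L2[OF hat_G[OF q]]
  note tr = transform[OF A_integrable[OF hL], unfolded pull_pair_Ti_T]
  have "\<bar>LINT x|M. d x * (N (T x) (Rm x (p x)) \<bullet> Rm x (q x)) - N x (p x) \<bullet> q x\<bar> \<le> \<bar>400 * K * s\<bar> * (nrm p * nrm q)"
  proof (rule L2_bound_integrable(2)[OF L])
    show "(\<lambda>x. d x * (N (T x) (Rm x (p x)) \<bullet> Rm x (q x)) - N x (p x) \<bullet> q x) \<in> borel_measurable M"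
      using tr(1) A_integrable[OF L] by measurable
    show "AE x in M. \<bar>d x * (N (T x) (Rm x (p x)) \<bullet> Rm x (q x)) - N x (p x) \<bullet> q x\<bar> \<le> 400 * K * s * (norm (p x) * norm (q x))"
    proof (rule AE_I2)
      fix x
      show "\<bar>d x * (N (T x) (Rm x (p x)) \<bullet> Rm x (q x)) - N x (p x) \<bullet> q x\<bar> \<le> 400 * K * s * (norm (p x) * norm (q x))"
      proof (cases "x \<in> B")
        case False
        then have "x \<notin> fsupport u" using supp_B by blast
        then show ?thesis using off_support[of x] K s0 by simp
      next
        case True
        let ?n = "norm (p x)"
        have b: "norm (\<epsilon> x) \<le> K" "norm (\<nu> x) \<le> K" "norm (\<epsilon> (T x)) \<le> K" "norm (\<nu> (T x)) \<le> K"
          using bound_B[OF True] bound_B[OF T_B[OF True]] by auto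
        have K0: "K \<ge> 0" using K by simp
        have 1: "norm (N x (p x)) \<le> K * ?n" by (rule N_norm_le[OF b(1,2)])
        have 2: "norm (N (T x) (Rm x (p x))) \<le> 2 * K * ?n"
          using N_norm_le[OF b(3,4), of "Rm x (p x)"] mult_left_mono[OF Rm_norm[of x "p x"] K0] by simp
        have "N (T x) (Rm x (p x)) - N x (p x) = (N (T x) (Rm x (p x)) - N x (Rm x (p x))) + N x (Rm x (p x) - p x)"
          by (simp add: linear_diff[OF N_linear])
        also have "norm \<dots> \<le> K * s * (2 * ?n) + K * (40 * s * ?n)"
        proof (rule norm_triangle_mono)
          show "norm (N (T x) (Rm x (p x)) - N x (Rm x (p x))) \<le> K * s * (2 * ?n)"
            using N_diff_le[OF True, of "Rm x (p x)"] mult_left_mono[OF Rm_norm[of x "p x"], of "K * s"] K0 s0 by simp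
          show "norm (N x (Rm x (p x) - p x)) \<le> K * (40 * s * ?n)"
            using N_norm_le[OF b(1,2), of "Rm x (p x) - p x"] mult_left_mono[OF Rm_near[of x "p x"] K0] by simp
        qed
        \<comment> \<open>Here 42 is 2 for the tensors plus 40 for the pair. With
          \<open>perturbed_inner_le\<close> it leads to 324, the sum of \<open>3 * 40 * 2\<close>
          and \<open>2 * 42\<close>, which is rounded up to 400.\<close>
        finally have 3: "norm (N (T x) (Rm x (p x)) - N x (p x)) \<le> 42 * (K * s * ?n)" by simp
        have "norm (N x (p x)) \<le> 2 * K * ?n" using 1 mult_nonneg_nonneg[OF K0 norm_ge_zero[of "p x"]] by linarith
        from perturbed_inner_le[OF d_near s40 this 2 3 Rm_near]
        have "\<bar>d x * (N (T x) (Rm x (p x)) \<bullet> Rm x (q x)) - N x (p x) \<bullet> q x\<bar> \<le> (3 * (40 * s) * (2 * K * ?n) + 2 * (42 * (K * s * ?n))) * norm (q x)" .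
        also have "\<dots> = 324 * (K * s * ?n * norm (q x))" by (simp add: algebra_simps)
        also have "\<dots> \<le> 400 * (K * s * ?n * norm (q x))"
          using K0 s0 by (intro mult_right_mono) auto
        finally show ?thesis by (simp add: mult_ac)
      qed
    qed
  qed
  then show ?thesis
    using tr A_integrable[OF L] K s0 by (simp add: A_def)
qed

text \<open>Membership of \<open>T x\<close> in the image set is membership of \<open>x\<close> in
  \<omega>, so the indicator is unchanged and only the argument of \<open>Lambda_pen\<close>
  moves.\<close>

lemma S_hat:
  assumes \<gamma>: "\<gamma> > 0" and p: "p \<in> G" and q: "q \<in> G" and \<omega>: "\<omega> \<in> sets M" "T ` \<omega> \<in> sets M"
  shows "\<bar>S \<gamma> (T ` \<omega>) (hat p) (hat q) - S \<gamma> \<omega> p q\<bar> \<le> 200 * j * s * (m1 * nrm q)"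
proof -
  note L = G_L2[OF p] G_L2[OF q] and hL = G_L2[OF hat_G[OF p]] G_L2[OF hat_G[OF q]]
  let ?\<Lambda> = "Lambda_pen j \<gamma>"
  have ind: "indicator (T ` \<omega>) (T x) = (indicator \<omega> x :: real)" for x
    by (simp add: indicator_def T_mem_iff)
  note tr = transform[OF S_integrable[OF \<gamma> hL \<omega>(2)], unfolded pull_pair_Ti_T ind]
  let ?h = "\<lambda>x. d x * (indicator \<omega> x * (?\<Lambda> (fst (Rm x (p x))) \<bullet> fst (Rm x (q x)))) - indicator \<omega> x * (?\<Lambda> (fst (p x)) \<bullet> fst (q x))"
  have "\<bar>LINT x|M. ?h x\<bar> \<le> \<bar>200 * j * s\<bar> * (m1 * nrm q)"
  proof (rule L2_bound_integrable(2)[OF one_L2 L(2)])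
    show "?h \<in> borel_measurable M"
      using tr(1) S_integrable[OF \<gamma> L \<omega>(1)] by measurable
    show "AE x in M. \<bar>?h x\<bar> \<le> 200 * j * s * (norm (1::real) * norm (q x))"
    proof (rule AE_I2)
      fix x
      let ?a = "fst (p x)" and ?a' = "fst (Rm x (p x))"
      \<comment> \<open>The argument moves by at most \<open>2 s\<close> times its own norm, which
        is the extra factor in \<open>Lambda_pen_diff\<close>; dividing by it leaves
        \<open>4 j s\<close> for every \<gamma>.\<close>
      have 3: "norm (?\<Lambda> ?a' - ?\<Lambda> ?a) \<le> 4 * j * s"
      proof (cases "?a = 0")
        case True
        then show ?thesis using j s0 by (simp add: fst_Rm)
      next
        case False
        have "norm (?\<Lambda> ?a' - ?\<Lambda> ?a) * norm ?a \<le> 2 * j * norm (?a' - ?a)"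
          by (rule Lambda_pen_diff[OF j \<gamma>])
        also have "\<dots> \<le> 2 * j * (2 * s * norm ?a)"
          using j by (intro mult_left_mono fst_Rm_near) auto
        finally have "norm (?\<Lambda> ?a' - ?\<Lambda> ?a) * norm ?a \<le> (4 * j * s) * norm ?a" by (simp add: mult_ac)
        then show ?thesis using False by (simp add: mult_le_cancel_right)
      qed
      have "\<bar>d x * (?\<Lambda> ?a' \<bullet> fst (Rm x (q x))) - ?\<Lambda> ?a \<bullet> fst (q x)\<bar> \<le> (3 * (40 * s) * j + 2 * (4 * j * s)) * norm (fst (q x))"
        by (rule perturbed_inner_le[OF d_near s40 Lambda_pen_norm[OF j \<gamma>] Lambda_pen_norm[OF j \<gamma>] 3 fst_Rm_near40])
      also have "\<dots> = 128 * j * s * norm (fst (q x))" by (simp add: algebra_simps)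
      also have "\<dots> \<le> 200 * j * s * norm (q x)"
        using j s0 norm_fst_snd_le(1)[of "q x"] by (intro mult_mono) auto
      finally have "\<bar>d x * (?\<Lambda> ?a' \<bullet> fst (Rm x (q x))) - ?\<Lambda> ?a \<bullet> fst (q x)\<bar> \<le> 200 * j * s * norm (q x)" .
      then show "\<bar>?h x\<bar> \<le> 200 * j * s * (norm (1::real) * norm (q x))"
        using j s0 by (cases "x \<in> \<omega>") auto
    qed
  qed
  then show ?thesis
    using tr S_integrable[OF \<gamma> L \<omega>(1)] j s0 by (simp add: S_def)
qed

lemma R_hat:
  assumes q: "q \<in> G"
  shows "\<bar>R (hat q) - R q\<bar> \<le> 200 * K * s * (m1 * nrm q)"
proof -
  note L = G_L2[OF q] and hL = G_L2[OF hat_G[OF q]]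
  note tr = transform[OF R_integrable[OF hL], unfolded pull_pair_Ti_T]
  let ?h = "\<lambda>x. d x * (f (T x) \<bullet> fst (Rm x (q x))) - f x \<bullet> fst (q x)"
  have "\<bar>LINT x|M. ?h x\<bar> \<le> \<bar>200 * K * s\<bar> * (m1 * nrm q)"
  proof (rule L2_bound_integrable(2)[OF one_L2 L])
    show "?h \<in> borel_measurable M"
      using tr(1) R_integrable[OF L] by measurable
    show "AE x in M. \<bar>?h x\<bar> \<le> 200 * K * s * (norm (1::real) * norm (q x))"
    proof (rule AE_I2)
      fix x
      show "\<bar>?h x\<bar> \<le> 200 * K * s * (norm (1::real) * norm (q x))"
      proof (cases "x \<in> B")
        case False
        then have "x \<notin> fsupport u" using supp_B by blast
        then show ?thesis using off_support[of x] K s0 by simp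
      next
        case True
        have b: "norm (f x) \<le> K" "norm (f (T x)) \<le> K"
          using bound_B[OF True] bound_B[OF T_B[OF True]] by auto
        have "\<bar>?h x\<bar> \<le> (3 * (40 * s) * K + 2 * (K * s)) * norm (fst (q x))"
          by (rule perturbed_inner_le[OF d_near s40 b lip_T(3)[OF True] fst_Rm_near40])
        also have "\<dots> = 122 * K * s * norm (fst (q x))" by (simp add: algebra_simps)
        also have "\<dots> \<le> 200 * K * s * norm (q x)"
          using K s0 norm_fst_snd_le(1)[of "q x"] by (intro mult_mono) auto
        finally show ?thesis by simp
      qed
    qed
  qed
  then show ?thesis
    using tr R_integrable[OF L] K s0 by (simp add: R_def)
qed

lemma S_monotone:
  assumes \<gamma>: "\<gamma> > 0" and p: "p \<in> L2 M" and q: "q \<in> L2 M" and \<omega>: "\<omega> \<in> sets M"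
  shows "S \<gamma> \<omega> q (\<lambda>x. p x - q x) \<le> S \<gamma> \<omega> p (\<lambda>x. p x - q x)"
proof -
  have d: "(\<lambda>x. p x - q x) \<in> L2 M" by (rule L2_diff(1)[OF p q])
  show ?thesis
    unfolding S_def
  proof (rule integral_mono[OF S_integrable[OF \<gamma> q d \<omega>] S_integrable[OF \<gamma> p d \<omega>]])
    show "indicator \<omega> x * (Lambda_pen j \<gamma> (fst (q x)) \<bullet> fst (p x - q x)) \<le> indicator \<omega> x * (Lambda_pen j \<gamma> (fst (p x)) \<bullet> fst (p x - q x))" for x
      using Lambda_pen_monotone[OF j \<gamma>, of "fst (p x)" "fst (q x)"]
      by (intro mult_left_mono) (auto simp: inner_diff_left)
  qed
qed

text \<open>The equation on the image set is tested with \<open>w'\<close>, the equation on \<omega>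
  with the back-transported field \<open>w\<close>. Since \<open>hat w = w'\<close>, the transport
  lemmas turn one equation into the other up to errors proportional to \<open>s * nrm w\<close>, and
  coercivity converts these into the bound.\<close>

lemma state_estimate:
  assumes \<gamma>: "\<gamma> > 0" and \<omega>: "open \<omega>" "\<omega> \<subseteq> \<Omega>" and \<omega>': "open (T ` \<omega>)" "T ` \<omega> \<subseteq> \<Omega>"
  shows "nrm (\<lambda>x. st \<gamma> (T ` \<omega>) x - hat (st \<gamma> \<omega>) x) \<le> C1 * s"
proof -
  let ?p = "st \<gamma> \<omega>" and ?p' = "st \<gamma> (T ` \<omega>)"
  define w where "w x = pull_pair T Ti ?p' x - ?p x" for x
  define w' where "w' x = ?p' x - hat ?p x" for x
  note pG = st_works(1)[OF \<gamma> \<omega>] and p'G = st_works(1)[OF \<gamma> \<omega>']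
  have wG: "w \<in> G" unfolding w_def[abs_def] by (intro G_diff unhat_G pG p'G)
  have w'G: "w' \<in> G" unfolding w'_def[abs_def] by (intro G_diff hat_G pG p'G)
  have hw: "hat w = w'"
    unfolding w_def[abs_def] w'_def[abs_def] by (simp add: dTi.pull_pair_diff fun_eq_iff pull_pair_inverse)
  have "w = pull_pair T Ti w'" by (simp add: hw[symmetric] pull_pair_inverse)
  then have w_le: "nrm w \<le> 6 * nrm w'" using unhat_nrm[OF G_L2[OF w'G]] by simp
  have sets: "\<omega> \<in> sets M" "T ` \<omega> \<in> sets M" using open_sets_M \<omega> \<omega>' by auto
  note L = G_L2[OF p'G] G_L2[OF hat_G[OF pG]] G_L2[OF w'G]
  have "c * (nrm w')\<^sup>2 \<le> A w' w'" by (rule A_coercive[OF L(3)])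
  also have "\<dots> = A ?p' w' - A (hat ?p) w'"
    using A_diff_left[OF L] by (simp add: w'_def[abs_def])
  also have "\<dots> = R w' - S \<gamma> (T ` \<omega>) ?p' w' - A (hat ?p) w'"
    using st_works(2)[OF \<gamma> \<omega>' w'G] by simp
  \<comment> \<open>Monotonicity replaces the new state by the transported old one inside
    \<open>Lambda_pen\<close>, the form that \<open>S_hat\<close> can compare.\<close>
  also have "\<dots> \<le> R w' - S \<gamma> (T ` \<omega>) (hat ?p) w' - A (hat ?p) w'"
    using S_monotone[OF \<gamma> L(1,2) sets(2)] by (simp add: w'_def[abs_def])
  also have "\<dots> \<le> (R w - S \<gamma> \<omega> ?p w - A ?p w)
      + (200 * K * s * (m1 * nrm w) + 200 * j * s * (m1 * nrm w) + 400 * K * s * (nrm ?p * nrm w))"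
    using R_hat[OF wG] S_hat[OF \<gamma> pG wG sets] A_hat[OF pG wG] unfolding hw abs_le_iff by linarith
  also have "R w - S \<gamma> \<omega> ?p w - A ?p w = 0"
    using st_works(2)[OF \<gamma> \<omega> wG] by simp
  also have "0 + (200 * K * s * (m1 * nrm w) + 200 * j * s * (m1 * nrm w) + 400 * K * s * (nrm ?p * nrm w))
      = s * (400 * K * nrm ?p + 200 * (K + j) * m1) * nrm w"
    by (simp add: algebra_simps)
  also have "\<dots> \<le> s * (400 * K * P0 + 200 * (K + j) * m1) * (6 * nrm w')"
    using s0 K j w_le st_bound[OF \<gamma> \<omega>] P0_nonneg
    by (intro mult_mono mult_left_mono add_right_mono) (auto simp: P0_def[symmetric])
  also have "\<dots> = (c * (C1 * s)) * nrm w'"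
    using c by (simp add: C1_def)
  finally have "(c * nrm w') * nrm w' \<le> (c * (C1 * s)) * nrm w'"
    by (simp add: power2_eq_square mult.assoc)
  moreover have "C1 \<ge> 0" unfolding C1_def using c K j P0_nonneg by auto
  ultimately have "nrm w' \<le> C1 * s"
    using L2norm_nonneg[of M w'] c s0 by (cases "nrm w' = 0") (simp_all add: mult_le_cancel_right mult_le_cancel_left del: L2norm_nonneg)
  then show ?thesis by (simp add: w'_def[abs_def])
qed

text \<open>Determinant, weight and squared misfit are exchanged in turn, contributing 15, 1 and 2
  to the factor 18 in \<open>18 K s X^2\<close>. Bounding \<open>X^2\<close> by eight times the sum
  of squares gives 144, rounded up to 400.\<close>

lemma Q_hat_pointwise:
  "\<bar>d x * (\<kappa>B (T x) * (norm (fst (Rm x y) - EB (T x)))\<^sup>2) - \<kappa>B x * (norm (fst y - EB x))\<^sup>2\<bar>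
    \<le> 400 * K * s * ((norm y)\<^sup>2 + K\<^sup>2)"
proof (cases "x \<in> B")
  case False
  then have "x \<notin> fsupport u" using supp_B by blast
  then show ?thesis using off_support[of x] K s0 by simp
next
  case True
  let ?z' = "fst (Rm x y) - E\<^sub>d (T x)" and ?z = "fst y - E\<^sub>d x"
  define X where "X = 2 * norm y + 2 * K"
  have K0: "K \<ge> 0" using K by simp
  have b: "norm (\<kappa> x) \<le> K" "norm (\<kappa> (T x)) \<le> K" "norm (E\<^sub>d x) \<le> K" "norm (E\<^sub>d (T x)) \<le> K"
    using bound_B[OF True] bound_B[OF T_B[OF True]] by auto
  have X: "X \<ge> 0" using K0 by (simp add: X_def)
  have ny: "norm (fst y) \<le> norm y" by (rule norm_fst_snd_le)
  have "norm (fst (Rm x y)) \<le> 2 * norm y"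
    using norm_fst_snd_le(1)[of "Rm x y"] Rm_norm[of x y] by linarith
  then have z': "norm ?z' \<le> X" using norm_triangle_ineq4[of "fst (Rm x y)" "E\<^sub>d (T x)"] b K0 by (simp add: X_def)
  have z: "norm ?z \<le> X" using norm_triangle_ineq4[of "fst y" "E\<^sub>d x"] b ny K0 norm_ge_zero[of y] unfolding X_def by linarith
  have "?z' - ?z = (fst (Rm x y) - fst y) - (E\<^sub>d (T x) - E\<^sub>d x)" by simp
  also have "norm \<dots> \<le> norm (fst (Rm x y) - fst y) + norm (E\<^sub>d (T x) - E\<^sub>d x)" by (rule norm_triangle_ineq4)
  also have "\<dots> \<le> 2 * s * norm (fst y) + K * s" by (intro add_mono fst_Rm_near lip_T(5)[OF True])
  also have "\<dots> \<le> s * X"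
  proof -
    have "2 * s * norm (fst y) \<le> 2 * s * norm y" using ny s0 by (intro mult_left_mono) auto
    moreover have "0 \<le> K * s" using K0 s0 by simp
    ultimately show ?thesis by (simp add: X_def algebra_simps)
  qed
  finally have zz: "norm (?z' - ?z) \<le> s * X" .
  have inner_le: "\<bar>v \<bullet> w\<bar> \<le> X * X" if "norm v \<le> X" "norm w \<le> X" for v w :: vec3
    using that X by (intro order_trans[OF Cauchy_Schwarz_ineq2] mult_mono) auto
  have 1: "\<bar>(d x - 1) * (\<kappa> (T x) * (?z' \<bullet> ?z'))\<bar> \<le> 15 * s * (K * (X * X))"
    unfolding abs_mult using det_T[of x] b(2) inner_le[OF z' z'] s0 K0 by (intro mult_mono) auto
  have 2: "\<bar>(\<kappa> (T x) - \<kappa> x) * (?z' \<bullet> ?z')\<bar> \<le> K * s * (X * X)"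
    unfolding abs_mult using lip_T(4)[OF True] inner_le[OF z' z'] s0 K0 by (intro mult_mono) auto
  have 3: "\<bar>\<kappa> x * ((?z' - ?z) \<bullet> (?z' + ?z))\<bar> \<le> K * ((s * X) * (2 * X))"
  proof -
    have "norm (?z' + ?z) \<le> 2 * X" using norm_triangle_ineq[of ?z' ?z] z z' by linarith
    then have "\<bar>(?z' - ?z) \<bullet> (?z' + ?z)\<bar> \<le> (s * X) * (2 * X)"
      using zz s0 X by (intro order_trans[OF Cauchy_Schwarz_ineq2] mult_mono) auto
    then show ?thesis unfolding abs_mult using b(1) K0 by (intro mult_mono) auto
  qed
  have diff: "d x * (\<kappa> (T x) * (?z' \<bullet> ?z')) - \<kappa> x * (?z \<bullet> ?z)
      = (d x - 1) * (\<kappa> (T x) * (?z' \<bullet> ?z')) + (\<kappa> (T x) - \<kappa> x) * (?z' \<bullet> ?z') + \<kappa> x * ((?z' - ?z) \<bullet> (?z' + ?z))"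
  proof -
    have "(?z' - ?z) \<bullet> (?z' + ?z) = ?z' \<bullet> ?z' - ?z \<bullet> ?z"
      using inner_diff_sum[of ?z' ?z] by (simp only: power2_norm_eq_inner)
    then show ?thesis by (simp only: left_diff_distrib right_diff_distrib)
  qed
  have "\<bar>d x * (\<kappa> (T x) * (?z' \<bullet> ?z')) - \<kappa> x * (?z \<bullet> ?z)\<bar> \<le> 15 * s * (K * (X * X)) + K * s * (X * X) + K * ((s * X) * (2 * X))"
    unfolding diff by (intro order_trans[OF abs_triangle_ineq] add_mono 1 2 3)
  also have "\<dots> = 18 * K * s * X\<^sup>2" by (simp add: power2_eq_square algebra_simps)
  also have "\<dots> \<le> 18 * K * s * (8 * (norm y)\<^sup>2 + 8 * K\<^sup>2)"
  proof (rule mult_left_mono)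
    have "2 * norm y * K \<le> (norm y)\<^sup>2 + K\<^sup>2" by (rule sum_squares_bound)
    then show "X\<^sup>2 \<le> 8 * (norm y)\<^sup>2 + 8 * K\<^sup>2"
      by (simp add: X_def power2_sum power_mult_distrib)
  qed (use K0 s0 in auto)
  also have "\<dots> = 144 * (K * s * ((norm y)\<^sup>2 + K\<^sup>2))" by (simp add: algebra_simps)
  also have "\<dots> \<le> 400 * (K * s * ((norm y)\<^sup>2 + K\<^sup>2))"
    using K0 s0 by (intro mult_right_mono) auto
  finally show ?thesis
    using True T_B[OF True] by (simp add: power2_norm_eq_inner mult_ac \<kappa>B_def EB_def)
qed

lemma Q_hat:
  assumes p: "p \<in> G"
  shows "\<bar>Q (hat p) - Q p\<bar> \<le> 400 * K * s * ((nrm p)\<^sup>2 + K\<^sup>2 * m1\<^sup>2)"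
proof -
  interpret finite_measure M by (rule fin)
  note L = G_L2[OF p] and hL = G_L2[OF hat_G[OF p]]
  note tr = transform[OF Q_integrable[OF hL], unfolded pull_pair_Ti_T]
  let ?h = "\<lambda>x. d x * (\<kappa>B (T x) * (norm (fst (Rm x (p x)) - EB (T x)))\<^sup>2) - \<kappa>B x * (norm (fst (p x) - EB x))\<^sup>2"
  have ih: "integrable M ?h" using tr(1) Q_integrable[OF L] by simp
  have "\<bar>LINT x|M. ?h x\<bar> \<le> (LINT x|M. \<bar>?h x\<bar>)"
    using integral_norm_bound[of M ?h] by simp
  also have "\<dots> \<le> (LINT x|M. 400 * K * s * ((norm (p x))\<^sup>2 + K\<^sup>2))"
    using ih L2_integrable[OF L] by (intro integral_mono Q_hat_pointwise) auto
  also have "\<dots> = 400 * K * s * ((nrm p)\<^sup>2 + K\<^sup>2 * m1\<^sup>2)"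
    using L2_integrable[OF L] by (simp add: L2norm_sq algebra_simps)
  finally show ?thesis
    using tr Q_integrable[OF L] by (simp add: Q_def)
qed

text \<open>The volume of the image is the integral over \<omega> of the determinant, which differs
  from 1 by at most \<open>15 s\<close>.\<close>

lemma measure_estimate:
  assumes \<omega>: "open \<omega>" "\<omega> \<subseteq> \<Omega>" and \<omega>': "open (T ` \<omega>)" "T ` \<omega> \<subseteq> \<Omega>"
  shows "\<bar>measure lebesgue (T ` \<omega>) - measure lebesgue \<omega>\<bar> \<le> 15 * s * m1\<^sup>2"
proof -
  interpret finite_measure M by (rule fin)
  have sets: "\<omega> \<in> sets M" "T ` \<omega> \<in> sets M" using open_sets_M \<omega> \<omega>' by auto
  have me: "measure lebesgue W = (LINT x|M. indicator W x)" if "W \<in> sets M" "W \<subseteq> \<Omega>" for W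
  proof -
    have "(LINT x|M. indicator W x) = measure M W"
      unfolding Bochner_Integration.integral_indicator using that by (intro arg_cong[of _ _ "measure M"]) auto
    then show ?thesis using \<Omega>_sets that by (subst (asm) measure_restrict_space) auto
  qed
  have int: "integrable M (indicator W :: _ \<Rightarrow> real)" if "W \<in> sets M" for W
    using that emeasure_finite[of W] by (intro integrable_real_indicator) (auto simp: less_top[symmetric])
  have ind: "indicator (T ` \<omega>) (T x) = (indicator \<omega> x :: real)" for x
    by (simp add: indicator_def T_mem_iff)
  note tr = transform[OF int[OF sets(2)], unfolded ind]
  have "\<bar>measure lebesgue (T ` \<omega>) - measure lebesgue \<omega>\<bar> = \<bar>LINT x|M. d x * indicator \<omega> x - indicator \<omega> x\<bar>"
    using tr int[OF sets(1)] me[OF sets(1) \<omega>(2)] me[OF sets(2) \<omega>'(2)] by simp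
  also have "\<dots> \<le> (LINT x|M. \<bar>d x * indicator \<omega> x - indicator \<omega> x\<bar>)"
    using integral_norm_bound[of M "\<lambda>x. d x * indicator \<omega> x - indicator \<omega> x"] by simp
  also have "\<dots> \<le> (LINT x|M. 15 * s)"
  proof (rule integral_mono)
    show "\<bar>d x * indicator \<omega> x - indicator \<omega> x\<bar> \<le> 15 * s" for x
      using det_T[of x] s0 by (cases "x \<in> \<omega>") auto
  qed (use tr(1) int[OF sets(1)] in auto)
  also have "\<dots> = 15 * s * m1\<^sup>2" by (simp add: m1_sq)
  finally show ?thesis .
qed

text \<open>The transported state is the intermediate point: \<open>Q_hat\<close> leads from the old
  state to it, \<open>state_estimate\<close> with \<open>Q_diff\<close> from there to the new
  state.\<close>

lemma J_estimate:
  assumes \<gamma>: "\<gamma> > 0" and \<omega>: "open \<omega>" "\<omega> \<subseteq> \<Omega>" and \<omega>': "open (T ` \<omega>)" "T ` \<omega> \<subseteq> \<Omega>"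
  shows "\<bar>J \<gamma> (T ` \<omega>) - J \<gamma> \<omega>\<bar> \<le> C2 * s"
proof -
  let ?p = "st \<gamma> \<omega>" and ?p' = "st \<gamma> (T ` \<omega>)"
  note pG = st_works(1)[OF \<gamma> \<omega>] and p'G = st_works(1)[OF \<gamma> \<omega>']
  note L = G_L2[OF pG] G_L2[OF p'G] G_L2[OF hat_G[OF pG]]
  have P: "nrm ?p \<le> P0" "nrm ?p' \<le> P0"
    using st_bound[OF \<gamma> \<omega>] st_bound[OF \<gamma> \<omega>'] by (auto simp: P0_def)
  have hP: "nrm (hat ?p) \<le> 6 * P0" using hat_nrm[OF L(1)] P(1) by linarith
  have K0: "K \<ge> 0" using K by simp
  have "C1 \<ge> 0" unfolding C1_def using c K j P0_nonneg by auto
  have "\<bar>Q ?p' - Q (hat ?p)\<bar> \<le> K * nrm (\<lambda>x. ?p' x - hat ?p x) * (nrm ?p' + nrm (hat ?p) + 2 * K * m1)"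
    by (rule Q_diff[OF L(2,3)])
  also have "\<dots> \<le> (K * (C1 * s)) * (7 * P0 + 2 * K * m1)"
    using K0 P hP P0_nonneg s0 \<open>C1 \<ge> 0\<close> by (intro mult_mono mult_left_mono state_estimate[OF \<gamma> \<omega> \<omega>']) auto
  finally have 1: "\<bar>Q ?p' - Q (hat ?p)\<bar> \<le> s * (K * C1 * (7 * P0 + 2 * K * m1))" by (simp add: mult_ac)
  have "\<bar>Q (hat ?p) - Q ?p\<bar> \<le> 400 * K * s * ((nrm ?p)\<^sup>2 + K\<^sup>2 * m1\<^sup>2)" by (rule Q_hat[OF pG])
  also have "\<dots> \<le> 400 * K * s * (P0\<^sup>2 + K\<^sup>2 * m1\<^sup>2)"
    using K0 s0 P(1) by (intro mult_left_mono add_right_mono power_mono) auto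
  finally have 2: "\<bar>Q (hat ?p) - Q ?p\<bar> \<le> 2 * (s * (200 * K * (P0\<^sup>2 + K\<^sup>2 * m1\<^sup>2)))" by (simp add: mult_ac)
  have 3: "\<bar>measure lebesgue (T ` \<omega>) - measure lebesgue \<omega>\<bar> \<le> s * (15 * m1\<^sup>2)"
    using measure_estimate[OF \<omega> \<omega>'] by (simp add: mult_ac)
  have 4: "0 \<le> s * (K * C1 * (7 * P0 + 2 * K * m1))"
    using K0 s0 \<open>C1 \<ge> 0\<close> P0_nonneg by auto
  have "C2 * s = s * (K * C1 * (7 * P0 + 2 * K * m1)) + s * (200 * K * (P0\<^sup>2 + K\<^sup>2 * m1\<^sup>2)) + s * (15 * m1\<^sup>2)"
    by (simp add: C2_def algebra_simps)
  then show ?thesis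
    unfolding J_eq using 1 2 3 4 by (simp add: abs_le_iff)
qed

end

section \<open>Flows of Lipschitz fields\<close>

lemma primitive_exists:
  fixes g :: "real \<Rightarrow> vec3"
  assumes g: "continuous_on UNIV g"
  obtains F where "F 0 = 0" "\<And>t. (F has_vector_derivative g t) (at t)"
proof
  let ?F = "\<lambda>u. LBINT y=0..ereal u. g y"
  show "?F 0 = 0" by (simp add: zero_ereal_def)
  fix t :: real
  \<comment> \<open>An interval with 0 and \<open>t\<close> in its interior, so that the derivative
    within it is the two-sided one.\<close>
  let ?a = "- \<bar>t\<bar> - 1" and ?b = "\<bar>t\<bar> + 1"
  have "(?F has_vector_derivative g t) (at t within {?a..?b})"
    using interval_integral_FTC2[of ?a 0 ?b g t] continuous_on_subset[OF g]
    by (simp add: zero_ereal_def)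
  moreover have "t \<in> interior {?a..?b}" by auto
  ultimately show "(?F has_vector_derivative g t) (at t)"
    by (metis at_within_interior)
qed

lemma has_vector_derivative_reflect:
  fixes x :: "real \<Rightarrow> 'a::real_normed_vector"
  assumes "\<And>t. (x has_vector_derivative x' t) (at t)"
  shows "((\<lambda>t. x (- t)) has_vector_derivative - x' (- t)) (at t)"
proof -
  have "((\<lambda>t::real. - t) has_vector_derivative - 1) (at t)"
    by (auto intro!: derivative_eq_intros)
  from vector_diff_chain_at[OF this assms[of "- t"]] show ?thesis by (simp add: o_def)
qed

text \<open>Integrating an exponential of rate \<open>L\<close> gains the factor
  \<open>1 / L\<close>, which makes the Picard operator a contraction on the whole line. Negative
  times follow by reflection.\<close>

lemma exponential_growth_bound:
  fixes F :: "real \<Rightarrow> vec3"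
  assumes F: "F 0 = 0" "\<And>t. (F has_vector_derivative g t) (at t)"
    and L: "L > 0" and g: "\<And>t. norm (g t) \<le> D * exp (L * \<bar>t\<bar>)" and D: "D \<ge> 0"
  shows "norm (F t) \<le> D / L * exp (L * \<bar>t\<bar>)"
proof -
  have pos: "norm (H r) \<le> D / L * exp (L * r)" if r: "r \<ge> 0" "H 0 = 0" "\<And>t. (H has_vector_derivative h t) (at t)"
    "\<And>t. norm (h t) \<le> D * exp (L * \<bar>t\<bar>)" for H h :: "real \<Rightarrow> vec3" and r
  proof (cases "r = 0")
    case True
    then show ?thesis using D L r(2) by simp
  next
    case False
    have "norm (H r - H 0) \<le> D / L * exp (L * r) - D / L * exp (L * 0)"
    proof (rule differentiable_bound_general[where f' = h and \<phi>' = "\<lambda>t. D * exp (L * t)"])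
      show "0 < r" using False r(1) by simp
      show "continuous_on {0..r} H"
        using r(3) by (meson continuous_at_imp_continuous_on has_vector_derivative_continuous)
      show "continuous_on {0..r} (\<lambda>t. D / L * exp (L * t))" by (intro continuous_intros)
      show "((\<lambda>t. D / L * exp (L * t)) has_vector_derivative D * exp (L * x)) (at x)" for x
        unfolding has_real_derivative_iff_has_vector_derivative[symmetric]
        using L by (auto intro!: derivative_eq_intros)
      show "norm (h x) \<le> D * exp (L * x)" if "0 < x" for x
        using r(4)[of x] that by simp
    qed (use r(3) in auto)
    moreover have "D / L \<ge> 0" using D L by simp
    ultimately show ?thesis using r(2) by simp
  qed
  show ?thesis
  proof (cases "t \<ge> 0")
    case True
    then show ?thesis using pos[OF True F g] by simp
  next
    case False
    have "norm (F (- (- t))) \<le> D / L * exp (L * (- t))"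
      by (rule pos[where H = "\<lambda>t. F (- t)" and h = "\<lambda>t. - g (- t)"])
         (use False F g has_vector_derivative_reflect[OF F(2)] g[of "- s" for s] in auto)
    then show ?thesis using False by simp
  qed
qed

text \<open>Picard iteration for all times at once. The unknown is the displacement
  \<open>x t - X\<close> divided by \<open>exp(2 K \<bar>t\<bar>)\<close>, a bounded continuous
  function; in this weighted norm the integral operator has Lipschitz constant
  \<open>K / (2 K)\<close>, which is one half.\<close>

lemma ode_solution_exists:
  fixes \<theta> :: "vec3 \<Rightarrow> vec3"
  assumes K: "K > 0" and lip: "\<And>x y. norm (\<theta> x - \<theta> y) \<le> K * norm (x - y)" and bound: "\<And>x. norm (\<theta> x) \<le> b"
  obtains x where "x 0 = X" "\<And>t. (x has_vector_derivative \<theta> (x t)) (at t)"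
proof -
  have b: "b \<ge> 0" using order_trans[OF norm_ge_zero bound] .
  have cont\<theta>: "continuous_on UNIV \<theta>"
    by (rule lipschitz_on_continuous_on[of K]) (use K lip in \<open>auto intro!: lipschitz_onI simp: dist_norm\<close>)
  let ?w = "\<lambda>t::real. exp (2 * K * \<bar>t\<bar>)"
  define g where "g y s = \<theta> (X + ?w s *\<^sub>R apply_bcontfun y s)" for y :: "real \<Rightarrow>\<^sub>C vec3" and s
  have contg: "continuous_on UNIV (g y)" for y
    unfolding g_def[abs_def] by (intro continuous_on_compose2[OF cont\<theta>] continuous_intros) auto
  have "\<exists>F. F 0 = 0 \<and> (\<forall>t. (F has_vector_derivative g y t) (at t))" for y
    using primitive_exists[OF contg] by metis
  then obtain F where F: "\<And>y. F y 0 = 0" "\<And>y t. (F y has_vector_derivative g y t) (at t)" by metis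
  define \<Phi> where "\<Phi> y t = (1 / ?w t) *\<^sub>R F y t" for y t
  have "\<Phi> y \<in> bcontfun" for y
  proof (rule bcontfun_normI)
    have "continuous_on UNIV (F y)"
      using F(2) by (meson continuous_at_imp_continuous_on has_vector_derivative_continuous)
    then show "continuous_on UNIV (\<Phi> y)"
      unfolding \<Phi>_def[abs_def] by (intro continuous_intros) auto
    show "norm (\<Phi> y t) \<le> b / (2 * K)" for t
    proof -
      have "norm (g y s) \<le> b * ?w s" for s
        using bound[of "X + ?w s *\<^sub>R apply_bcontfun y s"] mult_left_mono[of 1 "?w s" b] b K
        unfolding g_def by simp
      from exponential_growth_bound[OF F(1,2) _ this b] K have "norm (F y t) \<le> b / (2 * K) * ?w t" by simp
      then show ?thesis by (simp add: \<Phi>_def pos_divide_le_eq)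
    qed
  qed
  then have app: "apply_bcontfun (Bcontfun (\<Phi> y)) = \<Phi> y" for y by (simp add: Bcontfun_inverse)
  have "\<exists>!y. Bcontfun (\<Phi> y) = y"
  proof (rule banach_fix_type[of "1/2"])
    show "\<forall>y z. dist (Bcontfun (\<Phi> y)) (Bcontfun (\<Phi> z)) \<le> 1 / 2 * dist y z"
    proof (intro allI dist_bound)
      fix y z :: "real \<Rightarrow>\<^sub>C vec3" and t
      let ?D = "dist y z"
      have "norm (g y s - g z s) \<le> (K * ?D) * ?w s" for s
      proof -
        have "norm (g y s - g z s) \<le> K * norm (?w s *\<^sub>R apply_bcontfun y s - ?w s *\<^sub>R apply_bcontfun z s)"
          unfolding g_def using lip[of "X + ?w s *\<^sub>R apply_bcontfun y s" "X + ?w s *\<^sub>R apply_bcontfun z s"] by simp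
        also have "\<dots> = K * (?w s * dist (apply_bcontfun y s) (apply_bcontfun z s))"
          by (simp add: dist_norm scaleR_diff_right[symmetric])
        also have "\<dots> \<le> K * (?w s * ?D)"
          using K by (intro mult_left_mono dist_bounded) auto
        finally show ?thesis by (simp add: mult_ac)
      qed
      from exponential_growth_bound[OF _ has_vector_derivative_diff[OF F(2) F(2)] _ this] F(1) K
      have "norm (F y t - F z t) \<le> (K * ?D) / (2 * K) * ?w t" by simp
      then have "norm (F y t - F z t) \<le> 1 / 2 * ?D * ?w t" using K by simp
      then show "dist (apply_bcontfun (Bcontfun (\<Phi> y)) t) (apply_bcontfun (Bcontfun (\<Phi> z)) t) \<le> 1 / 2 * ?D"
        unfolding app by (simp add: \<Phi>_def dist_norm scaleR_diff_right[symmetric] pos_divide_le_eq)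
    qed
  qed auto
  then obtain y where "Bcontfun (\<Phi> y) = y" by blast
  then have y: "apply_bcontfun y t = (1 / ?w t) *\<^sub>R F y t" for t
    using app[of y] by (simp add: \<Phi>_def)
  show ?thesis
  proof
    show "X + F y 0 = X" using F(1) by simp
    fix t
    have "g y t = \<theta> (X + F y t)" by (simp add: g_def y)
    then show "((\<lambda>t. X + F y t) has_vector_derivative \<theta> (X + F y t)) (at t)"
      using F(2)[of y t] has_vector_derivative_add[OF has_vector_derivative_const] by fastforce
  qed
qed

text \<open>For positive times the squared distance of the solutions times
  \<open>exp(- 2 K s)\<close> is nonincreasing, since the Lipschitz bound controls the inner product
  in its derivative. Time reversal gives the negative times.\<close>

lemma ode_gronwall:
  fixes \<theta> :: "vec3 \<Rightarrow> vec3"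
  assumes K: "K > 0" and lip: "\<And>x y. norm (\<theta> x - \<theta> y) \<le> K * norm (x - y)"
    and x: "\<And>t. (x has_vector_derivative \<theta> (x t)) (at t)" and y: "\<And>t. (y has_vector_derivative \<theta> (y t)) (at t)"
  shows "norm (x t - y t) \<le> exp (K * \<bar>t\<bar>) * norm (x 0 - y 0)"
proof -
  have pos: "norm (x t - y t) \<le> exp (K * t) * norm (x 0 - y 0)" if t: "t \<ge> 0"
    and x: "\<And>t. (x has_vector_derivative \<theta> (x t)) (at t)" and y: "\<And>t. (y has_vector_derivative \<theta> (y t)) (at t)"
    and lip: "\<And>x y. norm (\<theta> x - \<theta> y) \<le> K * norm (x - y)" for \<theta> :: "vec3 \<Rightarrow> vec3" and x y :: "real \<Rightarrow> vec3" and t :: real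
  proof -
    define w where "w s = exp (- (2 * K * s)) * ((x s - y s) \<bullet> (x s - y s))" for s
    let ?w' = "\<lambda>s. exp (- (2 * K * s)) * (2 * ((x s - y s) \<bullet> (\<theta> (x s) - \<theta> (y s)))) + - (2 * K) * exp (- (2 * K * s)) * ((x s - y s) \<bullet> (x s - y s))"
    have "(w has_real_derivative ?w' s) (at s)" for s
    proof -
      have d: "((\<lambda>s. x s - y s) has_derivative (\<lambda>h. h *\<^sub>R (\<theta> (x s) - \<theta> (y s)))) (at s)"
        using has_vector_derivative_diff[OF x y] by (simp add: has_vector_derivative_def)
      have "((\<lambda>s. (x s - y s) \<bullet> (x s - y s)) has_real_derivative 2 * ((x s - y s) \<bullet> (\<theta> (x s) - \<theta> (y s)))) (at s)"
        unfolding has_field_derivative_def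
        by (rule has_derivative_eq_rhs[OF has_derivative_inner[OF d d]])
           (auto simp: fun_eq_iff inner_commute algebra_simps)
      moreover have "((\<lambda>s. exp (- (2 * K * s))) has_real_derivative - (2 * K) * exp (- (2 * K * s))) (at s)"
        by (auto intro!: derivative_eq_intros)
      ultimately show ?thesis
        unfolding w_def[abs_def] using DERIV_mult by (fastforce simp: algebra_simps)
    qed
    moreover have "?w' s \<le> 0" for s
    proof -
      have "(x s - y s) \<bullet> (\<theta> (x s) - \<theta> (y s)) \<le> norm (x s - y s) * norm (\<theta> (x s) - \<theta> (y s))"
        by (rule norm_cauchy_schwarz)
      also have "\<dots> \<le> norm (x s - y s) * (K * norm (x s - y s))" by (intro mult_left_mono lip) auto
      finally have "(x s - y s) \<bullet> (\<theta> (x s) - \<theta> (y s)) \<le> K * ((x s - y s) \<bullet> (x s - y s))"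
        by (simp add: power2_norm_eq_inner[symmetric] power2_eq_square mult_ac)
      then have "exp (- (2 * K * s)) * (2 * ((x s - y s) \<bullet> (\<theta> (x s) - \<theta> (y s)))) \<le> exp (- (2 * K * s)) * (2 * (K * ((x s - y s) \<bullet> (x s - y s))))"
        by (intro mult_left_mono) auto
      then show ?thesis by (simp add: algebra_simps)
    qed
    ultimately have "w t \<le> w 0" using t by (intro DERIV_nonpos_imp_nonincreasing[of 0 t w]) blast+
    then have "exp (- (2 * K * t)) * (norm (x t - y t))\<^sup>2 \<le> (norm (x 0 - y 0))\<^sup>2"
      by (simp add: w_def power2_norm_eq_inner)
    then have "exp (2 * K * t) * (exp (- (2 * K * t)) * (norm (x t - y t))\<^sup>2) \<le> exp (2 * K * t) * (norm (x 0 - y 0))\<^sup>2"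
      by (intro mult_left_mono) auto
    then have "(norm (x t - y t))\<^sup>2 \<le> exp (2 * K * t) * (norm (x 0 - y 0))\<^sup>2"
      by (simp add: mult.assoc[symmetric] exp_add[symmetric])
    also have "exp (2 * K * t) = (exp (K * t))\<^sup>2" by (simp add: power2_eq_square exp_add[symmetric])
    finally have "(norm (x t - y t))\<^sup>2 \<le> (exp (K * t) * norm (x 0 - y 0))\<^sup>2" by (simp add: power_mult_distrib)
    then show ?thesis by (rule power2_le_imp_le) simp
  qed
  show ?thesis
  proof (cases "t \<ge> 0")
    case True
    then show ?thesis using pos[OF True x y lip] by simp
  next
    case False
    have "norm (x (- (- t)) - y (- (- t))) \<le> exp (K * (- t)) * norm (x (- 0) - y (- 0))"
    proof (rule pos[where \<theta> = "\<lambda>x. - \<theta> x" and x = "\<lambda>t. x (- t)" and y = "\<lambda>t. y (- t)"])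
      show "norm (- \<theta> a - - \<theta> b) \<le> K * norm (a - b)" for a b
        using lip[of b a] by (simp add: norm_minus_commute)
    qed (use False has_vector_derivative_reflect[OF x] has_vector_derivative_reflect[OF y] in auto)
    then show ?thesis using False by simp
  qed
qed

text \<open>\<open>flow\<close> is a definite description, and Gronwall's inequality supplies the
  uniqueness that gives it meaning.\<close>

lemma flow_solution:
  fixes \<theta> :: "vec3 \<Rightarrow> vec3"
  assumes K: "K > 0" and lip: "\<And>x y. norm (\<theta> x - \<theta> y) \<le> K * norm (x - y)" and bound: "\<And>x. norm (\<theta> x) \<le> b"
    and x: "\<And>t. (x has_vector_derivative \<theta> (x t)) (at t)"
  shows "flow \<theta> t (x 0) = x t"
proof -
  have "(THE y. y 0 = x 0 \<and> (\<forall>s. (y has_vector_derivative \<theta> (y s)) (at s))) = x"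
  proof (rule the_equality)
    fix y assume y: "y 0 = x 0 \<and> (\<forall>s. (y has_vector_derivative \<theta> (y s)) (at s))"
    show "y = x"
    proof
      fix t show "y t = x t"
        using ode_gronwall[OF K lip, of y x t] x y by simp
    qed
  qed (use x in auto)
  then show ?thesis by (simp add: flow_def)
qed

text \<open>Not the flow but its displacement must be small in the Lipschitz sense. Its difference
  at two points is the time integral of \<open>\<theta> (x s) - \<theta> (y s)\<close>, which is of
  order \<open>t\<close>; zeros of \<open>\<theta>\<close> are rest points.\<close>

lemma flow_displacement:
  fixes \<theta> :: "vec3 \<Rightarrow> vec3"
  assumes K: "K > 0" and lip: "\<And>x y. norm (\<theta> x - \<theta> y) \<le> K * norm (x - y)" and bound: "\<And>x. norm (\<theta> x) \<le> K"
    and t: "t \<ge> 0"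
  shows "norm (flow \<theta> t X - X) \<le> K * t"
    "norm ((flow \<theta> t X - X) - (flow \<theta> t Y - Y)) \<le> K * t * exp (K * t) * norm (X - Y)"
    "\<theta> X = 0 \<Longrightarrow> flow \<theta> t X = X"
proof -
  obtain x where x: "x 0 = X" "\<And>t. (x has_vector_derivative \<theta> (x t)) (at t)"
    using ode_solution_exists[OF K lip bound] by blast
  obtain y where y: "y 0 = Y" "\<And>t. (y has_vector_derivative \<theta> (y t)) (at t)"
    using ode_solution_exists[OF K lip bound] by blast
  have fx: "flow \<theta> t X = x t" and fy: "flow \<theta> t Y = y t"
    using flow_solution[OF K lip bound x(2), of t] flow_solution[OF K lip bound y(2), of t] x(1) y(1) by auto
  have mvt: "norm (z t - z 0) \<le> C * t" if "\<And>s. (z has_vector_derivative z' s) (at s)" "\<And>s. 0 \<le> s \<Longrightarrow> s \<le> t \<Longrightarrow> norm (z' s) \<le> C" for z z' :: "real \<Rightarrow> vec3" and C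
  proof -
    have "norm (z t - z 0) \<le> C * t - C * 0" if "0 < t"
    proof (rule differentiable_bound_general[where f' = z' and \<phi>' = "\<lambda>t. C", OF that])
      show "continuous_on {0..t} z"
        using \<open>\<And>s. (z has_vector_derivative z' s) (at s)\<close>
        by (meson continuous_at_imp_continuous_on has_vector_derivative_continuous)
      show "((\<lambda>t. C * t) has_vector_derivative C) (at x)" for x
        unfolding has_real_derivative_iff_has_vector_derivative[symmetric]
        by (auto intro!: derivative_eq_intros)
    qed (use that \<open>\<And>s. (z has_vector_derivative z' s) (at s)\<close> \<open>\<And>s. 0 \<le> s \<Longrightarrow> s \<le> t \<Longrightarrow> norm (z' s) \<le> C\<close> in
      \<open>auto intro!: continuous_intros\<close>)
    then show ?thesis using t by (cases "t = 0") auto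
  qed
  show "norm (flow \<theta> t X - X) \<le> K * t"
    using mvt[OF x(2) bound] by (simp add: fx x(1))
  have "norm ((x t - y t) - (x 0 - y 0)) \<le> (K * (exp (K * t) * norm (X - Y))) * t"
  proof (rule mvt[OF has_vector_derivative_diff[OF x(2) y(2)]])
    fix s assume s: "0 \<le> s" "s \<le> t"
    have "norm (x s - y s) \<le> exp (K * s) * norm (X - Y)"
      using ode_gronwall[OF K lip x(2) y(2), of s] s x(1) y(1) by simp
    also have "\<dots> \<le> exp (K * t) * norm (X - Y)"
      using s K by (intro mult_right_mono) auto
    finally have "K * norm (x s - y s) \<le> K * (exp (K * t) * norm (X - Y))" using K by (intro mult_left_mono) auto
    then show "norm (\<theta> (x s) - \<theta> (y s)) \<le> K * (exp (K * t) * norm (X - Y))"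
      using lip order_trans by blast
  qed
  then show "norm ((flow \<theta> t X - X) - (flow \<theta> t Y - Y)) \<le> K * t * exp (K * t) * norm (X - Y)"
    by (simp add: fx fy x(1) y(1) algebra_simps)
  show "flow \<theta> t X = X" if "\<theta> X = 0"
    using flow_solution[OF K lip bound, of "\<lambda>_. X" t] that by simp
qed

section \<open>Mollification\<close>

text \<open>All derivatives fall on the kernel, so the induction is over all smooth kernels
  \<open>\<rho>\<close> at once while the continuous factor \<open>v\<close> stays
  untouched.\<close>

lemma Ck_convolution:
  fixes \<rho> :: "vec3 \<Rightarrow> real" and v :: "vec3 \<Rightarrow> vec3"
  assumes \<rho>: "\<And>k. Ck k \<rho>" and v: "continuous_on UNIV v"
  shows "Ck k (\<lambda>x. integral (cbox a b) (\<lambda>y. \<rho> (y - x) *\<^sub>R v y))"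
  using \<rho>
proof (induction k arbitrary: \<rho>)
  have cont: "continuous_on UNIV (\<lambda>x. integral (cbox a b) (\<lambda>y. \<rho> (y - x) *\<^sub>R v y))"
    and der: "((\<lambda>x. integral (cbox a b) (\<lambda>y. \<rho> (y - x) *\<^sub>R v y)) has_derivative
       (\<lambda>w. integral (cbox a b) (\<lambda>y. (- frechet_derivative \<rho> (at (y - x)) w) *\<^sub>R v y))) (at x)"
    if \<rho>: "\<And>k. Ck k \<rho>" for \<rho> :: "vec3 \<Rightarrow> real" and x
  proof -
    let ?D = "\<lambda>z. frechet_derivative \<rho> (at z)"
    have Dc: "continuous_on UNIV (\<lambda>z. ?D z w)" for w
      using \<rho>[of "Suc 0"] by simp
    have \<rho>c: "continuous_on UNIV \<rho>" using \<rho>[of 0] by simp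
    have bl: "bounded_linear (\<lambda>w. (- ?D z w) *\<^sub>R c)" for z and c :: vec3
      by (intro bounded_linear_scaleR_const bounded_linear_minus has_derivative_bounded_linear[OF Ck_Suc_derivative[OF \<rho>]])
    \<comment> \<open>Leibniz's rule takes the derivative as a bounded operator that depends
      continuously on both variables.\<close>
    define fx where "fx x y = Blinfun (\<lambda>w. (- ?D (y - x) w) *\<^sub>R v y)" for x y
    have fx: "blinfun_apply (fx x y) = (\<lambda>w. (- ?D (y - x) w) *\<^sub>R v y)" for x y
      unfolding fx_def by (rule bounded_linear_Blinfun_apply[OF bl])
    have cfx: "continuous_on (UNIV \<times> cbox a b) (\<lambda>(x, y). fx x y)"
      unfolding split_beta
      by (rule continuous_on_blinfun_componentwise)
         (auto simp: fx intro!: continuous_intros continuous_on_compose2[OF Dc] continuous_on_compose2[OF v])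
    have D: "((\<lambda>x. integral (cbox a b) (\<lambda>y. \<rho> (y - x) *\<^sub>R v y)) has_derivative
       blinfun_apply (integral (cbox a b) (fx x))) (at x)" for x
    proof (rule leibniz_rule[where U = UNIV, simplified])
      fix x y :: vec3
      have "((\<lambda>x. y - x) has_derivative (\<lambda>w. - w)) (at x)" by (auto intro!: derivative_eq_intros)
      from has_derivative_compose[OF this Ck_Suc_derivative[OF \<rho>]]
      have "((\<lambda>x. \<rho> (y - x)) has_derivative (\<lambda>w. ?D (y - x) (- w))) (at x)" .
      then have "((\<lambda>x. \<rho> (y - x) *\<^sub>R v y) has_derivative (\<lambda>w. ?D (y - x) (- w) *\<^sub>R v y)) (at x)"
        by (rule has_derivative_scaleR_left)
      then show "((\<lambda>x. \<rho> (y - x) *\<^sub>R v y) has_derivative blinfun_apply (fx x y)) (at x)"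
        by (simp add: fx linear_neg[OF Ck_linear_derivative[OF \<rho>[of "Suc 0"]]])
      show "(\<lambda>y. \<rho> (y - x) *\<^sub>R v y) integrable_on cbox a b"
        by (intro integrable_continuous continuous_intros continuous_on_compose2[OF \<rho>c] continuous_on_compose2[OF v]) auto
      show "continuous_on (UNIV \<times> cbox a b) (\<lambda>(x, y). fx x y)" by (rule cfx)
    qed
    have "continuous_on (cbox a b) (\<lambda>y. (x, y))" "(\<lambda>y. (x, y)) ` cbox a b \<subseteq> UNIV \<times> cbox a b"
      by (auto intro!: continuous_intros)
    from continuous_on_compose2[OF cfx this] have "fx x integrable_on cbox a b"
      by (intro integrable_continuous) simp
    then have "blinfun_apply (integral (cbox a b) (fx x)) = (\<lambda>w. integral (cbox a b) (\<lambda>y. (- ?D (y - x) w) *\<^sub>R v y))"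
      by (simp add: fun_eq_iff blinfun_apply_integral fx)
    then show "((\<lambda>x. integral (cbox a b) (\<lambda>y. \<rho> (y - x) *\<^sub>R v y)) has_derivative
       (\<lambda>w. integral (cbox a b) (\<lambda>y. (- ?D (y - x) w) *\<^sub>R v y))) (at x)"
      using D[of x] by simp
    show "continuous_on UNIV (\<lambda>x. integral (cbox a b) (\<lambda>y. \<rho> (y - x) *\<^sub>R v y))"
      using D has_derivative_continuous by (blast intro: continuous_at_imp_continuous_on)
  qed
  {
    case 0
    then show ?case using cont by simp
  next
    case (Suc k)
    show ?case
    proof (rule Ck_SucI[OF der[OF Suc.prems]])
      fix w
      show "Ck k (\<lambda>x. integral (cbox a b) (\<lambda>y. (- frechet_derivative \<rho> (at (y - x)) w) *\<^sub>R v y))"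
      proof (rule Suc.IH[where \<rho> = "\<lambda>z. - frechet_derivative \<rho> (at z) w"])
        show "Ck m (\<lambda>z. - frechet_derivative \<rho> (at z) w)" for m
          using Suc.prems[of "Suc m"] by (intro Ck_minus) simp
      qed
    qed
  }
qed

text \<open>Averages of translates of \<open>v\<close> inherit its bound and its Lipschitz constant
  without loss, so the mollified displacement meets the same smallness conditions. The form with
  \<open>v (x + z)\<close> gives the estimates, the form with \<open>\<rho> (y - x)\<close> the
  smoothness.\<close>

lemma mollify:
  fixes v :: "vec3 \<Rightarrow> vec3"
  assumes lip: "\<And>x y. norm (v x - v y) \<le> l * norm (x - y)" and bound: "\<And>x. norm (v x) \<le> l"
    and supp: "compact W" "\<And>x. x \<notin> W \<Longrightarrow> v x = 0" and \<delta>: "\<delta> > 0"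
  obtains w where "\<And>k. Ck k w" "\<And>x y. norm (w x - w y) \<le> l * norm (x - y)" "\<And>x. norm (w x) \<le> l"
    "\<And>x. norm (w x - v x) \<le> l * \<delta>" "\<And>x. (\<And>y. y \<in> cball x \<delta> \<Longrightarrow> y \<notin> W) \<Longrightarrow> w x = 0"
proof -
  have l: "l \<ge> 0" using order_trans[OF norm_ge_zero bound] .
  have vc: "continuous_on UNIV v"
    by (rule lipschitz_on_continuous_on[of l]) (use l lip in \<open>auto intro!: lipschitz_onI simp: dist_norm\<close>)
  let ?b = "ball_bump 0 \<delta>"
  have bc: "continuous_on UNIV ?b" using Ck_ball_bump[of 0] by simp
  have b0: "?b x = 0" if "x \<notin> cball 0 \<delta>" for x
    using that \<delta> by (intro ball_bump_eq_0) auto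
  have ib: "integrable lborel ?b"
    by (rule integrable_continuous_fsupport[OF bc compact_cball b0])
  define m where "m = (LINT x|lborel. ?b x)"
  \<comment> \<open>Otherwise the bump would vanish almost everywhere and an open ball would be
    negligible.\<close>
  have m: "m > 0"
  proof -
    have "m \<noteq> 0"
    proof
      assume "m = 0"
      then have "AE x in lborel. ?b x = 0"
        using ib ball_bump_nonneg by (subst (asm) m_def, subst (asm) integral_nonneg_eq_0_iff_AE) auto
      then have "AE x in lborel. x \<notin> ball (0::vec3) \<delta>"
        by eventually_elim (use ball_bump_pos_iff[of \<delta> 0] \<delta> in \<open>force simp: less_le\<close>)
      then have "emeasure lborel (ball (0::vec3) \<delta>) = 0"
        by (subst (asm) AE_iff_measurable[OF _ refl]) (auto simp: ball_def)
      then have "ball (0::vec3) \<delta> \<in> null_sets lborel" by (intro null_setsI) auto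
      then have "negligible (ball (0::vec3) \<delta>)"
        using negligible_iff_null_sets null_sets_completionI by blast
      then show False using open_not_negligible[of "ball (0::vec3) \<delta>"] \<delta> by auto
    qed
    moreover have "m \<ge> 0" unfolding m_def by (intro Bochner_Integration.integral_nonneg) (rule ball_bump_nonneg)
    ultimately show ?thesis by simp
  qed
  define \<rho> where "\<rho> x = (1 / m) * ?b x" for x
  have \<rho>Ck: "Ck k \<rho>" for k unfolding \<rho>_def[abs_def] by (intro Ck_mult Ck_const Ck_ball_bump)
  have \<rho>c: "continuous_on UNIV \<rho>" using \<rho>Ck[of 0] by simp
  have \<rho>0: "\<rho> x \<ge> 0" for x using m ball_bump_nonneg by (simp add: \<rho>_def)
  have \<rho>z: "\<rho> x = 0" if "x \<notin> cball 0 \<delta>" for x using b0[OF that] by (simp add: \<rho>_def)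
  have \<rho>i: "integrable lborel \<rho>" unfolding \<rho>_def[abs_def] using ib by simp
  have \<rho>1: "(LINT x|lborel. \<rho> x) = 1" unfolding \<rho>_def using m by (simp add: m_def)
  define w where "w x = (LINT z|lborel. \<rho> z *\<^sub>R v (x + z))" for x
  have wi: "integrable lborel (\<lambda>z. \<rho> z *\<^sub>R v (x + z))" for x
    by (rule integrable_continuous_fsupport[OF _ compact_cball[of 0 \<delta>]])
       (auto intro!: continuous_intros \<rho>c continuous_on_compose2[OF vc] simp: \<rho>z)
  have avg: "norm (LINT z|lborel. \<rho> z *\<^sub>R g z) \<le> C"
    if g: "continuous_on UNIV g" "\<And>z. z \<in> cball 0 \<delta> \<Longrightarrow> norm (g z) \<le> C" for g :: "vec3 \<Rightarrow> vec3" and C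
  proof -
    have gi: "integrable lborel (\<lambda>z. \<rho> z *\<^sub>R g z)"
      by (rule integrable_continuous_fsupport[OF _ compact_cball[of 0 \<delta>]])
         (auto intro!: continuous_intros \<rho>c g simp: \<rho>z)
    have "norm (LINT z|lborel. \<rho> z *\<^sub>R g z) \<le> (LINT z|lborel. norm (\<rho> z *\<^sub>R g z))"
      by (rule integral_norm_bound)
    also have "\<dots> \<le> (LINT z|lborel. \<rho> z * C)"
    proof (rule integral_mono)
      show "norm (\<rho> z *\<^sub>R g z) \<le> \<rho> z * C" for z
        using g(2)[of z] \<rho>0[of z] \<rho>z[of z] by (cases "z \<in> cball 0 \<delta>") (auto intro!: mult_left_mono)
    qed (use integrable_norm[OF gi] \<rho>i in auto)
    also have "\<dots> = C" using \<rho>1 by simp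
    finally show ?thesis .
  qed
  show ?thesis
  proof (rule that[of w])
    obtain a c where ac: "W \<subseteq> cbox a c"
      using bounded_subset_cbox_symmetric[OF compact_imp_bounded[OF supp(1)]] by metis
    \<comment> \<open>The substitution \<open>y = x + z\<close> and a box containing
      \<open>W\<close>, outside which \<open>v\<close> vanishes, give the form treated in
      \<open>Ck_convolution\<close>.\<close>
    have "w x = integral (cbox a c) (\<lambda>y. \<rho> (y - x) *\<^sub>R v y)" for x
    proof -
      let ?h = "\<lambda>y. \<rho> (y - x) *\<^sub>R v y"
      have hc: "continuous_on UNIV ?h"
        by (intro continuous_intros continuous_on_compose2[OF \<rho>c] vc) auto
      have hi: "integrable lborel ?h"
        by (rule integrable_continuous_fsupport[OF hc supp(1)]) (simp add: supp(2))
      have "(LINT y|lborel. ?h y) = (LINT y|distr lborel borel ((+) x). ?h y)"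
        by (simp add: lborel_distr_plus)
      also have "\<dots> = (LINT z|lborel. ?h (x + z))"
        by (rule integral_distr) (use borel_measurable_continuous_onI[OF hc] in auto)
      finally have "w x = (LINT y|lborel. ?h y)" by (simp add: w_def)
      also have "\<dots> = integral UNIV ?h"
        using has_integral_integral_lborel[OF hi] by (simp add: integral_unique)
      also have "\<dots> = integral (cbox a c) ?h"
      proof -
        have "(\<lambda>y. if y \<in> cbox a c then ?h y else 0) = ?h"
          using ac supp(2) by (auto simp: fun_eq_iff)
        then show ?thesis using integral_restrict_UNIV[of "cbox a c" ?h] by simp
      qed
      finally show ?thesis .
    qed
    then have "w = (\<lambda>x. integral (cbox a c) (\<lambda>y. \<rho> (y - x) *\<^sub>R v y))" by (rule ext)
    then show "Ck k w" for k
      using Ck_convolution[OF \<rho>Ck vc, of k a c] by simp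
    show "norm (w x) \<le> l" for x
      unfolding w_def by (intro avg continuous_on_compose2[OF vc] continuous_intros bound) auto
    show "norm (w x - w y) \<le> l * norm (x - y)" for x y
    proof -
      have "w x - w y = (LINT z|lborel. \<rho> z *\<^sub>R (v (x + z) - v (y + z)))"
        unfolding w_def using wi by (simp add: scaleR_diff_right)
      moreover have "norm (LINT z|lborel. \<rho> z *\<^sub>R (v (x + z) - v (y + z))) \<le> l * norm (x - y)"
      proof (rule avg)
        show "norm (v (x + z) - v (y + z)) \<le> l * norm (x - y)" for z
          using lip[of "x + z" "y + z"] by simp
      qed (intro continuous_intros continuous_on_compose2[OF vc]; auto)
      ultimately show ?thesis by simp
    qed
    show "norm (w x - v x) \<le> l * \<delta>" for x
    proof -
      have "(LINT z|lborel. \<rho> z *\<^sub>R v x) = v x" using \<rho>1 \<rho>i by simp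
      then have "w x - v x = (LINT z|lborel. \<rho> z *\<^sub>R (v (x + z) - v x))"
        unfolding w_def scaleR_diff_right using wi[of x] \<rho>i by (subst Bochner_Integration.integral_diff) auto
      moreover have "norm (LINT z|lborel. \<rho> z *\<^sub>R (v (x + z) - v x)) \<le> l * \<delta>"
      proof (rule avg)
        show "norm (v (x + z) - v x) \<le> l * \<delta>" if "z \<in> cball 0 \<delta>" for z
          using lip[of "x + z" x] mult_left_mono[of "norm z" \<delta> l] that l by simp
      qed (intro continuous_intros continuous_on_compose2[OF vc]; auto)
      ultimately show ?thesis by simp
    qed
    show "w x = 0" if "\<And>y. y \<in> cball x \<delta> \<Longrightarrow> y \<notin> W" for x
    proof -
      have "norm (w x) \<le> 0"
        unfolding w_def
      proof (rule avg)
        fix z :: vec3 assume "z \<in> cball 0 \<delta>"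
        then have "x + z \<notin> W" by (intro that) (simp add: dist_norm)
        then show "norm (v (x + z)) \<le> 0" by (simp add: supp(2))
      qed (intro continuous_on_compose2[OF vc] continuous_intros; auto)
      then show ?thesis by simp
    qed
  qed
qed

section \<open>Lipschitz sets and fields\<close>

text \<open>The set lies in the image of the hyperplane \<open>y $ 3 = 0\<close> under the Lipschitz
  map \<open>F\<close>, which lifts points to the graph and undoes the rotation.\<close>

lemma negligible_rotated_graph:
  fixes Q :: "vec3 \<Rightarrow> vec3" and g :: "real^2 \<Rightarrow> real"
  assumes Q: "orthogonal_transformation Q" and g: "L-lipschitz_on UNIV g"
  shows "negligible {x. Q (x - p) $ 3 = g (vector [Q (x - p) $ 1, Q (x - p) $ 2])}"
proof -
  have L: "L \<ge> 0" using g by (rule lipschitz_on_nonneg)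
  define F where "F y = p + inv Q (vector [y $ 1, y $ 2, g (vector [y $ 1, y $ 2])])" for y :: vec3
  have oi: "orthogonal_transformation (inv Q)" by (rule orthogonal_transformation_inv[OF Q])
  have "negligible (F ` {y. y $ 3 = 0})"
  proof (rule negligible_locally_Lipschitz_image)
    show "negligible {y :: vec3. y $ 3 = 0}"
      using negligible_standard_hyperplane_cart[of 3] by simp
    have "norm (F y - F z) \<le> (2 + 2 * L) * norm (y - z)" for y z
    proof -
      let ?a = "vector [y $ 1, y $ 2] :: real^2" and ?b = "vector [z $ 1, z $ 2] :: real^2"
      have 2: "norm (?a - ?b) \<le> \<bar>y $ 1 - z $ 1\<bar> + \<bar>y $ 2 - z $ 2\<bar>"
        using norm_le_l1_cart[of "?a - ?b"] by (simp add: sum_2)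
      have 3: "\<bar>g ?a - g ?b\<bar> \<le> L * norm (?a - ?b)"
        using lipschitz_onD[OF g, of ?a ?b] by (simp add: dist_norm)
      have "norm (F y - F z) = norm (vector [y $ 1, y $ 2, g ?a] - vector [z $ 1, z $ 2, g ?b] :: vec3)"
        using orthogonal_transformation_norm[OF oi] linear_diff[OF orthogonal_transformation_linear[OF oi]]
        by (simp add: F_def) metis
      also have "\<dots> \<le> \<bar>y $ 1 - z $ 1\<bar> + \<bar>y $ 2 - z $ 2\<bar> + \<bar>g ?a - g ?b\<bar>"
        using norm_le_l1_cart[of "vector [y $ 1, y $ 2, g ?a] - vector [z $ 1, z $ 2, g ?b] :: vec3"] by (simp add: sum_3)
      also have "\<dots> \<le> (1 + L) * (\<bar>y $ 1 - z $ 1\<bar> + \<bar>y $ 2 - z $ 2\<bar>)"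
        using 3 mult_left_mono[OF 2 L] by (simp add: algebra_simps)
      also have "\<dots> \<le> (1 + L) * (2 * norm (y - z))"
        using L component_le_norm_cart[of "y - z" 1] component_le_norm_cart[of "y - z" 2] by (intro mult_left_mono) auto
      finally show ?thesis by (simp add: algebra_simps)
    qed
    then show "\<exists>T B. open T \<and> x \<in> T \<and> (\<forall>y\<in>{y. y $ 3 = 0} \<inter> T. norm (F y - F x) \<le> B * norm (y - x))" for x
      by (intro exI[of _ UNIV] exI[of _ "2 + 2 * L"]) auto
  qed simp
  moreover have "{x. Q (x - p) $ 3 = g (vector [Q (x - p) $ 1, Q (x - p) $ 2])} \<subseteq> F ` {y. y $ 3 = 0}"
  proof
    fix x assume "x \<in> {x. Q (x - p) $ 3 = g (vector [Q (x - p) $ 1, Q (x - p) $ 2])}"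
    then have x: "Q (x - p) $ 3 = g (vector [Q (x - p) $ 1, Q (x - p) $ 2])" by simp
    let ?y = "vector [Q (x - p) $ 1, Q (x - p) $ 2, 0] :: vec3"
    have "vector [?y $ 1, ?y $ 2, g (vector [?y $ 1, ?y $ 2])] = Q (x - p)"
      by (simp add: vec_eq_iff forall_3 x)
    then have "F ?y = x"
      unfolding F_def using inv_f_f[OF orthogonal_transformation_inj[OF Q]] by simp
    then show "x \<in> F ` {y. y $ 3 = 0}" by (intro image_eqI[of _ _ ?y]) auto
  qed
  ultimately show ?thesis by (rule negligible_subset)
qed

text \<open>Near each of its points the frontier lies in the zero set of \<open>h\<close>: the set
  is open, so frontier points are not below the graph, and a point strictly above the graph has a
  neighbourhood free of \<omega>.\<close>

lemma lipschitz_set_frontier_negligible: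
  assumes "lipschitz_set L \<omega>"
  shows "negligible (frontier \<omega>)"
proof (subst locally_negligible_alt, rule ballI)
  fix p assume "p \<in> frontier \<omega>"
  then obtain Q :: "vec3 \<Rightarrow> vec3" and g :: "real^2 \<Rightarrow> real" and r
    where Q: "orthogonal_transformation Q" and g: "L-lipschitz_on UNIV g" and r: "r > 0"
    and \<omega>: "\<And>x. x \<in> ball p r \<Longrightarrow> x \<in> \<omega> \<longleftrightarrow> Q (x - p) $ 3 < g (vector [Q (x - p) $ 1, Q (x - p) $ 2])"
    using assms unfolding lipschitz_set_def by blast
  define h where "h x = Q (x - p) $ 3 - g (vector [Q (x - p) $ 1, Q (x - p) $ 2])" for x
  have Qc: "continuous_on UNIV Q"
    using linear_continuous_on[OF linear_conv_bounded_linear[THEN iffD1, OF orthogonal_transformation_linear[OF Q]]] .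
  define a where "a x = (vector [Q (x - p) $ 1, Q (x - p) $ 2] :: real^2)" for x
  have Qp: "continuous_on UNIV (\<lambda>x. Q (x - p) $ i)" for i
    by (intro continuous_intros continuous_on_compose2[OF Qc]) auto
  have "continuous_on UNIV (\<lambda>x. a x $ i)" for i
    using exhaust_2[of i] Qp by (auto simp: a_def)
  then have ac: "continuous_on UNIV a"
    using continuous_on_vec_lambda[of UNIV "\<lambda>i x. a x $ i"] by simp
  have hc: "continuous_on UNIV h"
    unfolding h_def[abs_def] a_def[symmetric]
    by (intro continuous_on_diff Qp continuous_on_compose2[OF lipschitz_on_continuous_on[OF g] ac]) auto
  have "frontier \<omega> \<inter> ball p r \<subseteq> {x. h x = 0}"
  proof
    fix x assume x: "x \<in> frontier \<omega> \<inter> ball p r"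
    have op: "open \<omega>" using assms by (simp add: lipschitz_set_def)
    then have "x \<notin> \<omega>" using x by (simp add: frontier_def interior_open)
    then have "h x \<ge> 0" using \<omega>[of x] x by (simp add: h_def)
    moreover have "\<not> h x > 0"
    proof
      assume "h x > 0"
      moreover have "open {x. h x > 0}" using hc by (simp add: open_Collect_less continuous_on_const)
      ultimately have "open ({x. h x > 0} \<inter> ball p r)" "x \<in> {x. h x > 0} \<inter> ball p r" using x by auto
      moreover have "x \<in> closure \<omega>" using x by (simp add: frontier_def)
      ultimately obtain y where "y \<in> \<omega>" "h y > 0" "y \<in> ball p r"
        using open_Int_closure_eq_empty by blast
      then show False using \<omega>[of y] by (simp add: h_def)
    qed
    ultimately show "x \<in> {x. h x = 0}" by simp
  qed
  then have "negligible (frontier \<omega> \<inter> ball p r)"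
    using negligible_subset[OF negligible_rotated_graph[OF Q g, of p]] by (simp add: h_def)
  moreover have "openin (top_of_set (frontier \<omega>)) (frontier \<omega> \<inter> ball p r)" by (simp add: openin_open_Int)
  ultimately show "\<exists>U. openin (top_of_set (frontier \<omega>)) U \<and> p \<in> U \<and> negligible U"
    using \<open>p \<in> frontier \<omega>\<close> r by (intro exI[of _ "frontier \<omega> \<inter> ball p r"]) auto
qed

text \<open>A segment from the support of \<open>\<theta>\<close> to its complement meets the
  frontier of the support, which lies in \<open>B\<close> and where \<open>\<theta>\<close> vanishes
  by approximation from outside. Applying the bound between the first endpoint and that point covers
  the mixed case, whether or not the segment stays in \<open>B\<close>.\<close>

lemma lipschitz_extend_zero:
  fixes \<theta> :: "vec3 \<Rightarrow> vec3"
  assumes B: "open B" "fsupport \<theta> \<subseteq> B" and k: "k \<ge> 0"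
    and lip: "\<And>x y. x \<in> B \<Longrightarrow> y \<in> B \<Longrightarrow> norm (\<theta> x - \<theta> y) \<le> k * norm (x - y)"
  shows "norm (\<theta> x - \<theta> y) \<le> k * norm (x - y)"
proof -
  have frontier0: "\<theta> z = 0" if z: "z \<in> frontier (fsupport \<theta>)" for z
  proof -
    have zB: "z \<in> B" using z B(2) frontier_subset_closed[of "fsupport \<theta>"] by auto
    have "norm (\<theta> z) \<le> 0 + e" if e: "e > 0" for e
    proof -
      define e' where "e' = e / (k + 1)"
      have e': "e' > 0" using e k by (simp add: e'_def)
      have "open (ball z e' \<inter> B)" "z \<in> ball z e' \<inter> B" using B(1) zB e' by auto
      then obtain w where w: "w \<in> ball z e'" "w \<in> B" "w \<notin> fsupport \<theta>"
      proof -
        have "z \<in> closure (- fsupport \<theta>)" using z by (simp add: frontier_closures)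
        then have "(ball z e' \<inter> B) \<inter> - fsupport \<theta> \<noteq> {}"
          using open_Int_closure_eq_empty[OF \<open>open (ball z e' \<inter> B)\<close>] \<open>z \<in> ball z e' \<inter> B\<close> by blast
        then show ?thesis using that by blast
      qed
      have "norm (\<theta> z) \<le> k * norm (z - w)"
        using lip[OF zB w(2)] not_in_fsupport[OF w(3)] by simp
      also have "\<dots> \<le> (k + 1) * e'"
        using w(1) k by (intro mult_mono) (auto simp: dist_norm)
      also have "\<dots> = e" using k by (simp add: e'_def)
      finally show ?thesis by simp
    qed
    then have "norm (\<theta> z) \<le> 0" by (rule field_le_epsilon)
    then show ?thesis by simp
  qed
  have mixed: "norm (\<theta> x) \<le> k * norm (x - y)" if x: "x \<in> fsupport \<theta>" and y: "y \<notin> fsupport \<theta>" for x y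
  proof -
    have "closed_segment x y \<inter> frontier (fsupport \<theta>) \<noteq> {}"
      by (rule connected_Int_frontier) (use x y in auto)
    then obtain z where z: "z \<in> closed_segment x y" "z \<in> frontier (fsupport \<theta>)" by auto
    then have "z \<in> B" using B(2) frontier_subset_closed[of "fsupport \<theta>"] by auto
    then have "norm (\<theta> x) \<le> k * norm (x - z)" using lip[of x z] frontier0[OF z(2)] x B(2) by auto
    also have "\<dots> \<le> k * norm (x - y)"
      using segment_bound1[OF z(1)] k by (intro mult_left_mono) (auto simp: norm_minus_commute)
    finally show ?thesis .
  qed
  consider "x \<in> fsupport \<theta>" "y \<in> fsupport \<theta>" | "x \<in> fsupport \<theta>" "y \<notin> fsupport \<theta>"
    | "x \<notin> fsupport \<theta>" "y \<in> fsupport \<theta>" | "x \<notin> fsupport \<theta>" "y \<notin> fsupport \<theta>" by blast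
  then show ?thesis
  proof cases
    case 1
    then show ?thesis using lip B(2) by blast
  next
    case 2
    then show ?thesis using mixed[OF 2] by (simp add: not_in_fsupport)
  next
    case 3
    then show ?thesis using mixed[OF 3(2,1)] by (simp add: not_in_fsupport norm_minus_commute)
  next
    case 4
    then show ?thesis using k by (simp add: not_in_fsupport)
  qed
qed

text \<open>The suprema in \<open>C01_norm\<close> are informative for sets bounded above, which
  compact support and the Lipschitz constant on \<open>\<Omega>\<close> guarantee.\<close>

lemma C01_norm_bounds:
  fixes \<theta> :: "vec3 \<Rightarrow> vec3"
  assumes B: "open B" "B \<noteq> {}" "B \<subseteq> \<Omega>" and \<theta>: "\<theta> \<in> C01_c \<Omega>" "fsupport \<theta> \<subseteq> B"
  shows "norm (\<theta> x) \<le> C01_norm B \<theta>" "norm (\<theta> x - \<theta> y) \<le> C01_norm B \<theta> * norm (x - y)"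
proof -
  obtain k where k: "k-lipschitz_on \<Omega> \<theta>" using \<theta>(1) by (auto simp: C01_c_def)
  have supp: "compact (fsupport \<theta>)" using \<theta>(1) by (auto simp: C01_c_def)
  let ?P = "{(x, y). x \<in> B \<and> y \<in> B \<and> x \<noteq> y}" and ?q = "\<lambda>(x, y). norm (\<theta> x - \<theta> y) / norm (x - y)"
  let ?s1 = "SUP x\<in>B. norm (\<theta> x)" and ?s2 = "SUP p\<in>?P. ?q p"
  have N: "C01_norm B \<theta> = ?s1 + ?s2" by (simp add: C01_norm_def case_prod_beta')
  have "continuous_on (fsupport \<theta>) \<theta>"
    using lipschitz_on_continuous_on[OF k] \<theta>(2) B(3) continuous_on_subset by blast
  then have "bounded (\<theta> ` fsupport \<theta>)" using supp compact_continuous_image compact_imp_bounded by blast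
  then obtain m where m: "\<And>x. x \<in> fsupport \<theta> \<Longrightarrow> norm (\<theta> x) \<le> m" "m > 0" by (auto simp: bounded_pos)
  have m': "norm (\<theta> x) \<le> m" for x using m not_in_fsupport[of x \<theta>] by (cases "x \<in> fsupport \<theta>") auto
  have b1: "bdd_above ((\<lambda>x. norm (\<theta> x)) ` B)" using m' by (intro bdd_aboveI[of _ m]) auto
  have s1: "norm (\<theta> x) \<le> ?s1" if "x \<in> B" for x by (rule cSUP_upper[OF that b1])
  obtain b where b: "b \<in> B" using B(2) by auto
  have s10: "?s1 \<ge> 0" using s1[OF b] norm_ge_zero order_trans by blast
  have lk: "?q p \<le> k" if "p \<in> ?P" for p
  proof -
    obtain x y where xy: "p = (x, y)" by (cases p)
    then have p: "p = (x, y)" "x \<in> B" "y \<in> B" "x \<noteq> y" using that by simp_all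
    then have "norm (\<theta> x - \<theta> y) \<le> k * norm (x - y)"
      using lipschitz_onD[OF k, of x y] B(3) by (auto simp: dist_norm)
    then show ?thesis using p by (simp add: pos_divide_le_eq)
  qed
  have b2: "bdd_above (?q ` ?P)" using lk by (intro bdd_aboveI[of _ k]) blast
  have s2: "?q p \<le> ?s2" if "p \<in> ?P" for p by (rule cSUP_upper[OF that b2])
  \<comment> \<open>A pair of distinct points of \<open>B\<close> is produced, at which the second
    supremum is seen to be nonnegative.\<close>
  obtain e where e: "e > 0" "ball b e \<subseteq> B" using B(1) b open_contains_ball by blast
  have bp: "(b, b + (e / 2) *\<^sub>R axis 1 1) \<in> ?P"
  proof -
    have "b + (e / 2) *\<^sub>R axis 1 1 \<in> ball b e" using e(1) by (simp add: dist_norm)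
    moreover have "(e / 2) *\<^sub>R (axis 1 1 :: vec3) \<noteq> 0" using e(1) by (simp add: axis_eq_0_iff)
    ultimately show ?thesis using b e(2) by auto
  qed
  have s20: "0 \<le> ?s2"
  proof -
    have "0 \<le> ?q (b, b + (e / 2) *\<^sub>R axis 1 1)" by simp
    also have "\<dots> \<le> ?s2" by (rule s2[OF bp])
    finally show ?thesis .
  qed
  have lipB: "norm (\<theta> x - \<theta> y) \<le> ?s2 * norm (x - y)" if "x \<in> B" "y \<in> B" for x y
  proof (cases "x = y")
    case False
    then show ?thesis using s2[of "(x, y)"] that by (simp add: pos_divide_le_eq)
  qed simp
  show "norm (\<theta> x) \<le> C01_norm B \<theta>"
  proof (cases "x \<in> B")
    case True
    show ?thesis unfolding N by (rule add_increasing2[OF s20 s1[OF True]])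
  next
    case False
    then have "\<theta> x = 0" using \<theta>(2) by (intro not_in_fsupport) auto
    then show ?thesis unfolding N using s10 s20 by simp
  qed
  have "norm (\<theta> x - \<theta> y) \<le> ?s2 * norm (x - y)" by (rule lipschitz_extend_zero[OF B(1) \<theta>(2) s20 lipB])
  also have "\<dots> \<le> C01_norm B \<theta> * norm (x - y)" unfolding N by (rule mult_right_mono[OF _ norm_ge_zero]) (use s10 in simp)
  finally show "norm (\<theta> x - \<theta> y) \<le> C01_norm B \<theta> * norm (x - y)" .
qed

section \<open>From smooth to Lipschitz perturbations\<close>

context maxwell
begin

lemma tendsto_measure_symm_diff:
  assumes \<omega>: "\<And>n. \<omega> n \<in> sets M" "\<omega>' \<in> sets M"
    and conv: "AE x in M. eventually (\<lambda>n. x \<in> \<omega> n \<longleftrightarrow> x \<in> \<omega>') sequentially"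
  shows "(\<lambda>n. measure M ((\<omega> n - \<omega>') \<union> (\<omega>' - \<omega> n))) \<longlonglongrightarrow> 0"
proof -
  interpret finite_measure M by (rule fin)
  let ?D = "\<lambda>n. (\<omega> n - \<omega>') \<union> (\<omega>' - \<omega> n)"
  have D: "?D n \<in> sets M" for n using \<omega> by blast
  have "(\<lambda>n. LINT x|M. indicator (?D n) x :: real) \<longlonglongrightarrow> (LINT x|M. 0)"
  proof (rule integral_dominated_convergence[where w = "\<lambda>x. 1"])
    show "AE x in M. (\<lambda>n. indicator (?D n) x :: real) \<longlonglongrightarrow> 0"
      using conv
    proof eventually_elim
      case (elim x)
      then have "eventually (\<lambda>n. 0 = (indicator (?D n) x :: real)) sequentially"
        by eventually_elim (auto simp: indicator_def)
      then show ?case by (rule Lim_transform_eventually[OF tendsto_const])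
    qed
    show "(\<lambda>x. indicator (?D n) x :: real) \<in> borel_measurable M" for n
      by (rule borel_measurable_indicator[OF D])
    show "AE x in M. norm (indicator (?D n) x :: real) \<le> 1" for n
      by (intro AE_I2) (simp add: indicator_def)
    show "integrable M (\<lambda>x. 1 :: real)" by (rule integrable_const)
  qed measurable
  moreover have "(LINT x|M. indicator (?D n) x :: real) = measure M (?D n)" for n
    using Int_absorb2[OF sets.sets_into_space[OF D[of n]]]
    by (simp only: Bochner_Integration.integral_indicator)
  ultimately show ?thesis by (simp only: integral_zero)
qed

text \<open>Almost everywhere convergence of the indicators makes the measure of the symmetric
  difference tend to zero, and this measure controls both the states, by
  \<open>st_continuous\<close>, and the volumes.\<close>

lemma J_continuous:
  assumes \<gamma>: "\<gamma> > 0" and \<omega>: "\<And>n. open (\<omega> n)" "\<And>n. \<omega> n \<subseteq> \<Omega>" and \<omega>': "open \<omega>'" "\<omega>' \<subseteq> \<Omega>"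
    and conv: "AE x in M. eventually (\<lambda>n. x \<in> \<omega> n \<longleftrightarrow> x \<in> \<omega>') sequentially"
  shows "(\<lambda>n. J \<gamma> (\<omega> n)) \<longlonglongrightarrow> J \<gamma> \<omega>'"
proof -
  interpret finite_measure M by (rule fin)
  let ?\<mu> = "\<lambda>n. measure M ((\<omega> n - \<omega>') \<union> (\<omega>' - \<omega> n))"
  note sets = open_sets_M[OF \<omega>] open_sets_M[OF \<omega>']
  have \<mu>: "?\<mu> \<longlonglongrightarrow> 0" by (rule tendsto_measure_symm_diff[OF sets conv])
  note L = G_L2[OF st_works(1)[OF \<gamma> \<omega>]] G_L2[OF st_works(1)[OF \<gamma> \<omega>']]
  have "\<bar>Q (st \<gamma> (\<omega> n)) - Q (st \<gamma> \<omega>')\<bar> \<le> K * (j / c * sqrt (?\<mu> n)) * (2 * P0 + 2 * K * m1)" for n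
  proof -
    have "\<bar>Q (st \<gamma> (\<omega> n)) - Q (st \<gamma> \<omega>')\<bar> \<le> K * nrm (\<lambda>x. st \<gamma> (\<omega> n) x - st \<gamma> \<omega>' x) * (nrm (st \<gamma> (\<omega> n)) + nrm (st \<gamma> \<omega>') + 2 * K * m1)"
      by (rule Q_diff[OF L])
    also have "\<dots> \<le> K * (j / c * sqrt (?\<mu> n)) * (2 * P0 + 2 * K * m1)"
    proof (intro mult_mono mult_left_mono)
      show "nrm (\<lambda>x. st \<gamma> (\<omega> n) x - st \<gamma> \<omega>' x) \<le> j / c * sqrt (?\<mu> n)"
        using st_continuous[OF \<gamma> \<omega> \<omega>', of n] c by (simp add: field_simps)
      show "nrm (st \<gamma> (\<omega> n)) + nrm (st \<gamma> \<omega>') + 2 * K * m1 \<le> 2 * P0 + 2 * K * m1"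
        using st_bound[OF \<gamma> \<omega>, of n] st_bound[OF \<gamma> \<omega>'] by (simp add: P0_def)
    qed (use K j c P0_nonneg in auto)
    finally show ?thesis .
  qed
  then have "\<forall>\<^sub>F n in sequentially. norm (Q (st \<gamma> (\<omega> n)) - Q (st \<gamma> \<omega>')) \<le> K * (j / c * sqrt (?\<mu> n)) * (2 * P0 + 2 * K * m1)"
    by simp
  moreover have "(\<lambda>n. K * (j / c * sqrt (?\<mu> n)) * (2 * P0 + 2 * K * m1)) \<longlonglongrightarrow> K * (j / c * sqrt 0) * (2 * P0 + 2 * K * m1)"
    by (intro tendsto_intros \<mu>)
  ultimately have "(\<lambda>n. Q (st \<gamma> (\<omega> n)) - Q (st \<gamma> \<omega>')) \<longlonglongrightarrow> 0"
    unfolding real_sqrt_zero mult_zero_left mult_zero_right by (rule Lim_null_comparison)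
  then have 1: "(\<lambda>n. Q (st \<gamma> (\<omega> n))) \<longlonglongrightarrow> Q (st \<gamma> \<omega>')" by (simp add: LIM_zero_iff)
  have me: "measure lebesgue W = measure M W" if "W \<in> sets M" "W \<subseteq> \<Omega>" for W
    using \<Omega>_sets that by (subst measure_restrict_space) auto
  have "\<bar>measure M (\<omega> n) - measure M \<omega>'\<bar> \<le> ?\<mu> n" for n
  proof -
    have "measure M A \<le> measure M B + measure M ((A - B) \<union> (B - A))" if "A \<in> sets M" "B \<in> sets M" for A B
    proof -
      have "measure M A \<le> measure M (B \<union> ((A - B) \<union> (B - A)))"
        using that by (intro finite_measure_mono) auto
      also have "\<dots> \<le> measure M B + measure M ((A - B) \<union> (B - A))"
        using that by (intro measure_Un_le) auto
      finally show ?thesis .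
    qed
    from this[OF sets(1)[of n] sets(2)] this[OF sets(2) sets(1)[of n]] show ?thesis
      by (simp add: Un_commute abs_le_iff)
  qed
  then have "\<forall>\<^sub>F n in sequentially. norm (measure M (\<omega> n) - measure M \<omega>') \<le> ?\<mu> n" by simp
  then have "(\<lambda>n. measure M (\<omega> n) - measure M \<omega>') \<longlonglongrightarrow> 0" by (rule Lim_null_comparison[OF _ \<mu>])
  then have 2: "(\<lambda>n. measure lebesgue (\<omega> n)) \<longlonglongrightarrow> measure lebesgue \<omega>'"
    using me[OF sets(1) \<omega>(2)] me[OF sets(2) \<omega>'(2)] by (simp add: LIM_zero_iff)
  show ?thesis
    unfolding J_eq by (intro tendsto_intros 1 2) simp
qed

text \<open>The maps with mollified displacements \<open>w n\<close> satisfy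
  \<open>J_estimate\<close> with the same \<open>l\<close>. Off the image of
  \<open>frontier \<omega>\<close>, membership in the approximating images is eventually membership
  in the limit image, so \<open>J_continuous\<close> applies.\<close>

lemma J_lipschitz_perturbation:
  assumes \<gamma>: "\<gamma> > 0" and \<omega>: "open \<omega>" "\<omega> \<subseteq> B" "negligible (frontier \<omega>)"
    and l: "0 \<le> l" "l \<le> 1 / 100" "l \<le> r" and r: "r > 0"
    and v: "\<And>x y. norm (v x - v y) \<le> l * norm (x - y)" "\<And>x. norm (v x) \<le> l"
    and W: "compact W" "\<And>x. x \<notin> W \<Longrightarrow> v x = 0" "\<And>x. x \<in> W \<Longrightarrow> cball x (2 * r) \<subseteq> B"
  shows "\<bar>J \<gamma> ((\<lambda>x. x + v x) ` \<omega>) - J \<gamma> \<omega>\<bar> \<le> C2 * l"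
proof -
  interpret v: lipschitz_perturbation v l by unfold_locales (use l v in auto)
  \<comment> \<open>The room \<open>2 r\<close> around \<open>W\<close> is spent twice:
    mollification enlarges the support by at most \<open>r\<close>, and the displacement, at most
    \<open>l \<le> r\<close>, moves a point by at most \<open>r\<close> more.\<close>
  define \<delta> where "\<delta> n = r / real (Suc n)" for n
  have \<delta>: "0 < \<delta> n" "\<delta> n \<le> r" for n using r by (auto simp: \<delta>_def divide_le_eq mult_le_cancel_left1)
  have "\<exists>w. (\<forall>k. Ck k w) \<and> (\<forall>x y. norm (w x - w y) \<le> l * norm (x - y)) \<and> (\<forall>x. norm (w x) \<le> l)
     \<and> (\<forall>x. norm (w x - v x) \<le> l * \<delta> n) \<and> (\<forall>x. (\<forall>y. y \<in> cball x (\<delta> n) \<longrightarrow> y \<notin> W) \<longrightarrow> w x = 0)" for n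
    by (rule mollify[OF v W(1,2) \<delta>(1)[of n]]) blast+
  then obtain w where w: "\<And>n k. Ck k (w n)" "\<And>n x y. norm (w n x - w n y) \<le> l * norm (x - y)"
    "\<And>n x. norm (w n x) \<le> l" "\<And>n x. norm (w n x - v x) \<le> l * \<delta> n"
    "\<And>n x. (\<And>y. y \<in> cball x (\<delta> n) \<Longrightarrow> y \<notin> W) \<Longrightarrow> w n x = 0" by metis
  have pm: "perturbed_maxwell \<Omega> B E\<^sub>d f \<kappa> \<epsilon> \<nu> j c K (w n) l" for n
  proof unfold_locales
    show "fsupport (w n) \<subseteq> B"
    proof -
      let ?D = "{x + y |x y. x \<in> W \<and> y \<in> cball 0 (\<delta> n)}"
      have "closed ?D" using compact_sums[OF W(1) compact_cball] compact_imp_closed by blast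
      then have "fsupport (w n) \<subseteq> ?D"
      proof (rule fsupport_subset)
        fix x assume x: "x \<notin> ?D"
        show "w n x = 0"
        proof (rule w(5))
          fix y assume y: "y \<in> cball x (\<delta> n)"
          show "y \<notin> W"
          proof
            assume "y \<in> W"
            moreover have "x - y \<in> cball 0 (\<delta> n)" using y by (simp add: dist_norm norm_minus_commute)
            ultimately have "y + (x - y) \<in> ?D" by blast
            moreover have eq: "y + (x - y) = x" by simp
            ultimately have "x \<in> ?D" unfolding eq by blast
            with x show False by (rule notE)
          qed
        qed
      qed
      moreover have "?D \<subseteq> B"
      proof
        fix z assume "z \<in> ?D"
        then obtain x y where xy: "z = x + y" "x \<in> W" "y \<in> cball 0 (\<delta> n)" by blast
        then have "z \<in> cball x (2 * r)" using \<delta>[of n] r by (auto simp: dist_norm)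
        then show "z \<in> B" using W(3)[OF xy(2)] by blast
      qed
      ultimately show ?thesis by blast
    qed
    show "closed_segment x (x + w n x) \<subseteq> B" if x: "x \<in> B" for x
    proof (cases "w n x = 0")
      case True
      then show ?thesis using x by simp
    next
      case False
      then obtain y where y: "y \<in> cball x (\<delta> n)" "y \<in> W" using w(5)[of x n] by blast
      have "closed_segment x (x + w n x) \<subseteq> cball y (2 * r)"
      proof (rule closed_segment_subset)
        show "x \<in> cball y (2 * r)" using y(1) \<delta>[of n] r by (auto simp: dist_commute)
        have "dist y (x + w n x) \<le> dist y x + norm (w n x)"
          using dist_triangle[of y "x + w n x" x] by (simp add: dist_norm)
        then show "x + w n x \<in> cball y (2 * r)" using y(1) \<delta>[of n] w(3)[of n x] l(3) by (simp add: dist_commute)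
      qed simp
      then show ?thesis using W(3)[OF y(2)] by blast
    qed
  qed (use w l in auto)
  let ?T = "\<lambda>n. (\<lambda>x. x + w n x)"
  have lp: "lipschitz_perturbation (w n) l" for n by unfold_locales (use l w in auto)
  have Tn: "lipschitz_perturbation.T (w n) = ?T n" for n
    using lipschitz_perturbation.T_def[OF lp] by (simp add: fun_eq_iff)
  have TnB: "?T n ` \<omega> \<subseteq> B" for n
    using perturbed_maxwell.T_B[OF pm, of _ n] \<omega>(2) by (auto simp: Tn)
  have Tn_open: "open (?T n ` \<omega>)" for n
    using lipschitz_perturbation.open_T_image[OF lp \<omega>(1)] by (simp add: Tn)
  have vT: "v.T = (\<lambda>x. x + v x)" by (simp add: v.T_def fun_eq_iff)
  have TB: "v.T ` \<omega> \<subseteq> B"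
  proof -
    have "fsupport v \<subseteq> W" by (rule fsupport_subset[OF compact_imp_closed[OF W(1)] W(2)])
    also have "W \<subseteq> B" using W(3) r by (meson centre_in_cball less_imp_le mult_pos_pos subsetD subsetI zero_less_numeral)
    finally show ?thesis using v.T_image[of B] \<omega>(2) by blast
  qed
  have est: "\<bar>J \<gamma> (?T n ` \<omega>) - J \<gamma> \<omega>\<bar> \<le> C2 * l" for n
    using perturbed_maxwell.J_estimate[OF pm \<gamma> \<omega>(1), of n] Tn_open[of n] TnB[of n] \<omega>(2) B_sub
    by (simp add: Tn)
  have "(\<lambda>n. J \<gamma> (?T n ` \<omega>)) \<longlonglongrightarrow> J \<gamma> (v.T ` \<omega>)"
  proof (rule J_continuous[OF \<gamma> Tn_open _ v.open_T_image[OF \<omega>(1)]])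
    show "?T n ` \<omega> \<subseteq> \<Omega>" for n using TnB B_sub by blast
    show "v.T ` \<omega> \<subseteq> \<Omega>" using TB B_sub by blast
    \<comment> \<open>This image is the exceptional set in the convergence of the
      indicators.\<close>
    have "negligible (v.T ` frontier \<omega>)"
    proof (rule negligible_locally_Lipschitz_image)
      have "norm (v.T y - v.T x) \<le> 2 * norm (y - x)" for x y
      proof -
        have "norm (v.T y - v.T x) \<le> norm (y - x) + norm (v y - v x)"
          using norm_triangle_ineq[of "y - x" "v y - v x"] by (simp add: v.T_def algebra_simps)
        also have "norm (v y - v x) \<le> 1 * norm (y - x)"
          using v(1)[of y x] mult_right_mono[of l 1 "norm (y - x)"] l by simp
        finally show ?thesis by simp
      qed
      then show "\<exists>U C. open U \<and> x \<in> U \<and> (\<forall>y\<in>frontier \<omega> \<inter> U. norm (v.T y - v.T x) \<le> C * norm (y - x))" for x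
        by (intro exI[of _ UNIV] exI[of _ 2]) auto
    qed (use \<omega>(3) in auto)
    then have null: "v.T ` frontier \<omega> \<in> null_sets lebesgue" by (simp add: negligible_iff_null_sets)
    have "AE x in lebesgue. x \<notin> v.T ` frontier \<omega>" by (rule AE_not_in[OF null])
    then have "AE x in M. x \<notin> v.T ` frontier \<omega>"
      using \<Omega>_sets by (subst AE_restrict_space_iff) auto
    then show "AE x in M. \<forall>\<^sub>F n in sequentially. (x \<in> ?T n ` \<omega>) = (x \<in> v.T ` \<omega>)"
    proof eventually_elim
      case (elim x)
      define y where "y = v.Ti x"
      define yn where "yn n = lipschitz_perturbation.Ti (w n) x" for n
      have xy: "x = y + v y" using v.T_Ti[of x] by (simp add: y_def v.T_def)
      have xyn: "x = yn n + w n (yn n)" for n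
        using lipschitz_perturbation.T_Ti[OF lp, of n x] by (simp add: yn_def Tn)
      have preimage: "x \<in> v.T ` A \<longleftrightarrow> y \<in> A" for A
      proof
        assume "y \<in> A"
        then have "v.T y \<in> v.T ` A" by (rule imageI)
        then show "x \<in> v.T ` A" by (simp only: y_def v.T_Ti)
      next
        assume "x \<in> v.T ` A"
        then obtain z where "x = v.T z" "z \<in> A" by (rule imageE)
        then show "y \<in> A" by (simp only: y_def v.Ti_T)
      qed
      have y: "y \<notin> frontier \<omega>" using elim by (simp only: preimage not_False_eq_True)
      have memn: "x \<in> ?T n ` \<omega> \<longleftrightarrow> yn n \<in> \<omega>" for n
      proof
        assume "yn n \<in> \<omega>"
        then have "?T n (yn n) \<in> ?T n ` \<omega>" by (rule imageI)
        then show "x \<in> ?T n ` \<omega>" by (simp only: xyn[symmetric])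
      next
        assume "x \<in> ?T n ` \<omega>"
        then obtain z where z: "x = ?T n z" "z \<in> \<omega>" by (rule imageE)
        have "lipschitz_perturbation.Ti (w n) (?T n z) = z"
          using lipschitz_perturbation.Ti_T[OF lp, of n z] by (simp only: Tn)
        then show "yn n \<in> \<omega>" using z by (simp only: yn_def)
      qed
      \<comment> \<open>The preimages of \<open>x\<close> under the approximating maps converge to
        its preimage \<open>y\<close>: the maps expand distances by at least one half, and
        \<open>w n\<close> is uniformly close to \<open>v\<close>.\<close>
      have "norm (yn n - y) \<le> 2 * (l * \<delta> n)" for n
      proof -
        have "norm (yn n - y) \<le> 2 * norm (?T n (yn n) - ?T n y)"
          using lipschitz_perturbation.T_expand[OF lp, of "yn n" y n] by (simp add: Tn)
        also have "?T n (yn n) - ?T n y = v y - w n y" using xy xyn[of n] by (simp add: algebra_simps)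
        also have "norm \<dots> \<le> l * \<delta> n" using w(4)[of n y] by (simp add: norm_minus_commute)
        finally show ?thesis by simp
      qed
      then have "\<forall>\<^sub>F n in sequentially. norm (yn n - y) \<le> 2 * (l * \<delta> n)" by simp
      moreover have "(\<lambda>n. 2 * (l * \<delta> n)) \<longlonglongrightarrow> 2 * (l * 0)"
        unfolding \<delta>_def by (intro tendsto_intros LIMSEQ_Suc[OF lim_const_over_n])
      ultimately have "(\<lambda>n. yn n - y) \<longlonglongrightarrow> 0"
        unfolding mult_zero_right by (rule Lim_null_comparison)
      then have lim: "yn \<longlonglongrightarrow> y" by (simp add: LIM_zero_iff)
      have "\<forall>\<^sub>F n in sequentially. yn n \<in> \<omega> \<longleftrightarrow> y \<in> \<omega>"
      proof (cases "y \<in> \<omega>")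
        case True
        show ?thesis using topological_tendstoD[OF lim \<omega>(1) True] by eventually_elim (use True in simp)
      next
        case False
        then have "y \<in> - closure \<omega>" using y \<omega>(1) by (simp add: frontier_def interior_open)
        from topological_tendstoD[OF lim open_Compl[OF closed_closure] this] show ?thesis
          by (rule eventually_mono) (use False closure_subset[of \<omega>] in auto)
      qed
      then show ?case by (simp only: preimage memn)
    qed
  qed
  then have "(\<lambda>n. \<bar>J \<gamma> (?T n ` \<omega>) - J \<gamma> \<omega>\<bar>) \<longlonglongrightarrow> \<bar>J \<gamma> (v.T ` \<omega>) - J \<gamma> \<omega>\<bar>"
    by (intro tendsto_intros)
  then have "\<bar>J \<gamma> (v.T ` \<omega>) - J \<gamma> \<omega>\<bar> \<le> C2 * l"
    by (rule LIMSEQ_le_const2) (use est in auto)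
  then show ?thesis by (simp add: vT)
qed

text \<open>For small \<open>t\<close> the displacement of the flow has sup norm and Lipschitz
  constant at most \<open>2 k t\<close>, so the difference quotients are bounded by
  \<open>2 C2 k\<close>.\<close>

lemma shape_derivative_bound:
  assumes \<gamma>: "\<gamma> > 0" and \<omega>: "open \<omega>" "\<omega> \<subseteq> B" "negligible (frontier \<omega>)"
    and b: "\<And>x. norm (\<theta> x) \<le> b" "\<And>x y. norm (\<theta> x - \<theta> y) \<le> b * norm (x - y)"
    and \<theta>: "compact (fsupport \<theta>)" "fsupport \<theta> \<subseteq> B"
    and D: "has_shape_derivative (J \<gamma>) \<omega> \<theta> D"
  shows "\<bar>D\<bar> \<le> 2 * C2 * b"
proof -
  have b0: "b \<ge> 0" using order_trans[OF norm_ge_zero b(1)] .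
  obtain r where r: "r > 0" "\<And>x. x \<in> fsupport \<theta> \<Longrightarrow> cball x (2 * r) \<subseteq> B"
  proof -
    obtain e where e: "e > 0" "(\<Union>x\<in>fsupport \<theta>. ball x e) \<subseteq> B"
      using compact_subset_open_imp_ball_epsilon_subset[OF \<theta>(1) open_B \<theta>(2)] by blast
    have "cball x (2 * (e / 4)) \<subseteq> B" if "x \<in> fsupport \<theta>" for x
    proof -
      have "cball x (2 * (e / 4)) \<subseteq> ball x e" using e(1) by (auto simp: dist_norm)
      then show ?thesis using e(2) that by blast
    qed
    then show ?thesis using that[of "e / 4"] e(1) by simp
  qed
  \<comment> \<open>Taking \<open>k > b\<close> provides the positive Lipschitz constant of the flow
    lemmas even for \<open>b = 0\<close>; at the end \<open>k\<close> decreases to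
    \<open>b\<close>.\<close>
  have bound: "\<bar>D\<bar> \<le> 2 * C2 * k" if k: "k > b" for k
  proof -
    have k0: "k > 0" using b0 k by simp
    have lipk: "norm (\<theta> x - \<theta> y) \<le> k * norm (x - y)" and bk: "norm (\<theta> x) \<le> k" for x y
      using b(2)[of x y] b(1)[of x] mult_right_mono[of b k "norm (x - y)"] k by auto
    have est: "\<bar>(J \<gamma> (flow \<theta> t ` \<omega>) - J \<gamma> \<omega>) / t\<bar> \<le> 2 * C2 * k"
      if t: "t > 0" "2 * k * t \<le> 1 / 100" "2 * k * t \<le> r" for t
    proof -
      define v where "v x = flow \<theta> t x - x" for x
      have t0: "t \<ge> 0" using t by simp
      note fl = flow_displacement[OF k0 lipk bk t0]
      have kt: "0 \<le> k * t" "k * t \<le> 1 / 2" using t k0 by auto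
      \<comment> \<open>From \<open>k t \<le> 1/2\<close> one gets at most
        \<open>1 + 1/2 + 1/4\<close>, which is below 2; this is the source of the factor 2 in
        \<open>2 * k * t\<close>.\<close>
      have "exp (k * t) \<le> 1 + k * t + (k * t)\<^sup>2" using kt by (intro exp_bound) auto
      also have "(k * t)\<^sup>2 \<le> 1 / 4" using power_mono[OF kt(2,1), of 2] by (simp add: power2_eq_square)
      finally have e2: "exp (k * t) \<le> 2" using kt by simp
      have "\<bar>J \<gamma> ((\<lambda>x. x + v x) ` \<omega>) - J \<gamma> \<omega>\<bar> \<le> C2 * (2 * k * t)"
      proof (rule J_lipschitz_perturbation[OF \<gamma> \<omega> _ t(2,3) r(1) _ _ \<theta>(1) _ r(2)])
        show "norm (v x) \<le> 2 * k * t" for x using fl(1)[of x] kt by (simp add: v_def)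
        show "norm (v x - v y) \<le> 2 * k * t * norm (x - y)" for x y
        proof -
          have "norm (v x - v y) \<le> k * t * exp (k * t) * norm (x - y)" unfolding v_def by (rule fl(2))
          also have "\<dots> \<le> k * t * 2 * norm (x - y)"
            using e2 kt by (intro mult_right_mono mult_left_mono) auto
          finally show ?thesis by (simp add: mult_ac)
        qed
        show "v x = 0" if "x \<notin> fsupport \<theta>" for x
          using fl(3)[OF not_in_fsupport[OF that]] by (simp add: v_def)
      qed (use kt in auto)
      moreover have "flow \<theta> t = (\<lambda>x. x + v x)" by (simp add: v_def fun_eq_iff)
      ultimately show ?thesis using t(1) by (simp add: abs_divide pos_divide_le_eq mult_ac)
    qed
    define t0 where "t0 = min (1 / 100) r / (2 * k)"
    have t0: "t0 > 0" using r(1) k0 by (simp add: t0_def)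
    have small: "2 * k * t \<le> 1 / 100" "2 * k * t \<le> r" if "t < t0" for t
    proof -
      have "2 * k * t < 2 * k * t0"
        using that k0 by (intro mult_strict_left_mono) auto
      also have "2 * k * t0 = min (1 / 100) r" using k0 by (simp add: t0_def)
      finally show "2 * k * t \<le> 1 / 100" "2 * k * t \<le> r" by linarith+
    qed
    have "\<forall>\<^sub>F t in at_right 0. \<bar>(J \<gamma> (flow \<theta> t ` \<omega>) - J \<gamma> \<omega>) / t\<bar> \<le> 2 * C2 * k"
      using eventually_at_right_real[OF t0] by eventually_elim (use est small in auto)
    moreover have "((\<lambda>t. \<bar>(J \<gamma> (flow \<theta> t ` \<omega>) - J \<gamma> \<omega>) / t\<bar>) \<longlongrightarrow> \<bar>D\<bar>) (at_right 0)"
      using D unfolding has_shape_derivative_def by (rule tendsto_rabs)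
    ultimately show ?thesis by (intro tendsto_upperbound) auto
  qed
  have "((\<lambda>k. 2 * C2 * k) \<longlongrightarrow> 2 * C2 * b) (at_right b)" by (intro tendsto_intros)
  then show ?thesis
    by (rule tendsto_lowerbound) (auto simp: eventually_at_right_less intro: eventually_mono[OF eventually_at_right_less] bound)
qed

end

text \<open>The mean value inequality along a segment inside \<open>B\<close>; the bound of the
  function and that of its derivative are merged into one constant.\<close>

lemma C1_bounded_constant:
  fixes g :: "vec3 \<Rightarrow> 'b::real_normed_vector"
  assumes "g \<in> C1_bounded B"
  obtains k where "k \<ge> 0" "\<And>x. x \<in> B \<Longrightarrow> norm (g x) \<le> k"
    "\<And>x y. closed_segment x y \<subseteq> B \<Longrightarrow> norm (g y - g x) \<le> k * norm (y - x)" "continuous_on B g"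
proof -
  obtain g' :: "vec3 \<Rightarrow> vec3 \<Rightarrow>\<^sub>L 'b" where g': "\<And>x. x \<in> B \<Longrightarrow> (g has_derivative blinfun_apply (g' x)) (at x)" "bounded (g' ` B)"
    and bg: "bounded (g ` B)"
    using assms unfolding C1_bounded_def by blast
  obtain k1 where k1: "\<And>x. x \<in> B \<Longrightarrow> norm (g x) \<le> k1" "k1 > 0" using bg by (auto simp: bounded_pos)
  obtain k2 where k2: "\<And>x. x \<in> B \<Longrightarrow> norm (g' x) \<le> k2" "k2 > 0" using g'(2) by (auto simp: bounded_pos)
  have "norm (g y - g x) \<le> (k1 + k2) * norm (y - x)" if seg: "closed_segment x y \<subseteq> B" for x y
  proof -
    have "norm (g y - g x) \<le> k2 * norm (y - x)"
    proof (rule differentiable_bound[of "closed_segment x y" g "\<lambda>z. blinfun_apply (g' z)"])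
      show "(g has_derivative blinfun_apply (g' z)) (at z within closed_segment x y)" if "z \<in> closed_segment x y" for z
        using g'(1) seg that has_derivative_at_withinI by blast
      show "onorm (blinfun_apply (g' z)) \<le> k2" if "z \<in> closed_segment x y" for z
        using k2(1)[of z] seg that by (auto simp: norm_blinfun.rep_eq)
    qed auto
    also have "\<dots> \<le> (k1 + k2) * norm (y - x)" using k1(2) by (intro mult_right_mono) auto
    finally show ?thesis .
  qed
  moreover have "continuous_on B g"
    using g'(1) has_derivative_continuous by (blast intro: continuous_at_imp_continuous_on)
  ultimately show ?thesis using that[of "k1 + k2"] k1 k2(2) by (meson add_increasing2 add_pos_pos less_imp_le)
qed

theorem theorem5p1:
  fixes \<Omega> B \<omega> :: "(real^3) set"
    and E\<^sub>d f :: "real^3 \<Rightarrow> real^3"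
    and \<kappa> :: "real^3 \<Rightarrow> real"
    and \<epsilon> \<nu> :: "real^3 \<Rightarrow> real^3^3"
    and j\<^sub>c L :: real
  assumes "bounded_lipschitz_domain \<Omega>"
    and "bounded_lipschitz_domain B" and "B \<subseteq> \<Omega>"
    and "E\<^sub>d \<in> C1_bounded B"
    and "\<kappa> \<in> C1_bounded B" and "\<And>x. x \<in> B \<Longrightarrow> \<kappa> x > 0"
    and "j\<^sub>c > 0"
    and "\<epsilon> \<in> Linf_on \<Omega>" and "\<epsilon> \<in> C1_bounded B" and "unif_spd \<Omega> \<epsilon>"
    and "\<nu> \<in> Linf_on \<Omega>" and "\<nu> \<in> C1_bounded B" and "unif_spd \<Omega> \<nu>"
    and "f \<in> L2_on \<Omega>" and "f \<in> C1_bounded B"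
    and "\<omega> \<in> lipschitz_class B L"
  shows "\<exists>C. \<forall>\<gamma>>0. \<forall>\<theta>\<in>C01_c \<Omega>. fsupport \<theta> \<subseteq> B \<longrightarrow>
           (\<forall>D. has_shape_derivative (J_pen \<Omega> B j\<^sub>c \<kappa> \<epsilon> \<nu> f E\<^sub>d \<gamma>) \<omega> \<theta> D \<longrightarrow>
                \<bar>D\<bar> \<le> C * C01_norm B \<theta>)"
proof -
  have \<Omega>: "open \<Omega>" "bounded \<Omega>" and B: "open B" "B \<noteq> {}"
    using assms(1,2) by (auto simp: bounded_lipschitz_domain_def lipschitz_set_def)
  have \<omega>: "open \<omega>" "\<omega> \<subseteq> B" "negligible (frontier \<omega>)"
    using assms(16) lipschitz_set_frontier_negligible by (auto simp: lipschitz_class_def lipschitz_set_def)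
  obtain k1 where k1: "k1 \<ge> 0" "\<And>x. x \<in> B \<Longrightarrow> norm (E\<^sub>d x) \<le> k1"
    "\<And>x y. closed_segment x y \<subseteq> B \<Longrightarrow> norm (E\<^sub>d y - E\<^sub>d x) \<le> k1 * norm (y - x)" "continuous_on B E\<^sub>d"
    by (rule C1_bounded_constant[OF assms(4)]) (rule that)
  obtain k2 where k2: "k2 \<ge> 0" "\<And>x. x \<in> B \<Longrightarrow> norm (\<kappa> x) \<le> k2"
    "\<And>x y. closed_segment x y \<subseteq> B \<Longrightarrow> norm (\<kappa> y - \<kappa> x) \<le> k2 * norm (y - x)" "continuous_on B \<kappa>"
    by (rule C1_bounded_constant[OF assms(5)]) (rule that)
  obtain k3 where k3: "k3 \<ge> 0" "\<And>x. x \<in> B \<Longrightarrow> norm (\<epsilon> x) \<le> k3"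
    "\<And>x y. closed_segment x y \<subseteq> B \<Longrightarrow> norm (\<epsilon> y - \<epsilon> x) \<le> k3 * norm (y - x)" "continuous_on B \<epsilon>"
    by (rule C1_bounded_constant[OF assms(9)]) (rule that)
  obtain k4 where k4: "k4 \<ge> 0" "\<And>x. x \<in> B \<Longrightarrow> norm (\<nu> x) \<le> k4"
    "\<And>x y. closed_segment x y \<subseteq> B \<Longrightarrow> norm (\<nu> y - \<nu> x) \<le> k4 * norm (y - x)" "continuous_on B \<nu>"
    by (rule C1_bounded_constant[OF assms(12)]) (rule that)
  obtain k5 where k5: "k5 \<ge> 0" "\<And>x. x \<in> B \<Longrightarrow> norm (f x) \<le> k5"
    "\<And>x y. closed_segment x y \<subseteq> B \<Longrightarrow> norm (f y - f x) \<le> k5 * norm (y - x)" "continuous_on B f"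
    by (rule C1_bounded_constant[OF assms(15)]) (rule that)
  obtain k6 where k6: "AE x in lebesgue_on \<Omega>. norm (\<epsilon> x) \<le> k6"
    using assms(8) by (auto simp: Linf_on_def)
  obtain k7 where k7: "AE x in lebesgue_on \<Omega>. norm (\<nu> x) \<le> k7"
    using assms(11) by (auto simp: Linf_on_def)
  obtain c1 where c1: "c1 > 0" "AE x in lebesgue_on \<Omega>. \<forall>\<xi>. \<xi> \<bullet> (\<epsilon> x *v \<xi>) \<ge> c1 * (norm \<xi>)\<^sup>2"
    using assms(10) by (auto simp: unif_spd_def)
  obtain c2 where c2: "c2 > 0" "AE x in lebesgue_on \<Omega>. \<forall>\<xi>. \<xi> \<bullet> (\<nu> x *v \<xi>) \<ge> c2 * (norm \<xi>)\<^sup>2"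
    using assms(13) by (auto simp: unif_spd_def)
  \<comment> \<open>Absolute values are taken because no sign is recorded for the essential bounds
    \<open>k6\<close> and \<open>k7\<close>.\<close>
  define K where "K = 1 + k1 + k2 + k3 + k4 + k5 + \<bar>k6\<bar> + \<bar>k7\<bar>"
  have Kge: "1 \<le> K" "k1 \<le> K" "k2 \<le> K" "k3 \<le> K" "k4 \<le> K" "k5 \<le> K" "k6 \<le> K" "k7 \<le> K"
    unfolding K_def using k1(1) k2(1) k3(1) k4(1) k5(1) by linarith+
  have scale: "a \<le> K * norm z" if "a \<le> k * norm z" "k \<le> K" for a k and z :: vec3
    using that mult_right_mono[OF that(2) norm_ge_zero[of z]] by linarith
  interpret maxwell \<Omega> B E\<^sub>d f \<kappa> \<epsilon> \<nu> j\<^sub>c "min c1 c2" K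
  proof
    show "AE x in lebesgue_on \<Omega>. transpose (\<epsilon> x) = \<epsilon> x \<and> transpose (\<nu> x) = \<nu> x"
      using assms(10,13) by (auto simp: unif_spd_def)
    show "AE x in lebesgue_on \<Omega>. \<forall>\<xi>. min c1 c2 * (norm \<xi>)\<^sup>2 \<le> \<xi> \<bullet> (\<epsilon> x *v \<xi>) \<and> min c1 c2 * (norm \<xi>)\<^sup>2 \<le> \<xi> \<bullet> (\<nu> x *v \<xi>)"
      using c1(2) c2(2)
    proof eventually_elim
      case (elim x)
      have "min c1 c2 * (norm \<xi>)\<^sup>2 \<le> c1 * (norm \<xi>)\<^sup>2" "min c1 c2 * (norm \<xi>)\<^sup>2 \<le> c2 * (norm \<xi>)\<^sup>2" for \<xi> :: vec3
        by (auto intro!: mult_right_mono)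
      then show ?case using elim order_trans by blast
    qed
    show "AE x in lebesgue_on \<Omega>. norm (\<epsilon> x) \<le> K \<and> norm (\<nu> x) \<le> K"
      using k6 k7 by eventually_elim (use Kge in auto)
    show "norm (\<epsilon> x) \<le> K \<and> norm (\<nu> x) \<le> K \<and> norm (f x) \<le> K \<and> norm (\<kappa> x) \<le> K \<and> norm (E\<^sub>d x) \<le> K" if "x \<in> B" for x
      using k1(2)[OF that] k2(2)[OF that] k3(2)[OF that] k4(2)[OF that] k5(2)[OF that] Kge by linarith
    show "norm (\<epsilon> y - \<epsilon> x) \<le> K * norm (y - x) \<and> norm (\<nu> y - \<nu> x) \<le> K * norm (y - x) \<and> norm (f y - f x) \<le> K * norm (y - x)
        \<and> norm (\<kappa> y - \<kappa> x) \<le> K * norm (y - x) \<and> norm (E\<^sub>d y - E\<^sub>d x) \<le> K * norm (y - x)"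
      if "closed_segment x y \<subseteq> B" for x y
      by (intro conjI scale[OF k1(3)[OF that] Kge(2)] scale[OF k2(3)[OF that] Kge(3)] scale[OF k3(3)[OF that] Kge(4)]
          scale[OF k4(3)[OF that] Kge(5)] scale[OF k5(3)[OF that] Kge(6)])
  qed (use assms \<Omega> B k1(4) k2(4) c1(1) c2(1) Kge(1) in \<open>auto simp: Linf_on_def L2_on_eq\<close>)
  show ?thesis
  \<comment> \<open>\<open>C2\<close> is built from the data alone and is fixed ahead of \<gamma>
    and \<open>\<theta>\<close>, which gives the uniformity.\<close>
  proof (intro exI[of _ "2 * C2"] allI impI ballI)
    fix \<gamma> :: real and \<theta> D
    assume \<gamma>: "\<gamma> > 0" and \<theta>: "\<theta> \<in> C01_c \<Omega>" "fsupport \<theta> \<subseteq> B"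
      and D: "has_shape_derivative (J_pen \<Omega> B j\<^sub>c \<kappa> \<epsilon> \<nu> f E\<^sub>d \<gamma>) \<omega> \<theta> D"
    have "compact (fsupport \<theta>)" using \<theta>(1) by (simp add: C01_c_def)
    from shape_derivative_bound[OF \<gamma> \<omega> C01_norm_bounds[OF B assms(3) \<theta>] this \<theta>(2) D]
    show "\<bar>D\<bar> \<le> 2 * C2 * C01_norm B \<theta>" .
  qed
qed

end
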